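(* Let $\Lambda$ be a ring. Every additive functor $F\colon(\operatorname{\mathsf{Mod}}\Lambda)^{\mathrm{op}}\to\mathsf{Ab}$ preserving filtered colimits in $\operatorname{\mathsf{Mod}}\Lambda$ admits a minimal presentation $$\operatorname{Hom}_\Lambda(-,X)\longrightarrow\operatorname{Hom}_\Lambda(-,Y)\longrightarrow F\longrightarrow 0$$ with $X,Y\in\operatorname{\mathsf{Mod}}\Lambda$.
   Context: $\operatorname{\mathsf{Mod}}\Lambda$ is the category of all $\Lambda$-modules and $\mathsf{Ab}$ the category of abelian groups. A functor $F\colon(\operatorname{\mathsf{Mod}}\Lambda)^{\mathrm{op}}\to\mathsf{Ab}$ preserves filtered colimits in $\operatorname{\mathsf{Mod}}\Lambda$ if it takes filtered colimits of $\Lambda$-modules to the corresponding inverse limits in $\mathsf{Ab}$. A morphism $\alpha\colon U\to V$ (in any category) is right minimal if every endomorphism $\phi$ of $U$ with $\alpha\phi=\alpha$ is invertible. A presentation, i.e. a (pointwise) exact sequence $\operatorname{Hom}_\Lambda(-,X)\to\operatorname{Hom}_\Lambda(-,Y)\to F\to 0$, is called minimal if the morphisms $\operatorname{Hom}_\Lambda(-,Y)\to F$ and $\operatorname{Hom}_\Lambda(-,X)\to\operatorname{Hom}_\Lambda(-,Y)$ are right minimal. *)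

theory Defs
  imports "HOL-Algebra.Module" "HOL-Algebra.Product_Groups"
begin

unbundle cardinal_syntax

section \<open>Size conventions\<close>

text \<open>
  HOL has no type of all modules, so the category of modules is formed relative to a type \<open>'u\<close> that plays the role of a universe.  A set is small if it has
  fewer elements than \<open>'u\<close>, and the objects of the module category are the modules whose carrier
  is a small subset of \<open>'u\<close>.

  A Grothendieck universe would make the cardinality \<open>\<kappa>\<close> of \<open>'u\<close> strongly inaccessible.  HOL does
  not prove that such a type exists, so only the following weaker closure is demanded:
  \<open>\<kappa>\<close> is infinite and regular, and \<open>\<mu> < \<kappa>\<close> implies \<open>\<mu>\<^sup>\<lambda> < \<kappa>\<close> for \<open>\<lambda> = |R| * \<aleph>\<^sub>0\<close>.
  The case \<open>\<mu> = 2\<close> gives \<open>\<lambda> < \<kappa>\<close>, so \<open>\<kappa>\<close> is uncountable and \<open>R\<close> is small.  Every strongly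
  inaccessible \<open>\<kappa> > |R|\<close> qualifies, and so does the successor of \<open>2\<^sup>\<mu>\<close> for every \<open>\<mu> \<ge> \<lambda>\<close>
  (the lemma below is the case \<open>\<mu> = |B|\<close>), so there are arbitrarily large such \<open>\<kappa>\<close>.
\<close>

definition small :: "'u itself \<Rightarrow> 'a set \<Rightarrow> bool" where
  "small _ A \<longleftrightarrow> |A| <o |UNIV :: 'u set|"

definition module_universe :: "('r, 'k) ring_scheme \<Rightarrow> 'u itself \<Rightarrow> bool" where
  "module_universe R U \<longleftrightarrow>
     infinite (UNIV :: 'u set) \<and>
     regularCard |UNIV :: 'u set| \<and>
     (\<forall>A :: 'u set. small U A \<longrightarrow> small U ((carrier R \<times> (UNIV :: nat set)) \<rightarrow>\<^sub>E A))"

lemma module_universe_cardSuc: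
  fixes R :: "('r, 'k) ring_scheme" and B :: "'b set"
  assumes card: "|UNIV :: 'u set| =o cardSuc |Pow B|"
    and B: "|carrier R \<times> (UNIV :: nat set)| \<le>o |B|" and ne: "carrier R \<noteq> {}"
  shows "module_universe R TYPE('u)"
proof -
  let ?L = "carrier R \<times> (UNIV :: nat set)"
  have infL: "infinite ?L" using ne by (simp add: finite_cartesian_product_iff)
  then have infB: "infinite B" using B card_of_ordLeq_infinite by blast
  then have infP: "infinite (Pow B)" by simp
  have cinf: "Cinfinite |Pow B|"
    using infP card_of_Card_order card_of_Card_order by (metis cinfinite_def Field_card_of card_of_card_order_on)
  have cS: "Cinfinite (cardSuc |Pow B| )" by (rule Cinfinite_cardSuc[OF cinf])
  have reg: "regularCard |UNIV :: 'u set|"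
    by (rule regularCard_ordIso[OF ordIso_symmetric[OF card] cS regularCard_cardSuc[OF cinf]])
  have "Cinfinite |UNIV :: 'u set|" using Cinfinite_cong[OF ordIso_symmetric[OF card] cS] .
  then have inf: "infinite (UNIV :: 'u set)" by (metis cinfinite_def Field_card_of)
  have smallI: "small TYPE('u) S" if "|S| \<le>o |Pow B|" for S :: "(('r \<times> nat) \<Rightarrow> 'u) set"
  proof -
    have "|S| <o cardSuc |Pow B|" using that by (meson card_of_Card_order cardSuc_greater ordLeq_ordLess_trans)
    then show ?thesis unfolding small_def using card ordLess_ordIso_trans ordIso_symmetric by blast
  qed
  have "small TYPE('u) (?L \<rightarrow>\<^sub>E A)" if A: "small TYPE('u) A" for A :: "'u set"
  proof -
    have "|A| <o cardSuc |Pow B|" using A card unfolding small_def using ordLess_ordIso_trans by blast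
    then have "|A| \<le>o |Pow B|" using cardSuc_ordLeq_ordLess[OF card_of_Card_order card_of_Card_order] by blast
    then obtain f where f: "inj_on f A" "f ` A \<subseteq> Pow B" using card_of_ordLeq[of A "Pow B"] by blast
    define \<Phi> where "\<Phi> g = {(l, b). l \<in> ?L \<and> b \<in> f (g l)}" for g :: "'r \<times> nat \<Rightarrow> 'u"
    have "inj_on \<Phi> (?L \<rightarrow>\<^sub>E A)"
    proof (rule inj_onI)
      fix g h assume gh: "g \<in> ?L \<rightarrow>\<^sub>E A" "h \<in> ?L \<rightarrow>\<^sub>E A" "\<Phi> g = \<Phi> h"
      have "g l = h l" if "l \<in> ?L" for l
      proof -
        have "b \<in> f (g l) \<longleftrightarrow> b \<in> f (h l)" for b
        proof -
          have "(l, b) \<in> \<Phi> g \<longleftrightarrow> (l, b) \<in> \<Phi> h" using gh(3) by simp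
          then show ?thesis using that by (simp add: \<Phi>_def)
        qed
        then have "f (g l) = f (h l)" by blast
        moreover have "g l \<in> A" "h l \<in> A" using gh that by (auto simp: PiE_def Pi_def)
        ultimately show ?thesis using f(1) by (meson inj_onD)
      qed
      then show "g = h" using gh(1,2) by (meson PiE_ext)
    qed
    moreover have "\<Phi> ` (?L \<rightarrow>\<^sub>E A) \<subseteq> Pow (?L \<times> B)"
    proof -
      have "b \<in> B" if "g \<in> ?L \<rightarrow>\<^sub>E A" "l \<in> ?L" "b \<in> f (g l)" for g l b
        using f(2) that PiE_mem[OF that(1,2)] by blast
      then show ?thesis unfolding \<Phi>_def by blast
    qed
    ultimately have 1: "|?L \<rightarrow>\<^sub>E A| \<le>o |Pow (?L \<times> B)|" using card_of_ordLeq by blast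
    have "|?L \<times> B| \<le>o |B|"
      using card_of_Times_ordLeq_infinite_Field[of "|B|" ?L B] infB B
      by (metis Field_card_of card_of_Card_order card_of_mono1 subset_refl)
    then obtain g where g: "inj_on g (?L \<times> B)" "g ` (?L \<times> B) \<subseteq> B"
      using card_of_ordLeq[of "?L \<times> B" B] by blast
    have "inj_on (image g) (Pow (?L \<times> B))" using g(1) by (rule inj_on_image_Pow)
    moreover have "image g ` Pow (?L \<times> B) \<subseteq> Pow B" using g(2) by blast
    ultimately have "|Pow (?L \<times> B)| \<le>o |Pow B|" using card_of_ordLeq by blast
    with 1 have "|?L \<rightarrow>\<^sub>E A| \<le>o |Pow B|" by (rule ordLeq_transitive)
    then show ?thesis by (rule smallI)
  qed
  with inf reg show ?thesis unfolding module_universe_def by blast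
qed


section \<open>The category of modules\<close>

text \<open>
  The library locale for modules requires a commutative ring.  Left modules over an arbitrary ring
  reuse its record; the multiplicative fields of the record carry no meaning here.
\<close>

locale left_module = R?: ring R + M?: abelian_group M
  for R :: "('r, 'k) ring_scheme" (structure) and M :: "('r, 'm, 'l) module_scheme" (structure) +
  assumes smult_closed:
      "\<lbrakk>a \<in> carrier R; x \<in> carrier M\<rbrakk> \<Longrightarrow> a \<odot>\<^bsub>M\<^esub> x \<in> carrier M"
    and smult_l_distr:
      "\<lbrakk>a \<in> carrier R; b \<in> carrier R; x \<in> carrier M\<rbrakk> \<Longrightarrow>
        (a \<oplus>\<^bsub>R\<^esub> b) \<odot>\<^bsub>M\<^esub> x = a \<odot>\<^bsub>M\<^esub> x \<oplus>\<^bsub>M\<^esub> b \<odot>\<^bsub>M\<^esub> x"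
    and smult_r_distr:
      "\<lbrakk>a \<in> carrier R; x \<in> carrier M; y \<in> carrier M\<rbrakk> \<Longrightarrow>
        a \<odot>\<^bsub>M\<^esub> (x \<oplus>\<^bsub>M\<^esub> y) = a \<odot>\<^bsub>M\<^esub> x \<oplus>\<^bsub>M\<^esub> a \<odot>\<^bsub>M\<^esub> y"
    and smult_assoc:
      "\<lbrakk>a \<in> carrier R; b \<in> carrier R; x \<in> carrier M\<rbrakk> \<Longrightarrow>
        (a \<otimes>\<^bsub>R\<^esub> b) \<odot>\<^bsub>M\<^esub> x = a \<odot>\<^bsub>M\<^esub> (b \<odot>\<^bsub>M\<^esub> x)"
    and smult_one:
      "x \<in> carrier M \<Longrightarrow> \<one>\<^bsub>R\<^esub> \<odot>\<^bsub>M\<^esub> x = x"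

definition module_cat :: "('r, 'k) ring_scheme \<Rightarrow> ('r, 'u) module set" where
  "module_cat R = {M. left_module R M \<and> small TYPE('u) (carrier M)}"

text \<open>
  Morphisms are extensional functions, so that equality of morphisms is equality in HOL.
  Composition of \<open>f\<close> on \<open>M\<close> with \<open>g\<close> is \<^term>\<open>compose (carrier M) g f\<close>.
\<close>

definition mod_hom ::
    "('r, 'k) ring_scheme \<Rightarrow> ('r, 'u) module \<Rightarrow> ('r, 'u) module \<Rightarrow> ('u \<Rightarrow> 'u) set" where
  "mod_hom R M N = {f \<in> carrier M \<rightarrow>\<^sub>E carrier N.
     (\<forall>x\<in>carrier M. \<forall>y\<in>carrier M. f (x \<oplus>\<^bsub>M\<^esub> y) = f x \<oplus>\<^bsub>N\<^esub> f y) \<and>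
     (\<forall>a\<in>carrier R. \<forall>x\<in>carrier M. f (a \<odot>\<^bsub>M\<^esub> x) = a \<odot>\<^bsub>N\<^esub> f x)}"

definition mod_id :: "('r, 'u) module \<Rightarrow> 'u \<Rightarrow> 'u" where
  "mod_id M = (\<lambda>x\<in>carrier M. x)"

definition hom_group ::
    "('r, 'k) ring_scheme \<Rightarrow> ('r, 'u) module \<Rightarrow> ('r, 'u) module \<Rightarrow> ('u \<Rightarrow> 'u) monoid" where
  "hom_group R M N =
     \<lparr>carrier = mod_hom R M N,
      monoid.mult = (\<lambda>f g. \<lambda>x\<in>carrier M. f x \<oplus>\<^bsub>N\<^esub> g x),
      one = (\<lambda>x\<in>carrier M. \<zero>\<^bsub>N\<^esub>)\<rparr>"


section \<open>Additive contravariant functors to abelian groups\<close>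

text \<open>
  Abelian groups are written multiplicatively, as \<^locale>\<open>comm_group\<close>s.  The values of a functor
  are carried by a type \<open>'v\<close> that may differ from functor to functor.  For \<open>f\<close> from \<open>M\<close> to \<open>N\<close>, the
  induced map \<open>fmap F M N f\<close> goes from \<open>fob F N\<close> to \<open>fob F M\<close>; only its values on the carrier
  of \<open>fob F N\<close> matter.
\<close>

record ('r, 'u, 'v) mod_functor =
  fob :: "('r, 'u) module \<Rightarrow> 'v monoid"
  fmap :: "('r, 'u) module \<Rightarrow> ('r, 'u) module \<Rightarrow> ('u \<Rightarrow> 'u) \<Rightarrow> 'v \<Rightarrow> 'v"

definition additive_functor :: "('r, 'k) ring_scheme \<Rightarrow> ('r, 'u, 'v) mod_functor \<Rightarrow> bool" where
  "additive_functor R F \<longleftrightarrow>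
     (\<forall>M\<in>module_cat R. comm_group (fob F M)) \<and>
     (\<forall>M\<in>module_cat R. \<forall>N\<in>module_cat R. \<forall>f\<in>mod_hom R M N. fmap F M N f \<in> hom (fob F N) (fob F M)) \<and>
     (\<forall>M\<in>module_cat R. \<forall>x\<in>carrier (fob F M). fmap F M M (mod_id M) x = x) \<and>
     (\<forall>M\<in>module_cat R. \<forall>N\<in>module_cat R. \<forall>P\<in>module_cat R. \<forall>f\<in>mod_hom R M N. \<forall>g\<in>mod_hom R N P.
        \<forall>x\<in>carrier (fob F P).
          fmap F M P (compose (carrier M) g f) x = fmap F M N f (fmap F N P g x)) \<and>
     (\<forall>M\<in>module_cat R. \<forall>N\<in>module_cat R. \<forall>f\<in>mod_hom R M N. \<forall>g\<in>mod_hom R M N. \<forall>x\<in>carrier (fob F N).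
        fmap F M N (f \<otimes>\<^bsub>hom_group R M N\<^esub> g) x = fmap F M N f x \<otimes>\<^bsub>fob F M\<^esub> fmap F M N g x)"

definition Hom_functor ::
    "('r, 'k) ring_scheme \<Rightarrow> ('r, 'u) module \<Rightarrow> ('r, 'u, 'u \<Rightarrow> 'u) mod_functor" where
  "Hom_functor R Y =
     \<lparr>fob = (\<lambda>M. hom_group R M Y),
      fmap = (\<lambda>M N f g. compose (carrier M) g f)\<rparr>"

text \<open>
  Compatibility of \<open>F\<close> with the universe.  If \<open>\<kappa>\<close> is strongly inaccessible, this holds as soon as
  \<open>F\<close> takes values in small abelian groups.  In general one cannot ask for all values to be small,
  because \<open>F\<close> turns the coproduct of a small family of modules into a product; the requirement is
  therefore made for modules with at most \<open>|R| * \<aleph>\<^sub>0\<close> elements only, which up to isomorphism form a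
  small set.  A functor defined on the class of all modules satisfies it for every sufficiently
  large choice of \<open>\<kappa>\<close>.
\<close>

definition universe_compatible :: "('r, 'k) ring_scheme \<Rightarrow> ('r, 'u, 'v) mod_functor \<Rightarrow> bool" where
  "universe_compatible R F \<longleftrightarrow>
     (\<forall>M\<in>module_cat R. |carrier M| \<le>o |carrier R \<times> (UNIV :: nat set)|
        \<longrightarrow> small TYPE('u) (carrier (fob F M)))"


section \<open>Filtered colimits of modules\<close>

record ('i, 'a) category =
  Ob :: "'i set"
  Arr :: "'i \<Rightarrow> 'i \<Rightarrow> 'a set"
  Ide :: "'i \<Rightarrow> 'a"
  Comp :: "'i \<Rightarrow> 'i \<Rightarrow> 'i \<Rightarrow> 'a \<Rightarrow> 'a \<Rightarrow> 'a"

text \<open>\<open>Comp J i j k b a\<close> is the composite of \<open>a\<close> from \<open>i\<close> to \<open>j\<close> followed by \<open>b\<close> from \<open>j\<close> to \<open>k\<close>.\<close>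

definition is_category :: "('i, 'a) category \<Rightarrow> bool" where
  "is_category J \<longleftrightarrow>
     (\<forall>i\<in>Ob J. Ide J i \<in> Arr J i i) \<and>
     (\<forall>i\<in>Ob J. \<forall>j\<in>Ob J. \<forall>k\<in>Ob J. \<forall>a\<in>Arr J i j. \<forall>b\<in>Arr J j k.
        Comp J i j k b a \<in> Arr J i k) \<and>
     (\<forall>i\<in>Ob J. \<forall>j\<in>Ob J. \<forall>a\<in>Arr J i j.
        Comp J i i j a (Ide J i) = a \<and> Comp J i j j (Ide J j) a = a) \<and>
     (\<forall>i\<in>Ob J. \<forall>j\<in>Ob J. \<forall>k\<in>Ob J. \<forall>l\<in>Ob J. \<forall>a\<in>Arr J i j. \<forall>b\<in>Arr J j k. \<forall>c\<in>Arr J k l.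
        Comp J i k l c (Comp J i j k b a) = Comp J i j l (Comp J j k l c b) a)"

definition small_category :: "'u itself \<Rightarrow> ('i, 'a) category \<Rightarrow> bool" where
  "small_category U J \<longleftrightarrow>
     is_category J \<and> small U (Ob J) \<and> (\<forall>i\<in>Ob J. \<forall>j\<in>Ob J. small U (Arr J i j))"

definition filtered :: "('i, 'a) category \<Rightarrow> bool" where
  "filtered J \<longleftrightarrow>
     Ob J \<noteq> {} \<and>
     (\<forall>i\<in>Ob J. \<forall>j\<in>Ob J. \<exists>k\<in>Ob J. Arr J i k \<noteq> {} \<and> Arr J j k \<noteq> {}) \<and>
     (\<forall>i\<in>Ob J. \<forall>j\<in>Ob J. \<forall>a\<in>Arr J i j. \<forall>b\<in>Arr J i j.
        \<exists>k\<in>Ob J. \<exists>c\<in>Arr J j k. Comp J i j k c a = Comp J i j k c b)"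

definition mod_diagram ::
    "('r, 'k) ring_scheme \<Rightarrow> ('i, 'a) category \<Rightarrow> ('i \<Rightarrow> ('r, 'u) module) \<Rightarrow>
     ('i \<Rightarrow> 'i \<Rightarrow> 'a \<Rightarrow> 'u \<Rightarrow> 'u) \<Rightarrow> bool" where
  "mod_diagram R J D d \<longleftrightarrow>
     (\<forall>i\<in>Ob J. D i \<in> module_cat R) \<and>
     (\<forall>i\<in>Ob J. \<forall>j\<in>Ob J. \<forall>a\<in>Arr J i j. d i j a \<in> mod_hom R (D i) (D j)) \<and>
     (\<forall>i\<in>Ob J. d i i (Ide J i) = mod_id (D i)) \<and>
     (\<forall>i\<in>Ob J. \<forall>j\<in>Ob J. \<forall>k\<in>Ob J. \<forall>a\<in>Arr J i j. \<forall>b\<in>Arr J j k.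
        d i k (Comp J i j k b a) = compose (carrier (D i)) (d j k b) (d i j a))"

definition mod_cocone ::
    "('r, 'k) ring_scheme \<Rightarrow> ('i, 'a) category \<Rightarrow> ('i \<Rightarrow> ('r, 'u) module) \<Rightarrow>
     ('i \<Rightarrow> 'i \<Rightarrow> 'a \<Rightarrow> 'u \<Rightarrow> 'u) \<Rightarrow> ('r, 'u) module \<Rightarrow> ('i \<Rightarrow> 'u \<Rightarrow> 'u) \<Rightarrow> bool" where
  "mod_cocone R J D d C c \<longleftrightarrow>
     C \<in> module_cat R \<and>
     (\<forall>i\<in>Ob J. c i \<in> mod_hom R (D i) C) \<and>
     (\<forall>i\<in>Ob J. \<forall>j\<in>Ob J. \<forall>a\<in>Arr J i j. compose (carrier (D i)) (c j) (d i j a) = c i)"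

definition mod_colimit ::
    "('r, 'k) ring_scheme \<Rightarrow> ('i, 'a) category \<Rightarrow> ('i \<Rightarrow> ('r, 'u) module) \<Rightarrow>
     ('i \<Rightarrow> 'i \<Rightarrow> 'a \<Rightarrow> 'u \<Rightarrow> 'u) \<Rightarrow> ('r, 'u) module \<Rightarrow> ('i \<Rightarrow> 'u \<Rightarrow> 'u) \<Rightarrow> bool" where
  "mod_colimit R J D d C c \<longleftrightarrow>
     mod_cocone R J D d C c \<and>
     (\<forall>N n. mod_cocone R J D d N n \<longrightarrow>
        (\<exists>!h. h \<in> mod_hom R C N \<and> (\<forall>i\<in>Ob J. compose (carrier (D i)) h (c i) = n i)))"

text \<open>Here \<open>g i j a\<close> maps \<open>G j\<close> to \<open>G i\<close> for every arrow \<open>a\<close> from \<open>i\<close> to \<open>j\<close>.\<close>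

definition inverse_limit ::
    "('i, 'a) category \<Rightarrow> ('i \<Rightarrow> 'v monoid) \<Rightarrow> ('i \<Rightarrow> 'i \<Rightarrow> 'a \<Rightarrow> 'v \<Rightarrow> 'v) \<Rightarrow> ('i \<Rightarrow> 'v) monoid" where
  "inverse_limit J G g =
     (product_group (Ob J) G)
       \<lparr>carrier := {x \<in> carrier (product_group (Ob J) G).
          \<forall>i\<in>Ob J. \<forall>j\<in>Ob J. \<forall>a\<in>Arr J i j. g i j a (x j) = x i}\<rparr>"

text \<open>
  Every small category is isomorphic to one whose objects and arrows are elements of \<open>'u\<close>.
\<close>

definition preserves_filtered_colimits ::
    "('r, 'k) ring_scheme \<Rightarrow> ('r, 'u, 'v) mod_functor \<Rightarrow> bool" where
  "preserves_filtered_colimits R F \<longleftrightarrow>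
     (\<forall>(J :: ('u, 'u) category) D d C c.
        small_category TYPE('u) J \<and> filtered J \<and> mod_diagram R J D d \<and> mod_colimit R J D d C c \<longrightarrow>
        (\<lambda>x. \<lambda>i\<in>Ob J. fmap F (D i) C (c i) x) \<in>
          iso (fob F C)
            (inverse_limit J (\<lambda>i. fob F (D i)) (\<lambda>i j a. fmap F (D i) (D j) (d i j a))))"


section \<open>Minimal presentations\<close>

definition nat_trans ::
    "('r, 'k) ring_scheme \<Rightarrow> ('r, 'u, 'v) mod_functor \<Rightarrow> ('r, 'u, 'w) mod_functor \<Rightarrow>
     (('r, 'u) module \<Rightarrow> 'v \<Rightarrow> 'w) \<Rightarrow> bool" where
  "nat_trans R F G \<alpha> \<longleftrightarrow>
     (\<forall>M\<in>module_cat R. \<alpha> M \<in> hom (fob F M) (fob G M)) \<and>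
     (\<forall>M\<in>module_cat R. \<forall>N\<in>module_cat R. \<forall>f\<in>mod_hom R M N. \<forall>x\<in>carrier (fob F N).
        \<alpha> M (fmap F M N f x) = fmap G M N f (\<alpha> N x))"

definition nat_invertible ::
    "('r, 'k) ring_scheme \<Rightarrow> ('r, 'u, 'v) mod_functor \<Rightarrow> ('r, 'u, 'w) mod_functor \<Rightarrow>
     (('r, 'u) module \<Rightarrow> 'v \<Rightarrow> 'w) \<Rightarrow> bool" where
  "nat_invertible R F G \<alpha> \<longleftrightarrow>
     (\<exists>\<beta>. nat_trans R G F \<beta> \<and>
        (\<forall>M\<in>module_cat R. \<forall>x\<in>carrier (fob F M). \<beta> M (\<alpha> M x) = x) \<and>
        (\<forall>M\<in>module_cat R. \<forall>y\<in>carrier (fob G M). \<alpha> M (\<beta> M y) = y))"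

text \<open>
  The source of \<open>\<alpha>\<close> is \<open>F\<close>.  The target does not occur, since an equation between transformations
  into it is an equation between the values of their components.
\<close>

definition right_minimal ::
    "('r, 'k) ring_scheme \<Rightarrow> ('r, 'u, 'v) mod_functor \<Rightarrow>
     (('r, 'u) module \<Rightarrow> 'v \<Rightarrow> 'w) \<Rightarrow> bool" where
  "right_minimal R F \<alpha> \<longleftrightarrow>
     (\<forall>\<phi>. nat_trans R F F \<phi> \<and>
          (\<forall>M\<in>module_cat R. \<forall>x\<in>carrier (fob F M). \<alpha> M (\<phi> M x) = \<alpha> M x) \<longrightarrow>
        nat_invertible R F F \<phi>)"

definition presentation ::
    "('r, 'k) ring_scheme \<Rightarrow> ('r, 'u, 'v) mod_functor \<Rightarrow> ('r, 'u) module \<Rightarrow> ('r, 'u) module \<Rightarrow>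
     (('r, 'u) module \<Rightarrow> ('u \<Rightarrow> 'u) \<Rightarrow> ('u \<Rightarrow> 'u)) \<Rightarrow> (('r, 'u) module \<Rightarrow> ('u \<Rightarrow> 'u) \<Rightarrow> 'v) \<Rightarrow> bool"
  where
  "presentation R F X Y \<alpha> \<beta> \<longleftrightarrow>
     nat_trans R (Hom_functor R X) (Hom_functor R Y) \<alpha> \<and>
     nat_trans R (Hom_functor R Y) F \<beta> \<and>
     (\<forall>M\<in>module_cat R.
        \<alpha> M ` carrier (hom_group R M X) = kernel (hom_group R M Y) (fob F M) (\<beta> M) \<and>
        \<beta> M ` carrier (hom_group R M Y) = carrier (fob F M))"

definition minimal_presentation ::
    "('r, 'k) ring_scheme \<Rightarrow> ('r, 'u, 'v) mod_functor \<Rightarrow> ('r, 'u) module \<Rightarrow> ('r, 'u) module \<Rightarrow>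
     (('r, 'u) module \<Rightarrow> ('u \<Rightarrow> 'u) \<Rightarrow> ('u \<Rightarrow> 'u)) \<Rightarrow> (('r, 'u) module \<Rightarrow> ('u \<Rightarrow> 'u) \<Rightarrow> 'v) \<Rightarrow> bool"
  where
  "minimal_presentation R F X Y \<alpha> \<beta> \<longleftrightarrow>
     presentation R F X Y \<alpha> \<beta> \<and>
     right_minimal R (Hom_functor R Y) \<beta> \<and>
     right_minimal R (Hom_functor R X) \<alpha>"

end

theory Submission
  imports Defs
begin

text \<open>
  Consider the category of pairs \<^term>\<open>(M, x)\<close> with \<^term>\<open>x\<close> an element of \<^term>\<open>F\<close> at \<^term>\<open>M\<close>.  By
  Yoneda, a right minimal epimorphism from a representable functor onto \<^term>\<open>F\<close> is a weakly terminal
  object of this category all of whose endomorphisms are invertible.  The presentation is obtained by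
  applying the existence of such an object to \<^term>\<open>F\<close> and then to the kernel of the epimorphism.

  Since \<^term>\<open>F\<close> preserves filtered colimits, it is determined by finitely presented modules, whence it
  turns pushouts along pure monomorphisms into pullbacks.  The small object argument therefore yields
  an object that is injective with respect to pure monomorphisms between modules with at most
  \<^term>\<open>|carrier R \<times> (UNIV :: nat set)|\<close> elements.  By Zorn's lemma every object, however large, maps
  to it, because each module is exhausted by successive pure extensions of that size.

  For minimality, directed colimits first provide a weakly terminal object all of whose outgoing
  morphisms are injective (Enochs' kernel argument).  Among the objects with this property, one that is
  maximal under inclusion has only bijective endomorphisms: a proper injective endomorphism would
  exhibit it as a proper subobject of an isomorphic copy.
\<close>

section \<open>Linear maps and linear combinations\<close>

text \<open>The obstacle is size. The cardinal of \<open>'u\<close> is only regular and closed under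
  powers with exponent \<lambda> = |carrier R| * aleph_0, so neither the power set of a small set
  nor a hom set between small modules has to be small. Whatever must be enumerated is therefore cut
  down to modules with at most \<lambda> elements (\<open>tiny\<close>): they have a small set of
  representatives, few subsets, few maps into a small module, and small values of F. The bound
  \<lambda> suffices because a submodule can be closed under solutions of finite linear systems
  without exceeding it.

  Size returns at the end: a chain of objects whose outgoing morphisms are injective might have a
  union too large to be an object. To exclude this, weak terminality is proved against all modules
  on \<open>'u\<close>, small or not (\<open>big\<close>); such a union then embeds in a small
  module.

  Extensions are kept as literal inclusions of carriers, for which pushouts and isomorphic copies
  are rebuilt as supersets. Colimits of chains thus become unions, and Zorn's lemma can be applied
  to inclusion.\<close>

abbreviation restr :: "('r, 'a) module \<Rightarrow> 'a set \<Rightarrow> ('r, 'a) module" (infixl "\<restriction>" 70) where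
  "M \<restriction> N \<equiv> M\<lparr>carrier := N\<rparr>"

text \<open>Homomorphisms without extensionality: composites stay plain lambda terms, one function
  serves on every submodule of its domain, and the two modules may live on different types.
  \<open>mod_hom_eq\<close> gives the passage to \<open>mod_hom\<close>.\<close>

definition lin ::
    "('r, 'k) ring_scheme \<Rightarrow> ('r, 'a, 'l) module_scheme \<Rightarrow> ('r, 'b, 'm) module_scheme \<Rightarrow> ('a \<Rightarrow> 'b) \<Rightarrow> bool" where
  "lin R M N f \<longleftrightarrow> f \<in> carrier M \<rightarrow> carrier N \<and>
     (\<forall>x\<in>carrier M. \<forall>y\<in>carrier M. f (x \<oplus>\<^bsub>M\<^esub> y) = f x \<oplus>\<^bsub>N\<^esub> f y) \<and>
     (\<forall>a\<in>carrier R. \<forall>x\<in>carrier M. f (a \<odot>\<^bsub>M\<^esub> x) = a \<odot>\<^bsub>N\<^esub> f x)"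

lemma linI:
  assumes "\<And>x. x \<in> carrier M \<Longrightarrow> f x \<in> carrier N"
    and "\<And>x y. \<lbrakk>x \<in> carrier M; y \<in> carrier M\<rbrakk> \<Longrightarrow> f (x \<oplus>\<^bsub>M\<^esub> y) = f x \<oplus>\<^bsub>N\<^esub> f y"
    and "\<And>a x. \<lbrakk>a \<in> carrier R; x \<in> carrier M\<rbrakk> \<Longrightarrow> f (a \<odot>\<^bsub>M\<^esub> x) = a \<odot>\<^bsub>N\<^esub> f x"
  shows "lin R M N f"
  using assms by (auto simp: lin_def)

lemma lin_closed: "lin R M N f \<Longrightarrow> x \<in> carrier M \<Longrightarrow> f x \<in> carrier N"
  by (auto simp: lin_def)

lemma lin_add: "lin R M N f \<Longrightarrow> x \<in> carrier M \<Longrightarrow> y \<in> carrier M \<Longrightarrow> f (x \<oplus>\<^bsub>M\<^esub> y) = f x \<oplus>\<^bsub>N\<^esub> f y"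
  by (auto simp: lin_def)

lemma lin_smult: "lin R M N f \<Longrightarrow> a \<in> carrier R \<Longrightarrow> x \<in> carrier M \<Longrightarrow> f (a \<odot>\<^bsub>M\<^esub> x) = a \<odot>\<^bsub>N\<^esub> f x"
  by (auto simp: lin_def)

lemma mod_hom_eq: "mod_hom R M N = {f. lin R M N f \<and> f \<in> extensional (carrier M)}"
  by (auto simp: mod_hom_def lin_def PiE_def)

text \<open>Evaluation of a formal linear combination, kept as a list of coefficients and
  generators, at an assignment \<open>u\<close> of the generators. The lists play the part of the
  free module: one list can be evaluated in every module, so it serves as a relation, as an equation
  with unknowns, or as a name of an element.\<close>

definition lc :: "('r, 'a, 'l) module_scheme \<Rightarrow> ('g \<Rightarrow> 'a) \<Rightarrow> ('r \<times> 'g) list \<Rightarrow> 'a" where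
  "lc M u t = foldr (\<lambda>(r, g) z. r \<odot>\<^bsub>M\<^esub> u g \<oplus>\<^bsub>M\<^esub> z) t \<zero>\<^bsub>M\<^esub>"

lemma lc_simps [simp]:
  "lc M u [] = \<zero>\<^bsub>M\<^esub>"
  "lc M u (p # t) = fst p \<odot>\<^bsub>M\<^esub> u (snd p) \<oplus>\<^bsub>M\<^esub> lc M u t"
  by (auto simp: lc_def split: prod.split)

definition terms :: "('r, 'k) ring_scheme \<Rightarrow> 'g set \<Rightarrow> ('r \<times> 'g) list set" where
  "terms R G = lists (carrier R \<times> G)"

lemma terms_simps [simp]:
  "[] \<in> terms R G"
  "p # t \<in> terms R G \<longleftrightarrow> fst p \<in> carrier R \<and> snd p \<in> G \<and> t \<in> terms R G"
  "s @ t \<in> terms R G \<longleftrightarrow> s \<in> terms R G \<and> t \<in> terms R G"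
  by (auto simp: terms_def mem_Times_iff)

definition scale :: "('r, 'k) ring_scheme \<Rightarrow> 'r \<Rightarrow> ('r \<times> 'g) list \<Rightarrow> ('r \<times> 'g) list" where
  "scale R a = map (apfst ((\<otimes>\<^bsub>R\<^esub>) a))"

definition submod :: "('r, 'k) ring_scheme \<Rightarrow> ('r, 'a, 'l) module_scheme \<Rightarrow> 'a set \<Rightarrow> bool" where
  "submod R M N \<longleftrightarrow> N \<subseteq> carrier M \<and> \<zero>\<^bsub>M\<^esub> \<in> N \<and> (\<forall>x\<in>N. \<forall>y\<in>N. x \<oplus>\<^bsub>M\<^esub> y \<in> N) \<and>
     (\<forall>a\<in>carrier R. \<forall>x\<in>N. a \<odot>\<^bsub>M\<^esub> x \<in> N)"

text \<open>Negatives enter as scalar multiples by -1. The whole development subtracts in this way,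
  because closure of submodules and linearity of maps under it are then instances of the rules for
  scalars.\<close>

lemma left_moduleI:
  assumes "ring R" and "\<And>x y. \<lbrakk>x \<in> carrier M; y \<in> carrier M\<rbrakk> \<Longrightarrow> x \<oplus>\<^bsub>M\<^esub> y \<in> carrier M"
    and "\<zero>\<^bsub>M\<^esub> \<in> carrier M"
    and "\<And>x y z. \<lbrakk>x \<in> carrier M; y \<in> carrier M; z \<in> carrier M\<rbrakk> \<Longrightarrow> (x \<oplus>\<^bsub>M\<^esub> y) \<oplus>\<^bsub>M\<^esub> z = x \<oplus>\<^bsub>M\<^esub> (y \<oplus>\<^bsub>M\<^esub> z)"
    and "\<And>x y. \<lbrakk>x \<in> carrier M; y \<in> carrier M\<rbrakk> \<Longrightarrow> x \<oplus>\<^bsub>M\<^esub> y = y \<oplus>\<^bsub>M\<^esub> x"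
    and "\<And>x. x \<in> carrier M \<Longrightarrow> \<zero>\<^bsub>M\<^esub> \<oplus>\<^bsub>M\<^esub> x = x"
    and "\<And>x. x \<in> carrier M \<Longrightarrow> (\<ominus>\<^bsub>R\<^esub> \<one>\<^bsub>R\<^esub>) \<odot>\<^bsub>M\<^esub> x \<oplus>\<^bsub>M\<^esub> x = \<zero>\<^bsub>M\<^esub>"
    and smult_closed: "\<And>a x. \<lbrakk>a \<in> carrier R; x \<in> carrier M\<rbrakk> \<Longrightarrow> a \<odot>\<^bsub>M\<^esub> x \<in> carrier M"
    and "\<And>a b x. \<lbrakk>a \<in> carrier R; b \<in> carrier R; x \<in> carrier M\<rbrakk> \<Longrightarrow>
        (a \<oplus>\<^bsub>R\<^esub> b) \<odot>\<^bsub>M\<^esub> x = a \<odot>\<^bsub>M\<^esub> x \<oplus>\<^bsub>M\<^esub> b \<odot>\<^bsub>M\<^esub> x"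
    and "\<And>a x y. \<lbrakk>a \<in> carrier R; x \<in> carrier M; y \<in> carrier M\<rbrakk> \<Longrightarrow>
        a \<odot>\<^bsub>M\<^esub> (x \<oplus>\<^bsub>M\<^esub> y) = a \<odot>\<^bsub>M\<^esub> x \<oplus>\<^bsub>M\<^esub> a \<odot>\<^bsub>M\<^esub> y"
    and "\<And>a b x. \<lbrakk>a \<in> carrier R; b \<in> carrier R; x \<in> carrier M\<rbrakk> \<Longrightarrow>
        (a \<otimes>\<^bsub>R\<^esub> b) \<odot>\<^bsub>M\<^esub> x = a \<odot>\<^bsub>M\<^esub> (b \<odot>\<^bsub>M\<^esub> x)"
    and "\<And>x. x \<in> carrier M \<Longrightarrow> \<one>\<^bsub>R\<^esub> \<odot>\<^bsub>M\<^esub> x = x"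
  shows "left_module R M"
proof -
  interpret R: ring R by fact
  have "\<exists>y\<in>carrier M. y \<oplus>\<^bsub>M\<^esub> x = \<zero>\<^bsub>M\<^esub>" if "x \<in> carrier M" for x
    using assms(7)[OF that] smult_closed[of "\<ominus>\<^bsub>R\<^esub> \<one>\<^bsub>R\<^esub>" x] that by (intro bexI) auto
  then have "abelian_group M"
    using assms(2-6) by (intro abelian_groupI) blast+
  then show ?thesis
    using assms by (auto simp: left_module_def left_module_axioms_def)
qed

section \<open>Arithmetic of linear combinations\<close>

context left_module
begin

lemma smult_zero_left [simp]: "x \<in> carrier M \<Longrightarrow> \<zero>\<^bsub>R\<^esub> \<odot>\<^bsub>M\<^esub> x = \<zero>\<^bsub>M\<^esub>"
  by (metis M.add.r_cancel_one R.zero_closed R.l_zero smult_closed smult_l_distr)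

lemma smult_zero_right [simp]: "a \<in> carrier R \<Longrightarrow> a \<odot>\<^bsub>M\<^esub> \<zero>\<^bsub>M\<^esub> = \<zero>\<^bsub>M\<^esub>"
  by (metis M.add.r_cancel_one M.zero_closed M.l_zero smult_closed smult_r_distr)

lemma add_neg [simp]: "x \<in> carrier M \<Longrightarrow> x \<oplus>\<^bsub>M\<^esub> (\<ominus>\<^bsub>R\<^esub> \<one>\<^bsub>R\<^esub>) \<odot>\<^bsub>M\<^esub> x = \<zero>\<^bsub>M\<^esub>"
  by (metis R.add.inv_closed R.one_closed R.r_neg smult_l_distr smult_one smult_zero_left)

lemma neg_add [simp]: "x \<in> carrier M \<Longrightarrow> (\<ominus>\<^bsub>R\<^esub> \<one>\<^bsub>R\<^esub>) \<odot>\<^bsub>M\<^esub> x \<oplus>\<^bsub>M\<^esub> x = \<zero>\<^bsub>M\<^esub>"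
  by (metis R.add.inv_closed R.one_closed R.l_neg smult_l_distr smult_one smult_zero_left)

lemma eq_neg: "x \<in> carrier M \<Longrightarrow> y \<in> carrier M \<Longrightarrow> x \<oplus>\<^bsub>M\<^esub> y = \<zero>\<^bsub>M\<^esub> \<Longrightarrow> x = (\<ominus>\<^bsub>R\<^esub> \<one>\<^bsub>R\<^esub>) \<odot>\<^bsub>M\<^esub> y"
  by (metis M.add.inv_unique' M.add.inv_equality R.add.inv_closed R.one_closed add_neg neg_add smult_closed)

lemma add4: "a \<in> carrier M \<Longrightarrow> b \<in> carrier M \<Longrightarrow> c \<in> carrier M \<Longrightarrow> d \<in> carrier M \<Longrightarrow>
    (a \<oplus>\<^bsub>M\<^esub> b) \<oplus>\<^bsub>M\<^esub> (c \<oplus>\<^bsub>M\<^esub> d) = (a \<oplus>\<^bsub>M\<^esub> c) \<oplus>\<^bsub>M\<^esub> (b \<oplus>\<^bsub>M\<^esub> d)"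
  by (simp add: M.a_ac)

declare smult_closed [simp, intro]

lemma lc_closed: "t \<in> terms R G \<Longrightarrow> u \<in> G \<rightarrow> carrier M \<Longrightarrow> lc M u t \<in> carrier M"
  by (induction t) (auto simp: Pi_iff)

lemma lc_append: "s \<in> terms R G \<Longrightarrow> t \<in> terms R G \<Longrightarrow> u \<in> G \<rightarrow> carrier M \<Longrightarrow>
    lc M u (s @ t) = lc M u s \<oplus>\<^bsub>M\<^esub> lc M u t"
  by (induction s) (auto simp: M.a_ac Pi_iff lc_closed)

lemma lc_scale: "a \<in> carrier R \<Longrightarrow> t \<in> terms R G \<Longrightarrow> u \<in> G \<rightarrow> carrier M \<Longrightarrow>
    lc M u (scale R a t) = a \<odot>\<^bsub>M\<^esub> lc M u t"
  by (induction t) (auto simp: Pi_iff lc_closed scale_def smult_r_distr smult_assoc)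

lemma lc_add: "t \<in> terms R G \<Longrightarrow> u \<in> G \<rightarrow> carrier M \<Longrightarrow> v \<in> G \<rightarrow> carrier M \<Longrightarrow>
    lc M (\<lambda>g. u g \<oplus>\<^bsub>M\<^esub> v g) t = lc M u t \<oplus>\<^bsub>M\<^esub> lc M v t"
  by (induction t) (auto simp: Pi_iff lc_closed smult_r_distr M.a_ac)

lemma neg_smult: "a \<in> carrier R \<Longrightarrow> x \<in> carrier M \<Longrightarrow>
    a \<odot>\<^bsub>M\<^esub> ((\<ominus>\<^bsub>R\<^esub> \<one>\<^bsub>R\<^esub>) \<odot>\<^bsub>M\<^esub> x) = (\<ominus>\<^bsub>R\<^esub> \<one>\<^bsub>R\<^esub>) \<odot>\<^bsub>M\<^esub> (a \<odot>\<^bsub>M\<^esub> x)"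
  by (simp add: smult_assoc[symmetric] R.l_minus R.r_minus)

lemma lc_neg: "t \<in> terms R G \<Longrightarrow> u \<in> G \<rightarrow> carrier M \<Longrightarrow>
    lc M (\<lambda>g. (\<ominus>\<^bsub>R\<^esub> \<one>\<^bsub>R\<^esub>) \<odot>\<^bsub>M\<^esub> u g) t = (\<ominus>\<^bsub>R\<^esub> \<one>\<^bsub>R\<^esub>) \<odot>\<^bsub>M\<^esub> lc M u t"
  by (induction t) (auto simp: Pi_iff lc_closed smult_r_distr neg_smult)

lemma submod_carrier: "submod R M (carrier M)"
  by (auto simp: submod_def)

lemma lin_zero_map: "left_module R N \<Longrightarrow> lin R N M (\<lambda>x. \<zero>\<^bsub>M\<^esub>)"
  by (auto simp: lin_def)

end

lemma lc_cong: "(\<And>g. g \<in> G \<Longrightarrow> u g = v g) \<Longrightarrow> t \<in> terms R G \<Longrightarrow> lc M u t = lc M v t"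
  by (induction t) auto

lemma lc_map: "lc M u (map (apsnd v) t) = lc M (\<lambda>g. u (v g)) t"
  by (induction t) auto

lemma map_terms: "t \<in> terms R G \<Longrightarrow> v \<in> G \<rightarrow> H \<Longrightarrow> map (apsnd v) t \<in> terms R H"
  by (induction t) auto

lemma lc_restr [simp]: "lc (M \<restriction> N) u t = lc M u t"
  by (simp add: lc_def)

lemma lin_cong: "lin R M N f \<Longrightarrow> left_module R M \<Longrightarrow> (\<And>x. x \<in> carrier M \<Longrightarrow> f x = g x) \<Longrightarrow> lin R M N g"
  unfolding lin_def
  by (auto simp: Pi_iff left_module.smult_closed abelian_groupE(1)[OF left_module.axioms(2)])

lemma lin_comp: "lin R M N f \<Longrightarrow> lin R N P g \<Longrightarrow> lin R M P (\<lambda>x. g (f x))"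
  by (auto simp: lin_def Pi_iff)

lemma lin_id: "lin R M M (\<lambda>x. x)"
  by (auto simp: lin_def)

lemma lin_zero:
  assumes "left_module R M" "left_module R N" "lin R M N f"
  shows "f \<zero>\<^bsub>M\<^esub> = \<zero>\<^bsub>N\<^esub>"
proof -
  interpret M: left_module R M by fact
  interpret N: left_module R N by fact
  have "f (\<zero>\<^bsub>R\<^esub> \<odot>\<^bsub>M\<^esub> \<zero>\<^bsub>M\<^esub>) = \<zero>\<^bsub>R\<^esub> \<odot>\<^bsub>N\<^esub> f \<zero>\<^bsub>M\<^esub>"
    by (rule lin_smult[OF assms(3)]) auto
  then show ?thesis using lin_closed[OF assms(3)] by simp
qed

lemma lin_lc:
  assumes "left_module R M" "left_module R N" "lin R M N f" "t \<in> terms R G" "u \<in> G \<rightarrow> carrier M"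
  shows "f (lc M u t) = lc N (\<lambda>g. f (u g)) t"
  using assms(4)
proof (induction t)
  case Nil
  then show ?case using lin_zero[OF assms(1-3)] by simp
next
  case (Cons p t)
  interpret M: left_module R M by fact
  have "u (snd p) \<in> carrier M" "fst p \<in> carrier R" "lc M u t \<in> carrier M"
    using Cons assms(5) by (auto intro!: M.lc_closed)
  with Cons show ?case
    by (simp add: lin_add[OF assms(3)] lin_smult[OF assms(3)] M.smult_closed)
qed

lemma lin_plus:
  assumes "left_module R M" "left_module R N" "lin R M N f" "lin R M N g"
  shows "lin R M N (\<lambda>x. f x \<oplus>\<^bsub>N\<^esub> g x)"
proof -
  interpret M: left_module R M by fact
  interpret N: left_module R N by fact
  note [simp] = lin_closed[OF assms(3)] lin_closed[OF assms(4)]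
  show ?thesis
    by (rule linI) (simp_all add: lin_add[OF assms(3)] lin_add[OF assms(4)]
        lin_smult[OF assms(3)] lin_smult[OF assms(4)] N.smult_r_distr N.a_ac)
qed

lemma lin_neg:
  assumes "left_module R M" "left_module R N" "lin R M N f"
  shows "lin R M N (\<lambda>x. (\<ominus>\<^bsub>R\<^esub> \<one>\<^bsub>R\<^esub>) \<odot>\<^bsub>N\<^esub> f x)"
proof -
  interpret M: left_module R M by fact
  interpret N: left_module R N by fact
  note [simp] = lin_closed[OF assms(3)]
  have "(\<ominus>\<^bsub>R\<^esub> \<one>\<^bsub>R\<^esub>) \<odot>\<^bsub>N\<^esub> f (a \<odot>\<^bsub>M\<^esub> x) = a \<odot>\<^bsub>N\<^esub> ((\<ominus>\<^bsub>R\<^esub> \<one>\<^bsub>R\<^esub>) \<odot>\<^bsub>N\<^esub> f x)"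
    if "a \<in> carrier R" "x \<in> carrier M" for a x
    using that by (simp add: lin_smult[OF assms(3)] N.neg_smult)
  then show ?thesis
    by (intro linI) (simp_all add: lin_add[OF assms(3)] N.smult_r_distr N.smult_closed)
qed

lemma left_module_submod:
  assumes "left_module R M" "submod R M N"
  shows "left_module R (M \<restriction> N)"
proof -
  interpret left_module R M by fact
  have sub: "x \<in> carrier M" if "x \<in> N" for x using assms(2) that by (auto simp: submod_def)
  show ?thesis
    using assms(2) R.ring_axioms
    by (intro left_moduleI)
      (auto simp: submod_def sub M.a_ac smult_l_distr smult_r_distr smult_assoc smult_one)
qed

lemma submod_closed:
  assumes "submod R M N"
  shows "N \<subseteq> carrier M" "\<zero>\<^bsub>M\<^esub> \<in> N" "\<And>x y. x \<in> N \<Longrightarrow> y \<in> N \<Longrightarrow> x \<oplus>\<^bsub>M\<^esub> y \<in> N"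
    "\<And>a x. a \<in> carrier R \<Longrightarrow> x \<in> N \<Longrightarrow> a \<odot>\<^bsub>M\<^esub> x \<in> N"
  using assms by (auto simp: submod_def)

lemma lin_restr_dom: "lin R M N f \<Longrightarrow> A \<subseteq> carrier M \<Longrightarrow> lin R (M \<restriction> A) N f"
  by (auto simp: lin_def subset_iff Pi_iff)

lemma lin_restr_cod: "lin R M N f \<Longrightarrow> f \<in> carrier M \<rightarrow> A \<Longrightarrow> lin R M (N \<restriction> A) f"
  by (auto simp: lin_def)

lemma lin_incl: "A \<subseteq> B \<Longrightarrow> lin R (M \<restriction> A) (M \<restriction> B) (\<lambda>x. x)"
  by (auto simp: lin_def)

lemma submod_restr: "submod R M N \<Longrightarrow> A \<subseteq> N \<Longrightarrow> submod R (M \<restriction> N) A \<longleftrightarrow> submod R M A"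
  by (auto simp: submod_def)

lemma submod_Int: "submod R M A \<Longrightarrow> submod R M B \<Longrightarrow> submod R M (A \<inter> B)"
  by (auto simp: submod_def)

lemma submod_Inter: "\<A> \<noteq> {} \<Longrightarrow> (\<And>A. A \<in> \<A> \<Longrightarrow> submod R M A) \<Longrightarrow> submod R M (\<Inter>\<A>)"
  by (auto simp: submod_def Inter_subset)

section \<open>Sums and spans of submodules\<close>

definition msum :: "('r, 'a) module \<Rightarrow> 'a set \<Rightarrow> 'a set \<Rightarrow> 'a set" where
  "msum M A B = {a \<oplus>\<^bsub>M\<^esub> b | a b. a \<in> A \<and> b \<in> B}"

lemma submod_msum:
  assumes "left_module R M" "submod R M A" "submod R M B"
  shows "submod R M (msum M A B)" "A \<subseteq> msum M A B" "B \<subseteq> msum M A B"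
proof -
  interpret left_module R M by fact
  note A = submod_closed[OF assms(2)] and B = submod_closed[OF assms(3)]
  have sA: "a \<in> carrier M" if "a \<in> A" for a using A that by auto
  have sB: "a \<in> carrier M" if "a \<in> B" for a using B that by auto
  show "A \<subseteq> msum M A B"
  proof
    fix a assume "a \<in> A"
    then have "a = a \<oplus>\<^bsub>M\<^esub> \<zero>\<^bsub>M\<^esub>" using sA by simp
    with \<open>a \<in> A\<close> B(2) show "a \<in> msum M A B" unfolding msum_def by blast
  qed
  show "B \<subseteq> msum M A B"
  proof
    fix a assume "a \<in> B"
    then have "a = \<zero>\<^bsub>M\<^esub> \<oplus>\<^bsub>M\<^esub> a" using sB by simp
    with \<open>a \<in> B\<close> A(2) show "a \<in> msum M A B" unfolding msum_def by blast
  qed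
  show "submod R M (msum M A B)"
    unfolding submod_def
  proof (intro conjI ballI)
    show "msum M A B \<subseteq> carrier M" using sA sB by (auto simp: msum_def)
    show "\<zero>\<^bsub>M\<^esub> \<in> msum M A B" using A(2) \<open>A \<subseteq> msum M A B\<close> by blast
    fix x assume "x \<in> msum M A B"
    then obtain a b where x: "a \<in> A" "b \<in> B" "x = a \<oplus>\<^bsub>M\<^esub> b" by (auto simp: msum_def)
    { fix y assume "y \<in> msum M A B"
      then obtain c d where y: "c \<in> A" "d \<in> B" "y = c \<oplus>\<^bsub>M\<^esub> d" by (auto simp: msum_def)
      have "x \<oplus>\<^bsub>M\<^esub> y = (a \<oplus>\<^bsub>M\<^esub> c) \<oplus>\<^bsub>M\<^esub> (b \<oplus>\<^bsub>M\<^esub> d)" using x y sA sB by (simp add: add4)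
      then show "x \<oplus>\<^bsub>M\<^esub> y \<in> msum M A B" using A(3)[OF x(1) y(1)] B(3)[OF x(2) y(2)] unfolding msum_def by blast }
    { fix r assume "r \<in> carrier R"
      then have "r \<odot>\<^bsub>M\<^esub> x = r \<odot>\<^bsub>M\<^esub> a \<oplus>\<^bsub>M\<^esub> r \<odot>\<^bsub>M\<^esub> b" using x sA sB by (simp add: smult_r_distr)
      then show "r \<odot>\<^bsub>M\<^esub> x \<in> msum M A B" using A(4)[OF \<open>r \<in> carrier R\<close> x(1)] B(4)[OF \<open>r \<in> carrier R\<close> x(2)] unfolding msum_def by blast }
  qed
qed

definition mspan :: "('r, 'k) ring_scheme \<Rightarrow> ('r, 'a) module \<Rightarrow> 'a set \<Rightarrow> 'a set" where
  "mspan R M S = \<Inter>{N. submod R M N \<and> S \<subseteq> N}"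

lemma mspan:
  assumes "left_module R M" "S \<subseteq> carrier M"
  shows "submod R M (mspan R M S)" "S \<subseteq> mspan R M S" "\<And>N. submod R M N \<Longrightarrow> S \<subseteq> N \<Longrightarrow> mspan R M S \<subseteq> N"
proof -
  interpret left_module R M by fact
  show "submod R M (mspan R M S)"
    unfolding mspan_def using submod_carrier assms by (intro submod_Inter) auto
qed (auto simp: mspan_def)

section \<open>Cardinality\<close>

text \<open>The bound is the cardinal \<lambda> of the universe condition. It is infinite and at
  least |carrier R|, hence not exceeded when a submodule is generated. Functions from a tiny set to
  a small set form a small set, which the universe condition does not grant for arbitrary small
  domains.\<close>

definition tiny :: "('r, 'k) ring_scheme \<Rightarrow> 'a set \<Rightarrow> bool" where
  "tiny R A \<longleftrightarrow> |A| \<le>o |carrier R \<times> (UNIV :: nat set)|"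

lemma card_of_lists_ordLeq:
  assumes inf: "infinite B" and A: "|A| \<le>o |B|"
  shows "|lists A| \<le>o |B|"
proof -
  have "|{xs \<in> lists A. length xs = n}| \<le>o |B|" for n
  proof (induction n)
    case 0
    have "{xs \<in> lists A. length xs = 0} = {[]}" by auto
    then show ?case using inf card_of_singl_ordLeq by (metis finite.emptyI)
  next
    case (Suc n)
    have "{xs \<in> lists A. length xs = Suc n} \<subseteq> (\<lambda>(x, xs). x # xs) ` (A \<times> {xs \<in> lists A. length xs = n})"
    proof
      fix xs assume "xs \<in> {xs \<in> lists A. length xs = Suc n}"
      then show "xs \<in> (\<lambda>(x, xs). x # xs) ` (A \<times> {xs \<in> lists A. length xs = n})"
        by (cases xs) auto
    qed
    moreover have "|A \<times> {xs \<in> lists A. length xs = n}| \<le>o |B|"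
      by (rule card_of_Times_ordLeq_infinite_Field[OF _ _ _ card_of_Card_order]) (use inf A Suc in \<open>simp_all add: Field_card_of\<close>)
    ultimately show ?case
      by (meson card_of_image card_of_mono1 ordLeq_transitive)
  qed
  moreover have "|UNIV :: nat set| \<le>o |B|"
    using inf infinite_iff_card_of_nat by blast
  ultimately have "|\<Union>n. {xs \<in> lists A. length xs = n}| \<le>o |B|"
    using inf by (intro card_of_UNION_ordLeq_infinite) auto
  moreover have "(\<Union>n. {xs \<in> lists A. length xs = n}) = lists A" by auto
  ultimately show ?thesis by simp
qed

lemma tiny_mono: "tiny R A \<Longrightarrow> |B| \<le>o |A| \<Longrightarrow> tiny R B"
  unfolding tiny_def using ordLeq_transitive by blast

lemma tiny_subset: "tiny R A \<Longrightarrow> B \<subseteq> A \<Longrightarrow> tiny R B"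
  using tiny_mono card_of_mono1 by blast

lemma tiny_image: "tiny R A \<Longrightarrow> tiny R (f ` A)"
  using tiny_mono card_of_image by blast

section \<open>Closure properties of small and tiny sets\<close>

locale mod_univ =
  fixes R :: "'r ring" and U :: "'u itself"
  assumes ring: "ring R" and univ: "module_universe R U"
begin

sublocale R: ring R by (rule ring)

abbreviation "sm \<equiv> small U"

lemma infinite_L: "infinite (carrier R \<times> (UNIV :: nat set))"
  using R.zero_closed by (auto simp: finite_cartesian_product_iff)

lemma infinite_univ: "infinite (UNIV :: 'u set)"
  using univ by (simp add: module_universe_def)

lemma small_mono: "sm A \<Longrightarrow> |B| \<le>o |A| \<Longrightarrow> sm B"
  unfolding small_def using ordLeq_ordLess_trans by blast

lemma small_subset: "sm A \<Longrightarrow> B \<subseteq> A \<Longrightarrow> sm B"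
  using small_mono card_of_mono1 by blast

lemma small_image: "sm A \<Longrightarrow> sm (f ` A)"
  using small_mono card_of_image by blast

text \<open>Regularity of the universe enters only here, in the form that makes small sums and small
  unions of small sets small.\<close>

lemma small_stable: "stable |UNIV :: 'u set|"
  using univ infinite_univ
  by (intro regularCard_stable[OF card_of_Card_order]) (simp_all add: module_universe_def Field_card_of)

lemma small_Sigma: "sm A \<Longrightarrow> (\<And>a. a \<in> A \<Longrightarrow> sm (B a)) \<Longrightarrow> sm (Sigma A B)"
  unfolding small_def using small_stable stable_elim by blast

lemma small_UN: "sm A \<Longrightarrow> (\<And>a. a \<in> A \<Longrightarrow> sm (B a)) \<Longrightarrow> sm (\<Union>a\<in>A. B a)"
  unfolding small_def using small_stable stable_UNION by blast

lemma small_finite: "finite A \<Longrightarrow> sm A"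
  unfolding small_def using infinite_univ by (metis card_of_Well_order card_of_ordLeq_infinite not_ordLess_iff_ordLeq ordLess_or_ordLeq)

lemma ex_inj_small:
  assumes "sm A" obtains f :: "'a \<Rightarrow> 'u" where "inj_on f A"
  using assms ordLess_imp_ordLeq unfolding small_def by (metis card_of_ordLeq)

lemma tiny_Times: "tiny R A \<Longrightarrow> tiny R B \<Longrightarrow> tiny R (A \<times> B)"
  unfolding tiny_def using infinite_L
  by (intro card_of_Times_ordLeq_infinite_Field[OF _ _ _ card_of_Card_order]) (simp_all add: Field_card_of)

lemma tiny_lists: "tiny R A \<Longrightarrow> tiny R (lists A)"
  unfolding tiny_def using infinite_L by (intro card_of_lists_ordLeq)

lemma tiny_UN: "tiny R A \<Longrightarrow> (\<And>a. a \<in> A \<Longrightarrow> tiny R (B a)) \<Longrightarrow> tiny R (\<Union>a\<in>A. B a)"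
  unfolding tiny_def using infinite_L by (intro card_of_UNION_ordLeq_infinite) auto

lemma tiny_nat: "tiny R (A :: nat set)"
  unfolding tiny_def using infinite_L infinite_iff_card_of_nat
  by (meson card_of_mono1 ordLeq_transitive subset_UNIV)

lemma tiny_finite: "finite A \<Longrightarrow> tiny R A"
  using tiny_nat[of UNIV] unfolding tiny_def
  by (metis card_of_Well_order card_of_ordLeq_infinite infinite_L ordLeq_total)

lemma tiny_carrier: "tiny R (carrier R)"
  unfolding tiny_def by (intro card_of_Times1) auto

lemma tiny_Un: "tiny R A \<Longrightarrow> tiny R B \<Longrightarrow> tiny R (A \<union> B)"
  using tiny_UN[of "UNIV" "\<lambda>b. if b then A else B"] tiny_finite[of "UNIV :: bool set"]
  by (simp add: UNIV_bool Un_commute)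

lemma tiny_terms: "tiny R G \<Longrightarrow> tiny R (terms R G)"
  unfolding terms_def by (intro tiny_lists tiny_Times tiny_carrier)

text \<open>The universe condition speaks of the single domain
  \<open>carrier R \<times> UNIV\<close> and of codomains inside \<open>'u\<close>. Functions are
  moved there along an injection of A into this domain and an injection of B into
  \<open>'u\<close>.\<close>

lemma small_PiE:
  assumes A: "tiny R A" and B: "sm B"
  shows "sm (A \<rightarrow>\<^sub>E B)"
proof (cases "B = {}")
  case True
  have "A \<rightarrow>\<^sub>E B \<subseteq> {\<lambda>_. undefined}" using True by (cases "A = {}") auto
  then show ?thesis using small_finite finite_subset by blast
next
  case False
  then obtain b where b: "b \<in> B" by blast
  let ?L = "carrier R \<times> (UNIV :: nat set)"
  obtain j where j: "inj_on j A" "j ` A \<subseteq> ?L" using A card_of_ordLeq[of A ?L] unfolding tiny_def by blast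
  obtain e :: "_ \<Rightarrow> 'u" where e: "inj_on e B" using ex_inj_small[OF B] by blast
  \<comment> \<open>Outside the image of A the function is padded with the fixed value
    \<open>e b\<close>; hence the separate treatment of an empty B.\<close>
  define \<Phi> where "\<Phi> g = (\<lambda>l\<in>?L. if l \<in> j ` A then e (g (inv_into A j l)) else e b)" for g
  have "inj_on \<Phi> (A \<rightarrow>\<^sub>E B)"
  proof (rule inj_onI)
    fix g h assume g: "g \<in> A \<rightarrow>\<^sub>E B" and h: "h \<in> A \<rightarrow>\<^sub>E B" and eq: "\<Phi> g = \<Phi> h"
    have "g x = h x" if "x \<in> A" for x
    proof -
      have "\<Phi> g (j x) = \<Phi> h (j x)" using eq by simp
      moreover have "j x \<in> ?L" using j that by blast
      ultimately have "e (g x) = e (h x)"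
        using that j(1) by (simp add: \<Phi>_def del: mem_Sigma_iff)
      then show ?thesis using e g h that by (meson PiE_mem inj_onD)
    qed
    then show "g = h" using g h by (meson PiE_ext)
  qed
  moreover have "\<Phi> ` (A \<rightarrow>\<^sub>E B) \<subseteq> ?L \<rightarrow>\<^sub>E (e ` B)"
  proof
    fix x assume "x \<in> \<Phi> ` (A \<rightarrow>\<^sub>E B)"
    then obtain g where g: "g \<in> A \<rightarrow>\<^sub>E B" "x = \<Phi> g" by blast
    have "g (inv_into A j l) \<in> B" if "l \<in> j ` A" for l
      using PiE_mem[OF g(1) inv_into_into[OF that]] .
    then show "x \<in> ?L \<rightarrow>\<^sub>E (e ` B)"
      unfolding g(2) \<Phi>_def using b by (intro restrict_PiE_iff[THEN iffD2]) simp
  qed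
  ultimately have "|A \<rightarrow>\<^sub>E B| \<le>o |?L \<rightarrow>\<^sub>E (e ` B)|"
    by (rule card_of_ordLeqI[OF _ subsetD[OF _ imageI]])
  moreover have "sm (?L \<rightarrow>\<^sub>E (e ` B))"
    using small_image[OF B] univ unfolding module_universe_def by blast
  ultimately show ?thesis using small_mono by blast
qed

lemma small_Pow: assumes "tiny R A" shows "sm (Pow A)"
proof -
  have "inj_on (\<lambda>X. \<lambda>x\<in>A. x \<in> X) (Pow A)"
  proof (rule inj_onI)
    fix X Y assume X: "X \<in> Pow A" "Y \<in> Pow A" "(\<lambda>x\<in>A. x \<in> X) = (\<lambda>x\<in>A. x \<in> Y)"
    have "x \<in> X \<longleftrightarrow> x \<in> Y" if "x \<in> A" for x
      using fun_cong[OF X(3), of x] that by simp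
    with X(1,2) show "X = Y" by blast
  qed
  moreover have "(\<lambda>X. \<lambda>x\<in>A. x \<in> X) ` Pow A \<subseteq> A \<rightarrow>\<^sub>E (UNIV :: bool set)" by auto
  ultimately have "|Pow A| \<le>o |A \<rightarrow>\<^sub>E (UNIV :: bool set)|"
    by (rule card_of_ordLeqI[OF _ subsetD[OF _ imageI]])
  then show ?thesis
    by (rule small_mono[OF small_PiE[OF assms small_finite[of "UNIV :: bool set"]], rotated]) simp
qed

text \<open>By Cantor's theorem A is smaller than its power set, which is small by
  \<open>small_Pow\<close>.\<close>

lemma small_tiny: "tiny R A \<Longrightarrow> sm A"
  using small_Pow small_mono ordLess_imp_ordLeq[OF card_of_Pow] by blast

lemma small_Times: "sm A \<Longrightarrow> sm B \<Longrightarrow> sm (A \<times> B)"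
  by (rule small_Sigma)

lemma small_Un: "sm A \<Longrightarrow> sm B \<Longrightarrow> sm (A \<union> B)"
  using small_UN[of "UNIV" "\<lambda>b. if b then A else B"] small_finite[of "UNIV :: bool set"]
  by (simp add: UNIV_bool Un_commute)

lemma small_lists: assumes "sm A" shows "sm (lists A)"
proof -
  \<comment> \<open>The summand \<open>nat\<close> makes the bounding set infinite also when A is
    finite.\<close>
  have "sm (A <+> (UNIV :: nat set))"
    unfolding Plus_def using assms small_tiny[OF tiny_nat] by (intro small_Un small_image)
  moreover have "|lists A| \<le>o |A <+> (UNIV :: nat set)|"
    by (rule card_of_lists_ordLeq) (auto simp: card_of_Plus1)
  ultimately show ?thesis using small_mono by blast
qed

lemma small_terms: "sm G \<Longrightarrow> sm (terms R G)"
  unfolding terms_def by (intro small_lists small_Times small_tiny[OF tiny_carrier])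

lemma small_Fpow: assumes "sm A" shows "sm {S. finite S \<and> S \<subseteq> A}"
proof (rule small_subset[OF small_image[OF small_lists[OF assms], of set]])
  show "{S. finite S \<and> S \<subseteq> A} \<subseteq> set ` lists A"
    by (auto simp: lists_eq_set image_iff) (metis finite_list)
qed

lemma module_catD: "M \<in> module_cat R \<Longrightarrow> left_module R (M :: ('r, 'u) module)"
  "M \<in> module_cat R \<Longrightarrow> sm (carrier M)"
  unfolding module_cat_def small_def by auto

lemma module_catI: "left_module R (M :: ('r, 'u) module) \<Longrightarrow> sm (carrier M) \<Longrightarrow> M \<in> module_cat R"
  unfolding module_cat_def small_def by auto

lemma module_cat_restr: "(M :: ('r, 'u) module) \<in> module_cat R \<Longrightarrow> submod R M N \<Longrightarrow> M \<restriction> N \<in> module_cat R"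
  using submod_closed(1)[of R M N] small_subset[of "carrier M" N]
  by (auto intro!: module_catI left_module_submod dest: module_catD)

end

section \<open>Constructions with modules\<close>

text \<open>The module axioms are equations between elements of the carrier, so they can be checked
  after applying an injective map that respects the operations.\<close>

lemma left_module_inj:
  assumes M: "left_module R M" and inj: "inj_on \<phi> (carrier M')" and \<phi>: "lin R M' M \<phi>"
    and 0: "\<zero>\<^bsub>M'\<^esub> \<in> carrier M'" "\<phi> \<zero>\<^bsub>M'\<^esub> = \<zero>\<^bsub>M\<^esub>"
    and add: "\<And>x y. \<lbrakk>x \<in> carrier M'; y \<in> carrier M'\<rbrakk> \<Longrightarrow> x \<oplus>\<^bsub>M'\<^esub> y \<in> carrier M'"
    and smult: "\<And>a x. \<lbrakk>a \<in> carrier R; x \<in> carrier M'\<rbrakk> \<Longrightarrow> a \<odot>\<^bsub>M'\<^esub> x \<in> carrier M'"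
  shows "left_module R M'"
proof -
  interpret left_module R M by fact
  note [simp] = 0 add smult lin_closed[OF \<phi>] lin_add[OF \<phi>] lin_smult[OF \<phi>]
  show ?thesis
    by (rule left_moduleI) (auto intro!: R.ring_axioms inj_onD[OF inj] simp: M.a_ac smult_l_distr smult_r_distr smult_assoc smult_one)
qed

lemma lin_inv:
  assumes "left_module R M" "lin R M N f" "bij_betw f (carrier M) (carrier N)"
  shows "lin R N M (inv_into (carrier M) f)"
proof (rule linI)
  interpret left_module R M by fact
  let ?g = "inv_into (carrier M) f"
  have g: "?g y \<in> carrier M" "f (?g y) = y" if "y \<in> carrier N" for y
    using assms(3) that by (auto simp: bij_betw_def inv_into_into f_inv_into_f)
  have gf: "?g (f x) = x" if "x \<in> carrier M" for x
    using assms(3) that by (auto simp: bij_betw_def)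
  show "?g y \<in> carrier M" if "y \<in> carrier N" for y using g that by simp
  show "?g (x \<oplus>\<^bsub>N\<^esub> y) = ?g x \<oplus>\<^bsub>M\<^esub> ?g y" if "x \<in> carrier N" "y \<in> carrier N" for x y
    using gf[of "?g x \<oplus>\<^bsub>M\<^esub> ?g y"] that g by (simp add: lin_add[OF assms(2)])
  show "?g (a \<odot>\<^bsub>N\<^esub> y) = a \<odot>\<^bsub>M\<^esub> ?g y" if "a \<in> carrier R" "y \<in> carrier N" for a y
    using gf[of "a \<odot>\<^bsub>M\<^esub> ?g y"] that g by (simp add: lin_smult[OF assms(2)])
qed

lemma transport_module:
  assumes "left_module R M" "bij_betw \<theta> (carrier M) B"
  obtains M' :: "('r, 'b) module"
  where "left_module R M'" "carrier M' = B" "lin R M M' \<theta>"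
proof -
  interpret left_module R M by fact
  define \<phi> where "\<phi> = inv_into (carrier M) \<theta>"
  have \<phi>: "\<phi> y \<in> carrier M" "\<theta> (\<phi> y) = y" if "y \<in> B" for y
    using assms(2) that by (auto simp: \<phi>_def bij_betw_def inv_into_into f_inv_into_f)
  have \<theta>: "\<theta> x \<in> B" "\<phi> (\<theta> x) = x" if "x \<in> carrier M" for x
    using assms(2) that by (auto simp: \<phi>_def bij_betw_def)
  define M' :: "('r, 'b) module" where "M' = \<lparr>carrier = B, monoid.mult = undefined, one = undefined,
    zero = \<theta> \<zero>\<^bsub>M\<^esub>, add = (\<lambda>x y. \<theta> (\<phi> x \<oplus>\<^bsub>M\<^esub> \<phi> y)), smult = (\<lambda>a x. \<theta> (a \<odot>\<^bsub>M\<^esub> \<phi> x))\<rparr>"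
  have "left_module R M'"
  proof (rule left_module_inj[OF assms(1), of \<phi>])
    show "inj_on \<phi> (carrier M')" using \<phi>(2) by (auto simp: M'_def intro: inj_on_inverseI)
  qed (auto simp: lin_def M'_def \<phi> \<theta>)
  moreover have "lin R M M' \<theta>"
    by (auto simp: lin_def M'_def \<phi> \<theta>)
  ultimately show thesis by (intro that[of M']) (auto simp: M'_def)
qed

lemma quotient_module:
  fixes M :: "('r, 'a) module"
  assumes M: "left_module R M" and N: "submod R M N"
  obtains Q :: "('r, 'a set) module" and \<pi>
  where "left_module R Q" "lin R M Q \<pi>" "carrier Q = \<pi> ` carrier M"
    "\<And>x. x \<in> carrier M \<Longrightarrow> \<pi> x = \<zero>\<^bsub>Q\<^esub> \<longleftrightarrow> x \<in> N"
proof -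
  interpret left_module R M by fact
  have sub: "x \<in> carrier M" if "x \<in> N" for x using N that by (auto simp: submod_def)
  note N' = submod_closed(2-4)[OF N]
  define \<pi> where "\<pi> x = {x \<oplus>\<^bsub>M\<^esub> n | n. n \<in> N}" for x
  have mono: "\<pi> (x \<oplus>\<^bsub>M\<^esub> n) \<subseteq> \<pi> x" if "x \<in> carrier M" "n \<in> N" for x n
    using that N'(2)[of n] by (auto simp: \<pi>_def M.a_assoc sub)
  have shift: "\<pi> (x \<oplus>\<^bsub>M\<^esub> n) = \<pi> x" if "x \<in> carrier M" "n \<in> N" for x n
  proof
    have "(x \<oplus>\<^bsub>M\<^esub> n) \<oplus>\<^bsub>M\<^esub> ((\<ominus>\<^bsub>R\<^esub> \<one>\<^bsub>R\<^esub>) \<odot>\<^bsub>M\<^esub> n) = x" using that sub by (simp add: M.a_assoc)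
    then show "\<pi> x \<subseteq> \<pi> (x \<oplus>\<^bsub>M\<^esub> n)"
      using mono[of "x \<oplus>\<^bsub>M\<^esub> n" "(\<ominus>\<^bsub>R\<^esub> \<one>\<^bsub>R\<^esub>) \<odot>\<^bsub>M\<^esub> n"] that sub N' by simp
  qed (use mono that in blast)
  have mem: "\<exists>n\<in>N. y = x \<oplus>\<^bsub>M\<^esub> n" if "x \<in> carrier M" "y \<in> carrier M" "\<pi> x = \<pi> y" for x y
  proof -
    have "y \<oplus>\<^bsub>M\<^esub> \<zero>\<^bsub>M\<^esub> \<in> \<pi> y" using N' unfolding \<pi>_def by blast
    then show ?thesis using that by (auto simp: \<pi>_def)
  qed
  \<comment> \<open>The operations on cosets are computed on chosen representatives. A
    representative differs from the given element by a member of N (\<open>rep\<close>), and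
    \<open>shift\<close> absorbs that difference.\<close>
  define r where "r X = (SOME x. x \<in> carrier M \<and> \<pi> x = X)" for X
  have r: "r (\<pi> x) \<in> carrier M" "\<pi> (r (\<pi> x)) = \<pi> x" if "x \<in> carrier M" for x
    using someI[of "\<lambda>y. y \<in> carrier M \<and> \<pi> y = \<pi> x" x] that by (simp_all add: r_def)
  have rep: "\<exists>n\<in>N. r (\<pi> x) = x \<oplus>\<^bsub>M\<^esub> n" if "x \<in> carrier M" for x
    using mem[OF that r(1)[OF that]] r(2)[OF that] by simp
  define Q :: "('r, 'a set) module" where "Q = \<lparr>carrier = \<pi> ` carrier M, monoid.mult = undefined,
    one = undefined, zero = \<pi> \<zero>\<^bsub>M\<^esub>, add = (\<lambda>X Y. \<pi> (r X \<oplus>\<^bsub>M\<^esub> r Y)), smult = (\<lambda>a X. \<pi> (a \<odot>\<^bsub>M\<^esub> r X))\<rparr>"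
  have add: "\<pi> x \<oplus>\<^bsub>Q\<^esub> \<pi> y = \<pi> (x \<oplus>\<^bsub>M\<^esub> y)" if xy: "x \<in> carrier M" "y \<in> carrier M" for x y
  proof -
    obtain m n where "m \<in> N" "n \<in> N" "r (\<pi> x) = x \<oplus>\<^bsub>M\<^esub> m" "r (\<pi> y) = y \<oplus>\<^bsub>M\<^esub> n"
      using rep[OF xy(1)] rep[OF xy(2)] by blast
    then have "r (\<pi> x) \<oplus>\<^bsub>M\<^esub> r (\<pi> y) = (x \<oplus>\<^bsub>M\<^esub> y) \<oplus>\<^bsub>M\<^esub> (m \<oplus>\<^bsub>M\<^esub> n)" "m \<oplus>\<^bsub>M\<^esub> n \<in> N"
      using that sub N' by (auto simp: add4)
    then show ?thesis using shift that by (simp add: Q_def)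
  qed
  have smult: "a \<odot>\<^bsub>Q\<^esub> \<pi> x = \<pi> (a \<odot>\<^bsub>M\<^esub> x)" if ax: "a \<in> carrier R" "x \<in> carrier M" for a x
  proof -
    obtain m where "m \<in> N" "r (\<pi> x) = x \<oplus>\<^bsub>M\<^esub> m"
      using rep[OF ax(2)] by blast
    then have "a \<odot>\<^bsub>M\<^esub> r (\<pi> x) = a \<odot>\<^bsub>M\<^esub> x \<oplus>\<^bsub>M\<^esub> a \<odot>\<^bsub>M\<^esub> m" "a \<odot>\<^bsub>M\<^esub> m \<in> N"
      using that sub N' by (auto simp: smult_r_distr)
    then show ?thesis using shift that by (simp add: Q_def)
  qed
  have c: "carrier Q = \<pi> ` carrier M" and z: "\<zero>\<^bsub>Q\<^esub> = \<pi> \<zero>\<^bsub>M\<^esub>" by (auto simp: Q_def)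
  have "left_module R Q"
    by (rule left_moduleI)
      (auto simp: c z add smult R.ring_axioms M.a_ac smult_l_distr smult_r_distr smult_assoc smult_one)
  moreover have "lin R M Q \<pi>"
    by (rule linI) (auto simp: c add smult)
  moreover have "\<pi> x = \<zero>\<^bsub>Q\<^esub> \<longleftrightarrow> x \<in> N" if "x \<in> carrier M" for x
    using mem[of "\<zero>\<^bsub>M\<^esub>" x] shift[of "\<zero>\<^bsub>M\<^esub>" x] that sub by (auto simp: z)
  ultimately show thesis using that c by blast
qed

section \<open>Directed colimits of modules\<close>

definition dsystem where
  "dsystem R I po M e \<longleftrightarrow> I \<noteq> {} \<and> (\<forall>i\<in>I. po i i) \<and>
     (\<forall>i\<in>I. \<forall>j\<in>I. \<forall>k\<in>I. po i j \<longrightarrow> po j k \<longrightarrow> po i k) \<and>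
     (\<forall>i\<in>I. \<forall>j\<in>I. \<exists>k\<in>I. po i k \<and> po j k) \<and> (\<forall>i\<in>I. left_module R (M i)) \<and>
     (\<forall>i\<in>I. \<forall>j\<in>I. po i j \<longrightarrow> lin R (M i) (M j) (e i j)) \<and>
     (\<forall>i\<in>I. \<forall>x\<in>carrier (M i). e i i x = x) \<and>
     (\<forall>i\<in>I. \<forall>j\<in>I. \<forall>k\<in>I. po i j \<longrightarrow> po j k \<longrightarrow> (\<forall>x\<in>carrier (M i). e j k (e i j x) = e i k x))"

text \<open>The elementwise criterion in place of the universal property: the legs are jointly
  surjective, and an element vanishes in L only if it already vanishes at a later stage. It can be
  checked directly for unions and for presentations, and \<open>dcolim_univ\<close> recovers the
  universal property.\<close>

definition dcolim where
  "dcolim R I po M e L c \<longleftrightarrow> left_module R L \<and> (\<forall>i\<in>I. lin R (M i) L (c i)) \<and>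
     (\<forall>i\<in>I. \<forall>j\<in>I. po i j \<longrightarrow> (\<forall>x\<in>carrier (M i). c j (e i j x) = c i x)) \<and>
     (\<forall>y\<in>carrier L. \<exists>i\<in>I. \<exists>x\<in>carrier (M i). y = c i x) \<and>
     (\<forall>i\<in>I. \<forall>x\<in>carrier (M i). c i x = \<zero>\<^bsub>L\<^esub> \<longrightarrow> (\<exists>j\<in>I. po i j \<and> e i j x = \<zero>\<^bsub>M j\<^esub>))"

lemma dcolim_eqD:
  assumes S: "dsystem R I po M e" and C: "dcolim R I po M e L c"
    and i: "i \<in> I" and x: "x \<in> carrier (M i)" "y \<in> carrier (M i)" and eq: "c i x = c i y"
  obtains j where "j \<in> I" "po i j" "e i j x = e i j y"
proof -
  interpret Mi: left_module R "M i" using S i by (auto simp: dsystem_def)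
  interpret L: left_module R L using C by (auto simp: dcolim_def)
  have ci: "lin R (M i) L (c i)" using C i by (auto simp: dcolim_def)
  let ?n = "(\<ominus>\<^bsub>R\<^esub> \<one>\<^bsub>R\<^esub>)"
  have "c i (x \<oplus>\<^bsub>M i\<^esub> ?n \<odot>\<^bsub>M i\<^esub> y) = \<zero>\<^bsub>L\<^esub>"
    using x eq lin_closed[OF ci] by (simp add: lin_add[OF ci] lin_smult[OF ci])
  then obtain j where j: "j \<in> I" "po i j" "e i j (x \<oplus>\<^bsub>M i\<^esub> ?n \<odot>\<^bsub>M i\<^esub> y) = \<zero>\<^bsub>M j\<^esub>"
  proof -
    have "x \<oplus>\<^bsub>M i\<^esub> ?n \<odot>\<^bsub>M i\<^esub> y \<in> carrier (M i)" using x by simp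
    then show thesis using C i that \<open>c i (x \<oplus>\<^bsub>M i\<^esub> ?n \<odot>\<^bsub>M i\<^esub> y) = \<zero>\<^bsub>L\<^esub>\<close> unfolding dcolim_def by blast
  qed
  interpret Mj: left_module R "M j" using S j unfolding dsystem_def by blast
  have e: "lin R (M i) (M j) (e i j)" using S i j unfolding dsystem_def by blast
  have "e i j x \<oplus>\<^bsub>M j\<^esub> ?n \<odot>\<^bsub>M j\<^esub> e i j y = \<zero>\<^bsub>M j\<^esub>"
    using j(3) x by (simp add: lin_add[OF e] lin_smult[OF e])
  then have "e i j x = ?n \<odot>\<^bsub>M j\<^esub> (?n \<odot>\<^bsub>M j\<^esub> e i j y)"
    using x lin_closed[OF e] by (intro Mj.eq_neg) auto
  also have "\<dots> = e i j y"
    using x lin_closed[OF e] by (simp add: Mj.smult_assoc[symmetric] Mi.R.l_minus Mj.smult_one)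
  finally show thesis using j that by blast
qed

lemma directed_colimit_exists:
  fixes M :: "'i \<Rightarrow> ('r, 'a) module"
  assumes ring: "ring R" and S: "dsystem R I po M e"
  obtains L :: "('r, ('i \<times> 'a) set) module" and c where "dcolim R I po M e L c"
proof -
  interpret R: ring R by fact
  have ne: "I \<noteq> {}" and refl: "\<And>i. i \<in> I \<Longrightarrow> po i i"
    using S by (simp_all add: dsystem_def)
  have trans: "po i k" if "i \<in> I" "j \<in> I" "k \<in> I" "po i j" "po j k" for i j k
    using S that unfolding dsystem_def by meson
  have dir: "\<exists>k\<in>I. po i k \<and> po j k" if "i \<in> I" "j \<in> I" for i j
    using S that unfolding dsystem_def by meson
  have M: "left_module R (M i)" if "i \<in> I" for i
    using S that unfolding dsystem_def by meson
  have e: "lin R (M i) (M j) (e i j)" if "i \<in> I" "j \<in> I" "po i j" for i j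
    using S that unfolding dsystem_def by meson
  have e_id: "e i i x = x" if "i \<in> I" "x \<in> carrier (M i)" for i x
    using S that unfolding dsystem_def by meson
  have e_comp: "e j k (e i j x) = e i k x"
    if "i \<in> I" "j \<in> I" "k \<in> I" "po i j" "po j k" "x \<in> carrier (M i)" for i j k x
    using S that unfolding dsystem_def by meson
  note ec = lin_closed[OF e]
  \<comment> \<open>Pairs of a stage and an element are identified when their images agree at a
    common later stage; the elements of L are the resulting classes.\<close>
  define eqv where "eqv i x j y \<longleftrightarrow> (\<exists>k\<in>I. po i k \<and> po j k \<and> e i k x = e j k y)" for i x j y
  have eqv_up: "eqv i x j y" if "eqv i x k z" "eqv k z j y" "i \<in> I" "j \<in> I" "k \<in> I"
      "x \<in> carrier (M i)" "y \<in> carrier (M j)" "z \<in> carrier (M k)" for i j k x y z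
  proof -
    from that obtain a b where ab: "a \<in> I" "po i a" "po k a" "e i a x = e k a z"
      "b \<in> I" "po k b" "po j b" "e k b z = e j b y" by (auto simp: eqv_def)
    obtain c where c: "c \<in> I" "po a c" "po b c" using dir ab by blast
    have "e i c x = e j c y"
      using ab c that e_comp[of i a c x] e_comp[of k a c z] e_comp[of k b c z] e_comp[of j b c y] by simp
    moreover have "po i c" "po j c" using trans ab c that by blast+
    ultimately show ?thesis using c by (auto simp: eqv_def)
  qed
  have eqv_sym: "eqv i x j y \<Longrightarrow> eqv j y i x" for i x j y by (auto simp: eqv_def)
  have eqv_refl: "i \<in> I \<Longrightarrow> eqv i x i x" for i x using refl by (auto simp: eqv_def)
  define c where "c i x = {(j, y). j \<in> I \<and> y \<in> carrier (M j) \<and> eqv i x j y}" for i x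
  have c_eq: "c i x = c j y \<longleftrightarrow> eqv i x j y"
    if "i \<in> I" "j \<in> I" "x \<in> carrier (M i)" "y \<in> carrier (M j)" for i j x y
  proof
    assume "c i x = c j y"
    then have "(j, y) \<in> c i x" using that eqv_refl by (auto simp: c_def)
    then show "eqv i x j y" by (auto simp: c_def)
  next
    assume "eqv i x j y"
    then have "eqv i x k z \<longleftrightarrow> eqv j y k z" if "k \<in> I" "z \<in> carrier (M k)" for k z
      using that \<open>i \<in> I\<close> \<open>j \<in> I\<close> \<open>x \<in> carrier (M i)\<close> \<open>y \<in> carrier (M j)\<close> eqv_up eqv_sym by meson
    then show "c i x = c j y" unfolding c_def by blast
  qed
  have c_e: "c j (e i j x) = c i x" if "i \<in> I" "j \<in> I" "po i j" "x \<in> carrier (M i)" for i j x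
    using that refl by (subst c_eq) (auto simp: ec e_id eqv_def intro!: bexI[of _ j])
  define C where "C = {c i x | i x. i \<in> I \<and> x \<in> carrier (M i)}"
  \<comment> \<open>Two classes are added through representatives at a common stage. Any two choices
    become equal further along, which is what the facts \<open>add\<close> and \<open>sc\<close>
    establish.\<close>
  define add where "add X Y = (SOME Z. \<exists>k\<in>I. \<exists>a\<in>carrier (M k). \<exists>b\<in>carrier (M k).
     X = c k a \<and> Y = c k b \<and> Z = c k (a \<oplus>\<^bsub>M k\<^esub> b))" for X Y
  define sc where "sc r X = (SOME Z. \<exists>k\<in>I. \<exists>a\<in>carrier (M k). X = c k a \<and> Z = c k (r \<odot>\<^bsub>M k\<^esub> a))" for r X
  have Madd: "x \<oplus>\<^bsub>M i\<^esub> y \<in> carrier (M i)" if "i \<in> I" "x \<in> carrier (M i)" "y \<in> carrier (M i)" for i x y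
    using M that by (meson abelian_groupE(1) left_module.axioms(2))
  have Msm: "r \<odot>\<^bsub>M i\<^esub> x \<in> carrier (M i)" if "i \<in> I" "x \<in> carrier (M i)" "r \<in> carrier R" for i x r
    using M that by (meson left_module.smult_closed)
  have add: "add (c k a) (c k b) = c k (a \<oplus>\<^bsub>M k\<^esub> b)"
    if k: "k \<in> I" "a \<in> carrier (M k)" "b \<in> carrier (M k)" for k a b
  proof -
    have "\<exists>Z. \<exists>l\<in>I. \<exists>a'\<in>carrier (M l). \<exists>b'\<in>carrier (M l).
      c k a = c l a' \<and> c k b = c l b' \<and> Z = c l (a' \<oplus>\<^bsub>M l\<^esub> b')" using k by blast
    from someI_ex[OF this] obtain l a' b' where l: "l \<in> I" "a' \<in> carrier (M l)" "b' \<in> carrier (M l)"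
      "c k a = c l a'" "c k b = c l b'" "add (c k a) (c k b) = c l (a' \<oplus>\<^bsub>M l\<^esub> b')"
      unfolding add_def by blast
    then obtain p q where p: "p \<in> I" "po k p" "po l p" "e k p a = e l p a'"
      and q: "q \<in> I" "po k q" "po l q" "e k q b = e l q b'" using k c_eq by (auto simp: eqv_def)
    obtain m where m: "m \<in> I" "po p m" "po q m" using dir p q by blast
    have po: "po k m" "po l m" using trans k l p m by blast+
    have "e k m a = e l m a'" "e k m b = e l m b'"
      using e_comp[of k p m a] e_comp[of l p m a'] e_comp[of k q m b] e_comp[of l q m b'] k l p q m by auto
    then have "e k m (a \<oplus>\<^bsub>M k\<^esub> b) = e l m (a' \<oplus>\<^bsub>M l\<^esub> b')"
      using lin_add[OF e] k l m po by simp
    then have "c k (a \<oplus>\<^bsub>M k\<^esub> b) = c l (a' \<oplus>\<^bsub>M l\<^esub> b')"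
      using k l m po Madd by (subst c_eq) (auto simp: eqv_def)
    then show ?thesis using l by simp
  qed
  have sc: "sc r (c k a) = c k (r \<odot>\<^bsub>M k\<^esub> a)" if k: "k \<in> I" "a \<in> carrier (M k)" "r \<in> carrier R" for k a r
  proof -
    have "\<exists>Z. \<exists>l\<in>I. \<exists>a'\<in>carrier (M l). c k a = c l a' \<and> Z = c l (r \<odot>\<^bsub>M l\<^esub> a')" using k by blast
    from someI_ex[OF this] obtain l a' where l: "l \<in> I" "a' \<in> carrier (M l)"
      "c k a = c l a'" "sc r (c k a) = c l (r \<odot>\<^bsub>M l\<^esub> a')"
      unfolding sc_def by blast
    then obtain p where p: "p \<in> I" "po k p" "po l p" "e k p a = e l p a'"
      using k c_eq by (auto simp: eqv_def)
    then have "e k p (r \<odot>\<^bsub>M k\<^esub> a) = e l p (r \<odot>\<^bsub>M l\<^esub> a')"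
      using lin_smult[OF e] k l by simp
    then have "c k (r \<odot>\<^bsub>M k\<^esub> a) = c l (r \<odot>\<^bsub>M l\<^esub> a')"
      using k l p Msm by (subst c_eq) (auto simp: eqv_def)
    then show ?thesis using l by simp
  qed
  obtain i0 where i0: "i0 \<in> I" using ne by blast
  define L :: "('r, ('i \<times> 'a) set) module" where "L = \<lparr>carrier = C, monoid.mult = undefined,
    one = undefined, zero = c i0 \<zero>\<^bsub>M i0\<^esub>, add = add, smult = sc\<rparr>"
  have Lc: "carrier L = C" "\<zero>\<^bsub>L\<^esub> = c i0 \<zero>\<^bsub>M i0\<^esub>" by (auto simp: L_def)
  have Ladd: "c k a \<oplus>\<^bsub>L\<^esub> c k b = c k (a \<oplus>\<^bsub>M k\<^esub> b)" if "k \<in> I" "a \<in> carrier (M k)" "b \<in> carrier (M k)" for k a b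
    using add that by (simp add: L_def)
  have Lsc: "r \<odot>\<^bsub>L\<^esub> c k a = c k (r \<odot>\<^bsub>M k\<^esub> a)" if "k \<in> I" "a \<in> carrier (M k)" "r \<in> carrier R" for k a r
    using sc that by (simp add: L_def)
  have cC: "c k a \<in> C" if "k \<in> I" "a \<in> carrier (M k)" for k a using that by (auto simp: C_def)
  have Mz: "\<zero>\<^bsub>M i\<^esub> \<in> carrier (M i)" if "i \<in> I" for i
    using M that by (meson abelian_groupE(2) left_module.axioms(2))
  have L0: "c k \<zero>\<^bsub>M k\<^esub> = \<zero>\<^bsub>L\<^esub>" if k: "k \<in> I" for k
  proof -
    obtain m where m: "m \<in> I" "po k m" "po i0 m" using dir k i0 by blast
    then have "e k m \<zero>\<^bsub>M k\<^esub> = e i0 m \<zero>\<^bsub>M i0\<^esub>"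
      using lin_zero[OF M M e, of k m] lin_zero[OF M M e, of i0 m] k i0 by simp
    then show ?thesis using k i0 m Mz Lc by (auto simp: c_eq eqv_def)
  qed
  \<comment> \<open>Up to three classes have representatives at one common stage, which reduces
    every axiom for L to the same axiom in some \<open>M k\<close>.\<close>
  have up1: "\<exists>k\<in>I. \<exists>a\<in>carrier (M k). X = c k a" if "X \<in> C" for X using that by (auto simp: C_def)
  have up2: "\<exists>k\<in>I. \<exists>a\<in>carrier (M k). \<exists>b\<in>carrier (M k). X = c k a \<and> Y = c k b" if XY: "X \<in> C" "Y \<in> C" for X Y
  proof -
    obtain i x j y where *: "i \<in> I" "x \<in> carrier (M i)" "X = c i x" "j \<in> I" "y \<in> carrier (M j)" "Y = c j y"
      using XY by (auto simp: C_def)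
    obtain k where "k \<in> I" "po i k" "po j k" using dir * by blast
    with * show ?thesis
      by (intro bexI[of _ k] bexI[of _ "e i k x"] bexI[of _ "e j k y"]) (simp_all add: c_e ec)
  qed
  have up3: "\<exists>k\<in>I. \<exists>a\<in>carrier (M k). \<exists>b\<in>carrier (M k). \<exists>d\<in>carrier (M k). X = c k a \<and> Y = c k b \<and> Z = c k d"
    if XYZ: "X \<in> C" "Y \<in> C" "Z \<in> C" for X Y Z
  proof -
    obtain i x y where *: "i \<in> I" "x \<in> carrier (M i)" "X = c i x" "y \<in> carrier (M i)" "Y = c i y"
      using up2[OF XYZ(1,2)] by blast
    obtain j z where **: "j \<in> I" "z \<in> carrier (M j)" "Z = c j z"
      using up1[OF XYZ(3)] by blast
    obtain k where "k \<in> I" "po i k" "po j k" using dir * ** by blast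
    with * ** show ?thesis
      by (intro bexI[of _ k] bexI[of _ "e i k x"] bexI[of _ "e i k y"] bexI[of _ "e j k z"]) (simp_all add: c_e ec)
  qed
  have L: "left_module R L"
  proof (rule left_moduleI)
    fix X Y Z assume "X \<in> carrier L" "Y \<in> carrier L" "Z \<in> carrier L"
    then obtain k a b d where k: "k \<in> I" "a \<in> carrier (M k)" "b \<in> carrier (M k)" "d \<in> carrier (M k)"
      "X = c k a" "Y = c k b" "Z = c k d" using up3 Lc by metis
    interpret left_module R "M k" using M k by auto
    show "X \<oplus>\<^bsub>L\<^esub> Y \<oplus>\<^bsub>L\<^esub> Z = X \<oplus>\<^bsub>L\<^esub> (Y \<oplus>\<^bsub>L\<^esub> Z)"
      using k by (simp add: Ladd M.a_assoc)
  next
    fix X Y assume "X \<in> carrier L" "Y \<in> carrier L"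
    then obtain k a b where k: "k \<in> I" "a \<in> carrier (M k)" "b \<in> carrier (M k)"
      "X = c k a" "Y = c k b" using up2 Lc by metis
    interpret left_module R "M k" using M k by auto
    show "X \<oplus>\<^bsub>L\<^esub> Y \<in> carrier L" "X \<oplus>\<^bsub>L\<^esub> Y = Y \<oplus>\<^bsub>L\<^esub> X"
      using k cC by (simp_all add: Ladd Lc M.a_comm)
    fix r assume "r \<in> carrier R"
    then show "r \<odot>\<^bsub>L\<^esub> (X \<oplus>\<^bsub>L\<^esub> Y) = r \<odot>\<^bsub>L\<^esub> X \<oplus>\<^bsub>L\<^esub> r \<odot>\<^bsub>L\<^esub> Y"
      using k by (simp add: Ladd Lsc smult_r_distr)
  next
    fix X assume "X \<in> carrier L"
    then obtain k a where k: "k \<in> I" "a \<in> carrier (M k)" "X = c k a" using up1 Lc by metis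
    interpret left_module R "M k" using M k by auto
    show "\<zero>\<^bsub>L\<^esub> \<oplus>\<^bsub>L\<^esub> X = X" "(\<ominus>\<^bsub>R\<^esub> \<one>\<^bsub>R\<^esub>) \<odot>\<^bsub>L\<^esub> X \<oplus>\<^bsub>L\<^esub> X = \<zero>\<^bsub>L\<^esub>" "\<one>\<^bsub>R\<^esub> \<odot>\<^bsub>L\<^esub> X = X"
      using k by (simp_all add: Ladd Lsc L0[symmetric, OF k(1)] smult_one)
    fix r assume r: "r \<in> carrier R"
    then show "r \<odot>\<^bsub>L\<^esub> X \<in> carrier L" using k cC by (simp add: Lsc Lc)
    fix s assume "s \<in> carrier R"
    then show "(r \<oplus>\<^bsub>R\<^esub> s) \<odot>\<^bsub>L\<^esub> X = r \<odot>\<^bsub>L\<^esub> X \<oplus>\<^bsub>L\<^esub> s \<odot>\<^bsub>L\<^esub> X" "(r \<otimes>\<^bsub>R\<^esub> s) \<odot>\<^bsub>L\<^esub> X = r \<odot>\<^bsub>L\<^esub> (s \<odot>\<^bsub>L\<^esub> X)"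
      using k r by (simp_all add: Ladd Lsc smult_l_distr smult_assoc)
  qed (use i0 Mz Lc cC ring in auto)
  have "\<exists>j\<in>I. po i j \<and> e i j x = \<zero>\<^bsub>M j\<^esub>" if *: "i \<in> I" "x \<in> carrier (M i)" "c i x = \<zero>\<^bsub>L\<^esub>" for i x
  proof -
    have "eqv i x i \<zero>\<^bsub>M i\<^esub>" using * L0[of i] Mz[of i] c_eq[of i i x "\<zero>\<^bsub>M i\<^esub>"] by simp
    then obtain k where k: "k \<in> I" "po i k" "e i k x = e i k \<zero>\<^bsub>M i\<^esub>" by (auto simp: eqv_def)
    then show ?thesis using lin_zero[OF M M e, of i k] *(1) by auto
  qed
  then have "dcolim R I po M e L c"
    using L c_e cC by (auto simp: dcolim_def Lc Ladd Lsc up1 intro!: linI)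
  then show thesis by (rule that)
qed

text \<open>Generators \<open>\<gamma> g\<close> and relations E, with the mapping property tested
  on small modules. Uniqueness of the map h is a consequence of generation
  (\<open>presents_eq\<close>).\<close>

definition presents ::
    "('r, 'k) ring_scheme \<Rightarrow> ('r, 'u) module \<Rightarrow> 'g set \<Rightarrow> ('r \<times> 'g) list set \<Rightarrow> ('g \<Rightarrow> 'u) \<Rightarrow> bool" where
  "presents R P G E \<gamma> \<longleftrightarrow> P \<in> module_cat R \<and> \<gamma> \<in> G \<rightarrow> carrier P \<and> E \<subseteq> terms R G \<and>
     (\<forall>e\<in>E. lc P \<gamma> e = \<zero>\<^bsub>P\<^esub>) \<and> (\<forall>p\<in>carrier P. \<exists>t\<in>terms R G. p = lc P \<gamma> t) \<and>
     (\<forall>Q\<in>(module_cat R :: ('r, 'u) module set). \<forall>u\<in>G \<rightarrow> carrier Q. (\<forall>e\<in>E. lc Q u e = \<zero>\<^bsub>Q\<^esub>) \<longrightarrow>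
        (\<exists>h. lin R P Q h \<and> (\<forall>g\<in>G. h (\<gamma> g) = u g)))"

section \<open>Small modules on the universe type\<close>

context mod_univ
begin

lemma small_copy:
  fixes M :: "('r, 'a) module"
  assumes "left_module R M" "sm (carrier M)"
  obtains M' :: "('r, 'u) module" and \<theta>
  where "M' \<in> module_cat R" "lin R M M' \<theta>" "bij_betw \<theta> (carrier M) (carrier M')"
proof -
  obtain \<theta> :: "'a \<Rightarrow> 'u" where "inj_on \<theta> (carrier M)" using ex_inj_small[OF assms(2)] .
  then have \<theta>: "bij_betw \<theta> (carrier M) (\<theta> ` carrier M)" by (simp add: bij_betw_def)
  obtain M' :: "('r, 'u) module" where M': "left_module R M'" "carrier M' = \<theta> ` carrier M" "lin R M M' \<theta>"
    using transport_module[OF assms(1) \<theta>] .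
  with \<theta> show thesis by (intro that[of M' \<theta>]) (simp_all add: module_catI small_image assms(2))
qed

lemma not_small_UNIV: "\<not> sm (UNIV :: 'u set)"
  unfolding small_def using ordLess_irreflexive by blast

text \<open>A small module with an embedded copy of X is rebuilt so as to contain X itself. There is
  room for this: the complement of the small carrier of X in \<open>'u\<close> is not small, so the
  elements outside the image of X can be given names there.\<close>

lemma superset_copy:
  fixes M :: "('r, 'a) module" and X :: "('r, 'u) module"
  assumes X: "X \<in> module_cat R" and M: "left_module R M" "sm (carrier M)"
    and h: "lin R X M h" "inj_on h (carrier X)"
  obtains M' :: "('r, 'u) module" and \<theta>
  where "M' \<in> module_cat R" "lin R M M' \<theta>" "bij_betw \<theta> (carrier M) (carrier M')"
    "lin R X M' (\<lambda>x. x)" "\<And>x. x \<in> carrier X \<Longrightarrow> \<theta> (h x) = x"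
proof -
  let ?W = "UNIV - carrier X"
  have "\<not> sm ?W"
    using small_Un[OF module_catD(2)[OF X], of ?W] not_small_UNIV by (auto simp: Un_absorb1)
  then have "|UNIV :: 'u set| \<le>o |?W|" unfolding small_def using ordLeq_iff_ordLess_or_ordIso
    by (metis card_of_Well_order not_ordLess_iff_ordLeq)
  moreover have "|carrier M - h ` carrier X| \<le>o |UNIV :: 'u set|"
    using small_subset[OF M(2)] unfolding small_def by (intro ordLess_imp_ordLeq) auto
  ultimately have "|carrier M - h ` carrier X| \<le>o |?W|" using ordLeq_transitive by blast
  then obtain j where j: "inj_on j (carrier M - h ` carrier X)" "j ` (carrier M - h ` carrier X) \<subseteq> ?W"
    using card_of_ordLeq[of "carrier M - h ` carrier X" ?W] by blast
  define \<theta> where "\<theta> m = (if m \<in> h ` carrier X then inv_into (carrier X) h m else j m)" for m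
  have \<theta>h: "\<theta> (h x) = x" if "x \<in> carrier X" for x using that h(2) by (auto simp: \<theta>_def)
  have out: "\<theta> m \<notin> carrier X" if "m \<in> carrier M" "m \<notin> h ` carrier X" for m
    using that j(2) by (auto simp: \<theta>_def)
  have "inj_on \<theta> (carrier M)"
  proof (rule inj_onI)
    fix m n assume mn: "m \<in> carrier M" "n \<in> carrier M" "\<theta> m = \<theta> n"
    show "m = n"
    proof (cases "m \<in> h ` carrier X")
      case True
      then have "n \<in> h ` carrier X" using mn out \<theta>h by (metis imageE)
      with True mn \<theta>h show ?thesis by fastforce
    next
      case False
      then have n: "n \<notin> h ` carrier X" using mn out \<theta>h by (metis imageE)
      with False mn show ?thesis by (auto simp: \<theta>_def intro: inj_onD[OF j(1)])
    qed
  qed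
  then have \<theta>: "bij_betw \<theta> (carrier M) (\<theta> ` carrier M)" by (simp add: bij_betw_def)
  obtain M' :: "('r, 'u) module" where M': "left_module R M'" "carrier M' = \<theta> ` carrier M" "lin R M M' \<theta>"
    using transport_module[OF M(1) \<theta>] .
  have "lin R X M' (\<lambda>x. x)"
    by (rule lin_cong[OF lin_comp[OF h(1) M'(3)] module_catD(1)[OF X] \<theta>h])
  with M' \<theta> \<theta>h show thesis by (intro that[of M' \<theta>]) (simp_all add: module_catI small_image M(2))
qed

text \<open>Instead of dividing a free module by a congruence, a term is sent to the function
  recording its value in every small module equipped with a solution of the relations. The carrier
  of P is the set of these functions: an image of the small set of terms, hence small, on which the
  axioms hold because they hold coordinatewise.\<close>

lemma presents_exists:
  fixes E :: "('r \<times> 'g) list set"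
  assumes G: "sm G" and E: "E \<subseteq> terms R G"
  obtains P :: "('r, 'u) module" and \<gamma> where "presents R P G E \<gamma>"
proof -
  define V where "V = {(Q :: ('r, 'u) module, u). Q \<in> module_cat R \<and> u \<in> G \<rightarrow> carrier Q \<and> (\<forall>e\<in>E. lc Q u e = \<zero>\<^bsub>Q\<^esub>)}"
  define ev where "ev t = (\<lambda>q. if q \<in> V then lc (fst q) (snd q) t else undefined)" for t
  define P :: "('r, (('r, 'u) module \<times> ('g \<Rightarrow> 'u)) \<Rightarrow> 'u) module" where "P = \<lparr>carrier = ev ` terms R G,
    monoid.mult = undefined, one = undefined, zero = ev [],
    add = (\<lambda>f g q. if q \<in> V then f q \<oplus>\<^bsub>fst q\<^esub> g q else undefined),
    smult = (\<lambda>a f q. if q \<in> V then a \<odot>\<^bsub>fst q\<^esub> f q else undefined)\<rparr>"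
  have V: "left_module R (fst q)" "snd q \<in> G \<rightarrow> carrier (fst q)" if "q \<in> V" for q
    using that module_catD by (auto simp: V_def)
  have add: "ev s \<oplus>\<^bsub>P\<^esub> ev t = ev (s @ t)" if "s \<in> terms R G" "t \<in> terms R G" for s t
  proof
    fix q show "(ev s \<oplus>\<^bsub>P\<^esub> ev t) q = ev (s @ t) q"
      using V[of q] that by (auto simp: P_def ev_def left_module.lc_append)
  qed
  have smult: "a \<odot>\<^bsub>P\<^esub> ev t = ev (scale R a t)" if "a \<in> carrier R" "t \<in> terms R G" for a t
  proof
    fix q show "(a \<odot>\<^bsub>P\<^esub> ev t) q = ev (scale R a t) q"
      using V[of q] that by (auto simp: P_def ev_def left_module.lc_scale)
  qed
  have c: "carrier P = ev ` terms R G" and z: "\<zero>\<^bsub>P\<^esub> = ev []" by (auto simp: P_def)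
  have scale: "scale R a t \<in> terms R G" if "a \<in> carrier R" "t \<in> terms R G" for a and t :: "('r \<times> 'g) list"
    using that by (induction t) (auto simp: scale_def)
  have ev_eqI: "ev s = ev t"
    if "s \<in> terms R G" "t \<in> terms R G" "\<And>(Q :: ('r, 'u) module) u. \<lbrakk>left_module R Q; u \<in> G \<rightarrow> carrier Q\<rbrakk> \<Longrightarrow> lc Q u s = lc Q u t" for s t
    unfolding ev_def using that(3) V by (intro ext) simp
  have P: "left_module R P"
  proof (rule left_moduleI)
    fix x y z a b
    assume x: "x \<in> carrier P"
    then obtain s where s: "s \<in> terms R G" "x = ev s" by (auto simp: c)
    note terms_lc = left_module.lc_closed left_module.lc_append[where R = R and G = G] left_module.lc_scale[where R = R and G = G]
    interpret R: ring R by (rule ring)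
    show "\<zero>\<^bsub>P\<^esub> \<oplus>\<^bsub>P\<^esub> x = x" using s by (simp add: add z)
    show "(\<ominus>\<^bsub>R\<^esub> \<one>\<^bsub>R\<^esub>) \<odot>\<^bsub>P\<^esub> x \<oplus>\<^bsub>P\<^esub> x = \<zero>\<^bsub>P\<^esub>"
      using s by (auto simp: add smult scale z terms_lc left_module.neg_add intro!: ev_eqI)
    show "\<one>\<^bsub>R\<^esub> \<odot>\<^bsub>P\<^esub> x = x"
      using s by (auto simp: smult scale terms_lc left_module.smult_one intro!: ev_eqI)
    { assume "y \<in> carrier P"
      then obtain t where t: "t \<in> terms R G" "y = ev t" by (auto simp: c)
      show "x \<oplus>\<^bsub>P\<^esub> y \<in> carrier P" using s t by (auto simp: add c)
      show "x \<oplus>\<^bsub>P\<^esub> y = y \<oplus>\<^bsub>P\<^esub> x"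
        using s t by (auto simp: add terms_lc intro!: ev_eqI) (metis left_module.lc_closed left_module.axioms(2) abelian_groupE(4))
      { assume "z \<in> carrier P"
        then obtain r where r: "r \<in> terms R G" "z = ev r" by (auto simp: c)
        show "x \<oplus>\<^bsub>P\<^esub> y \<oplus>\<^bsub>P\<^esub> z = x \<oplus>\<^bsub>P\<^esub> (y \<oplus>\<^bsub>P\<^esub> z)" using s t r by (auto simp: add) }
      assume "a \<in> carrier R"
      then show "a \<odot>\<^bsub>P\<^esub> (x \<oplus>\<^bsub>P\<^esub> y) = a \<odot>\<^bsub>P\<^esub> x \<oplus>\<^bsub>P\<^esub> a \<odot>\<^bsub>P\<^esub> y"
        using s t by (simp add: add smult scale) (simp add: scale_def) }
    assume a: "a \<in> carrier R"
    then show "a \<odot>\<^bsub>P\<^esub> x \<in> carrier P" using s by (auto simp: smult c scale)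
    assume b: "b \<in> carrier R"
    show "(a \<oplus>\<^bsub>R\<^esub> b) \<odot>\<^bsub>P\<^esub> x = a \<odot>\<^bsub>P\<^esub> x \<oplus>\<^bsub>P\<^esub> b \<odot>\<^bsub>P\<^esub> x"
      using s a b by (auto simp: add smult scale terms_lc left_module.smult_l_distr intro!: ev_eqI)
    show "(a \<otimes>\<^bsub>R\<^esub> b) \<odot>\<^bsub>P\<^esub> x = a \<odot>\<^bsub>P\<^esub> (b \<odot>\<^bsub>P\<^esub> x)"
      using s a b by (auto simp: smult scale terms_lc left_module.smult_assoc intro!: ev_eqI)
  qed (auto simp: c z ring)
  have "sm (carrier P)" unfolding c by (intro small_image small_terms G)
  then obtain P' :: "('r, 'u) module" and \<theta> where P': "P' \<in> module_cat R" "lin R P P' \<theta>" "bij_betw \<theta> (carrier P) (carrier P')"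
    using small_copy[OF P] by blast
  define \<gamma>0 where "\<gamma>0 g = ev [(\<one>\<^bsub>R\<^esub>, g)]" for g
  have \<gamma>0: "\<gamma>0 \<in> G \<rightarrow> carrier P" by (auto simp: \<gamma>0_def c)
  have lc\<gamma>: "lc P \<gamma>0 t = ev t" if "t \<in> terms R G" for t
    using that
  proof (induction t)
    case (Cons p t)
    then have "fst p \<odot>\<^bsub>P\<^esub> \<gamma>0 (snd p) \<oplus>\<^bsub>P\<^esub> ev t = ev (scale R (fst p) [(\<one>\<^bsub>R\<^esub>, snd p)] @ t)"
      by (simp add: \<gamma>0_def smult add scale)
    also have "scale R (fst p) [(\<one>\<^bsub>R\<^esub>, snd p)] = [p]" using Cons by (auto simp: scale_def)
    finally show ?case using Cons by simp
  qed (simp add: z)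
  have lc\<gamma>': "lc P' (\<lambda>g. \<theta> (\<gamma>0 g)) t = \<theta> (ev t)" if "t \<in> terms R G" for t
    using lin_lc[OF P module_catD(1)[OF P'(1)] P'(2) that \<gamma>0] lc\<gamma>[OF that] by simp
  show thesis
  proof (rule that[of P' "\<lambda>g. \<theta> (\<gamma>0 g)"], unfold presents_def, intro conjI ballI impI)
    show "P' \<in> module_cat R" "E \<subseteq> terms R G" by fact+
    show "(\<lambda>g. \<theta> (\<gamma>0 g)) \<in> G \<rightarrow> carrier P'" using \<gamma>0 lin_closed[OF P'(2)] by auto
    show "lc P' (\<lambda>g. \<theta> (\<gamma>0 g)) e = \<zero>\<^bsub>P'\<^esub>" if "e \<in> E" for e
    proof -
      have "ev e = \<zero>\<^bsub>P\<^esub>" using that by (auto simp: ev_def z V_def)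
      then show ?thesis using lc\<gamma>'[of e] that E lin_zero[OF P module_catD(1)[OF P'(1)] P'(2)] by auto
    qed
    show "\<exists>t\<in>terms R G. p = lc P' (\<lambda>g. \<theta> (\<gamma>0 g)) t" if "p \<in> carrier P'" for p
    proof -
      have "p \<in> \<theta> ` carrier P" using that P'(3) by (auto simp: bij_betw_def)
      then show ?thesis by (auto simp: c lc\<gamma>' intro: bexI)
    qed
    fix Q :: "('r, 'u) module" and u assume Q: "Q \<in> module_cat R" "u \<in> G \<rightarrow> carrier Q" "\<forall>e\<in>E. lc Q u e = \<zero>\<^bsub>Q\<^esub>"
    then have q: "(Q, u) \<in> V" by (auto simp: V_def)
    interpret Q: left_module R Q using module_catD(1)[OF Q(1)] .
    \<comment> \<open>The map with prescribed values on the generators is the projection to the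
      coordinate \<open>(Q, u)\<close>.\<close>
    have "lin R P Q (\<lambda>f. f (Q, u))"
    proof (rule linI)
      show "f (Q, u) \<in> carrier Q" if "f \<in> carrier P" for f
        using that q Q(2) by (auto simp: c ev_def Q.lc_closed)
    qed (use q in \<open>auto simp: P_def\<close>)
    from lin_comp[OF lin_inv[OF P P'(2,3)] this]
    have "lin R P' Q (\<lambda>p. inv_into (carrier P) \<theta> p (Q, u))" .
    moreover have "inv_into (carrier P) \<theta> (\<theta> (\<gamma>0 g)) (Q, u) = u g" if "g \<in> G" for g
    proof -
      have "inv_into (carrier P) \<theta> (\<theta> (\<gamma>0 g)) = \<gamma>0 g"
        using P'(3) \<gamma>0 that by (auto simp: bij_betw_def intro: inv_into_f_f)
      moreover have "u g \<in> carrier Q" using Q that by auto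
      ultimately show ?thesis using q by (simp add: \<gamma>0_def ev_def Q.smult_one)
    qed
    ultimately show "\<exists>h. lin R P' Q h \<and> (\<forall>g\<in>G. h (\<theta> (\<gamma>0 g)) = u g)" by blast
  qed
qed

end

text \<open>The operations come from the directed colimit of the inclusions. These identify no two
  distinct elements, so the colimit is in bijection with the union of the carriers, and its
  structure is transported there.\<close>

lemma union_module:
  fixes \<V> :: "('r, 'a) module set"
  assumes ring: "ring R" and ne: "\<V> \<noteq> {}" and mods: "\<And>A. A \<in> \<V> \<Longrightarrow> left_module R A"
    and dir: "\<And>A B. \<lbrakk>A \<in> \<V>; B \<in> \<V>\<rbrakk> \<Longrightarrow> \<exists>C\<in>\<V>. lin R A C (\<lambda>x. x) \<and> lin R B C (\<lambda>x. x)"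
  obtains V :: "('r, 'a) module"
  where "left_module R V" "carrier V = (\<Union>A\<in>\<V>. carrier A)" "\<And>A. A \<in> \<V> \<Longrightarrow> lin R A V (\<lambda>x. x)"
proof -
  let ?po = "\<lambda>A B. lin R A B (\<lambda>x. x)"
  have S: "dsystem R \<V> ?po (\<lambda>A. A) (\<lambda>_ _ x. x)"
    unfolding dsystem_def using ne mods dir lin_id lin_comp by (intro conjI ballI impI) fast+
  obtain L :: "('r, (('r, 'a) module \<times> 'a) set) module" and c where L: "dcolim R \<V> ?po (\<lambda>A. A) (\<lambda>_ _ x. x) L c"
    using directed_colimit_exists[OF ring S] by blast
  have c: "lin R A L (c A)" if "A \<in> \<V>" for A using L that by (auto simp: dcolim_def)
  have c_up: "c B x = c A x" if "A \<in> \<V>" "B \<in> \<V>" "?po A B" "x \<in> carrier A" for A B x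
    using L that unfolding dcolim_def by meson
  have c_eq: "x = y \<longleftrightarrow> c A x = c B y" if AB: "A \<in> \<V>" "B \<in> \<V>" "x \<in> carrier A" "y \<in> carrier B" for A B x y
  proof -
    obtain C where C: "C \<in> \<V>" "?po A C" "?po B C" using dir[OF AB(1,2)] by blast
    have mem: "x \<in> carrier C" "y \<in> carrier C" using lin_closed[OF C(2)] lin_closed[OF C(3)] AB by auto
    have "x = y" if "c C x = c C y"
      using dcolim_eqD[OF S L C(1) mem that] by blast
    then show ?thesis using c_up[OF AB(1) C(1,2) AB(3)] c_up[OF AB(2) C(1,3) AB(4)] by auto
  qed
  define \<theta> where "\<theta> l = (THE x. \<exists>A\<in>\<V>. x \<in> carrier A \<and> c A x = l)" for l
  have \<theta>: "\<theta> (c A x) = x" if "A \<in> \<V>" "x \<in> carrier A" for A x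
    unfolding \<theta>_def using that c_eq by (intro the_equality) blast+
  have surj: "\<exists>A\<in>\<V>. \<exists>x\<in>carrier A. l = c A x" if "l \<in> carrier L" for l
    using L that unfolding dcolim_def by blast
  have "inj_on \<theta> (carrier L)"
    by (rule inj_onI) (metis surj \<theta> c_eq)
  moreover have "\<theta> ` carrier L = (\<Union>A\<in>\<V>. carrier A)"
  proof
    show "\<theta> ` carrier L \<subseteq> (\<Union>A\<in>\<V>. carrier A)" using surj \<theta> by fastforce
    show "(\<Union>A\<in>\<V>. carrier A) \<subseteq> \<theta> ` carrier L"
    proof
      fix x assume "x \<in> (\<Union>A\<in>\<V>. carrier A)"
      then obtain A where A: "A \<in> \<V>" "x \<in> carrier A" by blast
      then show "x \<in> \<theta> ` carrier L" using \<theta>[OF A] lin_closed[OF c] by (metis imageI)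
    qed
  qed
  ultimately have bij: "bij_betw \<theta> (carrier L) (\<Union>A\<in>\<V>. carrier A)" by (simp add: bij_betw_def)
  have lm: "left_module R L" using L unfolding dcolim_def by blast
  obtain V :: "('r, 'a) module"
    where V: "left_module R V" "carrier V = (\<Union>A\<in>\<V>. carrier A)" "lin R L V \<theta>"
    using transport_module[OF lm bij] .
  have "lin R A V (\<lambda>x. x)" if "A \<in> \<V>" for A
    by (rule lin_cong[OF lin_comp[OF c[OF that] V(3)] mods[OF that]]) (simp add: \<theta> that)
  with V show thesis using that by blast
qed

section \<open>Pushouts along submodules\<close>

context mod_univ
begin

text \<open>The pushout is the quotient of the direct sum by K, the set of pairs (-f n, n). A pair
  in K with second entry zero is zero, so A embeds in the quotient, and \<open>superset_copy\<close>
  makes Q contain A literally. The last conclusion says that the map from the direct sum has no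
  kernel beyond K; the purity arguments rest on it.\<close>

lemma pushout_exists:
  fixes A B :: "('r, 'u) module"
  assumes A: "A \<in> module_cat R" and B: "B \<in> module_cat R" and N: "submod R B N"
    and f: "lin R (B \<restriction> N) A f"
  obtains Q :: "('r, 'u) module" and k
  where "Q \<in> module_cat R" "lin R A Q (\<lambda>x. x)" "lin R B Q k"
    "\<And>q. q \<in> carrier Q \<Longrightarrow> \<exists>a\<in>carrier A. \<exists>b\<in>carrier B. q = a \<oplus>\<^bsub>Q\<^esub> k b"
    "\<And>n. n \<in> N \<Longrightarrow> k n = f n"
    "\<And>a b. \<lbrakk>a \<in> carrier A; b \<in> carrier B; a \<oplus>\<^bsub>Q\<^esub> k b = \<zero>\<^bsub>Q\<^esub>\<rbrakk> \<Longrightarrow> b \<in> N \<and> a \<oplus>\<^bsub>A\<^esub> f b = \<zero>\<^bsub>A\<^esub>"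
proof -
  interpret A: left_module R A using module_catD(1)[OF A] .
  interpret B: left_module R B using module_catD(1)[OF B] .
  note N' = submod_closed[OF N]
  have sub: "n \<in> carrier B" if "n \<in> N" for n using N' that by auto
  have fc: "f n \<in> carrier A" if "n \<in> N" for n using lin_closed[OF f] that by simp
  have fadd: "f (m \<oplus>\<^bsub>B\<^esub> n) = f m \<oplus>\<^bsub>A\<^esub> f n" if "m \<in> N" "n \<in> N" for m n using lin_add[OF f] that by simp
  have fsm: "f (a \<odot>\<^bsub>B\<^esub> n) = a \<odot>\<^bsub>A\<^esub> f n" if "a \<in> carrier R" "n \<in> N" for a n using lin_smult[OF f] that by simp
  have f0: "f \<zero>\<^bsub>B\<^esub> = \<zero>\<^bsub>A\<^esub>"
    using lin_zero[OF left_module_submod[OF _ N] _ f] A.left_module_axioms B.left_module_axioms by simp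
  define D :: "('r, 'u \<times> 'u) module" where "D = \<lparr>carrier = carrier A \<times> carrier B, monoid.mult = undefined,
    one = undefined, zero = (\<zero>\<^bsub>A\<^esub>, \<zero>\<^bsub>B\<^esub>), add = (\<lambda>(a, b) (c, d). (a \<oplus>\<^bsub>A\<^esub> c, b \<oplus>\<^bsub>B\<^esub> d)),
    smult = (\<lambda>r (a, b). (r \<odot>\<^bsub>A\<^esub> a, r \<odot>\<^bsub>B\<^esub> b))\<rparr>"
  have D: "left_module R D"
    by (rule left_moduleI) (auto simp: D_def ring A.M.a_ac B.M.a_ac A.smult_l_distr B.smult_l_distr
        A.smult_r_distr B.smult_r_distr A.smult_assoc B.smult_assoc A.smult_one B.smult_one)
  define K where "K = {(a, b). a \<in> carrier A \<and> b \<in> N \<and> a \<oplus>\<^bsub>A\<^esub> f b = \<zero>\<^bsub>A\<^esub>}"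
  have K: "submod R D K"
    unfolding submod_def
  proof (intro conjI ballI)
    show "K \<subseteq> carrier D" using sub by (auto simp: K_def D_def)
    show "\<zero>\<^bsub>D\<^esub> \<in> K" using N' f0 by (auto simp: K_def D_def)
    fix x assume x: "x \<in> K"
    show "x \<oplus>\<^bsub>D\<^esub> y \<in> K" if y: "y \<in> K" for y
    proof -
      obtain a b c d where *: "x = (a, b)" "y = (c, d)" by (cases x, cases y)
      then have "(a \<oplus>\<^bsub>A\<^esub> c) \<oplus>\<^bsub>A\<^esub> f (b \<oplus>\<^bsub>B\<^esub> d) = (a \<oplus>\<^bsub>A\<^esub> f b) \<oplus>\<^bsub>A\<^esub> (c \<oplus>\<^bsub>A\<^esub> f d)"
        using x y A.add4[of a c "f b" "f d"] by (simp add: K_def fadd fc)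
      then show ?thesis using * x y N' by (auto simp: K_def D_def)
    qed
    show "r \<odot>\<^bsub>D\<^esub> x \<in> K" if r: "r \<in> carrier R" for r
    proof -
      obtain a b where *: "x = (a, b)" by (cases x)
      have ab: "a \<in> carrier A" "b \<in> N" using * x by (auto simp: K_def)
      have "r \<odot>\<^bsub>A\<^esub> a \<oplus>\<^bsub>A\<^esub> f (r \<odot>\<^bsub>B\<^esub> b) = r \<odot>\<^bsub>A\<^esub> (a \<oplus>\<^bsub>A\<^esub> f b)"
        using r ab by (simp add: fsm fc A.smult_r_distr)
      then show ?thesis using * x r N' by (auto simp: K_def D_def)
    qed
  qed
  obtain Q0 :: "('r, ('u \<times> 'u) set) module" and \<pi> where Q0: "left_module R Q0" "lin R D Q0 \<pi>"
    "carrier Q0 = \<pi> ` carrier D" "\<And>x. x \<in> carrier D \<Longrightarrow> \<pi> x = \<zero>\<^bsub>Q0\<^esub> \<longleftrightarrow> x \<in> K"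
    using quotient_module[OF D K] by metis
  interpret Q0: left_module R Q0 by fact
  define i where "i a = \<pi> (a, \<zero>\<^bsub>B\<^esub>)" for a
  define j where "j b = \<pi> (\<zero>\<^bsub>A\<^esub>, b)" for b
  have i: "lin R A Q0 i"
    unfolding i_def by (rule lin_comp[OF _ Q0(2)]) (auto simp: D_def intro!: linI)
  have j: "lin R B Q0 j"
    unfolding j_def by (rule lin_comp[OF _ Q0(2)]) (auto simp: D_def intro!: linI)
  have ij: "i a \<oplus>\<^bsub>Q0\<^esub> j b = \<pi> (a, b)" if "a \<in> carrier A" "b \<in> carrier B" for a b
    using lin_add[OF Q0(2), of "(a, \<zero>\<^bsub>B\<^esub>)" "(\<zero>\<^bsub>A\<^esub>, b)"] that by (simp add: i_def j_def D_def)
  have ker: "b \<in> N \<and> a \<oplus>\<^bsub>A\<^esub> f b = \<zero>\<^bsub>A\<^esub> \<longleftrightarrow> i a \<oplus>\<^bsub>Q0\<^esub> j b = \<zero>\<^bsub>Q0\<^esub>" if "a \<in> carrier A" "b \<in> carrier B" for a b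
    using Q0(4)[of "(a, b)"] that by (simp add: ij D_def K_def)
  have j0: "j \<zero>\<^bsub>B\<^esub> = \<zero>\<^bsub>Q0\<^esub>" using lin_zero[OF B.left_module_axioms Q0(1) j] .
  let ?n = "\<ominus>\<^bsub>R\<^esub> \<one>\<^bsub>R\<^esub>"
  have "inj_on i (carrier A)"
  proof (rule inj_onI)
    fix a b assume *: "a \<in> carrier A" "b \<in> carrier A" "i a = i b"
    have "i (a \<oplus>\<^bsub>A\<^esub> ?n \<odot>\<^bsub>A\<^esub> b) = \<zero>\<^bsub>Q0\<^esub>"
      using * lin_closed[OF i] by (simp add: lin_add[OF i] lin_smult[OF i])
    then have "a \<oplus>\<^bsub>A\<^esub> ?n \<odot>\<^bsub>A\<^esub> b = \<zero>\<^bsub>A\<^esub>"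
      using ker[of "a \<oplus>\<^bsub>A\<^esub> ?n \<odot>\<^bsub>A\<^esub> b" "\<zero>\<^bsub>B\<^esub>"] * lin_closed[OF i] by (simp add: j0 f0)
    then have "a = ?n \<odot>\<^bsub>A\<^esub> (?n \<odot>\<^bsub>A\<^esub> b)" using * by (intro A.eq_neg) auto
    then show "a = b" using * by (simp add: A.smult_assoc[symmetric] R.l_minus A.smult_one)
  qed
  moreover have "sm (carrier Q0)"
    unfolding Q0(3) by (intro small_image) (simp add: D_def small_Times module_catD(2) A B)
  ultimately obtain Q and \<theta> where Q: "Q \<in> module_cat R" "lin R Q0 Q \<theta>" "bij_betw \<theta> (carrier Q0) (carrier Q)"
    "lin R A Q (\<lambda>x. x)" and \<theta>: "\<And>x. x \<in> carrier A \<Longrightarrow> \<theta> (i x) = x"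
    using superset_copy[OF A Q0(1) _ i] by blast
  have k: "lin R B Q (\<lambda>b. \<theta> (j b))" using lin_comp[OF j Q(2)] .
  have sum: "\<theta> (i a \<oplus>\<^bsub>Q0\<^esub> j b) = a \<oplus>\<^bsub>Q\<^esub> \<theta> (j b)" if "a \<in> carrier A" "b \<in> carrier B" for a b
    using that lin_closed[OF i] lin_closed[OF j] \<theta> by (simp add: lin_add[OF Q(2)])
  have \<theta>0: "\<theta> x = \<zero>\<^bsub>Q\<^esub> \<longleftrightarrow> x = \<zero>\<^bsub>Q0\<^esub>" if "x \<in> carrier Q0" for x
    using Q(3) that lin_zero[OF Q0(1) module_catD(1)[OF Q(1)] Q(2)]
    by (metis Q0.M.zero_closed bij_betw_def inj_onD)
  show thesis
  proof (rule that[OF Q(1,4) k])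
    show "\<exists>a\<in>carrier A. \<exists>b\<in>carrier B. q = a \<oplus>\<^bsub>Q\<^esub> \<theta> (j b)" if q: "q \<in> carrier Q" for q
    proof -
      have "q \<in> \<theta> ` \<pi> ` (carrier A \<times> carrier B)"
        using q Q(3) unfolding Q0(3) by (simp add: bij_betw_def D_def)
      then obtain a b where "a \<in> carrier A" "b \<in> carrier B" "q = \<theta> (\<pi> (a, b))" by blast
      then show ?thesis using sum ij by metis
    qed
    show "\<theta> (j n) = f n" if n: "n \<in> N" for n
    proof -
      have nn: "?n \<odot>\<^bsub>B\<^esub> n \<in> N" using N' n by auto
      \<comment> \<open>The description of the kernel is applied to the pair (f n, -n).\<close>
      have "i (f n) \<oplus>\<^bsub>Q0\<^esub> j (?n \<odot>\<^bsub>B\<^esub> n) = \<zero>\<^bsub>Q0\<^esub>"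
        using ker[of "f n" "?n \<odot>\<^bsub>B\<^esub> n"] n nn fc sub by (simp add: fsm)
      then have "i (f n) \<oplus>\<^bsub>Q0\<^esub> ?n \<odot>\<^bsub>Q0\<^esub> j n = \<zero>\<^bsub>Q0\<^esub>" using n sub by (simp add: lin_smult[OF j])
      then have "i (f n) = ?n \<odot>\<^bsub>Q0\<^esub> (?n \<odot>\<^bsub>Q0\<^esub> j n)"
        using n sub fc lin_closed[OF i] lin_closed[OF j] by (intro Q0.eq_neg) auto
      then have "i (f n) = j n"
        using n sub lin_closed[OF j] by (simp add: Q0.smult_assoc[symmetric] R.l_minus Q0.smult_one)
      then show ?thesis using \<theta> fc n by metis
    qed
    show "b \<in> N \<and> a \<oplus>\<^bsub>A\<^esub> f b = \<zero>\<^bsub>A\<^esub>"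
      if "a \<in> carrier A" "b \<in> carrier B" "a \<oplus>\<^bsub>Q\<^esub> \<theta> (j b) = \<zero>\<^bsub>Q\<^esub>" for a b
      using ker that sum \<theta>0[of "i a \<oplus>\<^bsub>Q0\<^esub> j b"] lin_closed[OF i] lin_closed[OF j] by simp
  qed
qed

end

text \<open>Setting \<open>h (c i x) = n i x\<close> is well defined: elements with the same image
  in C agree at a later stage, where n gives them the same value.\<close>

lemma dcolim_univ:
  assumes S: "dsystem R I po M e" and C: "dcolim R I po M e C c" and N: "left_module R N"
    and n: "\<And>i. i \<in> I \<Longrightarrow> lin R (M i) N (n i)"
    and n_e: "\<And>i j x. \<lbrakk>i \<in> I; j \<in> I; po i j; x \<in> carrier (M i)\<rbrakk> \<Longrightarrow> n j (e i j x) = n i x"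
  obtains h where "lin R C N h" "\<And>i x. \<lbrakk>i \<in> I; x \<in> carrier (M i)\<rbrakk> \<Longrightarrow> h (c i x) = n i x"
proof -
  have dir: "\<exists>k\<in>I. po i k \<and> po j k" if "i \<in> I" "j \<in> I" for i j
    using S that unfolding dsystem_def by meson
  have M: "left_module R (M i)" if "i \<in> I" for i
    using S that unfolding dsystem_def by meson
  have e: "lin R (M i) (M j) (e i j)" if "i \<in> I" "j \<in> I" "po i j" for i j
    using S that unfolding dsystem_def by meson
  have c: "lin R (M i) C (c i)" if "i \<in> I" for i
    using C that unfolding dcolim_def by meson
  have c_e: "c j (e i j x) = c i x" if "i \<in> I" "j \<in> I" "po i j" "x \<in> carrier (M i)" for i j x
    using C that unfolding dcolim_def by meson
  have surj: "\<exists>i\<in>I. \<exists>x\<in>carrier (M i). y = c i x" if "y \<in> carrier C" for y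
    using C that unfolding dcolim_def by meson
  have surj2: "\<exists>i\<in>I. \<exists>x\<in>carrier (M i). \<exists>x'\<in>carrier (M i). y = c i x \<and> y' = c i x'"
    if "y \<in> carrier C" "y' \<in> carrier C" for y y'
  proof -
    from surj[OF that(1)] surj[OF that(2)] obtain i x j x' where
      *: "i \<in> I" "x \<in> carrier (M i)" "y = c i x" "j \<in> I" "x' \<in> carrier (M j)" "y' = c j x'" by blast
    then obtain k where k: "k \<in> I" "po i k" "po j k" using dir by blast
    with * show ?thesis
      by (intro bexI[of _ k] bexI[of _ "e i k x"] bexI[of _ "e j k x'"])
        (simp_all add: c_e lin_closed[OF e])
  qed
  have wd1: "n i x = n i x'"
    if *: "i \<in> I" "x \<in> carrier (M i)" "x' \<in> carrier (M i)" "c i x = c i x'" for i x x'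
  proof -
    obtain j where "j \<in> I" "po i j" "e i j x = e i j x'" using dcolim_eqD[OF S C *] .
    then show ?thesis using n_e[of i j x] n_e[of i j x'] * by simp
  qed
  have wd: "n i x = n j x'"
    if *: "i \<in> I" "x \<in> carrier (M i)" "j \<in> I" "x' \<in> carrier (M j)" "c i x = c j x'" for i x j x'
  proof -
    obtain k where k: "k \<in> I" "po i k" "po j k" using dir * by blast
    then have "n k (e i k x) = n k (e j k x')"
      using * by (intro wd1) (simp_all add: c_e lin_closed[OF e])
    then show ?thesis using k * by (simp add: n_e)
  qed
  define h where "h y = (THE z. \<exists>i\<in>I. \<exists>x\<in>carrier (M i). y = c i x \<and> z = n i x)" for y
  have h: "h (c i x) = n i x" if "i \<in> I" "x \<in> carrier (M i)" for i x
    unfolding h_def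
  proof (rule the_equality)
    fix z assume "\<exists>j\<in>I. \<exists>x'\<in>carrier (M j). c i x = c j x' \<and> z = n j x'"
    then obtain j x' where "j \<in> I" "x' \<in> carrier (M j)" "c i x = c j x'" "z = n j x'" by blast
    then show "z = n i x" using wd[of i x j x'] that by simp
  qed (use that in blast)
  have "lin R C N h"
  proof (rule linI)
    fix y assume y: "y \<in> carrier C"
    then obtain i x where i: "i \<in> I" "x \<in> carrier (M i)" "y = c i x" using surj by blast
    then show "h y \<in> carrier N" using h lin_closed[OF n] by simp
    show "h (a \<odot>\<^bsub>C\<^esub> y) = a \<odot>\<^bsub>N\<^esub> h y" if "a \<in> carrier R" for a
      using i that h left_module.smult_closed[OF M] by (simp add: lin_smult[OF c, symmetric] lin_smult[OF n])
    fix y' assume "y' \<in> carrier C"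
    with y obtain i x x' where i: "i \<in> I" "x \<in> carrier (M i)" "x' \<in> carrier (M i)" "y = c i x" "y' = c i x'"
      using surj2 by blast
    moreover have "x \<oplus>\<^bsub>M i\<^esub> x' \<in> carrier (M i)"
      using left_module.axioms(2)[OF M[OF i(1)]] i by (meson abelian_groupE(1))
    ultimately show "h (y \<oplus>\<^bsub>C\<^esub> y') = h y \<oplus>\<^bsub>N\<^esub> h y'"
      using h by (simp add: lin_add[OF c, symmetric] lin_add[OF n])
  qed
  with h show thesis using that by blast
qed

section \<open>Functors preserving filtered colimits\<close>

locale mod_fun = mod_univ R U for R :: "'r ring" and U :: "'u itself" +
  fixes F :: "('r, 'u, 'v) mod_functor"
  assumes additive: "additive_functor R F"
    and compat: "universe_compatible R F"
    and pres: "preserves_filtered_colimits R F"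
begin

text \<open>The action of F on maps in the sense of \<open>lin\<close>. The restriction supplies the
  extensionality built into \<open>mod_hom\<close>, and by \<open>Fm_cong\<close> only the values on
  the carrier count.\<close>

definition Fm :: "('r, 'u) module \<Rightarrow> ('r, 'u) module \<Rightarrow> ('u \<Rightarrow> 'u) \<Rightarrow> 'v \<Rightarrow> 'v" where
  "Fm M N f x = fmap F M N (restrict f (carrier M)) x"

abbreviation FF :: "('r, 'u) module \<Rightarrow> 'v set" where
  "FF M \<equiv> carrier (fob F M)"

lemma F_group: "M \<in> module_cat R \<Longrightarrow> comm_group (fob F M)"
  using additive unfolding additive_functor_def by blast

lemma mod_hom_restrict:
  "(M :: ('r, 'u) module) \<in> module_cat R \<Longrightarrow> lin R M N f \<Longrightarrow> restrict f (carrier M) \<in> mod_hom R M N"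
  using lin_cong[of R M N f "restrict f (carrier M)"] module_catD by (auto simp: mod_hom_eq)

lemma Fm_hom: "M \<in> module_cat R \<Longrightarrow> N \<in> module_cat R \<Longrightarrow> lin R M N f \<Longrightarrow> Fm M N f \<in> hom (fob F N) (fob F M)"
  using additive mod_hom_restrict[of M N f] unfolding additive_functor_def Fm_def[abs_def] by blast

lemma Fm_closed: "M \<in> module_cat R \<Longrightarrow> N \<in> module_cat R \<Longrightarrow> lin R M N f \<Longrightarrow> x \<in> FF N \<Longrightarrow> Fm M N f x \<in> FF M"
  using Fm_hom by (auto simp: hom_def)

lemma Fm_cong: "(\<And>x. x \<in> carrier M \<Longrightarrow> f x = g x) \<Longrightarrow> Fm M N f = Fm M N g"
  unfolding Fm_def[abs_def] by (metis restrict_ext)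

lemma Fm_id: "M \<in> module_cat R \<Longrightarrow> x \<in> FF M \<Longrightarrow> Fm M M (\<lambda>x. x) x = x"
  using additive unfolding additive_functor_def Fm_def mod_id_def by blast

lemma Fm_comp:
  assumes M: "M \<in> module_cat R" "N \<in> module_cat R" "P \<in> module_cat R"
    and f: "lin R M N f" and g: "lin R N P g" and x: "x \<in> FF P"
  shows "Fm M P (\<lambda>a. g (f a)) x = Fm M N f (Fm N P g x)"
proof -
  have "compose (carrier M) (restrict g (carrier N)) (restrict f (carrier M)) = restrict (\<lambda>a. g (f a)) (carrier M)"
    using lin_closed[OF f] by (auto simp: compose_def)
  moreover have "fmap F M P (compose (carrier M) (restrict g (carrier N)) (restrict f (carrier M))) x =
      fmap F M N (restrict f (carrier M)) (fmap F N P (restrict g (carrier N)) x)"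
    using additive M mod_hom_restrict[OF M(1) f] mod_hom_restrict[OF M(2) g] x
    unfolding additive_functor_def by blast
  ultimately show ?thesis by (simp add: Fm_def)
qed

lemma Fm_add:
  assumes "M \<in> module_cat R" "N \<in> module_cat R" "lin R M N f" "lin R M N g" "y \<in> FF N"
  shows "Fm M N (\<lambda>x. f x \<oplus>\<^bsub>N\<^esub> g x) y = Fm M N f y \<otimes>\<^bsub>fob F M\<^esub> Fm M N g y"
proof -
  have "restrict f (carrier M) \<otimes>\<^bsub>hom_group R M N\<^esub> restrict g (carrier M) = restrict (\<lambda>x. f x \<oplus>\<^bsub>N\<^esub> g x) (carrier M)"
    by (auto simp: hom_group_def)
  moreover have "fmap F M N (restrict f (carrier M) \<otimes>\<^bsub>hom_group R M N\<^esub> restrict g (carrier M)) y =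
      fmap F M N (restrict f (carrier M)) y \<otimes>\<^bsub>fob F M\<^esub> fmap F M N (restrict g (carrier M)) y"
    using additive assms mod_hom_restrict[OF assms(1,3)] mod_hom_restrict[OF assms(1,4)]
    unfolding additive_functor_def by blast
  ultimately show ?thesis by (simp add: Fm_def)
qed

text \<open>The zero map is its own sum with itself, so by additivity its value is an idempotent
  element of a group.\<close>

lemma Fm_zero:
  assumes "M \<in> module_cat R" "N \<in> module_cat R" "y \<in> FF N"
  shows "Fm M N (\<lambda>x. \<zero>\<^bsub>N\<^esub>) y = \<one>\<^bsub>fob F M\<^esub>"
proof -
  interpret N: left_module R N using module_catD(1)[OF assms(2)] .
  interpret G: comm_group "fob F M" using F_group[OF assms(1)] .
  have z: "lin R M N (\<lambda>x. \<zero>\<^bsub>N\<^esub>)" using N.lin_zero_map module_catD(1)[OF assms(1)] by blast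
  have "Fm M N (\<lambda>x. \<zero>\<^bsub>N\<^esub> \<oplus>\<^bsub>N\<^esub> \<zero>\<^bsub>N\<^esub>) y = Fm M N (\<lambda>x. \<zero>\<^bsub>N\<^esub>) y \<otimes>\<^bsub>fob F M\<^esub> Fm M N (\<lambda>x. \<zero>\<^bsub>N\<^esub>) y"
    using Fm_add[OF assms(1,2) z z assms(3)] .
  then show ?thesis using Fm_closed[OF assms(1,2) z assms(3)] by simp
qed

lemma Fm_one:
  assumes "M \<in> module_cat R" "N \<in> module_cat R" "lin R M N f"
  shows "Fm M N f \<one>\<^bsub>fob F N\<^esub> = \<one>\<^bsub>fob F M\<^esub>"
  using hom_one[OF Fm_hom[OF assms]] F_group assms comm_group.axioms(2) by blast

text \<open>The hypothesis on filtered categories, rewritten for directed systems. Injectivity says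
  that elements over a colimit are separated by the stages, surjectivity that compatible families
  glue.\<close>

lemma colim_iso:
  assumes S: "dsystem R I po M e" and I: "sm I" and M: "\<And>i. i \<in> I \<Longrightarrow> M i \<in> module_cat R"
    and C: "dcolim R I po M e C c" and Ccat: "C \<in> module_cat R"
  shows "inj_on (\<lambda>x. \<lambda>i\<in>I. Fm (M i) C (c i) x) (FF C)"
    "\<And>z. (\<And>i. i \<in> I \<Longrightarrow> z i \<in> FF (M i)) \<Longrightarrow>
      (\<And>i j. \<lbrakk>i \<in> I; j \<in> I; po i j\<rbrakk> \<Longrightarrow> Fm (M i) (M j) (e i j) (z j) = z i) \<Longrightarrow>
      \<exists>x\<in>FF C. \<forall>i\<in>I. Fm (M i) C (c i) x = z i"
proof -
  have refl: "po i i" if "i \<in> I" for i using S that unfolding dsystem_def by meson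
  have trans: "po i k" if "i \<in> I" "j \<in> I" "k \<in> I" "po i j" "po j k" for i j k
    using S that unfolding dsystem_def by meson
  have dir: "\<exists>k\<in>I. po i k \<and> po j k" if "i \<in> I" "j \<in> I" for i j
    using S that unfolding dsystem_def by meson
  have ne: "I \<noteq> {}" using S unfolding dsystem_def by meson
  have lm: "left_module R (M i)" if "i \<in> I" for i
    using S that unfolding dsystem_def by meson
  have e: "lin R (M i) (M j) (e i j)" if "i \<in> I" "j \<in> I" "po i j" for i j
    using S that unfolding dsystem_def by meson
  have e_id: "e i i x = x" if "i \<in> I" "x \<in> carrier (M i)" for i x
    using S that unfolding dsystem_def by meson
  have e_comp: "e j k (e i j x) = e i k x"
    if "i \<in> I" "j \<in> I" "k \<in> I" "po i j" "po j k" "x \<in> carrier (M i)" for i j k x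
    using S that unfolding dsystem_def by meson
  have c: "lin R (M i) C (c i)" if "i \<in> I" for i
    using C that unfolding dcolim_def by meson
  have c_e: "c j (e i j x) = c i x" if "i \<in> I" "j \<in> I" "po i j" "x \<in> carrier (M i)" for i j x
    using C that unfolding dcolim_def by meson
  have surj: "\<exists>i\<in>I. \<exists>x\<in>carrier (M i). y = c i x" if "y \<in> carrier C" for y
    using C that unfolding dcolim_def by meson
  obtain \<iota> :: "_ \<Rightarrow> 'u" where \<iota>: "inj_on \<iota> I" using ex_inj_small[OF I] .
  define \<kappa> where "\<kappa> = inv_into I \<iota>"
  have \<kappa>: "\<kappa> (\<iota> i) = i" if "i \<in> I" for i using \<iota> that by (simp add: \<kappa>_def)
  \<comment> \<open>The index set is copied into \<open>'u\<close>, the type over which the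
    hypothesis quantifies. Arrow sets have at most one element, so parallel arrows are equal
    already.\<close>
  define J :: "('u, 'u) category" where "J = \<lparr>Ob = \<iota> ` I,
    Arr = (\<lambda>p q. if po (\<kappa> p) (\<kappa> q) then {undefined} else {}),
    Ide = (\<lambda>_. undefined), Comp = (\<lambda>_ _ _ _ _. undefined)\<rparr>"
  define D where "D p = M (\<kappa> p)" for p
  define d :: "'u \<Rightarrow> 'u \<Rightarrow> 'u \<Rightarrow> 'u \<Rightarrow> 'u" where "d p q a = restrict (e (\<kappa> p) (\<kappa> q)) (carrier (M (\<kappa> p)))" for p q a
  define c' where "c' p = restrict (c (\<kappa> p)) (carrier (M (\<kappa> p)))" for p
  have D: "D (\<iota> i) = M i" if "i \<in> I" for i using that by (simp add: D_def \<kappa>)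
  have cc: "Fm (D (\<iota> i)) C (c i) = fmap F (D (\<iota> i)) C (c' (\<iota> i))" if "i \<in> I" for i
    using that by (simp add: D_def c'_def \<kappa> Fm_def[abs_def])
  have arr: "a \<in> Arr J p q \<longleftrightarrow> po (\<kappa> p) (\<kappa> q) \<and> a = undefined" for a p q by (simp add: J_def)
  have \<kappa>I: "\<kappa> p \<in> I" if "p \<in> Ob J" for p using that \<kappa> by (auto simp: J_def)
  have "is_category J"
    unfolding is_category_def
  proof (intro conjI ballI)
    fix p q r a b assume "p \<in> Ob J" "q \<in> Ob J" "r \<in> Ob J" "a \<in> Arr J p q" "b \<in> Arr J q r"
    then show "Comp J p q r b a \<in> Arr J p r"
      unfolding arr using trans[of "\<kappa> p" "\<kappa> q" "\<kappa> r"] \<kappa>I by (simp add: J_def)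
  next
    fix p assume "p \<in> Ob J"
    then show "Ide J p \<in> Arr J p p" using refl \<kappa>I by (simp add: J_def)
  next
    fix p q a assume "p \<in> Ob J" "q \<in> Ob J" "a \<in> Arr J p q"
    then show "Comp J p p q a (Ide J p) = a" "Comp J p q q (Ide J q) a = a"
      unfolding arr by (simp_all add: J_def)
  qed (simp add: J_def)
  then have sJ: "small_category TYPE('u) J"
    using small_image[OF I, of \<iota>] small_finite[of "{}"] small_finite[of "{undefined}"]
    by (auto simp: small_category_def J_def small_def)
  have fJ: "filtered J"
  proof -
    have "\<exists>k\<in>Ob J. Arr J p k \<noteq> {} \<and> Arr J q k \<noteq> {}" if pq: "p \<in> Ob J" "q \<in> Ob J" for p q
    proof -
      obtain i j where "i \<in> I" "j \<in> I" "p = \<iota> i" "q = \<iota> j" using pq by (auto simp: J_def)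
      moreover from this obtain k where "k \<in> I" "po i k" "po j k" using dir by blast
      ultimately show ?thesis by (intro bexI[of _ "\<iota> k"]) (simp_all add: J_def \<kappa>)
    qed
    moreover have "\<exists>k\<in>Ob J. \<exists>c\<in>Arr J j k. Comp J i j k c a = Comp J i j k c b" if "j \<in> Ob J" for i j a b
      by (rule bexI[where x = j], rule bexI[where x = undefined]) (use that refl[OF \<kappa>I[OF that]] in \<open>simp_all add: J_def\<close>)
    ultimately show ?thesis using ne unfolding filtered_def by (auto simp: J_def)
  qed
  have mh: "restrict f (carrier (M i)) \<in> mod_hom R (M i) N" if "i \<in> I" "lin R (M i) N f" for i N f
    using mod_hom_restrict[OF M that(2)] that(1) .
  have Dd: "mod_diagram R J D d"
    unfolding mod_diagram_def
  proof (intro conjI ballI)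
    fix p assume "p \<in> Ob J"
    then show "D p \<in> module_cat R" using M \<kappa>I by (simp add: D_def)
    show "d p p (Ide J p) = mod_id (D p)"
      using e_id \<kappa>I[OF \<open>p \<in> Ob J\<close>] by (auto simp: d_def D_def mod_id_def)
  next
    fix p q a assume p: "p \<in> Ob J" "q \<in> Ob J" "a \<in> Arr J p q"
    then have "lin R (M (\<kappa> p)) (M (\<kappa> q)) (e (\<kappa> p) (\<kappa> q))" using e \<kappa>I unfolding arr by blast
    then show "d p q a \<in> mod_hom R (D p) (D q)"
      using mh \<kappa>I p unfolding d_def D_def by blast
    fix r b assume r: "r \<in> Ob J" "b \<in> Arr J q r"
    then have "e (\<kappa> p) (\<kappa> r) x = e (\<kappa> q) (\<kappa> r) (e (\<kappa> p) (\<kappa> q) x)" "e (\<kappa> p) (\<kappa> q) x \<in> carrier (M (\<kappa> q))"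
      if "x \<in> carrier (M (\<kappa> p))" for x
      using e_comp[of "\<kappa> p" "\<kappa> q" "\<kappa> r" x] \<kappa>I p that lin_closed[OF e, of "\<kappa> p" "\<kappa> q" x] unfolding arr by auto
    then show "d p r (Comp J p q r b a) = compose (carrier (D p)) (d q r b) (d p q a)"
      by (auto simp: d_def D_def compose_def)
  qed
  have cone: "mod_cocone R J D d C c'"
    unfolding mod_cocone_def
  proof (intro conjI ballI)
    fix p assume "p \<in> Ob J"
    then show "c' p \<in> mod_hom R (D p) C" using mh c \<kappa>I unfolding c'_def D_def by blast
  next
    fix p q a assume "p \<in> Ob J" "q \<in> Ob J" "a \<in> Arr J p q"
    then have "c (\<kappa> q) (e (\<kappa> p) (\<kappa> q) x) = c (\<kappa> p) x" "e (\<kappa> p) (\<kappa> q) x \<in> carrier (M (\<kappa> q))"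
      if "x \<in> carrier (M (\<kappa> p))" for x
      using c_e[of "\<kappa> p" "\<kappa> q" x] \<kappa>I that lin_closed[OF e, of "\<kappa> p" "\<kappa> q" x] unfolding arr by auto
    then show "compose (carrier (D p)) (c' q) (d p q a) = c' p"
      by (auto simp: c'_def d_def D_def compose_def)
  qed (rule Ccat)
  have univ: "\<exists>!h. h \<in> mod_hom R C N \<and> (\<forall>i\<in>Ob J. compose (carrier (D i)) h (c' i) = n i)"
    if N: "mod_cocone R J D d N n" for N n
  proof -
    have n: "n (\<iota> i) \<in> mod_hom R (M i) N" if "i \<in> I" for i
      using N that by (auto simp: mod_cocone_def J_def D_def \<kappa>)
    have n_e: "n (\<iota> j) (e i j x) = n (\<iota> i) x" if "i \<in> I" "j \<in> I" "po i j" "x \<in> carrier (M i)" for i j x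
    proof -
      have "compose (carrier (D (\<iota> i))) (n (\<iota> j)) (d (\<iota> i) (\<iota> j) undefined) = n (\<iota> i)"
        using N that unfolding mod_cocone_def by (simp add: J_def \<kappa>)
      then show ?thesis using that by (auto simp: D_def d_def \<kappa> compose_def dest: fun_cong[of _ _ x])
    qed
    have Nl: "left_module R N" using N module_catD by (auto simp: mod_cocone_def)
    obtain h where h: "lin R C N h" "\<And>i x. \<lbrakk>i \<in> I; x \<in> carrier (M i)\<rbrakk> \<Longrightarrow> h (c i x) = n (\<iota> i) x"
      using dcolim_univ[OF S C Nl, of "\<lambda>i. n (\<iota> i)"] n n_e by (auto simp: mod_hom_eq)
    have nx: "n (\<iota> i) = restrict (\<lambda>x. h (c i x)) (carrier (M i))" if "i \<in> I" for i
      using n[OF that] h(2)[OF that] by (auto simp: mod_hom_def PiE_def intro: extensionalityI)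
    show ?thesis
    proof (intro ex1I[of _ "restrict h (carrier C)"] conjI ballI)
      show "restrict h (carrier C) \<in> mod_hom R C N" using mod_hom_restrict[OF Ccat h(1)] .
      show "compose (carrier (D p)) (restrict h (carrier C)) (c' p) = n p" if "p \<in> Ob J" for p
        using that lin_closed[OF c] by (auto simp: J_def D_def c'_def \<kappa> compose_def nx intro!: restrict_ext)
      fix h' assume h': "h' \<in> mod_hom R C N \<and> (\<forall>p\<in>Ob J. compose (carrier (D p)) h' (c' p) = n p)"
      have "h' y = h y" if "y \<in> carrier C" for y
      proof -
        from surj[OF that] obtain i x where i: "i \<in> I" "x \<in> carrier (M i)" "y = c i x" by blast
        then have "compose (carrier (D (\<iota> i))) h' (c' (\<iota> i)) x = n (\<iota> i) x" using h' by (simp add: J_def)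
        then show ?thesis using i h(2) by (simp add: D_def c'_def \<kappa> compose_def)
      qed
      with h' show "h' = restrict h (carrier C)"
        by (auto simp: mod_hom_def PiE_def intro!: extensionalityI)
    qed
  qed
  have "(\<lambda>x. \<lambda>p\<in>Ob J. fmap F (D p) C (c' p) x) \<in>
          iso (fob F C) (inverse_limit J (\<lambda>i. fob F (D i)) (\<lambda>i j a. fmap F (D i) (D j) (d i j a)))"
    using pres sJ fJ Dd cone univ unfolding preserves_filtered_colimits_def mod_colimit_def by blast
  then have bij: "bij_betw (\<lambda>x. \<lambda>p\<in>Ob J. fmap F (D p) C (c' p) x) (FF C)
      {z \<in> (\<Pi>\<^sub>E p\<in>Ob J. FF (D p)). \<forall>p\<in>Ob J. \<forall>q\<in>Ob J. \<forall>a\<in>Arr J p q. fmap F (D p) (D q) (d p q a) (z q) = z p}"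
    by (simp add: iso_def inverse_limit_def product_group_def)
  show "inj_on (\<lambda>x. \<lambda>i\<in>I. Fm (M i) C (c i) x) (FF C)"
  proof (rule inj_onI)
    fix x y assume x: "x \<in> FF C" "y \<in> FF C" "(\<lambda>i\<in>I. Fm (M i) C (c i) x) = (\<lambda>i\<in>I. Fm (M i) C (c i) y)"
    have "fmap F (D p) C (c' p) x = fmap F (D p) C (c' p) y" if p: "p \<in> Ob J" for p
    proof -
      obtain i where i: "i \<in> I" "p = \<iota> i" using p by (auto simp: J_def)
      then have "Fm (M i) C (c i) x = Fm (M i) C (c i) y" using fun_cong[OF x(3), of i] by simp
      then show ?thesis using i cc[OF i(1)] by (simp add: D)
    qed
    then have "(\<lambda>p\<in>Ob J. fmap F (D p) C (c' p) x) = (\<lambda>p\<in>Ob J. fmap F (D p) C (c' p) y)" by auto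
    with x(1,2) bij show "x = y" by (auto simp: bij_betw_def inj_on_def)
  qed
  fix z assume z: "\<And>i. i \<in> I \<Longrightarrow> z i \<in> FF (M i)"
    and ze: "\<And>i j. \<lbrakk>i \<in> I; j \<in> I; po i j\<rbrakk> \<Longrightarrow> Fm (M i) (M j) (e i j) (z j) = z i"
  have "(\<lambda>p\<in>Ob J. z (\<kappa> p)) \<in> {z \<in> (\<Pi>\<^sub>E p\<in>Ob J. FF (D p)). \<forall>p\<in>Ob J. \<forall>q\<in>Ob J. \<forall>a\<in>Arr J p q.
      fmap F (D p) (D q) (d p q a) (z q) = z p}"
    using z ze by (auto simp: J_def D_def \<kappa> d_def Fm_def split: if_splits)
  then have "(\<lambda>p\<in>Ob J. z (\<kappa> p)) \<in> (\<lambda>x. \<lambda>p\<in>Ob J. fmap F (D p) C (c' p) x) ` FF C"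
    unfolding bij_betw_imp_surj_on[OF bij] .
  then obtain x where x: "x \<in> FF C" "(\<lambda>p\<in>Ob J. fmap F (D p) C (c' p) x) = (\<lambda>p\<in>Ob J. z (\<kappa> p))"
    by (metis (no_types, lifting) imageE)
  have "Fm (M i) C (c i) x = z i" if "i \<in> I" for i
  proof -
    have "fmap F (D (\<iota> i)) C (c' (\<iota> i)) x = z (\<kappa> (\<iota> i))"
      using fun_cong[OF x(2), of "\<iota> i"] that by (simp add: J_def)
    then show ?thesis using that cc[OF that] by (simp add: D \<kappa>)
  qed
  with x(1) show "\<exists>x\<in>FF C. \<forall>i\<in>I. Fm (M i) C (c i) x = z i" by blast
qed

lemma colim_sep:
  assumes "dsystem R I po M e" "sm I" "\<And>i. i \<in> I \<Longrightarrow> M i \<in> module_cat R"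
    "dcolim R I po M e C c" "C \<in> module_cat R" "x \<in> FF C" "y \<in> FF C"
    "\<And>i. i \<in> I \<Longrightarrow> Fm (M i) C (c i) x = Fm (M i) C (c i) y"
  shows "x = y"
proof -
  have "(\<lambda>i\<in>I. Fm (M i) C (c i) x) = (\<lambda>i\<in>I. Fm (M i) C (c i) y)" using assms(8) by auto
  then show ?thesis using inj_onD[OF colim_iso(1)[OF assms(1-5)]] assms(6,7) by blast
qed

lemmas colim_glue = colim_iso(2)

end

lemma presents_eq:
  assumes "presents R P G E \<gamma>" "left_module R P" "left_module R Q" "lin R P Q f" "lin R P Q f'"
    and "\<And>g. g \<in> G \<Longrightarrow> f (\<gamma> g) = f' (\<gamma> g)" "x \<in> carrier P"
  shows "f x = f' x"
proof -
  obtain t where t: "t \<in> terms R G" "x = lc P \<gamma> t" using assms(1,7) unfolding presents_def by blast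
  have \<gamma>: "\<gamma> \<in> G \<rightarrow> carrier P" using assms(1) unfolding presents_def by blast
  show ?thesis
    using lin_lc[OF assms(2,3,4) t(1) \<gamma>] lin_lc[OF assms(2,3,5) t(1) \<gamma>] t(2)
      lc_cong[of G "\<lambda>g. f (\<gamma> g)" "\<lambda>g. f' (\<gamma> g)", OF assms(6) t(1)] by simp
qed

lemma presents_map:
  fixes P Q :: "('r, 'u) module"
  assumes "presents R P G E \<gamma>" "Q \<in> module_cat R" "u \<in> G \<rightarrow> carrier Q" "\<And>e. e \<in> E \<Longrightarrow> lc Q u e = \<zero>\<^bsub>Q\<^esub>"
  shows "\<exists>h. lin R P Q h \<and> (\<forall>g\<in>G. h (\<gamma> g) = u g)"
  using assms unfolding presents_def by blast

section \<open>Purity\<close>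

text \<open>Purity by finite systems of linear equations, with the elements of M themselves as
  unknowns: if they solve a finite system modulo N, a correction d in N turns them into a true
  solution. Equivalently, the values of -d solve in N the system with right-hand sides in N that M
  solves.\<close>

definition pure_in :: "('r, 'k) ring_scheme \<Rightarrow> ('r, 'a) module \<Rightarrow> 'a set \<Rightarrow> bool" where
  "pure_in R M N \<longleftrightarrow> submod R M N \<and>
     (\<forall>E. finite E \<and> E \<subseteq> terms R (carrier M) \<and> (\<forall>e\<in>E. lc M (\<lambda>s. s) e \<in> N) \<longrightarrow>
        (\<exists>d\<in>carrier M \<rightarrow> N. \<forall>e\<in>E. lc M (\<lambda>s. s \<oplus>\<^bsub>M\<^esub> d s) e = \<zero>\<^bsub>M\<^esub>))"

text \<open>Renaming the unknowns along v reduces an arbitrary index set G to the form used in the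
  definition.\<close>

lemma pure_lift:
  assumes N: "pure_in R M N" and E: "finite E" "E \<subseteq> terms R G" and v: "v \<in> G \<rightarrow> carrier M"
    and *: "\<And>e. e \<in> E \<Longrightarrow> lc M v e \<in> N"
  obtains d where "d \<in> G \<rightarrow> N" "\<And>e. e \<in> E \<Longrightarrow> lc M (\<lambda>g. v g \<oplus>\<^bsub>M\<^esub> d g) e = \<zero>\<^bsub>M\<^esub>"
proof -
  let ?E = "(\<lambda>e. map (apsnd v) e) ` E"
  have "finite ?E" "?E \<subseteq> terms R (carrier M)" using E map_terms[OF _ v] by auto
  moreover have "\<forall>e\<in>?E. lc M (\<lambda>s. s) e \<in> N" using * by (simp add: lc_map)
  ultimately obtain d where d: "d \<in> carrier M \<rightarrow> N" "\<forall>e\<in>?E. lc M (\<lambda>s. s \<oplus>\<^bsub>M\<^esub> d s) e = \<zero>\<^bsub>M\<^esub>"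
    using N unfolding pure_in_def by meson
  show thesis
    by (rule that[of "\<lambda>g. d (v g)"]) (use d v in \<open>auto simp: lc_map\<close>)
qed

lemma pure_submod: "pure_in R M N \<Longrightarrow> submod R M N"
  by (simp add: pure_in_def)

text \<open>A pushout of f along the pure submodule N of B in exact form: i and k together are onto,
  and the kernel of the map they induce on the direct sum consists of the pairs (-f n, n). The same
  shape covers abstract pushouts and, with identity maps, sums of two submodules.\<close>

definition pure_square where
  "pure_square R A B N f Q i k \<longleftrightarrow> A \<in> module_cat R \<and> B \<in> module_cat R \<and> Q \<in> module_cat R \<and>
     pure_in R B N \<and> lin R (B \<restriction> N) A f \<and> lin R A Q i \<and> lin R B Q k \<and>
     (\<forall>q\<in>carrier Q. \<exists>a\<in>carrier A. \<exists>b\<in>carrier B. q = i a \<oplus>\<^bsub>Q\<^esub> k b) \<and> (\<forall>n\<in>N. k n = i (f n)) \<and>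
     (\<forall>a\<in>carrier A. \<forall>b\<in>carrier B. i a \<oplus>\<^bsub>Q\<^esub> k b = \<zero>\<^bsub>Q\<^esub> \<longrightarrow> b \<in> N \<and> a \<oplus>\<^bsub>A\<^esub> f b = \<zero>\<^bsub>A\<^esub>)"

text \<open>Finiteness is imposed on the relations alone, so there may be infinitely many
  generators: such a module is finitely presented up to a free summand. This is the finiteness that
  purity sees, and it lets all elements of a module serve as generators in
  \<open>fp_colimit\<close>.\<close>

definition fin_pres :: "('r, 'k) ring_scheme \<Rightarrow> ('r, 'u) module \<Rightarrow> bool" where
  "fin_pres R P \<longleftrightarrow> (\<exists>(G :: 'u set) E \<gamma>. finite E \<and> presents R P G E \<gamma>)"

lemma fin_pres_cat: "fin_pres R P \<Longrightarrow> P \<in> module_cat R"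
  unfolding fin_pres_def presents_def by blast

context mod_univ
begin

text \<open>A homomorphism from \<^term>\<open>P\<close> is given on generators; purity corrects the choice of
  decompositions of their images so that the finitely many relations are respected.\<close>

lemma fin_pres_decompose:
  fixes A B Q P :: "('r, 'u) module"
  assumes sq: "pure_square R A B N f Q i k" and P: "fin_pres R P" and p: "lin R P Q p"
  obtains a b where "lin R P A a" "lin R P B b" "\<And>x. x \<in> carrier P \<Longrightarrow> p x = i (a x) \<oplus>\<^bsub>Q\<^esub> k (b x)"
proof -
  from sq have cat: "A \<in> module_cat R" "B \<in> module_cat R" "Q \<in> module_cat R" and N: "pure_in R B N"
    and f: "lin R (B \<restriction> N) A f" and i: "lin R A Q i" and k: "lin R B Q k"
    and surj: "\<And>q. q \<in> carrier Q \<Longrightarrow> \<exists>a\<in>carrier A. \<exists>b\<in>carrier B. q = i a \<oplus>\<^bsub>Q\<^esub> k b"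
    and kf: "\<And>n. n \<in> N \<Longrightarrow> k n = i (f n)"
    and ker: "\<And>a b. \<lbrakk>a \<in> carrier A; b \<in> carrier B; i a \<oplus>\<^bsub>Q\<^esub> k b = \<zero>\<^bsub>Q\<^esub>\<rbrakk> \<Longrightarrow> b \<in> N \<and> a \<oplus>\<^bsub>A\<^esub> f b = \<zero>\<^bsub>A\<^esub>"
    unfolding pure_square_def by blast+
  interpret A: left_module R A using module_catD(1) cat by blast
  interpret B: left_module R B using module_catD(1) cat by blast
  interpret Q: left_module R Q using module_catD(1) cat by blast
  obtain G E \<gamma> where E: "finite E" and pr: "presents R P (G :: 'u set) E \<gamma>"
    using P unfolding fin_pres_def by blast
  have Pm: "left_module R P" using fin_pres_cat[OF P] module_catD(1) by blast
  have \<gamma>: "\<gamma> \<in> G \<rightarrow> carrier P" and ET: "E \<subseteq> terms R G" and rel: "\<And>e. e \<in> E \<Longrightarrow> lc P \<gamma> e = \<zero>\<^bsub>P\<^esub>"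
    using pr unfolding presents_def by blast+
  note N' = submod_closed[OF pure_submod[OF N]]
  have "\<exists>a b. a \<in> carrier A \<and> b \<in> carrier B \<and> p (\<gamma> g) = i a \<oplus>\<^bsub>Q\<^esub> k b" if "g \<in> G" for g
    using surj[of "p (\<gamma> g)"] lin_closed[OF p] \<gamma> that by blast
  then obtain a0 b0 where a0: "\<And>g. g \<in> G \<Longrightarrow> a0 g \<in> carrier A" and b0: "\<And>g. g \<in> G \<Longrightarrow> b0 g \<in> carrier B"
    and ab0: "\<And>g. g \<in> G \<Longrightarrow> p (\<gamma> g) = i (a0 g) \<oplus>\<^bsub>Q\<^esub> k (b0 g)" by metis
  have aF: "a0 \<in> G \<rightarrow> carrier A" and bF: "b0 \<in> G \<rightarrow> carrier B" using a0 b0 by auto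
  have rel_sum: "i (lc A a e) \<oplus>\<^bsub>Q\<^esub> k (lc B b e) = \<zero>\<^bsub>Q\<^esub>"
    if "e \<in> E" "a \<in> G \<rightarrow> carrier A" "b \<in> G \<rightarrow> carrier B" "\<And>g. g \<in> G \<Longrightarrow> p (\<gamma> g) = i (a g) \<oplus>\<^bsub>Q\<^esub> k (b g)" for a b e
  proof -
    have e: "e \<in> terms R G" using that ET by blast
    have "i (lc A a e) \<oplus>\<^bsub>Q\<^esub> k (lc B b e) = lc Q (\<lambda>g. i (a g)) e \<oplus>\<^bsub>Q\<^esub> lc Q (\<lambda>g. k (b g)) e"
      using lin_lc[OF A.left_module_axioms Q.left_module_axioms i e that(2)]
        lin_lc[OF B.left_module_axioms Q.left_module_axioms k e that(3)] by simp
    also have "\<dots> = lc Q (\<lambda>g. i (a g) \<oplus>\<^bsub>Q\<^esub> k (b g)) e"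
      using that lin_closed[OF i] lin_closed[OF k] by (intro Q.lc_add[symmetric, OF e]) (auto simp: Pi_iff)
    also have "\<dots> = lc Q (\<lambda>g. p (\<gamma> g)) e" using that(4) by (intro lc_cong[OF _ e]) simp
    also have "\<dots> = p \<zero>\<^bsub>P\<^esub>" using lin_lc[OF Pm Q.left_module_axioms p e \<gamma>] rel[OF that(1)] by simp
    finally show ?thesis using lin_zero[OF Pm Q.left_module_axioms p] by simp
  qed
  have "lc B b0 e \<in> N" if "e \<in> E" for e
    using ker[OF A.lc_closed[OF _ aF] B.lc_closed[OF _ bF] rel_sum[OF that aF bF ab0]] ET that by blast
  then obtain d where d: "d \<in> G \<rightarrow> N" "\<And>e. e \<in> E \<Longrightarrow> lc B (\<lambda>g. b0 g \<oplus>\<^bsub>B\<^esub> d g) e = \<zero>\<^bsub>B\<^esub>"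
    using pure_lift[OF N E ET bF] by blast
  \<comment> \<open>The correction is moved across the square: b gains \<open>d g\<close> and a
    loses \<open>f (d g)\<close>. Since k agrees with i f on N, the sum keeps its value.\<close>
  define b where "b g = b0 g \<oplus>\<^bsub>B\<^esub> d g" for g
  define a where "a g = a0 g \<oplus>\<^bsub>A\<^esub> (\<ominus>\<^bsub>R\<^esub> \<one>\<^bsub>R\<^esub>) \<odot>\<^bsub>A\<^esub> f (d g)" for g
  have dg: "d g \<in> N" "d g \<in> carrier B" "f (d g) \<in> carrier A" if "g \<in> G" for g
    using d(1) that N'(1) lin_closed[OF f, of "d g"] by auto
  have bF': "b \<in> G \<rightarrow> carrier B" and aF': "a \<in> G \<rightarrow> carrier A" using b0 a0 dg by (auto simp: a_def b_def)
  have ab: "p (\<gamma> g) = i (a g) \<oplus>\<^bsub>Q\<^esub> k (b g)" if g: "g \<in> G" for g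
  proof -
    have i': "i (a0 g) \<in> carrier Q" "i (f (d g)) \<in> carrier Q" "k (b0 g) \<in> carrier Q"
      using a0 b0 dg g lin_closed[OF i] lin_closed[OF k] by auto
    have "i (a g) = i (a0 g) \<oplus>\<^bsub>Q\<^esub> (\<ominus>\<^bsub>R\<^esub> \<one>\<^bsub>R\<^esub>) \<odot>\<^bsub>Q\<^esub> i (f (d g))"
      using a0 dg g by (simp add: a_def lin_add[OF i] lin_smult[OF i])
    moreover have "k (b g) = i (f (d g)) \<oplus>\<^bsub>Q\<^esub> k (b0 g)"
      using b0 dg g i' kf[of "d g"] by (simp add: b_def lin_add[OF k] Q.M.a_comm)
    ultimately have "i (a g) \<oplus>\<^bsub>Q\<^esub> k (b g) = i (a0 g) \<oplus>\<^bsub>Q\<^esub> ((\<ominus>\<^bsub>R\<^esub> \<one>\<^bsub>R\<^esub>) \<odot>\<^bsub>Q\<^esub> i (f (d g)) \<oplus>\<^bsub>Q\<^esub> i (f (d g))) \<oplus>\<^bsub>Q\<^esub> k (b0 g)"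
      using i' by (simp add: Q.M.a_assoc del: Q.neg_add)
    then show ?thesis using ab0[OF g] i' by simp
  qed
  have brel: "lc B b e = \<zero>\<^bsub>B\<^esub>" if "e \<in> E" for e using d(2)[OF that] unfolding b_def .
  \<comment> \<open>Once a relation holds for b, the kernel condition reads a + f 0 = 0 for the
    corresponding value of a, so the relation holds for a as well.\<close>
  have arel: "lc A a e = \<zero>\<^bsub>A\<^esub>" if e: "e \<in> E" for e
  proof -
    have et: "e \<in> terms R G" using ET e by blast
    have 0: "f \<zero>\<^bsub>B\<^esub> = \<zero>\<^bsub>A\<^esub>"
      using lin_zero[OF left_module_submod[OF B.left_module_axioms pure_submod[OF N]] A.left_module_axioms f] by simp
    from ker[OF A.lc_closed[OF et aF'] B.lc_closed[OF et bF'] rel_sum[OF e aF' bF' ab]]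
    show ?thesis using brel[OF e] 0 A.lc_closed[OF et aF'] by simp
  qed
  obtain \<alpha> where \<alpha>: "lin R P A \<alpha>" "\<And>g. g \<in> G \<Longrightarrow> \<alpha> (\<gamma> g) = a g"
    using presents_map[OF pr cat(1) aF' arel] by blast
  obtain \<beta> where \<beta>: "lin R P B \<beta>" "\<And>g. g \<in> G \<Longrightarrow> \<beta> (\<gamma> g) = b g"
    using presents_map[OF pr cat(2) bF' brel] by blast
  have "p x = i (\<alpha> x) \<oplus>\<^bsub>Q\<^esub> k (\<beta> x)" if "x \<in> carrier P" for x
    by (rule presents_eq[OF pr Pm Q.left_module_axioms p _ _ that])
      (use \<alpha> \<beta> ab in \<open>auto intro!: lin_plus[OF Pm Q.left_module_axioms] lin_comp[OF _ i] lin_comp[OF _ k]\<close>)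
  with \<alpha> \<beta> show thesis using that by blast
qed

text \<open>All elements of C serve as generators, and every finite set E of relations valid in C
  gives a stage. An element of a stage that vanishes in C is named by a term that is itself a
  relation of C; adding this term to E makes the element vanish.\<close>

lemma fp_colimit:
  fixes C :: "('r, 'u) module"
  assumes C: "C \<in> module_cat R"
  defines "I \<equiv> {E. finite E \<and> E \<subseteq> terms R (carrier C) \<and> (\<forall>e\<in>E. lc C (\<lambda>c. c) e = \<zero>\<^bsub>C\<^esub>)}"
  shows "sm I \<and> (\<exists>(P :: _ \<Rightarrow> ('r, 'u) module) \<gamma> e p. (\<forall>E\<in>I. presents R (P E) (carrier C) E (\<gamma> E)) \<and>
    dsystem R I (\<subseteq>) P e \<and> dcolim R I (\<subseteq>) P e C p \<and> (\<forall>E\<in>I. \<forall>c\<in>carrier C. p E (\<gamma> E c) = c))"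
proof -
  let ?G = "carrier C"
  interpret C: left_module R C using module_catD(1)[OF C] .
  have "sm I"
    by (rule small_subset[OF small_Fpow[OF small_terms[OF module_catD(2)[OF C]]]]) (auto simp: I_def)
  have "\<exists>P \<gamma>. presents R (P :: ('r, 'u) module) ?G E \<gamma>" if E: "E \<in> I" for E
  proof -
    have "E \<subseteq> terms R ?G" using E by (auto simp: I_def)
    then obtain P :: "('r, 'u) module" and \<gamma> where "presents R P ?G E \<gamma>"
      by (rule presents_exists[OF module_catD(2)[OF C]])
    then show ?thesis by blast
  qed
  then obtain P :: "_ \<Rightarrow> ('r, 'u) module" and \<gamma> where pr: "\<And>E. E \<in> I \<Longrightarrow> presents R (P E) ?G E (\<gamma> E)" by metis
  have Pc: "P E \<in> module_cat R" and \<gamma>: "\<gamma> E \<in> ?G \<rightarrow> carrier (P E)"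
    and rel: "\<And>e. e \<in> E \<Longrightarrow> lc (P E) (\<gamma> E) e = \<zero>\<^bsub>P E\<^esub>"
    and gen: "\<And>x. x \<in> carrier (P E) \<Longrightarrow> \<exists>t\<in>terms R ?G. x = lc (P E) (\<gamma> E) t" if "E \<in> I" for E
    using pr[OF that] unfolding presents_def by blast+
  have Pm: "left_module R (P E)" if "E \<in> I" for E using module_catD(1) Pc that by blast
  have "\<exists>h. lin R (P E) (P E') h \<and> (\<forall>g\<in>?G. h (\<gamma> E g) = \<gamma> E' g)" if EE': "E \<in> I" "E' \<in> I" "E \<subseteq> E'" for E E'
  proof -
    have "lc (P E') (\<gamma> E') e = \<zero>\<^bsub>P E'\<^esub>" if "e \<in> E" for e using rel[OF EE'(2)] EE'(3) that by blast
    then show ?thesis by (rule presents_map[OF pr[OF EE'(1)] Pc[OF EE'(2)] \<gamma>[OF EE'(2)]])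
  qed
  then obtain e where e: "\<And>E E'. \<lbrakk>E \<in> I; E' \<in> I; E \<subseteq> E'\<rbrakk> \<Longrightarrow> lin R (P E) (P E') (e E E')"
    and e\<gamma>: "\<And>E E' g. \<lbrakk>E \<in> I; E' \<in> I; E \<subseteq> E'; g \<in> ?G\<rbrakk> \<Longrightarrow> e E E' (\<gamma> E g) = \<gamma> E' g" by metis
  have "\<exists>h. lin R (P E) C h \<and> (\<forall>g\<in>?G. h (\<gamma> E g) = g)" if E: "E \<in> I" for E
  proof -
    have "lc C (\<lambda>c. c) e = \<zero>\<^bsub>C\<^esub>" if "e \<in> E" for e using E that by (auto simp: I_def)
    then show ?thesis by (intro presents_map[OF pr[OF E] C]) auto
  qed
  then obtain p where p: "\<And>E. E \<in> I \<Longrightarrow> lin R (P E) C (p E)"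
    and p\<gamma>: "\<And>E g. \<lbrakk>E \<in> I; g \<in> ?G\<rbrakk> \<Longrightarrow> p E (\<gamma> E g) = g" by metis
  have un: "E \<union> E' \<in> I" if "E \<in> I" "E' \<in> I" for E E' using that by (auto simp: I_def)
  have S: "dsystem R I (\<subseteq>) P e"
    unfolding dsystem_def
  proof (intro conjI ballI impI)
    show "I \<noteq> {}" by (auto simp: I_def)
    show "\<exists>k\<in>I. i \<subseteq> k \<and> j \<subseteq> k" if "i \<in> I" "j \<in> I" for i j
      using un[OF that] by blast
    show "e i i x = x" if "i \<in> I" "x \<in> carrier (P i)" for i x
      using presents_eq[OF pr Pm Pm e lin_id] e\<gamma> that by blast
    show "e j k (e i j x) = e i k x"
      if "i \<in> I" "j \<in> I" "k \<in> I" "i \<subseteq> j" "j \<subseteq> k" "x \<in> carrier (P i)" for i j k x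
    proof -
      have ik: "i \<subseteq> k" using that by blast
      show ?thesis
        by (rule presents_eq[OF pr[OF that(1)] Pm[OF that(1)] Pm[OF that(3)]
              lin_comp[OF e[OF that(1,2,4)] e[OF that(2,3,5)]] e[OF that(1,3) ik] _ that(6)])
          (simp add: that ik e\<gamma>)
    qed
  qed (use Pm e in auto)
  have lcp: "p E (lc (P E) (\<gamma> E) t) = lc C (\<lambda>c. c) t" if "E \<in> I" "t \<in> terms R ?G" for E t
    using lin_lc[OF Pm[OF that(1)] C.left_module_axioms p[OF that(1)] that(2) \<gamma>[OF that(1)]]
      lc_cong[of ?G "\<lambda>g. p E (\<gamma> E g)" "\<lambda>c. c", OF p\<gamma>[OF that(1)] that(2)] by simp
  have "dcolim R I (\<subseteq>) P e C p"
    unfolding dcolim_def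
  proof (intro conjI ballI impI)
    show "p j (e i j x) = p i x" if "i \<in> I" "j \<in> I" "i \<subseteq> j" "x \<in> carrier (P i)" for i j x
      by (rule presents_eq[OF pr[OF that(1)] Pm[OF that(1)] C.left_module_axioms
            lin_comp[OF e[OF that(1-3)] p[OF that(2)]] p[OF that(1)] _ that(4)])
        (simp add: that e\<gamma> p\<gamma>)
    show "\<exists>i\<in>I. \<exists>x\<in>carrier (P i). y = p i x" if "y \<in> carrier C" for y
    proof -
      have "{} \<in> I" by (auto simp: I_def)
      then show ?thesis using p\<gamma>[of "{}" y] \<gamma>[of "{}"] that by (metis funcset_mem)
    qed
    show "\<exists>j\<in>I. i \<subseteq> j \<and> e i j x = \<zero>\<^bsub>P j\<^esub>" if i: "i \<in> I" "x \<in> carrier (P i)" "p i x = \<zero>\<^bsub>C\<^esub>" for i x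
    proof -
      obtain t where t: "t \<in> terms R ?G" "x = lc (P i) (\<gamma> i) t" using gen i by blast
      then have j: "insert t i \<in> I" using i lcp[OF i(1) t(1)] by (auto simp: I_def)
      have "e i (insert t i) x = lc (P (insert t i)) (\<gamma> (insert t i)) t"
        using lin_lc[OF Pm[OF i(1)] Pm[OF j] e[OF i(1) j subset_insertI] t(1) \<gamma>[OF i(1)]] t(2)
          lc_cong[of ?G "\<lambda>g. e i (insert t i) (\<gamma> i g)" "\<gamma> (insert t i)", OF e\<gamma>[OF i(1) j subset_insertI] t(1)]
        by simp
      then show ?thesis using rel[OF j, of t] j by (intro bexI[of _ "insert t i"]) auto
    qed
  qed (use p C.left_module_axioms in auto)
  with \<open>sm I\<close> pr S p\<gamma> show ?thesis by blast
qed

lemma restr_cat: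
  fixes M :: "('r, 'u) module"
  shows "left_module R M \<Longrightarrow> submod R M N \<Longrightarrow> sm N \<Longrightarrow> M \<restriction> N \<in> module_cat R"
  by (auto intro!: module_catI left_module_submod)

end

lemma lin_subset: "A \<subseteq> carrier M \<Longrightarrow> lin R (M \<restriction> A) M (\<lambda>x. x)"
  using lin_restr_dom[OF lin_id] .

section \<open>Determination of the functor by finitely presented modules\<close>

context mod_fun
begin

lemma fp_sep:
  assumes C: "C \<in> module_cat R" and x: "x \<in> FF C" "y \<in> FF C"
    and eq: "\<And>P p. fin_pres R P \<Longrightarrow> lin R P C p \<Longrightarrow> Fm P C p x = Fm P C p y"
  shows "x = y"
proof -
  let ?I = "{E. finite E \<and> E \<subseteq> terms R (carrier C) \<and> (\<forall>e\<in>E. lc C (\<lambda>c. c) e = \<zero>\<^bsub>C\<^esub>)}"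
  have I: "sm ?I" using fp_colimit[OF C] by (rule conjunct1)
  from fp_colimit[OF C, THEN conjunct2] obtain P :: "_ \<Rightarrow> ('r, 'u) module" and \<gamma> e p
    where pr': "\<forall>E\<in>?I. presents R (P E) (carrier C) E (\<gamma> E)"
      and S: "dsystem R ?I (\<subseteq>) P e" and D: "dcolim R ?I (\<subseteq>) P e C p"
      and p\<gamma>': "\<forall>E\<in>?I. \<forall>c\<in>carrier C. p E (\<gamma> E c) = c" by blast
  note pr = bspec[OF pr'] and p\<gamma> = bspec[OF bspec[OF p\<gamma>']]
  have fp: "fin_pres R (P E)" if "E \<in> ?I" for E
  proof -
    have "finite E" using that by blast
    with pr[OF that] show ?thesis unfolding fin_pres_def by (intro exI conjI)
  qed
  show ?thesis
    using colim_sep[OF S I _ D C x] fp fin_pres_cat eq D unfolding dcolim_def by (metis (no_types, lifting))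
qed

text \<open>The family is indexed by all maps from such modules to C, so its users do not have to
  know a particular colimit system. The element is glued over the system of
  \<open>fp_colimit\<close>; it has the prescribed value along any other map because that map
  factors through a stage of the system.\<close>

lemma fp_glue:
  assumes C: "C \<in> module_cat R"
    and z: "\<And>P p. fin_pres R P \<Longrightarrow> lin R P C p \<Longrightarrow> z P p \<in> FF P"
    and nat: "\<And>P P' m p. \<lbrakk>fin_pres R P; fin_pres R P'; lin R P P' m; lin R P' C p\<rbrakk> \<Longrightarrow>
       Fm P P' m (z P' p) = z P (\<lambda>x. p (m x))"
    and cong: "\<And>P p p'. \<lbrakk>fin_pres R P; lin R P C p; \<And>x. x \<in> carrier P \<Longrightarrow> p x = p' x\<rbrakk> \<Longrightarrow> z P p = z P p'"
  obtains x where "x \<in> FF C" "\<And>P p. fin_pres R P \<Longrightarrow> lin R P C p \<Longrightarrow> Fm P C p x = z P p"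
proof -
  let ?I = "{E. finite E \<and> E \<subseteq> terms R (carrier C) \<and> (\<forall>e\<in>E. lc C (\<lambda>c. c) e = \<zero>\<^bsub>C\<^esub>)}"
  have I: "sm ?I" using fp_colimit[OF C] by (rule conjunct1)
  from fp_colimit[OF C, THEN conjunct2] obtain P :: "_ \<Rightarrow> ('r, 'u) module" and \<gamma> e p
    where pr': "\<forall>E\<in>?I. presents R (P E) (carrier C) E (\<gamma> E)"
      and S: "dsystem R ?I (\<subseteq>) P e" and D: "dcolim R ?I (\<subseteq>) P e C p"
      and p\<gamma>': "\<forall>E\<in>?I. \<forall>c\<in>carrier C. p E (\<gamma> E c) = c" by blast
  note pr = bspec[OF pr'] and p\<gamma> = bspec[OF bspec[OF p\<gamma>']]
  have fp: "fin_pres R (P E)" if "E \<in> ?I" for E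
  proof -
    have "finite E" using that by blast
    with pr[OF that] show ?thesis unfolding fin_pres_def by (intro exI conjI)
  qed
  have p: "lin R (P E) C (p E)" if "E \<in> ?I" for E using D that unfolding dcolim_def by blast
  have Cm: "left_module R C" using module_catD(1)[OF C] .
  have "\<exists>x\<in>FF C. \<forall>E\<in>?I. Fm (P E) C (p E) x = z (P E) (p E)"
  proof (rule colim_glue[OF S I _ D C])
    show "z (P E) (p E) \<in> FF (P E)" if "E \<in> ?I" for E using z[OF fp p] that by blast
    fix E E' assume E: "E \<in> ?I" "E' \<in> ?I" "E \<subseteq> E'"
    then have e: "lin R (P E) (P E') (e E E')" using S unfolding dsystem_def by blast
    have "p E x = p E' (e E E' x)" if "x \<in> carrier (P E)" for x
      using D E that unfolding dcolim_def by (metis (no_types, lifting))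
    then show "Fm (P E) (P E') (e E E') (z (P E') (p E')) = z (P E) (p E)"
      using nat[OF fp[OF E(1)] fp[OF E(2)] e p[OF E(2)]] cong[OF fp[OF E(1)] p[OF E(1)], of "\<lambda>x. p E' (e E E' x)"] by simp
  qed (use fp fin_pres_cat in blast)
  then obtain x where x: "x \<in> FF C" and xz: "\<And>E. E \<in> ?I \<Longrightarrow> Fm (P E) C (p E) x = z (P E) (p E)" by blast
  have "Fm Q C q x = z Q q" if Q: "fin_pres R Q" and q: "lin R Q C q" for Q :: "('r, 'u) module" and q
  proof -
    obtain G E' \<delta> where E': "finite E'" and prQ: "presents R Q (G :: 'u set) E' \<delta>"
      using Q unfolding fin_pres_def by blast
    have Qm: "left_module R Q" using module_catD(1)[OF fin_pres_cat[OF Q]] .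
    have \<delta>: "\<delta> \<in> G \<rightarrow> carrier Q" and E'T: "E' \<subseteq> terms R G" and rel: "\<And>e. e \<in> E' \<Longrightarrow> lc Q \<delta> e = \<zero>\<^bsub>Q\<^esub>"
      using prQ unfolding presents_def by blast+
    define v where "v g = q (\<delta> g)" for g
    have v: "v \<in> G \<rightarrow> carrier C" using \<delta> lin_closed[OF q] by (auto simp: v_def Pi_iff)
    \<comment> \<open>The stage through which q factors: the relations of Q, with each generator
      replaced by its image in C.\<close>
    define E where "E = (\<lambda>t. map (apsnd v) t) ` E'"
    have "lc C v t = \<zero>\<^bsub>C\<^esub>" if "t \<in> E'" for t
    proof -
      have t: "t \<in> terms R G" using E'T that by blast
      show ?thesis
        using lin_lc[OF Qm Cm q t \<delta>] rel[OF that] lin_zero[OF Qm Cm q] by (simp add: v_def[abs_def])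
    qed
    then have E: "E \<in> ?I" using E' E'T map_terms[OF _ v] by (auto simp: E_def lc_map)
    have \<gamma>: "\<gamma> E \<in> carrier C \<rightarrow> carrier (P E)" and relE: "\<And>e. e \<in> E \<Longrightarrow> lc (P E) (\<gamma> E) e = \<zero>\<^bsub>P E\<^esub>"
      using pr[OF E] unfolding presents_def by blast+
    have \<gamma>v: "(\<lambda>g. \<gamma> E (v g)) \<in> G \<rightarrow> carrier (P E)" using \<gamma> v by auto
    have relm: "lc (P E) (\<lambda>g. \<gamma> E (v g)) t = \<zero>\<^bsub>P E\<^esub>" if "t \<in> E'" for t
      using relE[of "map (apsnd v) t"] that by (simp add: E_def lc_map)
    obtain m where m: "lin R Q (P E) m" "\<And>g. g \<in> G \<Longrightarrow> m (\<delta> g) = \<gamma> E (v g)"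
      using presents_map[OF prQ fin_pres_cat[OF fp[OF E]] \<gamma>v relm] by blast
    have qm: "p E (m y) = q y" if "y \<in> carrier Q" for y
    proof (rule presents_eq[OF prQ Qm Cm lin_comp[OF m(1) p[OF E]] q _ that])
      fix g assume "g \<in> G"
      then show "p E (m (\<delta> g)) = q (\<delta> g)" using m(2) p\<gamma>[OF E] v by (simp add: v_def Pi_iff)
    qed
    have "Fm Q C q x = Fm Q C (\<lambda>y. p E (m y)) x" using Fm_cong[of Q q "\<lambda>y. p E (m y)" C] qm by simp
    also have "\<dots> = Fm Q (P E) m (Fm (P E) C (p E) x)"
      by (rule Fm_comp[OF fin_pres_cat[OF Q] fin_pres_cat[OF fp[OF E]] C m(1) p[OF E] x])
    also have "\<dots> = Fm Q (P E) m (z (P E) (p E))" using xz[OF E] by simp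
    also have "\<dots> = z Q (\<lambda>y. p E (m y))" by (rule nat[OF Q fp[OF E] m(1) p[OF E]])
    also have "\<dots> = z Q q" by (rule cong[OF Q lin_comp[OF m(1) p[OF E]] qm])
    finally show ?thesis .
  qed
  with x show thesis using that by blast
qed

text \<open>By \<open>fin_pres_decompose\<close> a map p to Q is the sum of a map through A and a
  map through B, and additivity computes \<open>Fm P Q p\<close> from the two restrictions of the
  element.\<close>

lemma pure_square_sep:
  assumes sq: "pure_square R A B N f Q i k" and x: "x \<in> FF Q" "y \<in> FF Q"
    and eq: "Fm A Q i x = Fm A Q i y" "Fm B Q k x = Fm B Q k y"
  shows "x = y"
proof (rule fp_sep[OF _ x])
  from sq have cat: "A \<in> module_cat R" "B \<in> module_cat R" "Q \<in> module_cat R"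
    and i: "lin R A Q i" and k: "lin R B Q k" unfolding pure_square_def by blast+
  show "Q \<in> module_cat R" by fact
  fix P :: "('r, 'u) module" and p assume P: "fin_pres R P" and p: "lin R P Q p"
  note Pc = fin_pres_cat[OF P]
  obtain a b where a: "lin R P A a" and b: "lin R P B b"
    and ab: "\<And>x. x \<in> carrier P \<Longrightarrow> p x = i (a x) \<oplus>\<^bsub>Q\<^esub> k (b x)"
    using fin_pres_decompose[OF sq P p] by blast
  have "Fm P Q p x = Fm P A a (Fm A Q i x) \<otimes>\<^bsub>fob F P\<^esub> Fm P B b (Fm B Q k x)" if "x \<in> FF Q" for x
    using Fm_cong[of P p "\<lambda>x. i (a x) \<oplus>\<^bsub>Q\<^esub> k (b x)" Q, OF ab]
      Fm_add[OF Pc cat(3) lin_comp[OF a i] lin_comp[OF b k] that]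
      Fm_comp[OF Pc cat(1,3) a i that] Fm_comp[OF Pc cat(2,3) b k that] by simp
  then show "Fm P Q p x = Fm P Q p y" using x eq by simp
qed

text \<open>Along a map p = i a + k b the glued element must restrict to the product of y restricted
  along a and n restricted along b. This prescribes a family on finitely presented modules, which
  \<open>fp_glue\<close> assembles.\<close>

lemma pure_square_glue:
  assumes sq: "pure_square R A B N f Q i k" and y: "y \<in> FF A" and n: "n \<in> FF B"
    and eq: "Fm (B \<restriction> N) A f y = Fm (B \<restriction> N) B (\<lambda>x. x) n"
  obtains x where "x \<in> FF Q" "Fm A Q i x = y" "Fm B Q k x = n"
proof -
  from sq have cat: "A \<in> module_cat R" "B \<in> module_cat R" "Q \<in> module_cat R" and N: "pure_in R B N"
    and f: "lin R (B \<restriction> N) A f" and i: "lin R A Q i" and k: "lin R B Q k"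
    and ker: "\<And>a b. \<lbrakk>a \<in> carrier A; b \<in> carrier B; i a \<oplus>\<^bsub>Q\<^esub> k b = \<zero>\<^bsub>Q\<^esub>\<rbrakk> \<Longrightarrow> b \<in> N \<and> a \<oplus>\<^bsub>A\<^esub> f b = \<zero>\<^bsub>A\<^esub>"
    unfolding pure_square_def by blast+
  interpret A: left_module R A using module_catD(1) cat by blast
  interpret B: left_module R B using module_catD(1) cat by blast
  interpret Q: left_module R Q using module_catD(1) cat by blast
  note Nsub = pure_submod[OF N]
  have Nc: "B \<restriction> N \<in> module_cat R" using module_cat_restr[OF cat(2) Nsub] .
  have NB: "N \<subseteq> carrier B" using submod_closed(1)[OF Nsub] .
  \<comment> \<open>Two decompositions differ by a map d into N, with a' = a + f d and b = b' + d.
    The extra factors are the restrictions along d of y and n, which \<open>eq\<close> identifies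
    over N.\<close>
  have indep: "Fm P A a y \<otimes>\<^bsub>fob F P\<^esub> Fm P B b n = Fm P A a' y \<otimes>\<^bsub>fob F P\<^esub> Fm P B b' n"
    if P: "P \<in> module_cat R" and ab: "lin R P A a" "lin R P B b" "lin R P A a'" "lin R P B b'"
      and eq': "\<And>x. x \<in> carrier P \<Longrightarrow> i (a x) \<oplus>\<^bsub>Q\<^esub> k (b x) = i (a' x) \<oplus>\<^bsub>Q\<^esub> k (b' x)" for P a b a' b'
  proof -
    have Pm: "left_module R P" using module_catD(1)[OF P] .
    interpret G: comm_group "fob F P" using F_group[OF P] .
    let ?n = "\<ominus>\<^bsub>R\<^esub> \<one>\<^bsub>R\<^esub>"
    define d where "d x = b x \<oplus>\<^bsub>B\<^esub> ?n \<odot>\<^bsub>B\<^esub> b' x" for x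
    have d: "lin R P B d"
      unfolding d_def by (intro lin_plus[OF Pm B.left_module_axioms] lin_neg[OF Pm B.left_module_axioms] ab)
    have key: "d x \<in> N \<and> a' x = a x \<oplus>\<^bsub>A\<^esub> f (d x) \<and> b x = b' x \<oplus>\<^bsub>B\<^esub> d x" if x: "x \<in> carrier P" for x
    proof -
      have m: "a x \<in> carrier A" "a' x \<in> carrier A" "b x \<in> carrier B" "b' x \<in> carrier B"
        by (rule lin_closed[OF ab(1) x] lin_closed[OF ab(3) x] lin_closed[OF ab(2) x] lin_closed[OF ab(4) x])+
      then have m': "i (a x) \<in> carrier Q" "i (a' x) \<in> carrier Q" "k (b x) \<in> carrier Q" "k (b' x) \<in> carrier Q"
        by (simp_all add: lin_closed[OF i] lin_closed[OF k])
      have "i (a x \<oplus>\<^bsub>A\<^esub> ?n \<odot>\<^bsub>A\<^esub> a' x) \<oplus>\<^bsub>Q\<^esub> k (d x) =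
          (i (a x) \<oplus>\<^bsub>Q\<^esub> ?n \<odot>\<^bsub>Q\<^esub> i (a' x)) \<oplus>\<^bsub>Q\<^esub> (k (b x) \<oplus>\<^bsub>Q\<^esub> ?n \<odot>\<^bsub>Q\<^esub> k (b' x))"
        using m by (simp add: d_def lin_add[OF i] lin_add[OF k] lin_smult[OF i] lin_smult[OF k])
      also have "\<dots> = (i (a x) \<oplus>\<^bsub>Q\<^esub> k (b x)) \<oplus>\<^bsub>Q\<^esub> ?n \<odot>\<^bsub>Q\<^esub> (i (a' x) \<oplus>\<^bsub>Q\<^esub> k (b' x))"
        using m' Q.add4[of "i (a x)" "?n \<odot>\<^bsub>Q\<^esub> i (a' x)" "k (b x)" "?n \<odot>\<^bsub>Q\<^esub> k (b' x)"] by (simp add: Q.smult_r_distr)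
      also have "\<dots> = \<zero>\<^bsub>Q\<^esub>" using eq'[OF x] m' by simp
      finally have *: "d x \<in> N" "(a x \<oplus>\<^bsub>A\<^esub> ?n \<odot>\<^bsub>A\<^esub> a' x) \<oplus>\<^bsub>A\<^esub> f (d x) = \<zero>\<^bsub>A\<^esub>"
        using ker[of "a x \<oplus>\<^bsub>A\<^esub> ?n \<odot>\<^bsub>A\<^esub> a' x" "d x"] m lin_closed[OF d x] by auto
      have fd: "f (d x) \<in> carrier A" using *(1) lin_closed[OF f, of "d x"] by simp
      have "(a x \<oplus>\<^bsub>A\<^esub> f (d x)) \<oplus>\<^bsub>A\<^esub> ?n \<odot>\<^bsub>A\<^esub> a' x = \<zero>\<^bsub>A\<^esub>" using * m fd by (simp add: A.M.a_ac)
      then have "a x \<oplus>\<^bsub>A\<^esub> f (d x) = ?n \<odot>\<^bsub>A\<^esub> (?n \<odot>\<^bsub>A\<^esub> a' x)" using m fd by (intro A.eq_neg) auto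
      then have "a' x = a x \<oplus>\<^bsub>A\<^esub> f (d x)" using m by (simp add: A.smult_assoc[symmetric] R.l_minus A.smult_one)
      moreover have "b' x \<oplus>\<^bsub>B\<^esub> d x = b x \<oplus>\<^bsub>B\<^esub> (b' x \<oplus>\<^bsub>B\<^esub> ?n \<odot>\<^bsub>B\<^esub> b' x)"
        using m by (simp add: d_def B.M.a_lcomm del: B.add_neg)
      ultimately show ?thesis using * m by simp
    qed
    have dN: "lin R P (B \<restriction> N) d" using lin_restr_cod[OF d] key by blast
    have "Fm P A a' y = Fm P A (\<lambda>x. a x \<oplus>\<^bsub>A\<^esub> f (d x)) y"
      using Fm_cong[of P a' "\<lambda>x. a x \<oplus>\<^bsub>A\<^esub> f (d x)" A] key by simp
    also have "\<dots> = Fm P A a y \<otimes>\<^bsub>fob F P\<^esub> Fm P A (\<lambda>x. f (d x)) y"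
      by (rule Fm_add[OF P cat(1) ab(1) lin_comp[OF dN f] y])
    also have "Fm P A (\<lambda>x. f (d x)) y = Fm P (B \<restriction> N) d (Fm (B \<restriction> N) B (\<lambda>x. x) n)"
      using Fm_comp[OF P Nc cat(1) dN f y] eq by simp
    also have "\<dots> = Fm P B d n"
      using Fm_comp[OF P Nc cat(2) dN lin_subset[OF NB] n] by simp
    finally have 1: "Fm P A a' y = Fm P A a y \<otimes>\<^bsub>fob F P\<^esub> Fm P B d n" .
    have "Fm P B b n = Fm P B (\<lambda>x. b' x \<oplus>\<^bsub>B\<^esub> d x) n"
      using Fm_cong[of P b "\<lambda>x. b' x \<oplus>\<^bsub>B\<^esub> d x" B] key by simp
    also have "\<dots> = Fm P B b' n \<otimes>\<^bsub>fob F P\<^esub> Fm P B d n"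
      by (rule Fm_add[OF P cat(2) ab(4) d n])
    finally have 2: "Fm P B b n = Fm P B b' n \<otimes>\<^bsub>fob F P\<^esub> Fm P B d n" .
    show ?thesis
      using Fm_closed[OF P cat(1) ab(1) y] Fm_closed[OF P cat(2) ab(4) n] Fm_closed[OF P cat(2) d n]
      by (simp add: 1 2 G.m_ac)
  qed
  define z where "z P p = (SOME w. \<exists>a b. lin R P A a \<and> lin R P B b \<and>
      (\<forall>x\<in>carrier P. p x = i (a x) \<oplus>\<^bsub>Q\<^esub> k (b x)) \<and> w = Fm P A a y \<otimes>\<^bsub>fob F P\<^esub> Fm P B b n)" for P p
  have z: "z P p = Fm P A a y \<otimes>\<^bsub>fob F P\<^esub> Fm P B b n"
    if "P \<in> module_cat R" "lin R P A a" "lin R P B b" "\<And>x. x \<in> carrier P \<Longrightarrow> p x = i (a x) \<oplus>\<^bsub>Q\<^esub> k (b x)" for P p a b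
    unfolding z_def
  proof (rule some_equality)
    fix w assume "\<exists>a b. lin R P A a \<and> lin R P B b \<and>
      (\<forall>x\<in>carrier P. p x = i (a x) \<oplus>\<^bsub>Q\<^esub> k (b x)) \<and> w = Fm P A a y \<otimes>\<^bsub>fob F P\<^esub> Fm P B b n"
    then obtain a' b' where "lin R P A a'" "lin R P B b'" "\<forall>x\<in>carrier P. p x = i (a' x) \<oplus>\<^bsub>Q\<^esub> k (b' x)"
      "w = Fm P A a' y \<otimes>\<^bsub>fob F P\<^esub> Fm P B b' n" by blast
    then show "w = Fm P A a y \<otimes>\<^bsub>fob F P\<^esub> Fm P B b n"
      using indep[OF that(1) _ _ that(2,3), of a' b'] that(4) by simp
  qed (use that in blast)
  have dec: "\<exists>a b. lin R P A a \<and> lin R P B b \<and> (\<forall>x\<in>carrier P. p x = i (a x) \<oplus>\<^bsub>Q\<^esub> k (b x))"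
    if "fin_pres R P" "lin R P Q p" for P :: "('r, 'u) module" and p
    using fin_pres_decompose[OF sq that] by metis
  obtain x where x: "x \<in> FF Q" "\<And>P p. fin_pres R P \<Longrightarrow> lin R P Q p \<Longrightarrow> Fm P Q p x = z P p"
  proof (rule fp_glue[OF cat(3), of z])
    fix P :: "('r, 'u) module" and p assume P: "fin_pres R P" and p: "lin R P Q p"
    note Pc = fin_pres_cat[OF P]
    interpret G: comm_group "fob F P" using F_group[OF Pc] .
    obtain a b where ab: "lin R P A a" "lin R P B b" "\<And>x. x \<in> carrier P \<Longrightarrow> p x = i (a x) \<oplus>\<^bsub>Q\<^esub> k (b x)"
      using dec[OF P p] by blast
    have zp: "z P p = Fm P A a y \<otimes>\<^bsub>fob F P\<^esub> Fm P B b n" by (rule z[OF Pc ab])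
    show "z P p \<in> FF P"
      unfolding zp using Fm_closed[OF Pc cat(1) ab(1) y] Fm_closed[OF Pc cat(2) ab(2) n] by simp
    show "z P p = z P p'" if "\<And>x. x \<in> carrier P \<Longrightarrow> p x = p' x" for p'
      unfolding zp by (rule z[symmetric, OF Pc ab(1,2)]) (use ab(3) that in simp)
  next
    fix P P' :: "('r, 'u) module" and m p assume P: "fin_pres R P" and P': "fin_pres R P'" and m: "lin R P P' m" and p: "lin R P' Q p"
    note Pc = fin_pres_cat[OF P] and Pc' = fin_pres_cat[OF P']
    obtain a b where ab: "lin R P' A a" "lin R P' B b" "\<And>x. x \<in> carrier P' \<Longrightarrow> p x = i (a x) \<oplus>\<^bsub>Q\<^esub> k (b x)"
      using dec[OF P' p] by blast
    have zp: "z P' p = Fm P' A a y \<otimes>\<^bsub>fob F P'\<^esub> Fm P' B b n" by (rule z[OF Pc' ab])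
    have "z P (\<lambda>x. p (m x)) = Fm P A (\<lambda>x. a (m x)) y \<otimes>\<^bsub>fob F P\<^esub> Fm P B (\<lambda>x. b (m x)) n"
      using lin_closed[OF m] by (intro z[OF Pc lin_comp[OF m ab(1)] lin_comp[OF m ab(2)]] ab(3))
    also have "\<dots> = Fm P P' m (Fm P' A a y) \<otimes>\<^bsub>fob F P\<^esub> Fm P P' m (Fm P' B b n)"
      using Fm_comp[OF Pc Pc' cat(1) m ab(1) y] Fm_comp[OF Pc Pc' cat(2) m ab(2) n] by simp
    also have "\<dots> = Fm P P' m (z P' p)"
      unfolding zp
      using hom_mult[OF Fm_hom[OF Pc Pc' m] Fm_closed[OF Pc' cat(1) ab(1) y] Fm_closed[OF Pc' cat(2) ab(2) n]] by simp
    finally show "Fm P P' m (z P' p) = z P (\<lambda>x. p (m x))" by simp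
  qed blast
  \<comment> \<open>For a map q into A the map i q has the decomposition (q, 0); the restriction to
    B is treated below with (0, q).\<close>
  have "Fm A Q i x = y"
  proof (rule fp_sep[OF cat(1) Fm_closed[OF cat(1,3) i x(1)] y])
    fix P :: "('r, 'u) module" and q assume P: "fin_pres R P" and q: "lin R P A q"
    note Pc = fin_pres_cat[OF P]
    interpret G: comm_group "fob F P" using F_group[OF Pc] .
    have Pm: "left_module R P" using module_catD(1)[OF Pc] .
    have "Fm P A q (Fm A Q i x) = z P (\<lambda>x. i (q x))"
      using Fm_comp[OF Pc cat(1,3) q i x(1)] x(2)[OF P lin_comp[OF q i]] by simp
    also have "\<dots> = Fm P A q y \<otimes>\<^bsub>fob F P\<^esub> Fm P B (\<lambda>x. \<zero>\<^bsub>B\<^esub>) n"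
      using lin_zero[OF B.left_module_axioms Q.left_module_axioms k] lin_closed[OF i] lin_closed[OF q]
      by (intro z[OF Pc q B.lin_zero_map[OF Pm]]) simp
    finally show "Fm P A q (Fm A Q i x) = Fm P A q y"
      using Fm_zero[OF Pc cat(2) n] Fm_closed[OF Pc cat(1) q y] by simp
  qed
  moreover have "Fm B Q k x = n"
  proof (rule fp_sep[OF cat(2) Fm_closed[OF cat(2,3) k x(1)] n])
    fix P :: "('r, 'u) module" and q assume P: "fin_pres R P" and q: "lin R P B q"
    note Pc = fin_pres_cat[OF P]
    interpret G: comm_group "fob F P" using F_group[OF Pc] .
    have Pm: "left_module R P" using module_catD(1)[OF Pc] .
    have "Fm P B q (Fm B Q k x) = z P (\<lambda>x. k (q x))"
      using Fm_comp[OF Pc cat(2,3) q k x(1)] x(2)[OF P lin_comp[OF q k]] by simp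
    also have "\<dots> = Fm P A (\<lambda>x. \<zero>\<^bsub>A\<^esub>) y \<otimes>\<^bsub>fob F P\<^esub> Fm P B q n"
      using lin_zero[OF A.left_module_axioms Q.left_module_axioms i] lin_closed[OF k] lin_closed[OF q]
      by (intro z[OF Pc A.lin_zero_map[OF Pm] q]) simp
    finally show "Fm P B q (Fm B Q k x) = Fm P B q n"
      using Fm_zero[OF Pc cat(1) y] Fm_closed[OF Pc cat(2) q n] by simp
  qed
  ultimately show thesis using that x(1) by blast
qed

end

section \<open>Directed unions\<close>

lemma finite_subset_directed:
  assumes "finite S" "S \<subseteq> \<Union>\<V>" "\<V> \<noteq> {}" "\<And>A B. A \<in> \<V> \<Longrightarrow> B \<in> \<V> \<Longrightarrow> \<exists>C\<in>\<V>. A \<union> B \<subseteq> C"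
  shows "\<exists>A\<in>\<V>. S \<subseteq> A"
  using assms(1,2)
proof (induction S)
  case empty
  then show ?case using assms(3) by blast
next
  case (insert s S)
  then obtain A B where "A \<in> \<V>" "S \<subseteq> A" "B \<in> \<V>" "s \<in> B" by blast
  with assms(4)[of A B] show ?case by blast
qed

text \<open>The hypothesis makes the operations of A and V agree on the carrier of A, although the
  two records may differ elsewhere; both directions of the identity are therefore linear.\<close>

lemma lin_incl_submod:
  assumes "left_module R A" "left_module R V" "lin R A V (\<lambda>x. x)"
  shows "submod R V (carrier A)" "lin R (V \<restriction> carrier A) A (\<lambda>x. x)"
proof -
  interpret A: left_module R A by fact
  have z: "\<zero>\<^bsub>V\<^esub> = \<zero>\<^bsub>A\<^esub>" using lin_zero[OF assms] by simp
  have add: "x \<oplus>\<^bsub>V\<^esub> y = x \<oplus>\<^bsub>A\<^esub> y" if "x \<in> carrier A" "y \<in> carrier A" for x y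
    using lin_add[OF assms(3) that] by simp
  have sm: "a \<odot>\<^bsub>V\<^esub> x = a \<odot>\<^bsub>A\<^esub> x" if "a \<in> carrier R" "x \<in> carrier A" for a x
    using lin_smult[OF assms(3) that] by simp
  show "submod R V (carrier A)"
    using lin_closed[OF assms(3)] by (auto simp: submod_def z add sm)
  show "lin R (V \<restriction> carrier A) A (\<lambda>x. x)"
    by (rule linI) (auto simp: add sm)
qed

lemma lin_corestrict:
  assumes "left_module R N" "lin R N Y f" "lin R X Y (\<lambda>x. x)" "f \<in> carrier N \<rightarrow> carrier X"
  shows "lin R N X f"
proof (rule linI)
  show "f x \<in> carrier X" if "x \<in> carrier N" for x using assms(4) that by auto
  show "f (x \<oplus>\<^bsub>N\<^esub> y) = f x \<oplus>\<^bsub>X\<^esub> f y" if "x \<in> carrier N" "y \<in> carrier N" for x y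
    using lin_add[OF assms(2) that] lin_add[OF assms(3), of "f x" "f y"] assms(4) that by (simp add: Pi_iff)
  show "f (a \<odot>\<^bsub>N\<^esub> x) = a \<odot>\<^bsub>X\<^esub> f x" if "a \<in> carrier R" "x \<in> carrier N" for a x
    using lin_smult[OF assms(2) that] lin_smult[OF assms(3), of a "f x"] assms(4) that by (simp add: Pi_iff)
qed

text \<open>Indexing the union by finite subsets keeps the index set small whenever M is
  small.\<close>

lemma span_colimit:
  assumes "left_module R M"
  defines "I \<equiv> {S. finite S \<and> S \<subseteq> carrier M}"
  shows "dsystem R I (\<subseteq>) (\<lambda>S. M \<restriction> mspan R M S) (\<lambda>_ _ x. x)"
    "dcolim R I (\<subseteq>) (\<lambda>S. M \<restriction> mspan R M S) (\<lambda>_ _ x. x) M (\<lambda>_ x. x)"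
proof -
  note sp = mspan[OF assms(1)]
  have sub: "submod R M (mspan R M S)" "S \<subseteq> mspan R M S" if "S \<in> I" for S
    using sp that by (auto simp: I_def)
  have mono: "mspan R M S \<subseteq> mspan R M S'" if "S \<in> I" "S' \<in> I" "S \<subseteq> S'" for S S'
    using sp(3)[of S] sub[OF that(2)] that by (auto simp: I_def)
  have un: "S \<union> S' \<in> I" if "S \<in> I" "S' \<in> I" for S S' using that by (auto simp: I_def)
  show "dsystem R I (\<subseteq>) (\<lambda>S. M \<restriction> mspan R M S) (\<lambda>_ _ x. x)"
    unfolding dsystem_def
  proof (intro conjI ballI impI)
    show "I \<noteq> {}" by (auto simp: I_def)
    show "\<exists>k\<in>I. i \<subseteq> k \<and> j \<subseteq> k" if "i \<in> I" "j \<in> I" for i j using un[OF that] by blast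
    show "left_module R (M \<restriction> mspan R M i)" if "i \<in> I" for i
      using left_module_submod[OF assms(1) sub(1)[OF that]] .
    show "lin R (M \<restriction> mspan R M i) (M \<restriction> mspan R M j) (\<lambda>x. x)" if "i \<in> I" "j \<in> I" "i \<subseteq> j" for i j
      using lin_incl[OF mono[OF that]] .
  qed auto
  show "dcolim R I (\<subseteq>) (\<lambda>S. M \<restriction> mspan R M S) (\<lambda>_ _ x. x) M (\<lambda>_ x. x)"
    unfolding dcolim_def
  proof (intro conjI ballI impI)
    show "lin R (M \<restriction> mspan R M i) M (\<lambda>x. x)" if "i \<in> I" for i
      using lin_subset submod_closed(1)[OF sub(1)[OF that]] by blast
    show "\<exists>i\<in>I. \<exists>x\<in>carrier (M \<restriction> mspan R M i). y = x" if "y \<in> carrier M" for y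
    proof -
      have "{y} \<in> I" using that by (auto simp: I_def)
      then show ?thesis using sub(2)[of "{y}"] by auto
    qed
    show "\<exists>j\<in>I. i \<subseteq> j \<and> x = \<zero>\<^bsub>M \<restriction> mspan R M j\<^esub>" if "i \<in> I" "x = \<zero>\<^bsub>M\<^esub>" for i x
      using that by auto
  qed (simp_all add: assms(1))
qed

context mod_fun
begin

lemma Fm_restr:
  assumes M: "M \<in> module_cat R" and A: "submod R M A" and B: "submod R M B" "A \<subseteq> B" and x: "x \<in> FF M"
  shows "Fm (M \<restriction> A) (M \<restriction> B) (\<lambda>x. x) (Fm (M \<restriction> B) M (\<lambda>x. x) x) = Fm (M \<restriction> A) M (\<lambda>x. x) x"
  using Fm_comp[OF module_cat_restr[OF M A] module_cat_restr[OF M B(1)] M lin_incl[OF B(2)] lin_subset[OF submod_closed(1)[OF B(1)]] x]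
  by simp

lemma restr_closed:
  "M \<in> module_cat R \<Longrightarrow> submod R M A \<Longrightarrow> x \<in> FF M \<Longrightarrow> Fm (M \<restriction> A) M (\<lambda>x. x) x \<in> FF (M \<restriction> A)"
  using Fm_closed[OF module_cat_restr _ lin_subset[OF submod_closed(1)]] by blast

text \<open>The family \<V> is a set of subsets of a small set and may fail to be small, so the
  colimit property cannot be applied to it directly. It is applied to the submodules generated by
  finite subsets: they form a small family, and each lies in a member of \<V>. The same detour
  serves \<open>union_glue\<close>.\<close>

lemma union_sep:
  assumes M: "M \<in> module_cat R" and xy: "x \<in> FF M" "y \<in> FF M"
    and V: "\<V> \<noteq> {}" "\<Union>\<V> = carrier M" "\<And>A. A \<in> \<V> \<Longrightarrow> submod R M A"
    and dir: "\<And>A B. A \<in> \<V> \<Longrightarrow> B \<in> \<V> \<Longrightarrow> \<exists>C\<in>\<V>. A \<union> B \<subseteq> C"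
    and eq: "\<And>A. A \<in> \<V> \<Longrightarrow> Fm (M \<restriction> A) M (\<lambda>x. x) x = Fm (M \<restriction> A) M (\<lambda>x. x) y"
  shows "x = y"
proof -
  have Mm: "left_module R M" using module_catD(1)[OF M] .
  let ?I = "{S. finite S \<and> S \<subseteq> carrier M}"
  show ?thesis
  proof (rule colim_sep[OF span_colimit(1)[OF Mm] small_Fpow[OF module_catD(2)[OF M]] _ span_colimit(2)[OF Mm] M xy])
    fix S assume S: "S \<in> ?I"
    have sp: "submod R M (mspan R M S)" using mspan(1)[OF Mm] S by blast
    show "M \<restriction> mspan R M S \<in> module_cat R" using module_cat_restr[OF M sp] .
    obtain A where A: "A \<in> \<V>" "S \<subseteq> A" using finite_subset_directed[OF _ _ V(1) dir, of S] S V(2) by auto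
    have "mspan R M S \<subseteq> A" using mspan(3)[OF Mm _ V(3)[OF A(1)] A(2)] S by blast
    then show "Fm (M \<restriction> mspan R M S) M (\<lambda>x. x) x = Fm (M \<restriction> mspan R M S) M (\<lambda>x. x) y"
      using Fm_restr[OF M sp V(3)[OF A(1)]] xy eq[OF A(1)] by metis
  qed
qed

lemma union_glue:
  assumes M: "M \<in> module_cat R"
    and V: "\<V> \<noteq> {}" "\<Union>\<V> = carrier M" "\<And>A. A \<in> \<V> \<Longrightarrow> submod R M A"
    and dir: "\<And>A B. A \<in> \<V> \<Longrightarrow> B \<in> \<V> \<Longrightarrow> \<exists>C\<in>\<V>. A \<union> B \<subseteq> C"
    and z: "\<And>A. A \<in> \<V> \<Longrightarrow> z A \<in> FF (M \<restriction> A)"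
    and zz: "\<And>A B. \<lbrakk>A \<in> \<V>; B \<in> \<V>; A \<subseteq> B\<rbrakk> \<Longrightarrow> Fm (M \<restriction> A) (M \<restriction> B) (\<lambda>x. x) (z B) = z A"
  shows "\<exists>x\<in>FF M. \<forall>A\<in>\<V>. Fm (M \<restriction> A) M (\<lambda>x. x) x = z A"
proof -
  have Mm: "left_module R M" using module_catD(1)[OF M] .
  let ?I = "{S. finite S \<and> S \<subseteq> carrier M}"
  let ?s = "mspan R M"
  have sp: "submod R M (?s S)" if "S \<in> ?I" for S using mspan(1)[OF Mm] that by blast
  have spc: "M \<restriction> ?s S \<in> module_cat R" if "S \<in> ?I" for S using module_cat_restr[OF M sp[OF that]] .
  have Ac: "M \<restriction> A \<in> module_cat R" if "A \<in> \<V>" for A using module_cat_restr[OF M V(3)[OF that]] .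
  have "\<exists>A. A \<in> \<V> \<and> ?s S \<subseteq> A" if S: "S \<in> ?I" for S
  proof -
    obtain A where A: "A \<in> \<V>" "S \<subseteq> A" using finite_subset_directed[OF _ _ V(1) dir, of S] S V(2) by auto
    then show ?thesis using mspan(3)[OF Mm _ V(3)[OF A(1)] A(2)] S by blast
  qed
  then obtain a where a: "\<And>S. S \<in> ?I \<Longrightarrow> a S \<in> \<V> \<and> ?s S \<subseteq> a S" by metis
  \<comment> \<open>The value on a finitely generated submodule is restricted from a member
    containing it. Directedness makes the choice \<open>a S\<close> irrelevant, which is the content
    of the fact \<open>w\<close>.\<close>
  define w where "w S = Fm (M \<restriction> ?s S) (M \<restriction> a S) (\<lambda>x. x) (z (a S))" for S
  have down: "Fm (M \<restriction> ?s S) (M \<restriction> A) (\<lambda>x. x) (z A) = Fm (M \<restriction> ?s S) (M \<restriction> B) (\<lambda>x. x) (z B)"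
    if "S \<in> ?I" "A \<in> \<V>" "B \<in> \<V>" "A \<subseteq> B" "?s S \<subseteq> A" for S A B
    using Fm_comp[OF spc[OF that(1)] Ac[OF that(2)] Ac[OF that(3)] lin_incl[OF that(5)] lin_incl[OF that(4)] z[OF that(3)]]
      zz[OF that(2,3,4)] by simp
  have w: "w S = Fm (M \<restriction> ?s S) (M \<restriction> A) (\<lambda>x. x) (z A)" if S: "S \<in> ?I" "A \<in> \<V>" "?s S \<subseteq> A" for S A
  proof -
    obtain C where C: "C \<in> \<V>" "A \<union> a S \<subseteq> C" using dir[OF S(2)] a[OF S(1)] by blast
    then show ?thesis
      using down[OF S(1), of A C] down[OF S(1), of "a S" C] a[OF S(1)] S by (simp add: w_def)
  qed
  have wF: "w S \<in> FF (M \<restriction> ?s S)" if "S \<in> ?I" for S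
    unfolding w_def using a[OF that] by (intro Fm_closed spc that Ac lin_incl z) auto
  have "\<exists>x\<in>FF M. \<forall>S\<in>?I. Fm (M \<restriction> ?s S) M (\<lambda>x. x) x = w S"
  proof (rule colim_glue[OF span_colimit(1)[OF Mm] small_Fpow[OF module_catD(2)[OF M]] spc span_colimit(2)[OF Mm] M wF])
    fix S S' assume S: "S \<in> ?I" "S' \<in> ?I" "S \<subseteq> S'"
    have "?s S \<subseteq> ?s S'" using mspan(2,3)[OF Mm] S sp[OF S(2)] by (metis (no_types, lifting) dual_order.trans mem_Collect_eq)
    moreover from this have "w S = Fm (M \<restriction> ?s S) (M \<restriction> a S') (\<lambda>x. x) (z (a S'))"
      using a[OF S(2)] by (intro w[OF S(1)]) auto
    ultimately show "Fm (M \<restriction> ?s S) (M \<restriction> ?s S') (\<lambda>x. x) (w S') = w S"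
      using Fm_comp[OF spc[OF S(1)] spc[OF S(2)] Ac lin_incl lin_incl z] a[OF S(2)] by (simp add: w_def)
  qed
  then obtain x where x: "x \<in> FF M" "\<And>S. S \<in> ?I \<Longrightarrow> Fm (M \<restriction> ?s S) M (\<lambda>x. x) x = w S" by blast
  \<comment> \<open>Inside A equality is tested on the submodules generated by finite subsets of A,
    where both sides restrict to \<open>w\<close>.\<close>
  have "Fm (M \<restriction> A) M (\<lambda>x. x) x = z A" if A: "A \<in> \<V>" for A
  proof (rule union_sep[OF Ac[OF A] restr_closed[OF M V(3)[OF A] x(1)] z[OF A], of "?s ` {S. finite S \<and> S \<subseteq> A}"])
    have AM: "A \<subseteq> carrier M" using submod_closed(1)[OF V(3)[OF A]] .
    then have I: "S \<in> ?I" if "finite S" "S \<subseteq> A" for S using that by auto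
    have sA: "?s S \<subseteq> A" if "finite S" "S \<subseteq> A" for S using mspan(3)[OF Mm _ V(3)[OF A] that(2)] I[OF that] by blast
    have ins: "S \<subseteq> ?s S" if "finite S" "S \<subseteq> A" for S using mspan(2)[OF Mm] I[OF that] by blast
    show "\<Union> (?s ` {S. finite S \<and> S \<subseteq> A}) = carrier (M \<restriction> A)"
    proof
      show "carrier (M \<restriction> A) \<subseteq> \<Union> (?s ` {S. finite S \<and> S \<subseteq> A})"
      proof
        fix y assume "y \<in> carrier (M \<restriction> A)"
        then show "y \<in> \<Union> (?s ` {S. finite S \<and> S \<subseteq> A})" using ins[of "{y}"] by (intro UN_I[of "{y}"]) auto
      qed
    qed (use sA in auto)
    fix B assume "B \<in> ?s ` {S. finite S \<and> S \<subseteq> A}"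
    then obtain S where S: "finite S" "S \<subseteq> A" "B = ?s S" by blast
    show "submod R (M \<restriction> A) B"
      using sp[OF I[OF S(1,2)]] submod_restr[OF V(3)[OF A] sA[OF S(1,2)]] S(3) by simp
    show "Fm (M \<restriction> A \<restriction> B) (M \<restriction> A) (\<lambda>x. x) (Fm (M \<restriction> A) M (\<lambda>x. x) x) = Fm (M \<restriction> A \<restriction> B) (M \<restriction> A) (\<lambda>x. x) (z A)"
      using Fm_restr[OF M sp[OF I[OF S(1,2)]] V(3)[OF A] sA[OF S(1,2)] x(1)] x(2)[OF I[OF S(1,2)]]
        w[OF I[OF S(1,2)] A sA[OF S(1,2)]] S(3) by simp
  next
    fix B C assume "B \<in> ?s ` {S. finite S \<and> S \<subseteq> A}" "C \<in> ?s ` {S. finite S \<and> S \<subseteq> A}"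
    then obtain S T where S: "finite S" "S \<subseteq> A" "B = ?s S" "finite T" "T \<subseteq> A" "C = ?s T" by blast
    have AM: "A \<subseteq> carrier M" using submod_closed(1)[OF V(3)[OF A]] .
    have "?s S \<subseteq> ?s (S \<union> T)" "?s T \<subseteq> ?s (S \<union> T)"
      using mspan[OF Mm, of "S \<union> T"] mspan(3)[OF Mm, of S "?s (S \<union> T)"] mspan(3)[OF Mm, of T "?s (S \<union> T)"] S AM by auto
    with S show "\<exists>D\<in>?s ` {S. finite S \<and> S \<subseteq> A}. B \<union> C \<subseteq> D"
      by (intro bexI[of _ "?s (S \<union> T)"]) auto
  qed blast
  with x show ?thesis by blast
qed

section \<open>Modules with an element of the functor\<close>

definition good :: "('r, 'u) module \<times> 'v \<Rightarrow> bool" where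
  "good X \<longleftrightarrow> fst X \<in> module_cat R \<and> snd X \<in> FF (fst X)"

text \<open>A morphism of pairs whose underlying map is a literal inclusion. Chains of such
  morphisms have unions, with no colimit to be chosen.\<close>

definition ext :: "('r, 'u) module \<times> 'v \<Rightarrow> ('r, 'u) module \<times> 'v \<Rightarrow> bool" where
  "ext X X' \<longleftrightarrow> lin R (fst X) (fst X') (\<lambda>x. x) \<and> Fm (fst X) (fst X') (\<lambda>x. x) (snd X') = snd X"

lemma goodD: "good X \<Longrightarrow> fst X \<in> module_cat R" "good X \<Longrightarrow> snd X \<in> FF (fst X)"
  "good X \<Longrightarrow> left_module R (fst X)"
  using module_catD(1) by (auto simp: good_def)

lemma extD: "ext X X' \<Longrightarrow> lin R (fst X) (fst X') (\<lambda>x. x)" "ext X X' \<Longrightarrow> Fm (fst X) (fst X') (\<lambda>x. x) (snd X') = snd X"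
  "ext X X' \<Longrightarrow> carrier (fst X) \<subseteq> carrier (fst X')"
  by (auto simp: ext_def lin_def)

lemma ext_refl: "good X \<Longrightarrow> ext X X"
  by (auto simp: good_def ext_def lin_id Fm_id)

lemma ext_trans:
  assumes "good X" "good Y" "good Z" "ext X Y" "ext Y Z"
  shows "ext X Z"
  using Fm_comp[of "fst X" "fst Y" "fst Z" "\<lambda>x. x" "\<lambda>x. x" "snd Z"] lin_comp[of R "fst X" "fst Y" "\<lambda>x. x" "fst Z" "\<lambda>x. x"] assms
  by (auto simp: good_def ext_def)

text \<open>The module comes from \<open>union_module\<close>, the element from
  \<open>union_glue\<close>. The record \<open>fst X\<close> and the restriction of V to the same
  carrier agree only on that carrier, so elements of F are carried between them along the identity
  map.\<close>

lemma chain_union: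
  assumes ne: "\<C> \<noteq> {}" and gd: "\<And>X. X \<in> \<C> \<Longrightarrow> good X"
    and dir: "\<And>X Y. X \<in> \<C> \<Longrightarrow> Y \<in> \<C> \<Longrightarrow> \<exists>Z\<in>\<C>. ext X Z \<and> ext Y Z"
    and small: "sm (\<Union>X\<in>\<C>. carrier (fst X))"
  shows "\<exists>U. good U \<and> carrier (fst U) = (\<Union>X\<in>\<C>. carrier (fst X)) \<and> (\<forall>X\<in>\<C>. ext X U)"
proof -
  obtain V :: "('r, 'u) module" where V: "left_module R V" "carrier V = (\<Union>A\<in>fst ` \<C>. carrier A)"
    and incl: "\<forall>A\<in>fst ` \<C>. lin R A V (\<lambda>x. x)"
  proof (rule union_module[OF ring, of "fst ` \<C>"])
    fix A B assume "A \<in> fst ` \<C>" "B \<in> fst ` \<C>"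
    then obtain X Y where "X \<in> \<C>" "Y \<in> \<C>" "A = fst X" "B = fst Y" by blast
    with dir[of X Y] show "\<exists>C\<in>fst ` \<C>. lin R A C (\<lambda>x. x) \<and> lin R B C (\<lambda>x. x)" using extD(1) by blast
  next
    show "left_module R A" if "A \<in> fst ` \<C>" for A using that gd goodD(3) by blast
    show "fst ` \<C> \<noteq> {}" using ne by blast
    fix V :: "('r, 'u) module"
    assume V: "left_module R V" "carrier V = (\<Union>A\<in>fst ` \<C>. carrier A)" "\<And>A. A \<in> fst ` \<C> \<Longrightarrow> lin R A V (\<lambda>x. x)"
    then have "\<forall>A\<in>fst ` \<C>. lin R A V (\<lambda>x. x)" by blast
    with V(1,2) show thesis by (rule that)
  qed
  have Vc: "V \<in> module_cat R" using V small by (intro module_catI) auto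
  have in1: "lin R (fst X) V (\<lambda>x. x)" if "X \<in> \<C>" for X using incl that by blast
  have sub: "submod R V (carrier (fst X))" and incl_back: "lin R (V \<restriction> carrier (fst X)) (fst X) (\<lambda>x. x)" if "X \<in> \<C>" for X
    using lin_incl_submod[OF goodD(3)[OF gd[OF that]] V(1) in1[OF that]] by blast+
  note subc = module_cat_restr[OF Vc sub]
  define c where "c X = Fm (V \<restriction> carrier (fst X)) (fst X) (\<lambda>x. x) (snd X)" for X
  have cF: "c X \<in> FF (V \<restriction> carrier (fst X))" if "X \<in> \<C>" for X
    unfolding c_def using Fm_closed[OF subc[OF that] goodD(1)[OF gd[OF that]] incl_back[OF that] goodD(2)[OF gd[OF that]]] .
  have c_ext: "Fm (V \<restriction> carrier (fst X)) (V \<restriction> carrier (fst Y)) (\<lambda>x. x) (c Y) = c X"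
    if X: "X \<in> \<C>" "Y \<in> \<C>" "carrier (fst X) \<subseteq> carrier (fst Y)" for X Y
  proof -
    obtain Z where Z: "Z \<in> \<C>" "ext X Z" "ext Y Z" using dir X by blast
    note g = goodD(1)[OF gd]
    let ?r = "\<lambda>X. V \<restriction> carrier (fst X)"
    have c': "c W = Fm (?r W) (fst Z) (\<lambda>x. x) (snd Z)" if "W \<in> \<C>" "ext W Z" for W
      unfolding c_def extD(2)[OF that(2), symmetric]
      using Fm_comp[OF subc[OF that(1)] g[OF that(1)] g[OF Z(1)] incl_back[OF that(1)] extD(1)[OF that(2)] goodD(2)[OF gd[OF Z(1)]]] by simp
    have "lin R (?r Y) (fst Z) (\<lambda>x. x)" using lin_comp[OF incl_back[OF X(2)] extD(1)[OF Z(3)]] .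
    then have "Fm (?r X) (?r Y) (\<lambda>x. x) (c Y) = Fm (?r X) (fst Z) (\<lambda>x. x) (snd Z)"
      unfolding c'[OF X(2) Z(3)]
      using Fm_comp[OF subc[OF X(1)] subc[OF X(2)] g[OF Z(1)] lin_incl[OF X(3)] _ goodD(2)[OF gd[OF Z(1)]]] by simp
    then show ?thesis using c'[OF X(1) Z(2)] by simp
  qed
  \<comment> \<open>\<open>union_glue\<close> indexes by submodules, the chain by objects. Objects
    with equal carriers yield equal elements, so the choice is harmless.\<close>
  define z where "z A = c (SOME X. X \<in> \<C> \<and> carrier (fst X) = A)" for A
  have z: "z (carrier (fst X)) = c X" if "X \<in> \<C>" for X
  proof -
    define Y where "Y = (SOME Y. Y \<in> \<C> \<and> carrier (fst Y) = carrier (fst X))"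
    have Y: "Y \<in> \<C>" "carrier (fst Y) = carrier (fst X)"
      using someI[of "\<lambda>Y. Y \<in> \<C> \<and> carrier (fst Y) = carrier (fst X)" X] that by (auto simp: Y_def)
    have "c X = Fm (V \<restriction> carrier (fst X)) (V \<restriction> carrier (fst X)) (\<lambda>x. x) (c Y)"
      using c_ext[OF that Y(1)] Y(2) by simp
    also have "\<dots> = c Y" using Fm_id[OF subc[OF that]] cF[OF Y(1)] Y(2) by simp
    finally show ?thesis by (simp add: z_def Y_def)
  qed
  have "\<exists>x\<in>FF V. \<forall>A\<in>(\<lambda>X. carrier (fst X)) ` \<C>. Fm (V \<restriction> A) V (\<lambda>x. x) x = z A"
  proof (rule union_glue[OF Vc])
    show "\<exists>C\<in>(\<lambda>X. carrier (fst X)) ` \<C>. A \<union> B \<subseteq> C"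
      if AB: "A \<in> (\<lambda>X. carrier (fst X)) ` \<C>" "B \<in> (\<lambda>X. carrier (fst X)) ` \<C>" for A B
    proof -
      obtain X Y where X: "X \<in> \<C>" "Y \<in> \<C>" "A = carrier (fst X)" "B = carrier (fst Y)" using AB by blast
      obtain Z where "Z \<in> \<C>" "ext X Z" "ext Y Z" using dir X by blast
      then show ?thesis using extD(3) X by blast
    qed
  qed (use ne V sub z cF c_ext in auto)
  then obtain x where x: "x \<in> FF V" "\<And>X. X \<in> \<C> \<Longrightarrow> Fm (V \<restriction> carrier (fst X)) V (\<lambda>x. x) x = c X" using z by auto
  have "Fm (fst X) V (\<lambda>x. x) x = snd X" if X: "X \<in> \<C>" for X
  proof -
    note g = goodD(1,2)[OF gd[OF X]]
    have into: "lin R (fst X) (V \<restriction> carrier (fst X)) (\<lambda>x. x)" using lin_restr_cod[OF in1[OF X]] by simp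
    have "Fm (fst X) V (\<lambda>x. x) x = Fm (fst X) (V \<restriction> carrier (fst X)) (\<lambda>x. x) (c X)"
      using Fm_comp[OF g(1) subc[OF X] Vc into lin_subset[OF submod_closed(1)[OF sub[OF X]]] x(1)] x(2)[OF X] by simp
    also have "\<dots> = Fm (fst X) (fst X) (\<lambda>x. x) (snd X)"
      using Fm_comp[OF g(1) subc[OF X] g(1) into incl_back[OF X] g(2)] by (simp add: c_def)
    finally show ?thesis using Fm_id[OF g] by simp
  qed
  then show ?thesis
    using Vc x(1) V(2) in1 by (intro exI[of _ "(V, x)"]) (auto simp: good_def ext_def)
qed

text \<open>Successor and limit stages are treated alike: stage \<alpha> is one step applied to the
  union of all earlier stages. X0 is put into every union, so that the first stage has something to
  start from. The predicate records that all earlier stages lie in the intermediate object X; this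
  recovers the chain condition for the next union.\<close>

lemma transfinite_extension:
  assumes r: "Well_order r" and small: "sm (Field r)" and X0: "good X0"
    and step: "\<And>X \<alpha>. \<lbrakk>good X; ext X0 X; \<alpha> \<in> Field r\<rbrakk> \<Longrightarrow> \<exists>X'. good X' \<and> ext X X' \<and> Q \<alpha> X X'"
  shows "\<exists>f. \<forall>\<alpha>\<in>Field r. good (f \<alpha>) \<and> ext X0 (f \<alpha>) \<and>
    (\<exists>X. good X \<and> ext X0 X \<and> (\<forall>\<beta>. (\<beta>, \<alpha>) \<in> r \<and> \<beta> \<noteq> \<alpha> \<longrightarrow> ext (f \<beta>) X) \<and> ext X (f \<alpha>) \<and> Q \<alpha> X (f \<alpha>))"
proof -
  let ?P = "\<lambda>f \<alpha> Y. \<alpha> \<in> Field r \<longrightarrow> good Y \<and> ext X0 Y \<and>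
    (\<exists>X. good X \<and> ext X0 X \<and> (\<forall>\<beta>. (\<beta>, \<alpha>) \<in> r \<and> \<beta> \<noteq> \<alpha> \<longrightarrow> ext (f \<beta>) X) \<and> ext X Y \<and> Q \<alpha> X Y)"
  have "wf (r - Id)" using r by (simp add: well_order_on_def)
  then have "\<exists>f. \<forall>\<alpha>. ?P f \<alpha> (f \<alpha>)"
  proof (rule dependent_wf_choice)
    fix f g :: "_ \<Rightarrow> ('r, 'u) module \<times> 'v" and \<alpha> Y assume "\<And>z. (z, \<alpha>) \<in> r - Id \<Longrightarrow> f z = g z"
    then have "ext (f \<beta>) X \<longleftrightarrow> ext (g \<beta>) X" if "(\<beta>, \<alpha>) \<in> r \<and> \<beta> \<noteq> \<alpha>" for \<beta> X using that by simp
    then show "?P f \<alpha> Y = ?P g \<alpha> Y" by (metis (no_types, lifting))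
  next
    fix \<alpha> f assume IH: "\<And>\<beta>. (\<beta>, \<alpha>) \<in> r - Id \<Longrightarrow> ?P f \<beta> (f \<beta>)"
    show "\<exists>Y. ?P f \<alpha> Y"
    proof (cases "\<alpha> \<in> Field r")
      case True
      define \<C> where "\<C> = insert X0 (f ` {\<beta>. (\<beta>, \<alpha>) \<in> r - Id})"
      have fld: "\<beta> \<in> Field r" if "(\<beta>, \<alpha>) \<in> r - Id" for \<beta> using that by (auto simp: Field_def)
      have f: "good (f \<beta>)" "ext X0 (f \<beta>)" if "(\<beta>, \<alpha>) \<in> r - Id" for \<beta> using IH[OF that] fld[OF that] by blast+
      have mono: "ext (f \<beta>) (f \<gamma>)" if "(\<beta>, \<alpha>) \<in> r - Id" "(\<gamma>, \<alpha>) \<in> r - Id" "(\<beta>, \<gamma>) \<in> r" for \<beta> \<gamma>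
      proof (cases "\<beta> = \<gamma>")
        case True
        then show ?thesis using f(1)[OF that(1)] ext_refl by blast
      next
        case False
        from IH[OF that(2)] fld[OF that(2)] False that(3)
        obtain X where "good X" "ext (f \<beta>) X" "ext X (f \<gamma>)" by blast
        then show ?thesis using ext_trans f(1) that by blast
      qed
      have tot: "(\<beta>, \<gamma>) \<in> r \<or> (\<gamma>, \<beta>) \<in> r" if "\<beta> \<in> Field r" "\<gamma> \<in> Field r" for \<beta> \<gamma>
      proof (cases "\<beta> = \<gamma>")
        case True
        have "refl_on (Field r) r"
          using r by (simp add: well_order_on_def linear_order_on_def partial_order_on_def preorder_on_def)
        then show ?thesis using that True by (simp add: refl_on_def)
      next
        case False
        have "total_on (Field r) r" using r by (simp add: well_order_on_def linear_order_on_def)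
        then show ?thesis using that False by (simp add: total_on_def)
      qed
      have "\<exists>U. good U \<and> carrier (fst U) = (\<Union>X\<in>\<C>. carrier (fst X)) \<and> (\<forall>X\<in>\<C>. ext X U)"
      proof (rule chain_union)
        show "good X" if "X \<in> \<C>" for X using that f X0 by (auto simp: \<C>_def)
        show "\<exists>Z\<in>\<C>. ext X Z \<and> ext Y Z" if XY: "X \<in> \<C>" "Y \<in> \<C>" for X Y
        proof (cases "X = X0 \<or> Y = X0")
          case True
          then show ?thesis using that f ext_refl[OF X0] ext_refl unfolding \<C>_def by blast
        next
          case False
          then obtain \<beta> \<gamma> where "X = f \<beta>" "(\<beta>, \<alpha>) \<in> r - Id" "Y = f \<gamma>" "(\<gamma>, \<alpha>) \<in> r - Id"
            using XY unfolding \<C>_def by blast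
          then show ?thesis
            using tot[OF fld fld, of \<beta> \<gamma>] mono[of \<beta> \<gamma>] mono[of \<gamma> \<beta>] ext_refl[OF f(1)] XY by blast
        qed
        have "{\<beta>. (\<beta>, \<alpha>) \<in> r - Id} \<subseteq> Field r" by (auto simp: Field_def)
        then have "sm {\<beta>. (\<beta>, \<alpha>) \<in> r - Id}" using small_subset[OF small] by blast
        then have "sm \<C>"
          unfolding \<C>_def using small_Un[OF small_finite[of "{X0}"] small_image] by simp
        then show "sm (\<Union>X\<in>\<C>. carrier (fst X))"
        proof (rule small_UN)
          fix X assume "X \<in> \<C>"
          then have "good X" using f(1) X0 unfolding \<C>_def by blast
          then show "sm (carrier (fst X))" using module_catD(2)[OF goodD(1)] by blast
        qed
      qed (simp add: \<C>_def)
      then obtain U where U: "good U" "\<And>X. X \<in> \<C> \<Longrightarrow> ext X U" by blast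
      have U0: "ext X0 U" using U(2) by (simp add: \<C>_def)
      obtain Y where Y: "good Y" "ext U Y" "Q \<alpha> U Y" using step[OF U(1) U0 True] by blast
      moreover have "ext X0 Y" using ext_trans[OF X0 U(1) Y(1) U0 Y(2)] .
      moreover have "ext (f \<beta>) U" if "(\<beta>, \<alpha>) \<in> r \<and> \<beta> \<noteq> \<alpha>" for \<beta> using U(2) that by (simp add: \<C>_def)
      ultimately show ?thesis using U(1) U0 by blast
    qed blast
  qed
  then show ?thesis by blast
qed

text \<open>The intermediate object of each stage is kept in the conclusion, because Q relates a
  stage to the object on which its step was performed and not to X0.\<close>

lemma transfinite_union:
  assumes r: "Well_order r" and small: "sm (Field r)" and X0: "good X0"
    and step: "\<And>X \<alpha>. \<lbrakk>good X; ext X0 X; \<alpha> \<in> Field r\<rbrakk> \<Longrightarrow> \<exists>X'. good X' \<and> ext X X' \<and> Q \<alpha> X X'"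
  shows "\<exists>f Z. (\<forall>\<alpha>\<in>Field r. good (f \<alpha>) \<and> ext X0 (f \<alpha>) \<and> ext (f \<alpha>) Z \<and>
      (\<exists>X. good X \<and> ext X0 X \<and> (\<forall>\<beta>. (\<beta>, \<alpha>) \<in> r \<and> \<beta> \<noteq> \<alpha> \<longrightarrow> ext (f \<beta>) X) \<and> ext X (f \<alpha>) \<and> Q \<alpha> X (f \<alpha>))) \<and>
    (\<forall>\<alpha> \<beta>. (\<alpha>, \<beta>) \<in> r \<longrightarrow> ext (f \<alpha>) (f \<beta>)) \<and> good Z \<and> ext X0 Z \<and>
    carrier (fst Z) = carrier (fst X0) \<union> (\<Union>\<alpha>\<in>Field r. carrier (fst (f \<alpha>)))"
proof -
  obtain f where f: "\<forall>\<alpha>\<in>Field r. good (f \<alpha>) \<and> ext X0 (f \<alpha>) \<and>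
    (\<exists>X. good X \<and> ext X0 X \<and> (\<forall>\<beta>. (\<beta>, \<alpha>) \<in> r \<and> \<beta> \<noteq> \<alpha> \<longrightarrow> ext (f \<beta>) X) \<and> ext X (f \<alpha>) \<and> Q \<alpha> X (f \<alpha>))"
    using transfinite_extension[where Q = Q, OF r small X0 step] by blast
  have gd: "good (f \<alpha>)" "ext X0 (f \<alpha>)" if "\<alpha> \<in> Field r" for \<alpha> using f that by blast+
  have mono: "ext (f \<alpha>) (f \<beta>)" if ab: "(\<alpha>, \<beta>) \<in> r" for \<alpha> \<beta>
  proof (cases "\<alpha> = \<beta>")
    case True
    have "\<alpha> \<in> Field r" using ab by (auto simp: Field_def)
    then show ?thesis using ext_refl[OF gd(1)] True by simp
  next
    case False
    have ab': "\<alpha> \<in> Field r" "\<beta> \<in> Field r" using ab by (auto simp: Field_def)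
    then obtain X where "good X" "ext (f \<alpha>) X" "ext X (f \<beta>)" using f ab False by blast
    then show ?thesis using ext_trans gd(1) ab' by blast
  qed
  have tot: "(\<alpha>, \<beta>) \<in> r \<or> (\<beta>, \<alpha>) \<in> r" if "\<alpha> \<in> Field r" "\<beta> \<in> Field r" "\<alpha> \<noteq> \<beta>" for \<alpha> \<beta>
    using r that by (simp add: well_order_on_def linear_order_on_def total_on_def)
  let ?C = "insert X0 (f ` Field r)"
  have "\<exists>U. good U \<and> carrier (fst U) = (\<Union>Y\<in>?C. carrier (fst Y)) \<and> (\<forall>Y\<in>?C. ext Y U)"
  proof (rule chain_union)
    show gC: "good Y" if "Y \<in> ?C" for Y using that X0 gd(1) by blast
    show "\<exists>W\<in>?C. ext Y W \<and> ext Z W" if YZ: "Y \<in> ?C" "Z \<in> ?C" for Y Z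
    proof (cases "Y = X0 \<or> Z = X0 \<or> Y = Z")
      case True
      then show ?thesis using YZ gd ext_refl X0 by blast
    next
      case False
      then obtain \<alpha> \<beta> where ab: "\<alpha> \<in> Field r" "Y = f \<alpha>" "\<beta> \<in> Field r" "Z = f \<beta>" using YZ by blast
      then have "(\<alpha>, \<beta>) \<in> r \<or> (\<beta>, \<alpha>) \<in> r" using tot False by blast
      then show ?thesis using ab mono ext_refl gd(1) by blast
    qed
    have "sm ?C"
      using small_Un[OF small_finite[of "{X0}"] small_image[OF small, of f]] by simp
    then show "sm (\<Union>Y\<in>?C. carrier (fst Y))"
      by (rule small_UN) (use gC module_catD(2)[OF goodD(1)] in blast)
  qed blast
  then obtain U where U: "good U" "carrier (fst U) = (\<Union>Y\<in>?C. carrier (fst Y))" and ext: "\<forall>Y\<in>?C. ext Y U"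
    by (elim exE conjE)
  have "carrier (fst U) = carrier (fst X0) \<union> (\<Union>\<alpha>\<in>Field r. carrier (fst (f \<alpha>)))" using U(2) by simp
  moreover have "ext X0 U" "\<forall>\<alpha>\<in>Field r. ext (f \<alpha>) U" using ext by blast+
  ultimately show ?thesis using f mono U(1) by (intro exI[of _ f] exI[of _ U]) blast
qed

end

section \<open>An injective object\<close>

text \<open>The graphs of the two operations. A record has arbitrary values off its carrier and in
  the multiplicative fields, which would make the records on one carrier too numerous; the code
  forgets them and still determines the carrier, through the graph of addition.\<close>

definition mod_code :: "('r, 'k) ring_scheme \<Rightarrow> ('r, 'u) module \<Rightarrow> ('u \<times> 'u \<times> 'u) set \<times> ('r \<times> 'u \<times> 'u) set" where
  "mod_code R M = ({(x, y, x \<oplus>\<^bsub>M\<^esub> y) | x y. x \<in> carrier M \<and> y \<in> carrier M},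
     {(a, x, a \<odot>\<^bsub>M\<^esub> x) | a x. a \<in> carrier R \<and> x \<in> carrier M})"

lemma mod_code_eq:
  assumes "mod_code R M = mod_code R N"
  shows "carrier M = carrier N" "lin R M N (\<lambda>x. x)"
proof -
  have 1: "{(x, y, x \<oplus>\<^bsub>M\<^esub> y) | x y. x \<in> carrier M \<and> y \<in> carrier M} = {(x, y, x \<oplus>\<^bsub>N\<^esub> y) | x y. x \<in> carrier N \<and> y \<in> carrier N}"
    and 2: "{(a, x, a \<odot>\<^bsub>M\<^esub> x) | a x. a \<in> carrier R \<and> x \<in> carrier M} = {(a, x, a \<odot>\<^bsub>N\<^esub> x) | a x. a \<in> carrier R \<and> x \<in> carrier N}"
    using assms by (simp_all add: mod_code_def)
  have add: "y \<in> carrier M \<and> x \<in> carrier M \<longleftrightarrow> x \<in> carrier N \<and> y \<in> carrier N \<and> x \<oplus>\<^bsub>M\<^esub> y = x \<oplus>\<^bsub>N\<^esub> y" for x y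
  proof -
    have "y \<in> carrier M \<and> x \<in> carrier M \<longleftrightarrow>
        (x, y, x \<oplus>\<^bsub>M\<^esub> y) \<in> {(x, y, x \<oplus>\<^bsub>M\<^esub> y) | x y. x \<in> carrier M \<and> y \<in> carrier M}" by auto
    also have "\<dots> \<longleftrightarrow> x \<in> carrier N \<and> y \<in> carrier N \<and> x \<oplus>\<^bsub>M\<^esub> y = x \<oplus>\<^bsub>N\<^esub> y" unfolding 1 by auto
    finally show ?thesis .
  qed
  have sm: "a \<odot>\<^bsub>M\<^esub> x = a \<odot>\<^bsub>N\<^esub> x" if "a \<in> carrier R" "x \<in> carrier M" for a x
  proof -
    have "(a, x, a \<odot>\<^bsub>M\<^esub> x) \<in> {(a, x, a \<odot>\<^bsub>M\<^esub> x) | a x. a \<in> carrier R \<and> x \<in> carrier M}" using that by auto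
    then show ?thesis unfolding 2 by auto
  qed
  have sub: "x \<in> carrier N" if "x \<in> carrier M" for x using add[of x x] that by simp
  moreover have "x \<in> carrier M" if "x \<in> carrier N" for x
  proof -
    have "(x, x, x \<oplus>\<^bsub>N\<^esub> x) \<in> {(x, y, x \<oplus>\<^bsub>N\<^esub> y) | x y. x \<in> carrier N \<and> y \<in> carrier N}" using that by auto
    then show ?thesis unfolding 1[symmetric] by auto
  qed
  ultimately show "carrier M = carrier N" by blast
  show "lin R M N (\<lambda>x. x)"
    by (rule linI) (use sub add sm in auto)
qed

lemma pure_in_iso:
  assumes M: "left_module R M" "left_module R M'" and \<theta>: "lin R M M' \<theta>" "bij_betw \<theta> (carrier M) (carrier M')"
    and N: "pure_in R M N"
  shows "pure_in R M' (\<theta> ` N)"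
proof -
  interpret M: left_module R M by fact
  define \<phi> where "\<phi> = inv_into (carrier M) \<theta>"
  have \<phi>: "lin R M' M \<phi>" unfolding \<phi>_def by (rule lin_inv[OF M(1) \<theta>])
  have \<theta>\<phi>: "\<theta> (\<phi> y) = y" if "y \<in> carrier M'" for y
    using that \<theta>(2) by (simp add: \<phi>_def bij_betw_def f_inv_into_f)
  have \<phi>\<theta>: "\<phi> (\<theta> x) = x" if "x \<in> carrier M" for x
    using that \<theta>(2) by (simp add: \<phi>_def bij_betw_def)
  note N' = submod_closed[OF pure_submod[OF N]]
  show ?thesis
    unfolding pure_in_def
  proof (intro conjI allI impI)
    show "submod R M' (\<theta> ` N)"
      unfolding submod_def
    proof (intro conjI ballI)
      show "\<theta> ` N \<subseteq> carrier M'" using N'(1) lin_closed[OF \<theta>(1)] by blast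
      show "\<zero>\<^bsub>M'\<^esub> \<in> \<theta> ` N" using N'(2) lin_zero[OF M \<theta>(1)] by (metis imageI)
      show "x \<oplus>\<^bsub>M'\<^esub> y \<in> \<theta> ` N" if xy: "x \<in> \<theta> ` N" "y \<in> \<theta> ` N" for x y
      proof -
        obtain a b where "a \<in> N" "b \<in> N" "x = \<theta> a" "y = \<theta> b" using xy by blast
        then show ?thesis using lin_add[OF \<theta>(1), of a b] N'(1,3) by (metis image_eqI subsetD)
      qed
      show "a \<odot>\<^bsub>M'\<^esub> x \<in> \<theta> ` N" if ax: "a \<in> carrier R" "x \<in> \<theta> ` N" for a x
      proof -
        obtain b where "b \<in> N" "x = \<theta> b" using ax by blast
        then show ?thesis using lin_smult[OF \<theta>(1), of a b] N'(1,4) ax by (metis image_eqI subsetD)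
      qed
    qed
    fix E assume E: "finite E \<and> E \<subseteq> terms R (carrier M') \<and> (\<forall>e\<in>E. lc M' (\<lambda>s. s) e \<in> \<theta> ` N)"
    have \<phi>F: "\<phi> \<in> carrier M' \<rightarrow> carrier M" using lin_closed[OF \<phi>] by blast
    have "lc M \<phi> e \<in> N" if e: "e \<in> E" for e
    proof -
      have "lc M \<phi> e = \<phi> (lc M' (\<lambda>s. s) e)"
        using lin_lc[OF M(2,1) \<phi>, of e "carrier M'" "\<lambda>s. s"] E e by auto
      moreover obtain n where "n \<in> N" "lc M' (\<lambda>s. s) e = \<theta> n" using E e by blast
      ultimately show ?thesis using \<phi>\<theta> N'(1) by auto
    qed
    moreover have "finite E" "E \<subseteq> terms R (carrier M')" using E by blast+
    ultimately obtain d where d: "d \<in> carrier M' \<rightarrow> N" "\<And>e. e \<in> E \<Longrightarrow> lc M (\<lambda>g. \<phi> g \<oplus>\<^bsub>M\<^esub> d g) e = \<zero>\<^bsub>M\<^esub>"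
      using pure_lift[OF N _ _ \<phi>F, of E] by metis
    have dM: "d s \<in> carrier M" if "s \<in> carrier M'" for s using d(1) N'(1) that by auto
    have "lc M' (\<lambda>s. s \<oplus>\<^bsub>M'\<^esub> \<theta> (d s)) e = \<zero>\<^bsub>M'\<^esub>" if e: "e \<in> E" for e
    proof -
      have et: "e \<in> terms R (carrier M')" using E e by blast
      have "(\<lambda>g. \<phi> g \<oplus>\<^bsub>M\<^esub> d g) \<in> carrier M' \<rightarrow> carrier M"
        using \<phi>F dM by auto
      from lin_lc[OF M \<theta>(1) et this]
      have "lc M' (\<lambda>s. \<theta> (\<phi> s \<oplus>\<^bsub>M\<^esub> d s)) e = \<zero>\<^bsub>M'\<^esub>" using d(2)[OF e] lin_zero[OF M \<theta>(1)] by simp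
      moreover have "lc M' (\<lambda>s. s \<oplus>\<^bsub>M'\<^esub> \<theta> (d s)) e = lc M' (\<lambda>s. \<theta> (\<phi> s \<oplus>\<^bsub>M\<^esub> d s)) e"
        using \<phi>F dM by (intro lc_cong[OF _ et]) (simp add: lin_add[OF \<theta>(1)] \<theta>\<phi> Pi_iff)
      ultimately show ?thesis by simp
    qed
    then show "\<exists>d\<in>carrier M' \<rightarrow> \<theta> ` N. \<forall>e\<in>E. lc M' (\<lambda>s. s \<oplus>\<^bsub>M'\<^esub> d s) e = \<zero>\<^bsub>M'\<^esub>"
      using d(1) by (intro bexI[of _ "\<lambda>s. \<theta> (d s)"]) auto
  qed
qed

context mod_univ
begin

text \<open>Every tiny module is isomorphic to one on a subset of T, a fixed set of |carrier R| *
  aleph_0 elements of \<open>'u\<close>. The codes of such modules are pairs of subsets of tiny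
  sets, hence form a small set, and one module per realised code is kept.\<close>

lemma tiny_representatives:
  obtains \<N> :: "('r, 'u) module set" where "sm \<N>"
    "\<And>N. N \<in> \<N> \<Longrightarrow> N \<in> module_cat R \<and> tiny R (carrier N)"
    "\<And>N' :: ('r, 'u) module. \<lbrakk>N' \<in> module_cat R; tiny R (carrier N')\<rbrakk> \<Longrightarrow>
       \<exists>N\<in>\<N>. \<exists>\<theta>. lin R N' N \<theta> \<and> bij_betw \<theta> (carrier N') (carrier N)"
proof -
  let ?L = "carrier R \<times> (UNIV :: nat set)"
  have "tiny R ?L" unfolding tiny_def by (rule ordLeq_refl) (rule card_of_Card_order)
  then have L: "sm ?L" by (rule small_tiny)
  obtain \<iota> :: "_ \<Rightarrow> 'u" where \<iota>: "inj_on \<iota> ?L" by (rule ex_inj_small[OF L])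
  define T where "T = \<iota> ` ?L"
  have T: "tiny R T" unfolding T_def by (rule tiny_image) fact
  define K where "K = Pow (T \<times> T \<times> T) \<times> Pow (carrier R \<times> T \<times> T)"
  have K: "sm K" unfolding K_def by (intro small_Times small_Pow tiny_Times T tiny_carrier)
  define ok where "ok N k \<longleftrightarrow> N \<in> module_cat R \<and> carrier N \<subseteq> T \<and> mod_code R N = k" for N :: "('r, 'u) module" and k
  define rep where "rep k = (SOME N. ok N k)" for k
  have rep: "ok (rep k) k" if "ok N k" for N k using someI[of "\<lambda>N. ok N k", OF that] by (simp add: rep_def)
  define \<N> where "\<N> = rep ` {k \<in> K. \<exists>N. ok N k}"
  have "sm \<N>" unfolding \<N>_def by (rule small_image[OF small_subset[OF K]]) auto
  moreover have "N \<in> module_cat R \<and> tiny R (carrier N)" if N: "N \<in> \<N>" for N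
  proof -
    obtain k where "N = rep k" "ok (rep k) k" using N rep unfolding \<N>_def by blast
    then show ?thesis using tiny_subset[OF T] by (simp add: ok_def)
  qed
  moreover have "\<exists>N\<in>\<N>. \<exists>\<theta>. lin R N' N \<theta> \<and> bij_betw \<theta> (carrier N') (carrier N)"
    if N': "N' \<in> module_cat R" "tiny R (carrier N')" for N' :: "('r, 'u) module"
  proof -
    obtain j where j: "inj_on j (carrier N')" "j ` carrier N' \<subseteq> ?L"
      using N'(2) card_of_ordLeq[of "carrier N'" ?L] unfolding tiny_def by blast
    define \<theta> where "\<theta> x = \<iota> (j x)" for x
    have "inj_on \<theta> (carrier N')" 
      using comp_inj_on[OF j(1) inj_on_subset[OF \<iota> j(2)]] by (simp add: comp_def \<theta>_def[abs_def])
    then have bij: "bij_betw \<theta> (carrier N') (\<theta> ` carrier N')" by (simp add: bij_betw_def)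
    have \<theta>T: "\<theta> ` carrier N' \<subseteq> T" using j by (auto simp: \<theta>_def T_def)
    obtain N1 :: "('r, 'u) module" where N1: "left_module R N1" "carrier N1 = \<theta> ` carrier N'" "lin R N' N1 \<theta>"
      by (rule transport_module[OF module_catD(1)[OF N'(1)] bij])
    have N1c: "N1 \<in> module_cat R"
      by (rule module_catI[OF N1(1)]) (simp add: N1(2) small_image module_catD(2)[OF N'(1)])
    have cl: "y \<in> carrier N1 \<Longrightarrow> x \<oplus>\<^bsub>N1\<^esub> y \<in> T" "a \<in> carrier R \<Longrightarrow> a \<odot>\<^bsub>N1\<^esub> x \<in> T" if "x \<in> carrier N1" for x y a
    proof -
      interpret left_module R N1 by fact
      have "carrier N1 \<subseteq> T" using N1(2) \<theta>T by simp
      then show "y \<in> carrier N1 \<Longrightarrow> x \<oplus>\<^bsub>N1\<^esub> y \<in> T" "a \<in> carrier R \<Longrightarrow> a \<odot>\<^bsub>N1\<^esub> x \<in> T" using that by auto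
    qed
    have ok: "ok N1 (mod_code R N1)" using N1c N1(2) \<theta>T by (simp add: ok_def)
    have "mod_code R N1 \<in> K"
      using cl N1(2) \<theta>T by (auto simp: mod_code_def K_def)
    then have mem: "rep (mod_code R N1) \<in> \<N>" using ok unfolding \<N>_def by blast
    have code: "mod_code R N1 = mod_code R (rep (mod_code R N1))" using rep[OF ok] by (simp add: ok_def)
    have "lin R N' (rep (mod_code R N1)) \<theta>" using lin_comp[OF N1(3) mod_code_eq(2)[OF code]] .
    moreover have "bij_betw \<theta> (carrier N') (carrier (rep (mod_code R N1)))"
      using bij mod_code_eq(1)[OF code] N1(2) by simp
    ultimately show ?thesis using mem by blast
  qed
  ultimately show thesis using that by blast
qed

text \<open>The length of the small object argument is the successor of |carrier R| * aleph_0. It is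
  regular, so a tiny subset of the union of a chain lies in one member; it is a limit, so every
  stage has a later one; and it is at most the power set of a tiny set, hence small.\<close>

lemma cardSuc_small:
  defines "\<kappa> \<equiv> cardSuc |carrier R \<times> (UNIV :: nat set)|"
  shows "Well_order \<kappa>" "sm (Field \<kappa>)"
    "\<And>A B. (\<And>i j. (i, j) \<in> \<kappa> \<Longrightarrow> A i \<subseteq> A j) \<Longrightarrow> tiny R B \<Longrightarrow> B \<subseteq> (\<Union>i\<in>Field \<kappa>. A i) \<Longrightarrow> \<exists>i\<in>Field \<kappa>. B \<subseteq> A i"
    "\<And>a. a \<in> Field \<kappa> \<Longrightarrow> \<exists>b\<in>Field \<kappa>. a \<noteq> b \<and> (a, b) \<in> \<kappa>"
proof -
  let ?L = "carrier R \<times> (UNIV :: nat set)"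
  have co: "Card_order |?L|" by (rule card_of_Card_order)
  have inf: "infinite (Field |?L| )" using infinite_L by (simp add: Field_card_of)
  show "Well_order \<kappa>" unfolding \<kappa>_def using cardSuc_Well_order[OF co] .
  have "\<kappa> \<le>o |Pow ?L|" unfolding \<kappa>_def by (rule cardSuc_least[OF co card_of_Card_order card_of_Pow])
  then have "|Field \<kappa>| \<le>o |Pow ?L|"
    using card_of_Field_ordIso[OF cardSuc_Card_order[OF co]] ordIso_ordLeq_trans unfolding \<kappa>_def by blast
  moreover have "tiny R ?L" unfolding tiny_def by (rule ordLeq_refl) (rule card_of_Card_order)
  ultimately show "sm (Field \<kappa>)" using small_mono small_Pow by blast
  show "\<exists>i\<in>Field \<kappa>. B \<subseteq> A i" if "\<And>i j. (i, j) \<in> \<kappa> \<Longrightarrow> A i \<subseteq> A j" "tiny R B" "B \<subseteq> (\<Union>i\<in>Field \<kappa>. A i)" for A B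
    unfolding \<kappa>_def
  proof (rule cardSuc_UNION[OF co inf])
    show "relChain (cardSuc |?L| ) A" using that(1) by (auto simp: relChain_def \<kappa>_def)
  qed (use that in \<open>auto simp: tiny_def \<kappa>_def\<close>)
  show "\<exists>b\<in>Field \<kappa>. a \<noteq> b \<and> (a, b) \<in> \<kappa>" if "a \<in> Field \<kappa>" for a
    using infinite_Card_order_limit[OF cardSuc_Card_order[OF co]] cardSuc_finite[OF co] inf that unfolding \<kappa>_def by blast
qed

end

section \<open>Extension problems along pure submodules\<close>

context mod_fun
begin

text \<open>A lifting problem in the category of pairs: f is a morphism to X from the pure subobject
  of (N', n) carried by N, and the problem is to extend it to (N', n).\<close>

definition task :: "('r, 'u) module \<times> 'v \<Rightarrow> ('r, 'u) module \<Rightarrow> 'u set \<Rightarrow> 'v \<Rightarrow> ('u \<Rightarrow> 'u) \<Rightarrow> bool" where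
  "task X N' N n f \<longleftrightarrow> N' \<in> module_cat R \<and> pure_in R N' N \<and> n \<in> FF N' \<and> lin R (N' \<restriction> N) (fst X) f \<and>
     Fm (N' \<restriction> N) (fst X) f (snd X) = Fm (N' \<restriction> N) N' (\<lambda>x. x) n"

definition solved :: "('r, 'u) module \<times> 'v \<Rightarrow> ('r, 'u) module \<Rightarrow> 'u set \<Rightarrow> 'v \<Rightarrow> ('u \<Rightarrow> 'u) \<Rightarrow> bool" where
  "solved X N' N n f \<longleftrightarrow> (\<exists>g. lin R N' (fst X) g \<and> (\<forall>x\<in>N. g x = f x) \<and> Fm N' (fst X) g (snd X) = n)"

definition injective :: "('r, 'u) module \<times> 'v \<Rightarrow> bool" where
  "injective Y \<longleftrightarrow> good Y \<and> (\<forall>N' N n f. task Y N' N n f \<and> tiny R (carrier N') \<longrightarrow> solved Y N' N n f)"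

lemma task_restr_cat: "task X N' N n f \<Longrightarrow> N' \<restriction> N \<in> module_cat R"
  unfolding task_def using module_cat_restr pure_submod by blast

lemma task_ext:
  assumes "good X" "good X'" "ext X X'" "task X N' N n f"
  shows "task X' N' N n f"
proof -
  have f: "lin R (N' \<restriction> N) (fst X) f" using assms(4) by (simp add: task_def)
  have "Fm (N' \<restriction> N) (fst X') f (snd X') = Fm (N' \<restriction> N) (fst X) f (snd X)"
    using Fm_comp[OF task_restr_cat[OF assms(4)] goodD(1)[OF assms(1)] goodD(1)[OF assms(2)] f extD(1)[OF assms(3)] goodD(2)[OF assms(2)]]
      extD(2)[OF assms(3)] by simp
  then show ?thesis using assms(4) lin_comp[OF f extD(1)[OF assms(3)]] by (simp add: task_def)
qed

lemma solved_ext: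
  assumes "good X" "good X'" "ext X X'" "N' \<in> module_cat R" "solved X N' N n f"
  shows "solved X' N' N n f"
proof -
  obtain g where g: "lin R N' (fst X) g" "\<forall>x\<in>N. g x = f x" "Fm N' (fst X) g (snd X) = n"
    using assms(5) by (auto simp: solved_def)
  have "Fm N' (fst X') g (snd X') = Fm N' (fst X) g (snd X)"
    using Fm_comp[OF assms(4) goodD(1)[OF assms(1)] goodD(1)[OF assms(2)] g(1) extD(1)[OF assms(3)] goodD(2)[OF assms(2)]]
      extD(2)[OF assms(3)] by simp
  then show ?thesis using g lin_comp[OF g(1) extD(1)[OF assms(3)]] unfolding solved_def by auto
qed

text \<open>In the pushout of f along N the map from N' is a solution by construction. The element
  of F that makes it a morphism exists by \<open>pure_square_glue\<close>, which is where purity of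
  N enters.\<close>

lemma task_solvable:
  assumes X: "good X" and T: "task X N' N n f"
  shows "\<exists>X'. good X' \<and> ext X X' \<and> solved X' N' N n f"
proof -
  from T have N': "N' \<in> module_cat R" and N: "pure_in R N' N" and n: "n \<in> FF N'"
    and f: "lin R (N' \<restriction> N) (fst X) f" and eq: "Fm (N' \<restriction> N) (fst X) f (snd X) = Fm (N' \<restriction> N) N' (\<lambda>x. x) n"
    unfolding task_def by auto
  obtain Q k where Q: "Q \<in> module_cat R" "lin R (fst X) Q (\<lambda>x. x)" "lin R N' Q k"
    and kf: "\<forall>n\<in>N. k n = f n" and sq: "pure_square R (fst X) N' N f Q (\<lambda>x. x) k"
  proof (rule pushout_exists[OF goodD(1)[OF X] N' pure_submod[OF N] f])
    fix Q k assume Q: "Q \<in> module_cat R" "lin R (fst X) Q (\<lambda>x. x)" "lin R N' Q k"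
      and surj: "\<And>q. q \<in> carrier Q \<Longrightarrow> \<exists>a\<in>carrier (fst X). \<exists>b\<in>carrier N'. q = a \<oplus>\<^bsub>Q\<^esub> k b"
      and kf: "\<And>n. n \<in> N \<Longrightarrow> k n = f n"
      and ker: "\<And>a b. \<lbrakk>a \<in> carrier (fst X); b \<in> carrier N'; a \<oplus>\<^bsub>Q\<^esub> k b = \<zero>\<^bsub>Q\<^esub>\<rbrakk> \<Longrightarrow> b \<in> N \<and> a \<oplus>\<^bsub>fst X\<^esub> f b = \<zero>\<^bsub>fst X\<^esub>"
    have "\<forall>a\<in>carrier (fst X). \<forall>b\<in>carrier N'. a \<oplus>\<^bsub>Q\<^esub> k b = \<zero>\<^bsub>Q\<^esub> \<longrightarrow> b \<in> N \<and> a \<oplus>\<^bsub>fst X\<^esub> f b = \<zero>\<^bsub>fst X\<^esub>"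
      by (intro ballI impI ker)
    then have "pure_square R (fst X) N' N f Q (\<lambda>x. x) k"
      unfolding pure_square_def using goodD(1)[OF X] N' Q N f surj kf by simp
    moreover have "\<forall>n\<in>N. k n = f n" using kf by blast
    ultimately show thesis using that Q by blast
  qed
  from pure_square_glue[OF sq goodD(2)[OF X] n eq]
  obtain q where q: "q \<in> FF Q" "Fm (fst X) Q (\<lambda>x. x) q = snd X" "Fm N' Q k q = n" by blast
  then show ?thesis
    using Q kf by (intro exI[of _ "(Q, q)"]) (auto simp: good_def ext_def solved_def)
qed

lemma fob_small: "N \<in> module_cat R \<Longrightarrow> tiny R (carrier N) \<Longrightarrow> sm (FF N)"
  using compat unfolding universe_compatible_def tiny_def small_def by blast

text \<open>Solving one problem enlarges X, so the problems over X are listed beforehand and solved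
  one by one along a well-order; solutions persist by \<open>solved_ext\<close>. Only problems on
  representatives of tiny modules are listed. These form a small set because a tiny module has few
  subsets, few maps into X and a small value of F. Any other problem is carried to a listed one by
  an isomorphism.\<close>

lemma all_tasks_solvable:
  assumes X: "good X"
  shows "\<exists>X'. good X' \<and> ext X X' \<and> (\<forall>N' N n f. task X N' N n f \<and> tiny R (carrier N') \<longrightarrow> solved X' N' N n f)"
proof -
  obtain \<N> :: "('r, 'u) module set" where \<N>: "sm \<N>"
    and \<N>1: "\<And>N. N \<in> \<N> \<Longrightarrow> N \<in> module_cat R \<and> tiny R (carrier N)"
    and \<N>2: "\<And>N' :: ('r, 'u) module. \<lbrakk>N' \<in> module_cat R; tiny R (carrier N')\<rbrakk> \<Longrightarrow>
       \<exists>N\<in>\<N>. \<exists>\<theta>. lin R N' N \<theta> \<and> bij_betw \<theta> (carrier N') (carrier N)"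
    using tiny_representatives by blast
  define J where "J = (SIGMA N' : \<N>. Pow (carrier N') \<times> FF N' \<times> (carrier N' \<rightarrow>\<^sub>E carrier (fst X)))"
  have "sm J"
    unfolding J_def using \<N> \<N>1 module_catD(2)[OF goodD(1)[OF X]]
    by (intro small_Sigma small_Times small_Pow fob_small small_PiE) auto
  have "Field |J| = J" by (rule Field_card_of)
  with \<open>sm J\<close> have wo: "Well_order |J|" "sm (Field |J| )" using card_of_Well_order[of J] by simp_all
  \<comment> \<open>The problems remain those over the initial X; \<open>task_ext\<close> reads them
    over the current stage.\<close>
  define Q where "Q j X1 X2 \<longleftrightarrow> (case j of (N', N, n, f) \<Rightarrow> task X N' N n f \<longrightarrow> solved X2 N' N n f)"
    for j and X1 X2 :: "('r, 'u) module \<times> 'v"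
  have "\<exists>X2. good X2 \<and> ext X1 X2 \<and> Q j X1 X2" if X1: "good X1" "ext X X1" for X1 j
  proof -
    obtain N' N n f where j: "j = (N', N, n, f)" by (cases j)
    show ?thesis
    proof (cases "task X N' N n f")
      case True
      then show ?thesis using task_solvable[OF X1(1) task_ext[OF X X1(1,2)]] j by (auto simp: Q_def)
    next
      case False
      then show ?thesis using X1(1) ext_refl j by (intro exI[of _ X1]) (simp add: Q_def)
    qed
  qed
  then have "\<exists>h U. (\<forall>j\<in>Field |J|. good (h j) \<and> ext X (h j) \<and> ext (h j) U \<and>
      (\<exists>X1. good X1 \<and> ext X X1 \<and> (\<forall>i. (i, j) \<in> |J| \<and> i \<noteq> j \<longrightarrow> ext (h i) X1) \<and> ext X1 (h j) \<and> Q j X1 (h j))) \<and>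
    (\<forall>i j. (i, j) \<in> |J| \<longrightarrow> ext (h i) (h j)) \<and> good U \<and> ext X U \<and>
    carrier (fst U) = carrier (fst X) \<union> (\<Union>j\<in>Field |J|. carrier (fst (h j)))"
    by (intro transfinite_union[OF wo X])
  then obtain h U where h: "\<forall>j\<in>Field |J|. good (h j) \<and> ext X (h j) \<and> ext (h j) U \<and>
      (\<exists>X1. good X1 \<and> ext X X1 \<and> (\<forall>i. (i, j) \<in> |J| \<and> i \<noteq> j \<longrightarrow> ext (h i) X1) \<and> ext X1 (h j) \<and> Q j X1 (h j))"
    and U: "good U" "ext X U"
    by (elim exE conjE)
  note h = bspec[OF h[unfolded \<open>Field |J| = J\<close>]]
  have "solved U N' N n f" if T: "task X N' N n f" and tiny: "tiny R (carrier N')" for N' N n f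
  proof -
    from T have N': "N' \<in> module_cat R" and N: "pure_in R N' N" and n: "n \<in> FF N'"
      and f: "lin R (N' \<restriction> N) (fst X) f" and eq: "Fm (N' \<restriction> N) (fst X) f (snd X) = Fm (N' \<restriction> N) N' (\<lambda>x. x) n"
      unfolding task_def by auto
    have NN: "N \<subseteq> carrier N'" using submod_closed(1)[OF pure_submod[OF N]] .
    obtain M \<theta> where M: "M \<in> \<N>" and \<theta>: "lin R N' M \<theta>" "bij_betw \<theta> (carrier N') (carrier M)"
      using \<N>2[OF N' tiny] by blast
    have Mc: "M \<in> module_cat R" using \<N>1[OF M] by blast
    have lm: "left_module R N'" "left_module R M" using module_catD(1) N' Mc by blast+
    define \<phi> where "\<phi> = inv_into (carrier N') \<theta>"
    have \<phi>: "lin R M N' \<phi>" unfolding \<phi>_def by (rule lin_inv[OF lm(1) \<theta>])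
    have \<phi>\<theta>: "\<phi> (\<theta> x) = x" if "x \<in> carrier N'" for x
      using that \<theta>(2) by (simp add: \<phi>_def bij_betw_def)
    let ?A = "\<theta> ` N"
    have A: "pure_in R M ?A" by (rule pure_in_iso[OF lm \<theta> N])
    note Asub = submod_closed(1)[OF pure_submod[OF A]]
    interpret Xm: left_module R "fst X" by (rule goodD(3)[OF X])
    \<comment> \<open>The list J records maps on the whole module, so the map on \<open>?A\<close>
      is continued by zero.\<close>
    define f' where "f' = (\<lambda>x\<in>carrier M. if x \<in> ?A then f (\<phi> x) else \<zero>\<^bsub>fst X\<^esub>)"
    define n' where "n' = Fm M N' \<phi> n"
    have \<phi>A: "lin R (M \<restriction> ?A) (N' \<restriction> N) \<phi>"
    proof (rule lin_restr_cod[OF lin_restr_dom[OF \<phi> Asub]])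
      show "\<phi> \<in> carrier (M \<restriction> ?A) \<rightarrow> N" using \<phi>\<theta> NN by auto
    qed
    have Ac: "M \<restriction> ?A \<in> module_cat R" "N' \<restriction> N \<in> module_cat R"
      using module_cat_restr Mc N' pure_submod A N by blast+
    have f\<phi>: "lin R (M \<restriction> ?A) (fst X) (\<lambda>x. f (\<phi> x))" by (rule lin_comp[OF \<phi>A f])
    have f'eq: "f' x = f (\<phi> x)" if "x \<in> ?A" for x using that Asub by (auto simp: f'_def)
    have f': "lin R (M \<restriction> ?A) (fst X) f'"
      by (rule lin_cong[OF f\<phi> module_catD(1)[OF Ac(1)]]) (simp add: f'eq)
    have nF: "n' \<in> FF M" unfolding n'_def by (rule Fm_closed[OF Mc N' \<phi> n])
    have "Fm (M \<restriction> ?A) (fst X) f' (snd X) = Fm (M \<restriction> ?A) (fst X) (\<lambda>x. f (\<phi> x)) (snd X)"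
      using Fm_cong[of "M \<restriction> ?A" f' "\<lambda>x. f (\<phi> x)"] f'eq by simp
    also have "\<dots> = Fm (M \<restriction> ?A) (N' \<restriction> N) \<phi> (Fm (N' \<restriction> N) N' (\<lambda>x. x) n)"
      using Fm_comp[OF Ac goodD(1)[OF X] \<phi>A f goodD(2)[OF X]] eq by simp
    also have "\<dots> = Fm (M \<restriction> ?A) N' \<phi> n"
      using Fm_comp[OF Ac N' \<phi>A lin_subset[OF NN] n] by simp
    also have "\<dots> = Fm (M \<restriction> ?A) M (\<lambda>x. x) n'"
      using Fm_comp[OF Ac(1) Mc N' lin_subset[OF Asub] \<phi> n] by (simp add: n'_def)
    finally have T': "task X M ?A n' f'"
      using Mc A nF f' by (simp add: task_def)
    have "f' \<in> carrier M \<rightarrow>\<^sub>E carrier (fst X)"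
      using lin_closed[OF f'] f'eq by (auto simp: f'_def)
    then have mem: "(M, ?A, n', f') \<in> J" using M Asub nF by (simp add: J_def)
    then have "solved (h (M, ?A, n', f')) M ?A n' f'" using h[OF mem] T' by (auto simp: Q_def)
    then have "solved U M ?A n' f'" using solved_ext[OF _ U(1) _ Mc] h[OF mem] by blast
    then obtain g where g: "lin R M (fst U) g" "\<forall>x\<in>?A. g x = f' x" "Fm M (fst U) g (snd U) = n'"
      by (auto simp: solved_def)
    have "Fm N' (fst U) (\<lambda>x. g (\<theta> x)) (snd U) = Fm N' M \<theta> n'"
      using Fm_comp[OF N' Mc goodD(1)[OF U(1)] \<theta>(1) g(1) goodD(2)[OF U(1)]] g(3) by simp
    also have "\<dots> = Fm N' N' (\<lambda>x. \<phi> (\<theta> x)) n"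
      using Fm_comp[OF N' Mc N' \<theta>(1) \<phi> n] by (simp add: n'_def)
    also have "\<dots> = n" using Fm_cong[of N' "\<lambda>x. \<phi> (\<theta> x)" "\<lambda>x. x" N'] \<phi>\<theta> Fm_id[OF N' n] by simp
    finally show ?thesis
      unfolding solved_def using lin_comp[OF \<theta>(1) g(1)] g(2) f'eq \<phi>\<theta> NN
      by (intro exI[of _ "\<lambda>x. g (\<theta> x)"]) auto
  qed
  then show ?thesis using U by blast
qed

lemma ex_good: "\<exists>X. good X"
proof -
  define M :: "('r, 'u) module" where "M = \<lparr>carrier = {undefined}, monoid.mult = undefined,
    one = undefined, zero = undefined, add = (\<lambda>_ _. undefined), smult = (\<lambda>_ _. undefined)\<rparr>"
  have "left_module R M" by (rule left_moduleI) (simp_all add: ring M_def)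
  then have M: "M \<in> module_cat R" by (rule module_catI) (simp add: small_finite M_def)
  interpret comm_group "fob F M" using F_group[OF M] .
  show ?thesis using M by (intro exI[of _ "(M, \<one>\<^bsub>fob F M\<^esub>)"]) (simp add: good_def)
qed

text \<open>The small object argument: tiny submodules of the union of a chain of length
  \<^term>\<open>cardSuc |carrier R \<times> (UNIV :: nat set)|\<close> lie in a member of the chain.\<close>

lemma injective_exists: "\<exists>Y. injective Y"
proof -
  let ?\<kappa> = "cardSuc |carrier R \<times> (UNIV :: nat set)|"
  obtain X0 where X0: "good X0" using ex_good by blast
  define Q where "Q \<alpha> X X' \<longleftrightarrow> (\<forall>N' N n f. task X N' N n f \<and> tiny R (carrier N') \<longrightarrow> solved X' N' N n f)"
    for \<alpha> :: "('r \<times> nat) set" and X X'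
  have "\<exists>h U. (\<forall>\<alpha>\<in>Field ?\<kappa>. good (h \<alpha>) \<and> ext X0 (h \<alpha>) \<and> ext (h \<alpha>) U \<and>
      (\<exists>X. good X \<and> ext X0 X \<and> (\<forall>\<beta>. (\<beta>, \<alpha>) \<in> ?\<kappa> \<and> \<beta> \<noteq> \<alpha> \<longrightarrow> ext (h \<beta>) X) \<and> ext X (h \<alpha>) \<and> Q \<alpha> X (h \<alpha>))) \<and>
    (\<forall>\<alpha> \<beta>. (\<alpha>, \<beta>) \<in> ?\<kappa> \<longrightarrow> ext (h \<alpha>) (h \<beta>)) \<and> good U \<and> ext X0 U \<and>
    carrier (fst U) = carrier (fst X0) \<union> (\<Union>\<alpha>\<in>Field ?\<kappa>. carrier (fst (h \<alpha>)))"
    using all_tasks_solvable by (intro transfinite_union[OF cardSuc_small(1,2) X0]) (simp add: Q_def)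
  then obtain h U where h: "\<forall>\<alpha>\<in>Field ?\<kappa>. good (h \<alpha>) \<and> ext X0 (h \<alpha>) \<and> ext (h \<alpha>) U \<and>
      (\<exists>X. good X \<and> ext X0 X \<and> (\<forall>\<beta>. (\<beta>, \<alpha>) \<in> ?\<kappa> \<and> \<beta> \<noteq> \<alpha> \<longrightarrow> ext (h \<beta>) X) \<and> ext X (h \<alpha>) \<and> Q \<alpha> X (h \<alpha>))"
    and hmono: "\<forall>\<alpha> \<beta>. (\<alpha>, \<beta>) \<in> ?\<kappa> \<longrightarrow> ext (h \<alpha>) (h \<beta>)" and U1: "good U"
    and Uc: "carrier (fst U) = carrier (fst X0) \<union> (\<Union>\<alpha>\<in>Field ?\<kappa>. carrier (fst (h \<alpha>)))"
    by (elim exE conjE)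
  note h = bspec[OF h] and hmono = hmono[rule_format]
  obtain \<alpha>0 where \<alpha>0: "\<alpha>0 \<in> Field ?\<kappa>" using Field_cardSuc_not_empty[OF card_of_Card_order] by blast
  have "carrier (fst X0) \<subseteq> carrier (fst (h \<alpha>0))" using h[OF \<alpha>0] extD(3) by blast
  then have Uc: "carrier (fst U) = (\<Union>\<alpha>\<in>Field ?\<kappa>. carrier (fst (h \<alpha>)))" using \<alpha>0 unfolding Uc by blast
  have U3: "ext (h i) U" if "i \<in> Field ?\<kappa>" for i using h[OF that] by (elim conjE)
  note U = U1 Uc U3
  have "solved U N' N n f" if T: "task U N' N n f" and tiny: "tiny R (carrier N')" for N' N n f
  proof -
    from T have N': "N' \<in> module_cat R" and N: "pure_in R N' N" and n: "n \<in> FF N'"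
      and f: "lin R (N' \<restriction> N) (fst U) f" and eq: "Fm (N' \<restriction> N) (fst U) f (snd U) = Fm (N' \<restriction> N) N' (\<lambda>x. x) n"
      unfolding task_def by auto
    have NN: "N \<subseteq> carrier N'" using submod_closed(1)[OF pure_submod[OF N]] .
    have "tiny R (f ` N)" by (rule tiny_image[OF tiny_subset[OF tiny NN]])
    moreover have "f ` N \<subseteq> (\<Union>i\<in>Field ?\<kappa>. carrier (fst (h i)))" using lin_closed[OF f] U(2) by auto
    moreover have "carrier (fst (h i)) \<subseteq> carrier (fst (h j))" if "(i, j) \<in> ?\<kappa>" for i j
      using extD(3)[OF hmono[OF that]] .
    ultimately obtain i where i: "i \<in> Field ?\<kappa>" "f ` N \<subseteq> carrier (fst (h i))"
      using cardSuc_small(3)[of "\<lambda>i. carrier (fst (h i))" "f ` N"] by blast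
    \<comment> \<open>Stage i contains the image of f, but stage j solves the problems over the
      intermediate object X from which it is built. X contains all strictly earlier stages; for j
      beyond i the map f is therefore a problem over X and is solved in \<open>h j\<close>.\<close>
    obtain j where j: "j \<in> Field ?\<kappa>" "i \<noteq> j" "(i, j) \<in> ?\<kappa>" using cardSuc_small(4)[OF i(1)] by blast
    obtain X where X: "good X" "ext (h i) X" "ext X (h j)" "Q j X (h j)" using h[OF j(1)] j i by blast
    have XU: "ext X U" using ext_trans[OF X(1) _ U(1) X(3) U(3)] h j by blast
    note Nc = task_restr_cat[OF T]
    have fX: "lin R (N' \<restriction> N) (fst X) f"
      by (rule lin_corestrict[OF module_catD(1)[OF Nc] f extD(1)[OF XU]]) (use i(2) extD(3)[OF X(2)] in auto)
    have "Fm (N' \<restriction> N) (fst X) f (snd X) = Fm (N' \<restriction> N) (fst U) f (snd U)"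
      using Fm_comp[OF Nc goodD(1)[OF X(1)] goodD(1)[OF U(1)] fX extD(1)[OF XU] goodD(2)[OF U(1)]] extD(2)[OF XU] by simp
    then have "task X N' N n f" using fX T by (simp add: task_def)
    then have "solved (h j) N' N n f" using X(4) tiny by (simp add: Q_def)
    then show ?thesis using solved_ext[OF _ U(1) U(3) N'] h j by blast
  qed
  then show ?thesis using U(1) unfolding injective_def by blast
qed

end

section \<open>Tiny submodules compatible with a pure submodule\<close>

lemma terms_supp: "e \<in> terms R G \<Longrightarrow> snd ` set e \<subseteq> G"
  by (induction e) auto

lemma terms_mono: "e \<in> terms R G \<Longrightarrow> snd ` set e \<subseteq> S \<Longrightarrow> e \<in> terms R S"
  by (induction e) auto

text \<open>Finitely many terms involve finitely many unknowns, which can be numbered. Systems whose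
  unknowns are arbitrary elements of a large module could not be counted; with numbered unknowns the
  terms form a tiny set.\<close>

lemma finite_terms_enum:
  assumes "finite E" "E \<subseteq> terms R G"
  obtains S and \<nu> :: "'g \<Rightarrow> nat" where "finite S" "S \<subseteq> G" "E \<subseteq> terms R S" "inj_on \<nu> S"
proof -
  define S where "S = (\<Union>e\<in>E. snd ` set e)"
  have fin: "finite S" using assms(1) by (simp add: S_def)
  obtain \<nu> :: "'g \<Rightarrow> nat" where "inj_on \<nu> S" using finite_imp_inj_to_nat_seg[OF fin] by metis
  moreover have "S \<subseteq> G" using terms_supp assms(2) unfolding S_def by blast
  moreover have "E \<subseteq> terms R S"
  proof
    fix e assume "e \<in> E"
    then show "e \<in> terms R S" using terms_mono[of e R G S] assms(2) by (auto simp: S_def)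
  qed
  ultimately show thesis using that fin by blast
qed

text \<open>A system of linear conditions in numbered unknowns w with parameters a: the flag
  \<open>True\<close> marks an equation with right-hand side a, the flag \<open>False\<close> a
  congruence to a modulo N.\<close>

definition sol :: "('r, 'a) module \<Rightarrow> 'a set \<Rightarrow> (bool \<times> ('r \<times> nat) list \<times> 'a) set \<Rightarrow> (nat \<Rightarrow> 'a) \<Rightarrow> bool" where
  "sol V N D w \<longleftrightarrow> (\<forall>(b, e, a)\<in>D. \<exists>n\<in>(if b then {\<zero>\<^bsub>V\<^esub>} else N). lc V w e = a \<oplus>\<^bsub>V\<^esub> n)"

context mod_univ
begin

lemma tiny_Fpow: assumes "tiny R A" shows "tiny R {S. finite S \<and> S \<subseteq> A}"
proof (rule tiny_subset[OF tiny_image[OF tiny_lists[OF assms], of set]])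
  show "{S. finite S \<and> S \<subseteq> A} \<subseteq> set ` lists A"
    by (auto simp: lists_eq_set image_iff) (metis finite_list)
qed

text \<open>A Loewenheim-Skolem argument. Starting from v and zero, each round adds sums, scalar
  multiples and one chosen solution for every solvable finite system with parameters already
  present. A tiny set admits only tiny many such systems, so countably many rounds stay
  tiny.\<close>

lemma tiny_solution_closed:
  fixes V :: "('r, 'a) module"
  assumes V: "left_module R V" and v: "v \<in> carrier V"
  obtains N' where "submod R V N'" "tiny R N'" "v \<in> N'"
    "\<And>D w. \<lbrakk>finite D; D \<subseteq> UNIV \<times> terms R UNIV \<times> N'; w \<in> UNIV \<rightarrow> carrier V; sol V N D w\<rbrakk> \<Longrightarrow>
      \<exists>w'\<in>UNIV \<rightarrow> N'. sol V N D w'"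
proof -
  interpret left_module R V by fact
  define data :: "'a set \<Rightarrow> (bool \<times> ('r \<times> nat) list \<times> 'a) set set"
    where "data A = {D. finite D \<and> D \<subseteq> UNIV \<times> terms R UNIV \<times> A}" for A
  define w where "w D = (SOME w. w \<in> UNIV \<rightarrow> carrier V \<and> sol V N D w)" for D
  have w: "w D \<in> UNIV \<rightarrow> carrier V \<and> sol V N D (w D)" if "w' \<in> UNIV \<rightarrow> carrier V" "sol V N D w'" for D w'
    unfolding w_def using someI[of "\<lambda>w. w \<in> UNIV \<rightarrow> carrier V \<and> sol V N D w" w'] that by blast
  define \<Phi> where "\<Phi> A = A \<union> (\<lambda>(x, y). x \<oplus>\<^bsub>V\<^esub> y) ` (A \<times> A) \<union> (\<lambda>(a, x). a \<odot>\<^bsub>V\<^esub> x) ` (carrier R \<times> A) \<union>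
    (\<lambda>(D, j). w D j) ` ({D \<in> data A. \<exists>w. w \<in> UNIV \<rightarrow> carrier V \<and> sol V N D w} \<times> UNIV)" for A
  define A where "A n = (\<Phi> ^^ n) {v, \<zero>\<^bsub>V\<^esub>}" for n
  have A_Suc: "A (Suc n) = \<Phi> (A n)" for n by (simp add: A_def)
  have AV: "A n \<subseteq> carrier V" for n
  proof (induction n)
    case (Suc n)
    have "w D j \<in> carrier V" if "\<exists>w. w \<in> UNIV \<rightarrow> carrier V \<and> sol V N D w" for D j using w that by blast
    with Suc show ?case unfolding A_Suc \<Phi>_def by auto
  qed (use v in \<open>simp add: A_def\<close>)
  have At: "tiny R (A n)" for n
  proof (induction n)
    case (Suc n)
    have "tiny R (data (A n))"
      unfolding data_def by (intro tiny_Fpow tiny_Times tiny_terms Suc tiny_nat tiny_finite) simp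
    then have "tiny R {D \<in> data (A n). \<exists>w. w \<in> UNIV \<rightarrow> carrier V \<and> sol V N D w}" by (rule tiny_subset) auto
    then show ?case unfolding A_Suc \<Phi>_def by (intro tiny_Un tiny_image tiny_Times Suc tiny_carrier tiny_nat)
  qed (simp add: A_def tiny_finite)
  have A_mono: "A m \<subseteq> A n" if "m \<le> n" for m n
    by (rule lift_Suc_mono_le[OF _ that]) (auto simp: A_Suc \<Phi>_def)
  define N' where "N' = (\<Union>n. A n)"
  have dir: "\<exists>n. S \<subseteq> A n" if S: "finite S" "S \<subseteq> N'" for S
  proof -
    have "\<exists>B\<in>range A. S \<subseteq> B"
    proof (rule finite_subset_directed[OF S(1)])
      fix B C assume "B \<in> range A" "C \<in> range A"
      then obtain m n where "B = A m" "C = A n" by blast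
      then show "\<exists>D\<in>range A. B \<union> C \<subseteq> D" using A_mono[of m "max m n"] A_mono[of n "max m n"] by auto
    qed (use S N'_def in auto)
    then show ?thesis by blast
  qed
  have "submod R V N'"
    unfolding submod_def
  proof (intro conjI ballI)
    show "N' \<subseteq> carrier V" using AV by (auto simp: N'_def)
    have "\<zero>\<^bsub>V\<^esub> \<in> A 0" by (simp add: A_def)
    then show "\<zero>\<^bsub>V\<^esub> \<in> N'" unfolding N'_def by blast
    fix x assume x: "x \<in> N'"
    show "x \<oplus>\<^bsub>V\<^esub> y \<in> N'" if y: "y \<in> N'" for y
    proof -
      obtain n where "x \<in> A n" "y \<in> A n" using dir[of "{x, y}"] x y by auto
      then have "x \<oplus>\<^bsub>V\<^esub> y \<in> (\<lambda>(x, y). x \<oplus>\<^bsub>V\<^esub> y) ` (A n \<times> A n)" by force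
      then have "x \<oplus>\<^bsub>V\<^esub> y \<in> A (Suc n)" unfolding A_Suc \<Phi>_def by blast
      then show ?thesis by (auto simp: N'_def)
    qed
    show "a \<odot>\<^bsub>V\<^esub> x \<in> N'" if "a \<in> carrier R" for a
    proof -
      obtain n where "x \<in> A n" using x by (auto simp: N'_def)
      then have "a \<odot>\<^bsub>V\<^esub> x \<in> (\<lambda>(a, x). a \<odot>\<^bsub>V\<^esub> x) ` (carrier R \<times> A n)" using that by force
      then have "a \<odot>\<^bsub>V\<^esub> x \<in> A (Suc n)" unfolding A_Suc \<Phi>_def by blast
      then show ?thesis by (auto simp: N'_def)
    qed
  qed
  moreover have "tiny R N'" unfolding N'_def by (rule tiny_UN[OF tiny_nat At])
  moreover have "v \<in> N'"
  proof -
    have "v \<in> A 0" by (simp add: A_def)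
    then show ?thesis unfolding N'_def by blast
  qed
  moreover have "\<exists>w'\<in>UNIV \<rightarrow> N'. sol V N D w'"
    if D: "finite D" "D \<subseteq> UNIV \<times> terms R UNIV \<times> N'" "w' \<in> UNIV \<rightarrow> carrier V" "sol V N D w'" for D w'
  proof -
    \<comment> \<open>The finitely many parameters are all present after some round n, so the chosen
      solution lies in round n + 1.\<close>
    have "finite ((\<lambda>(b, e, a). a) ` D)" "(\<lambda>(b, e, a). a) ` D \<subseteq> N'" using D by auto
    then obtain n where n: "(\<lambda>(b, e, a). a) ` D \<subseteq> A n" using dir by blast
    have "D \<in> data (A n)" using D(1,2) n unfolding data_def by fastforce
    then have "w D j \<in> (\<lambda>(D, j). w D j) ` ({D \<in> data (A n). \<exists>w. w \<in> UNIV \<rightarrow> carrier V \<and> sol V N D w} \<times> UNIV)" for j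
      using D(3,4) by (intro image_eqI[of _ _ "(D, j)"]) auto
    then have "w D j \<in> A (Suc n)" for j unfolding A_Suc \<Phi>_def by blast
    then show ?thesis using w[OF D(3,4)] by (intro bexI[of _ "w D"]) (auto simp: N'_def)
  qed
  ultimately show thesis using that by blast
qed

text \<open>With N' closed under solutions of finite systems, each purity claim is encoded as a
  system of type \<open>sol\<close>. Purity of N is used before the encoding in the first claim, to
  solve the system in V, and after it in the second, to improve the solution found in N'.\<close>

lemma tiny_pure_extension:
  fixes V :: "('r, 'a) module"
  assumes V: "left_module R V" and N: "pure_in R V N" and v: "v \<in> carrier V"
  shows "\<exists>N'. submod R V N' \<and> tiny R N' \<and> v \<in> N' \<and> pure_in R (V \<restriction> N') (N \<inter> N') \<and> pure_in R V (msum V N N')"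
proof -
  interpret left_module R V by fact
  note Nsub = pure_submod[OF N]
  note Ncl = submod_closed[OF Nsub]
  let ?n = "\<ominus>\<^bsub>R\<^esub> \<one>\<^bsub>R\<^esub>"
  obtain N' where N': "submod R V N'" "tiny R N'" "v \<in> N'"
    and slv: "\<And>D w. \<lbrakk>finite D; D \<subseteq> UNIV \<times> terms R UNIV \<times> N'; w \<in> UNIV \<rightarrow> carrier V; sol V N D w\<rbrakk> \<Longrightarrow>
      \<exists>w'\<in>UNIV \<rightarrow> N'. sol V N D w'"
    using tiny_solution_closed[OF V v, of N] by metis
  note N'cl = submod_closed[OF N'(1)]
  have inV: "x \<in> carrier V" if "x \<in> N \<or> x \<in> N'" for x using that Ncl(1) N'cl(1) by blast
  have "pure_in R (V \<restriction> N') (N \<inter> N')"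
    unfolding pure_in_def
  proof (intro conjI allI impI)
    show "submod R (V \<restriction> N') (N \<inter> N')" using submod_Int[OF Nsub N'(1)] submod_restr[OF N'(1)] by simp
    fix E assume "finite E \<and> E \<subseteq> terms R (carrier (V \<restriction> N')) \<and> (\<forall>e\<in>E. lc (V \<restriction> N') (\<lambda>s. s) e \<in> N \<inter> N')"
    then have E: "finite E" "E \<subseteq> terms R N'" and EN: "\<And>e. e \<in> E \<Longrightarrow> lc V (\<lambda>s. s) e \<in> N" by auto
    obtain S and \<nu> :: "'a \<Rightarrow> nat" where S: "finite S" "S \<subseteq> N'" and ES: "E \<subseteq> terms R S" and \<nu>: "inj_on \<nu> S"
      by (rule finite_terms_enum[OF E])
    have "(\<lambda>s. s) \<in> S \<rightarrow> carrier V" using S(2) inV by auto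
    then obtain d where d: "d \<in> S \<rightarrow> N" "\<And>e. e \<in> E \<Longrightarrow> lc V (\<lambda>s. s \<oplus>\<^bsub>V\<^esub> d s) e = \<zero>\<^bsub>V\<^esub>"
      using pure_lift[OF N E(1) ES _ EN] by metis
    \<comment> \<open>First system: the given terms vanish, and the unknown numbered
      \<open>\<nu> s\<close> is congruent to s modulo N. In V it is solved by s + d s. A solution in
      N' differs from s by a correction that lies in N by the congruence and in N' by
      closure.\<close>
    define D where "D = (\<lambda>e. (True, map (apsnd \<nu>) e, \<zero>\<^bsub>V\<^esub>)) ` E \<union> (\<lambda>s. (False, [(\<one>\<^bsub>R\<^esub>, \<nu> s)], s)) ` S"
    define w where "w j = (if j \<in> \<nu> ` S then inv_into S \<nu> j \<oplus>\<^bsub>V\<^esub> d (inv_into S \<nu> j) else \<zero>\<^bsub>V\<^esub>)" for j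
    have w\<nu>: "w (\<nu> s) = s \<oplus>\<^bsub>V\<^esub> d s" if "s \<in> S" for s using that \<nu> by (simp add: w_def)
    have sd: "s \<in> carrier V" "d s \<in> carrier V" "d s \<in> N" if "s \<in> S" for s using that S(2) d(1) inV by auto
    have "w \<in> UNIV \<rightarrow> carrier V" using sd by (auto simp: w_def inv_into_into)
    moreover have "finite D" using E(1) S(1) by (simp add: D_def)
    moreover have "D \<subseteq> UNIV \<times> terms R UNIV \<times> N'"
      using map_terms[of _ R S \<nu> UNIV] ES S(2) N'cl(2) by (auto simp: D_def)
    moreover have "sol V N D w"
    proof -
      have "lc V w (map (apsnd \<nu>) e) = \<zero>\<^bsub>V\<^esub>" if "e \<in> E" for e
        using lc_cong[of S "\<lambda>g. w (\<nu> g)" "\<lambda>s. s \<oplus>\<^bsub>V\<^esub> d s" e R V, OF w\<nu>] ES that d(2)[OF that] by (simp add: lc_map subset_iff)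
      then show ?thesis using sd w\<nu> by (auto simp: sol_def D_def smult_one)
    qed
    ultimately obtain w' where w': "w' \<in> UNIV \<rightarrow> N'" "sol V N D w'" using slv by blast
    \<comment> \<open>Elements outside S do not occur in E, so their correction can be zero.\<close>
    define d' where "d' s = (if s \<in> S then ?n \<odot>\<^bsub>V\<^esub> s \<oplus>\<^bsub>V\<^esub> w' (\<nu> s) else \<zero>\<^bsub>V\<^esub>)" for s
    have w'V: "w' j \<in> carrier V" "w' j \<in> N'" for j using w'(1) inV by auto
    have sum: "s \<oplus>\<^bsub>V\<^esub> d' s = w' (\<nu> s)" if "s \<in> S" for s
      using that sd w'V by (simp add: d'_def M.a_assoc[symmetric])
    have "d' s \<in> N \<inter> N'" if "s \<in> N'" for s
    proof (cases "s \<in> S")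
      case True
      then obtain n where n: "n \<in> N" "w' (\<nu> s) = s \<oplus>\<^bsub>V\<^esub> n"
        using bspec[OF w'(2)[unfolded sol_def], of "(False, [(\<one>\<^bsub>R\<^esub>, \<nu> s)], s)"] True w'V
        by (auto simp: D_def smult_one)
      then have "d' s = n" using True sd inV by (simp add: d'_def M.a_assoc[symmetric])
      moreover have "d' s \<in> N'" using True S(2) w'V N'cl by (auto simp: d'_def)
      ultimately show ?thesis using n by simp
    qed (use Ncl N'cl in \<open>simp add: d'_def\<close>)
    moreover have "lc V (\<lambda>s. s \<oplus>\<^bsub>V\<^esub> d' s) e = \<zero>\<^bsub>V\<^esub>" if e: "e \<in> E" for e
    proof -
      have "lc V (\<lambda>s. s \<oplus>\<^bsub>V\<^esub> d' s) e = lc V (\<lambda>s. w' (\<nu> s)) e"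
        using sum ES e by (intro lc_cong[of S _ _ e R]) auto
      also have "\<dots> = lc V w' (map (apsnd \<nu>) e)" by (simp add: lc_map)
      also have "\<dots> = \<zero>\<^bsub>V\<^esub>"
        using bspec[OF w'(2)[unfolded sol_def], of "(True, map (apsnd \<nu>) e, \<zero>\<^bsub>V\<^esub>)"] e by (auto simp: D_def)
      finally show ?thesis .
    qed
    ultimately show "\<exists>d\<in>carrier (V \<restriction> N') \<rightarrow> N \<inter> N'. \<forall>e\<in>E. lc (V \<restriction> N') (\<lambda>s. s \<oplus>\<^bsub>V \<restriction> N'\<^esub> d s) e = \<zero>\<^bsub>V \<restriction> N'\<^esub>"
      by (intro bexI[of _ d']) auto
  qed
  moreover have "pure_in R V (msum V N N')"
    unfolding pure_in_def
  proof (intro conjI allI impI)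
    note ms = submod_msum[OF V Nsub N'(1)]
    show "submod R V (msum V N N')" using ms by blast
    fix E assume "finite E \<and> E \<subseteq> terms R (carrier V) \<and> (\<forall>e\<in>E. lc V (\<lambda>s. s) e \<in> msum V N N')"
    then have E: "finite E" "E \<subseteq> terms R (carrier V)" and EN: "\<forall>e\<in>E. \<exists>n n'. lc V (\<lambda>s. s) e = n \<oplus>\<^bsub>V\<^esub> n' \<and> n \<in> N \<and> n' \<in> N'"
      by (simp_all add: msum_def)
    then obtain p q where pq: "\<And>e. e \<in> E \<Longrightarrow> p e \<in> N" "\<And>e. e \<in> E \<Longrightarrow> q e \<in> N'"
      "\<And>e. e \<in> E \<Longrightarrow> lc V (\<lambda>s. s) e = p e \<oplus>\<^bsub>V\<^esub> q e" by metis
    obtain S and \<nu> :: "'a \<Rightarrow> nat" where S: "finite S" "S \<subseteq> carrier V" and ES: "E \<subseteq> terms R S" and \<nu>: "inj_on \<nu> S"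
      by (rule finite_terms_enum[OF E])
    \<comment> \<open>Second system: a term with value p e + q e is congruent to the parameter q e
      modulo N. The elements s solve it in V, hence some w' solves it in N'. Then u = s - w' makes
      the terms vanish modulo N, purity of N supplies d, and the total correction d - w' lies in N +
      N'.\<close>
    define D where "D = (\<lambda>e. (False, map (apsnd \<nu>) e, q e)) ` E"
    define w where "w j = (if j \<in> \<nu> ` S then inv_into S \<nu> j else \<zero>\<^bsub>V\<^esub>)" for j
    have w\<nu>: "w (\<nu> s) = s" if "s \<in> S" for s using that \<nu> by (simp add: w_def)
    have "w \<in> UNIV \<rightarrow> carrier V" using S(2) \<nu> by (auto simp: w_def subset_iff)
    moreover have "finite D" using E(1) by (simp add: D_def)
    moreover have "D \<subseteq> UNIV \<times> terms R UNIV \<times> N'"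
      using map_terms[of _ R S \<nu> UNIV] ES pq by (auto simp: D_def)
    moreover have "sol V N D w"
    proof -
      have "lc V w (map (apsnd \<nu>) e) = q e \<oplus>\<^bsub>V\<^esub> p e" if "e \<in> E" for e
        using lc_cong[of S "\<lambda>g. w (\<nu> g)" "\<lambda>s. s" e R V, OF w\<nu>] ES that pq[OF that] inV
        by (simp add: lc_map subset_iff M.a_comm)
      then show ?thesis using pq by (auto simp: sol_def D_def)
    qed
    ultimately obtain w' where w': "w' \<in> UNIV \<rightarrow> N'" "sol V N D w'" using slv by blast
    have w'V: "w' j \<in> carrier V" "w' j \<in> N'" for j using w'(1) inV by auto
    define u where "u s = s \<oplus>\<^bsub>V\<^esub> ?n \<odot>\<^bsub>V\<^esub> w' (\<nu> s)" for s
    have uV: "u \<in> S \<rightarrow> carrier V" using S(2) w'V by (auto simp: u_def)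
    have "lc V u e \<in> N" if e: "e \<in> E" for e
    proof -
      have et: "e \<in> terms R S" using ES e by blast
      obtain m where m: "m \<in> N" "lc V (\<lambda>s. w' (\<nu> s)) e = q e \<oplus>\<^bsub>V\<^esub> m"
        using bspec[OF w'(2)[unfolded sol_def], of "(False, map (apsnd \<nu>) e, q e)"] e by (auto simp: D_def lc_map)
      have mem: "p e \<in> carrier V" "q e \<in> carrier V" "m \<in> carrier V" using pq e m inV by auto
      have "lc V u e = lc V (\<lambda>s. s) e \<oplus>\<^bsub>V\<^esub> lc V (\<lambda>s. ?n \<odot>\<^bsub>V\<^esub> w' (\<nu> s)) e"
        unfolding u_def[abs_def] using S(2) w'V by (intro lc_add[OF et]) auto
      also have "lc V (\<lambda>s. ?n \<odot>\<^bsub>V\<^esub> w' (\<nu> s)) e = ?n \<odot>\<^bsub>V\<^esub> (q e \<oplus>\<^bsub>V\<^esub> m)"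
        unfolding m(2)[symmetric] using w'V by (intro lc_neg[OF et]) auto
      also have "lc V (\<lambda>s. s) e \<oplus>\<^bsub>V\<^esub> ?n \<odot>\<^bsub>V\<^esub> (q e \<oplus>\<^bsub>V\<^esub> m) = (p e \<oplus>\<^bsub>V\<^esub> ?n \<odot>\<^bsub>V\<^esub> m) \<oplus>\<^bsub>V\<^esub> (q e \<oplus>\<^bsub>V\<^esub> ?n \<odot>\<^bsub>V\<^esub> q e)"
        using pq(3)[OF e] mem by (simp add: smult_r_distr M.a_ac del: add_neg neg_add)
      also have "\<dots> = p e \<oplus>\<^bsub>V\<^esub> ?n \<odot>\<^bsub>V\<^esub> m" using mem by simp
      finally show ?thesis using pq(1)[OF e] m(1) Ncl by simp
    qed
    then obtain d where d: "d \<in> S \<rightarrow> N" "\<And>e. e \<in> E \<Longrightarrow> lc V (\<lambda>s. u s \<oplus>\<^bsub>V\<^esub> d s) e = \<zero>\<^bsub>V\<^esub>"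
      using pure_lift[OF N E(1) ES uV] by metis
    define d' where "d' s = (if s \<in> S then d s \<oplus>\<^bsub>V\<^esub> ?n \<odot>\<^bsub>V\<^esub> w' (\<nu> s) else \<zero>\<^bsub>V\<^esub>)" for s
    have "d' \<in> carrier V \<rightarrow> msum V N N'"
    proof
      fix s assume "s \<in> carrier V"
      show "d' s \<in> msum V N N'"
      proof (cases "s \<in> S")
        case True
        then have "d s \<in> N" "?n \<odot>\<^bsub>V\<^esub> w' (\<nu> s) \<in> N'" using d(1) w'V N'cl by auto
        with True show ?thesis unfolding msum_def d'_def by auto
      qed (use submod_closed(2)[OF ms(1)] in \<open>simp add: d'_def\<close>)
    qed
    moreover have "lc V (\<lambda>s. s \<oplus>\<^bsub>V\<^esub> d' s) e = \<zero>\<^bsub>V\<^esub>" if e: "e \<in> E" for e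
    proof -
      have "s \<oplus>\<^bsub>V\<^esub> d' s = u s \<oplus>\<^bsub>V\<^esub> d s" if "s \<in> S" for s
      proof -
        have "s \<in> carrier V" "d s \<in> carrier V" "?n \<odot>\<^bsub>V\<^esub> w' (\<nu> s) \<in> carrier V" using that S(2) d(1) inV w'V by auto
        then show ?thesis using that by (simp add: d'_def u_def M.a_ac)
      qed
      then have "lc V (\<lambda>s. s \<oplus>\<^bsub>V\<^esub> d' s) e = lc V (\<lambda>s. u s \<oplus>\<^bsub>V\<^esub> d s) e"
        using ES e by (intro lc_cong[of S _ _ e R]) auto
      then show ?thesis using d(2)[OF e] by simp
    qed
    ultimately show "\<exists>d\<in>carrier V \<rightarrow> msum V N N'. \<forall>e\<in>E. lc V (\<lambda>s. s \<oplus>\<^bsub>V\<^esub> d s) e = \<zero>\<^bsub>V\<^esub>" by blast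
  qed
  ultimately show ?thesis using N' by blast
qed

end

text \<open>A finite system has its finitely many values in a single member of the family, and the
  purity of this member gives the correction.\<close>

lemma pure_union:
  assumes ne: "\<V> \<noteq> {}" and pure: "\<And>A. A \<in> \<V> \<Longrightarrow> pure_in R V A"
    and dir: "\<And>A B. A \<in> \<V> \<Longrightarrow> B \<in> \<V> \<Longrightarrow> \<exists>C\<in>\<V>. A \<union> B \<subseteq> C"
  shows "pure_in R V (\<Union>\<V>)"
  unfolding pure_in_def
proof (intro conjI allI impI)
  note cl = submod_closed[OF pure_submod[OF pure]]
  show "submod R V (\<Union>\<V>)"
    unfolding submod_def
  proof (intro conjI ballI)
    show "\<Union>\<V> \<subseteq> carrier V" using cl(1) by blast
    show "\<zero>\<^bsub>V\<^esub> \<in> \<Union>\<V>" using cl(2) ne by blast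
    fix x assume "x \<in> \<Union>\<V>"
    then obtain A where A: "A \<in> \<V>" "x \<in> A" by blast
    show "a \<odot>\<^bsub>V\<^esub> x \<in> \<Union>\<V>" if "a \<in> carrier R" for a using cl(4)[OF A(1) that A(2)] A(1) by blast
    fix y assume "y \<in> \<Union>\<V>"
    then obtain B where B: "B \<in> \<V>" "y \<in> B" by blast
    obtain C where "C \<in> \<V>" "x \<in> C" "y \<in> C" using dir[OF A(1) B(1)] A B by blast
    then show "x \<oplus>\<^bsub>V\<^esub> y \<in> \<Union>\<V>" using cl(3) by blast
  qed
  fix E assume E: "finite E \<and> E \<subseteq> terms R (carrier V) \<and> (\<forall>e\<in>E. lc V (\<lambda>s. s) e \<in> \<Union>\<V>)"
  then have "finite ((\<lambda>e. lc V (\<lambda>s. s) e) ` E)" "(\<lambda>e. lc V (\<lambda>s. s) e) ` E \<subseteq> \<Union>\<V>" by auto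
  then obtain A where A: "A \<in> \<V>" "(\<lambda>e. lc V (\<lambda>s. s) e) ` E \<subseteq> A"
    using finite_subset_directed[OF _ _ ne dir] by metis
  then have "\<forall>e\<in>E. lc V (\<lambda>s. s) e \<in> A" by blast
  with E have "finite E \<and> E \<subseteq> terms R (carrier V) \<and> (\<forall>e\<in>E. lc V (\<lambda>s. s) e \<in> A)" by simp
  moreover have "finite E \<and> E \<subseteq> terms R (carrier V) \<and> (\<forall>e\<in>E. lc V (\<lambda>s. s) e \<in> A) \<longrightarrow>
      (\<exists>d\<in>carrier V \<rightarrow> A. \<forall>e\<in>E. lc V (\<lambda>s. s \<oplus>\<^bsub>V\<^esub> d s) e = \<zero>\<^bsub>V\<^esub>)"
    using pure[OF A(1)] unfolding pure_in_def by (rule conjunct2[THEN spec])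
  ultimately obtain d where "d \<in> carrier V \<rightarrow> A" "\<forall>e\<in>E. lc V (\<lambda>s. s \<oplus>\<^bsub>V\<^esub> d s) e = \<zero>\<^bsub>V\<^esub>" by blast
  then show "\<exists>d\<in>carrier V \<rightarrow> \<Union>\<V>. \<forall>e\<in>E. lc V (\<lambda>s. s \<oplus>\<^bsub>V\<^esub> d s) e = \<zero>\<^bsub>V\<^esub>"
    using A(1) by (intro bexI[of _ d]) auto
qed

section \<open>Weakly terminal objects\<close>

context mod_fun
begin

text \<open>An element of the extension of \<^term>\<open>F\<close> to arbitrary modules \<^term>\<open>V\<close> on the universe, given by
  its restrictions to small submodules.\<close>

definition big :: "('r, 'u) module \<Rightarrow> ('u set \<Rightarrow> 'v) \<Rightarrow> bool" where
  "big V x \<longleftrightarrow> left_module R V \<and> (\<forall>P. submod R V P \<and> sm P \<longrightarrow> x P \<in> FF (V \<restriction> P)) \<and>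
     (\<forall>P Q. submod R V P \<and> submod R V Q \<and> sm Q \<and> P \<subseteq> Q \<longrightarrow> Fm (V \<restriction> P) (V \<restriction> Q) (\<lambda>x. x) (x Q) = x P)"

text \<open>The test modules V range over all modules on \<open>'u\<close>, including those too
  large to be objects. On objects this yields the usual notion (\<open>weakly_terminal_map\<close>);
  the large ones serve to bound chains in \<open>rigid_union_embeds\<close>.\<close>

definition weakly_terminal :: "('r, 'u) module \<times> 'v \<Rightarrow> bool" where
  "weakly_terminal Y \<longleftrightarrow> good Y \<and> (\<forall>V x. big V x \<longrightarrow>
     (\<exists>f. lin R V (fst Y) f \<and> (\<forall>P. submod R V P \<and> sm P \<longrightarrow> Fm (V \<restriction> P) (fst Y) f (snd Y) = x P)))"

text \<open>On a zero module the identity is the zero map, so by \<open>Fm_zero\<close> every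
  element of F there is neutral.\<close>

lemma zero_module_eq:
  assumes M: "M \<in> module_cat R" "carrier M = {\<zero>\<^bsub>M\<^esub>}" and x: "x \<in> FF M" "y \<in> FF M"
  shows "x = y"
proof -
  have "Fm M M (\<lambda>x. x) z = Fm M M (\<lambda>x. \<zero>\<^bsub>M\<^esub>) z" for z using Fm_cong[of M "\<lambda>x. x" "\<lambda>x. \<zero>\<^bsub>M\<^esub>" M] M(2) by auto
  then show ?thesis using Fm_id[OF M(1)] Fm_zero[OF M(1,1)] x by metis
qed

lemma pure_zero: assumes "left_module R V" shows "pure_in R V {\<zero>\<^bsub>V\<^esub>}"
proof -
  interpret left_module R V by fact
  show ?thesis
    unfolding pure_in_def
  proof (intro conjI allI impI)
    show "submod R V {\<zero>\<^bsub>V\<^esub>}" by (auto simp: submod_def)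
    fix E assume E: "finite E \<and> E \<subseteq> terms R (carrier V) \<and> (\<forall>e\<in>E. lc V (\<lambda>s. s) e \<in> {\<zero>\<^bsub>V\<^esub>})"
    have "lc V (\<lambda>s. s \<oplus>\<^bsub>V\<^esub> \<zero>\<^bsub>V\<^esub>) e = \<zero>\<^bsub>V\<^esub>" if "e \<in> E" for e
      using lc_cong[of "carrier V" "\<lambda>s. s \<oplus>\<^bsub>V\<^esub> \<zero>\<^bsub>V\<^esub>" "\<lambda>s. s" e R V] E that by auto
    then show "\<exists>d\<in>carrier V \<rightarrow> {\<zero>\<^bsub>V\<^esub>}. \<forall>e\<in>E. lc V (\<lambda>s. s \<oplus>\<^bsub>V\<^esub> d s) e = \<zero>\<^bsub>V\<^esub>"
      by (intro bexI[of _ "\<lambda>_. \<zero>\<^bsub>V\<^esub>"]) auto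
  qed
qed

lemma lin_msum:
  assumes V: "left_module R V" and A: "submod R V A" and B: "submod R V B" and M: "left_module R M"
    and f: "lin R (V \<restriction> A) M f" and g: "lin R (V \<restriction> B) M g" and eq: "\<And>x. x \<in> A \<Longrightarrow> x \<in> B \<Longrightarrow> f x = g x"
  obtains h where "lin R (V \<restriction> msum V A B) M h" "\<And>x. x \<in> A \<Longrightarrow> h x = f x" "\<And>x. x \<in> B \<Longrightarrow> h x = g x"
proof -
  interpret V: left_module R V by fact
  interpret M: left_module R M by fact
  let ?n = "\<ominus>\<^bsub>R\<^esub> \<one>\<^bsub>R\<^esub>"
  note Ac = submod_closed[OF A] and Bc = submod_closed[OF B]
  have fA: "f a \<in> carrier M" "a \<in> carrier V" if "a \<in> A" for a using lin_closed[OF f] Ac(1) that by auto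
  have gB: "g b \<in> carrier M" "b \<in> carrier V" if "b \<in> B" for b using lin_closed[OF g] Bc(1) that by auto
  have f_add: "f (a \<oplus>\<^bsub>V\<^esub> a') = f a \<oplus>\<^bsub>M\<^esub> f a'" if "a \<in> A" "a' \<in> A" for a a' using lin_add[OF f] that by simp
  have g_add: "g (a \<oplus>\<^bsub>V\<^esub> a') = g a \<oplus>\<^bsub>M\<^esub> g a'" if "a \<in> B" "a' \<in> B" for a a' using lin_add[OF g] that by simp
  have wd: "f a \<oplus>\<^bsub>M\<^esub> g b = f a' \<oplus>\<^bsub>M\<^esub> g b'"
    if m: "a \<in> A" "b \<in> B" "a' \<in> A" "b' \<in> B" and e: "a \<oplus>\<^bsub>V\<^esub> b = a' \<oplus>\<^bsub>V\<^esub> b'" for a b a' b'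
  proof -
    \<comment> \<open>The difference of two decompositions lies in both A and B, where f and g
      agree.\<close>
    define d where "d = a' \<oplus>\<^bsub>V\<^esub> ?n \<odot>\<^bsub>V\<^esub> a"
    have dA: "d \<in> A" using m Ac by (simp add: d_def)
    have a': "a' = a \<oplus>\<^bsub>V\<^esub> d" using fA m by (simp add: d_def V.M.a_lcomm)
    have "a \<oplus>\<^bsub>V\<^esub> b = a \<oplus>\<^bsub>V\<^esub> (d \<oplus>\<^bsub>V\<^esub> b')" using e a' fA[OF dA] fA m gB by (simp add: V.M.a_assoc)
    then have b: "b = d \<oplus>\<^bsub>V\<^esub> b'" using fA[OF dA] fA m gB by simp
    have "d = b \<oplus>\<^bsub>V\<^esub> ?n \<odot>\<^bsub>V\<^esub> b'" unfolding b using fA[OF dA] gB m by (simp add: V.M.a_assoc)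
    then have dB: "d \<in> B" using m Bc by simp
    have "f a' = f a \<oplus>\<^bsub>M\<^esub> f d" unfolding a' by (rule f_add[OF m(1) dA])
    moreover have "g b = g d \<oplus>\<^bsub>M\<^esub> g b'" unfolding b by (rule g_add[OF dB m(4)])
    ultimately show ?thesis using eq[OF dA dB] fA m gB dB by (simp add: M.M.a_assoc)
  qed
  define h where "h x = (SOME z. \<exists>a\<in>A. \<exists>b\<in>B. x = a \<oplus>\<^bsub>V\<^esub> b \<and> z = f a \<oplus>\<^bsub>M\<^esub> g b)" for x
  have h: "h (a \<oplus>\<^bsub>V\<^esub> b) = f a \<oplus>\<^bsub>M\<^esub> g b" if ab: "a \<in> A" "b \<in> B" for a b
    unfolding h_def
  proof (rule some_equality)
    fix z assume "\<exists>a'\<in>A. \<exists>b'\<in>B. a \<oplus>\<^bsub>V\<^esub> b = a' \<oplus>\<^bsub>V\<^esub> b' \<and> z = f a' \<oplus>\<^bsub>M\<^esub> g b'"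
    then obtain a' b' where "a' \<in> A" "b' \<in> B" "a \<oplus>\<^bsub>V\<^esub> b = a' \<oplus>\<^bsub>V\<^esub> b'" "z = f a' \<oplus>\<^bsub>M\<^esub> g b'" by blast
    then show "z = f a \<oplus>\<^bsub>M\<^esub> g b" using wd[OF ab, of a' b'] by simp
  qed (use ab in blast)
  have f0: "f \<zero>\<^bsub>V\<^esub> = \<zero>\<^bsub>M\<^esub>" using lin_zero[OF left_module_submod[OF V A] M f] by simp
  have g0: "g \<zero>\<^bsub>V\<^esub> = \<zero>\<^bsub>M\<^esub>" using lin_zero[OF left_module_submod[OF V B] M g] by simp
  have "lin R (V \<restriction> msum V A B) M h"
  proof (rule linI)
    fix x assume "x \<in> carrier (V \<restriction> msum V A B)"
    then obtain a b where x: "a \<in> A" "b \<in> B" "x = a \<oplus>\<^bsub>V\<^esub> b" by (auto simp: msum_def)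
    show "h x \<in> carrier M" using x h fA gB by simp
    show "h (r \<odot>\<^bsub>V \<restriction> msum V A B\<^esub> x) = r \<odot>\<^bsub>M\<^esub> h x" if r: "r \<in> carrier R" for r
    proof -
      have "h (r \<odot>\<^bsub>V\<^esub> a \<oplus>\<^bsub>V\<^esub> r \<odot>\<^bsub>V\<^esub> b) = f (r \<odot>\<^bsub>V\<^esub> a) \<oplus>\<^bsub>M\<^esub> g (r \<odot>\<^bsub>V\<^esub> b)" using x r Ac Bc by (intro h) auto
      then show ?thesis
        using x r fA gB lin_smult[OF f r, of a] lin_smult[OF g r, of b] h[OF x(1,2)] by (simp add: V.smult_r_distr M.smult_r_distr)
    qed
    fix y assume "y \<in> carrier (V \<restriction> msum V A B)"
    then obtain c d where y: "c \<in> A" "d \<in> B" "y = c \<oplus>\<^bsub>V\<^esub> d" by (auto simp: msum_def)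
    have "h ((a \<oplus>\<^bsub>V\<^esub> c) \<oplus>\<^bsub>V\<^esub> (b \<oplus>\<^bsub>V\<^esub> d)) = f (a \<oplus>\<^bsub>V\<^esub> c) \<oplus>\<^bsub>M\<^esub> g (b \<oplus>\<^bsub>V\<^esub> d)" using x y Ac Bc by (intro h) auto
    also have "\<dots> = (f a \<oplus>\<^bsub>M\<^esub> g b) \<oplus>\<^bsub>M\<^esub> (f c \<oplus>\<^bsub>M\<^esub> g d)"
      using x y fA gB by (simp add: f_add g_add M.add4)
    finally show "h (x \<oplus>\<^bsub>V \<restriction> msum V A B\<^esub> y) = h x \<oplus>\<^bsub>M\<^esub> h y"
      using x y fA gB h by (simp add: V.add4)
  qed
  moreover have "h x = f x" if "x \<in> A" for x using h[OF that Bc(2)] g0 fA[OF that] by simp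
  moreover have "h x = g x" if "x \<in> B" for x using h[OF Ac(2) that] f0 gB[OF that] by simp
  ultimately show thesis using that by blast
qed

text \<open>Zorn's lemma is applied to partial maps from pure submodules N of V that induce x on all
  small submodules of N. If a maximal N misses an element, \<open>tiny_pure_extension\<close> puts
  this element into a tiny N'. Injectivity of Y extends the map from the intersection to N', and the
  two maps combine on N + N', which is again pure.\<close>

lemma injective_weakly_terminal:
  assumes Y: "injective Y"
  shows "weakly_terminal Y"
  unfolding weakly_terminal_def
proof (intro conjI allI impI)
  show gY: "good Y" using Y by (simp add: injective_def)
  note Yc = goodD(1)[OF gY] and yF = goodD(2)[OF gY] and Ym = goodD(3)[OF gY]
  fix V x assume big: "big V x"
  then have V: "left_module R V" and xF: "\<And>P. submod R V P \<Longrightarrow> sm P \<Longrightarrow> x P \<in> FF (V \<restriction> P)"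
    and xr: "\<And>P Q. \<lbrakk>submod R V P; submod R V Q; sm Q; P \<subseteq> Q\<rbrakk> \<Longrightarrow> Fm (V \<restriction> P) (V \<restriction> Q) (\<lambda>x. x) (x Q) = x P"
    unfolding big_def by blast+
  interpret V: left_module R V by fact
  note rc = restr_cat[OF V]
  define ok where "ok N f \<longleftrightarrow> pure_in R V N \<and> lin R (V \<restriction> N) (fst Y) f \<and>
    (\<forall>P. submod R V P \<and> sm P \<and> P \<subseteq> N \<longrightarrow> Fm (V \<restriction> P) (fst Y) f (snd Y) = x P)" for N f
  \<comment> \<open>Partial maps are represented by their graphs, so that extension is inclusion and
    the bound of a chain is its union.\<close>
  define gr where "gr N f = (\<lambda>a. (a, f a)) ` N" for N and f :: "'u \<Rightarrow> 'u"
  define \<A> where "\<A> = {gr N f | N f. ok N f}"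
  have ok0: "ok {\<zero>\<^bsub>V\<^esub>} (\<lambda>_. \<zero>\<^bsub>fst Y\<^esub>)"
    unfolding ok_def
  proof (intro conjI allI impI)
    show "pure_in R V {\<zero>\<^bsub>V\<^esub>}" by (rule pure_zero[OF V])
    interpret Y: left_module R "fst Y" by (rule Ym)
    have z: "lin R (V \<restriction> P) (fst Y) (\<lambda>_. \<zero>\<^bsub>fst Y\<^esub>)" for P by (rule linI) simp_all
    show "lin R (V \<restriction> {\<zero>\<^bsub>V\<^esub>}) (fst Y) (\<lambda>_. \<zero>\<^bsub>fst Y\<^esub>)" by (rule z)
    fix P assume P: "submod R V P \<and> sm P \<and> P \<subseteq> {\<zero>\<^bsub>V\<^esub>}"
    then have "P = {\<zero>\<^bsub>V\<^esub>}" by (auto simp: submod_def)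
    then show "Fm (V \<restriction> P) (fst Y) (\<lambda>_. \<zero>\<^bsub>fst Y\<^esub>) (snd Y) = x P"
      using P by (intro zero_module_eq[of "V \<restriction> P"] rc Fm_closed Yc yF z xF) auto
  qed
  have un: "\<Union>\<C> \<in> \<A>" if ne: "\<C> \<noteq> {}" and ch: "subset.chain \<A> \<C>" for \<C>
  proof -
    have "\<exists>N f. C = gr N f \<and> ok N f" if "C \<in> \<C>" for C using ch that unfolding subset.chain_def \<A>_def by blast
    then obtain n g where ng: "\<And>C. C \<in> \<C> \<Longrightarrow> C = gr (n C) (g C) \<and> ok (n C) (g C)" by metis
    have tot: "C \<subseteq> D \<or> D \<subseteq> C" if "C \<in> \<C>" "D \<in> \<C>" for C D using ch that unfolding subset.chain_def by blast
    have sub: "n C \<subseteq> n D \<and> (\<forall>a\<in>n C. g D a = g C a)" if CD: "C \<in> \<C>" "D \<in> \<C>" "C \<subseteq> D" for C D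
    proof -
      have "gr (n C) (g C) \<subseteq> gr (n D) (g D)" using CD ng by metis
      then show ?thesis by (auto simp: gr_def)
    qed
    define N where "N = \<Union>(n ` \<C>)"
    define f where "f a = (SOME b. \<exists>C\<in>\<C>. a \<in> n C \<and> b = g C a)" for a
    have f: "f a = g C a" if C: "C \<in> \<C>" "a \<in> n C" for C a
      unfolding f_def
    proof (rule some_equality)
      fix b assume "\<exists>D\<in>\<C>. a \<in> n D \<and> b = g D a"
      then obtain D where "D \<in> \<C>" "a \<in> n D" "b = g D a" by blast
      then show "b = g C a" using tot[OF C(1), of D] sub[OF C(1), of D] sub[of D C] C by metis
    qed (use C in blast)
    have dir: "\<exists>C\<in>n ` \<C>. A \<union> B \<subseteq> C" if AB: "A \<in> n ` \<C>" "B \<in> n ` \<C>" for A B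
    proof -
      obtain C D where "C \<in> \<C>" "D \<in> \<C>" "A = n C" "B = n D" using AB by blast
      then show ?thesis using tot[of C D] sub[of C D] sub[of D C] by blast
    qed
    have dir2: "\<exists>C\<in>\<C>. a \<in> n C \<and> b \<in> n C" if ab: "a \<in> N" "b \<in> N" for a b
    proof -
      obtain C D where "C \<in> \<C>" "D \<in> \<C>" "a \<in> n C" "b \<in> n D" using ab unfolding N_def by blast
      then show ?thesis using tot[of C D] sub[of C D] sub[of D C] by blast
    qed
    have okn: "pure_in R V (n C)" "lin R (V \<restriction> n C) (fst Y) (g C)"
      "\<And>P. \<lbrakk>submod R V P; sm P; P \<subseteq> n C\<rbrakk> \<Longrightarrow> Fm (V \<restriction> P) (fst Y) (g C) (snd Y) = x P" if "C \<in> \<C>" for C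
      using ng[OF that] unfolding ok_def by blast+
    note cl = submod_closed[OF pure_submod[OF okn(1)]]
    have pN: "pure_in R V N" unfolding N_def by (rule pure_union[OF _ _ dir]) (use ne okn in auto)
    have fl: "lin R (V \<restriction> N) (fst Y) f"
    proof (rule linI)
      fix a b assume ab: "a \<in> carrier (V \<restriction> N)" "b \<in> carrier (V \<restriction> N)"
      then obtain C where C: "C \<in> \<C>" "a \<in> n C" "b \<in> n C" using dir2 by auto
      then show "f (a \<oplus>\<^bsub>V \<restriction> N\<^esub> b) = f a \<oplus>\<^bsub>fst Y\<^esub> f b"
        using f cl(3) lin_add[OF okn(2), of C a b] by simp
    next
      fix a assume a: "a \<in> carrier (V \<restriction> N)"
      then obtain C where C: "C \<in> \<C>" "a \<in> n C" using dir2 by auto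
      then show "f a \<in> carrier (fst Y)" using f lin_closed[OF okn(2), of C a] by simp
      fix r assume "r \<in> carrier R"
      then show "f (r \<odot>\<^bsub>V \<restriction> N\<^esub> a) = r \<odot>\<^bsub>fst Y\<^esub> f a"
        using C f cl(4) lin_smult[OF okn(2), of C r a] by simp
    qed
    \<comment> \<open>A small P inside the union may lie in no member of the chain; it is exhausted
      by its intersections with the members.\<close>
    have "Fm (V \<restriction> P) (fst Y) f (snd Y) = x P" if P: "submod R V P \<and> sm P \<and> P \<subseteq> N" for P
    proof -
      have Pc: "V \<restriction> P \<in> module_cat R" using P by (intro rc) auto
      have flP: "lin R (V \<restriction> P) (fst Y) f" using lin_restr_dom[OF fl, of P] P by simp
      show ?thesis
      proof (rule union_sep[OF Pc Fm_closed[OF Pc Yc flP yF], of _ "(\<lambda>C. P \<inter> n C) ` \<C>"])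
        show "x P \<in> FF (V \<restriction> P)" using xF P by blast
        show "\<Union> ((\<lambda>C. P \<inter> n C) ` \<C>) = carrier (V \<restriction> P)" using P by (auto simp: N_def)
        show "\<exists>C\<in>(\<lambda>C. P \<inter> n C) ` \<C>. A \<union> B \<subseteq> C" if AB: "A \<in> (\<lambda>C. P \<inter> n C) ` \<C>" "B \<in> (\<lambda>C. P \<inter> n C) ` \<C>" for A B
        proof -
          obtain C D where "C \<in> \<C>" "D \<in> \<C>" "A = P \<inter> n C" "B = P \<inter> n D" using AB by blast
          then show ?thesis using tot[of C D] sub[of C D] sub[of D C] by blast
        qed
        fix A assume "A \<in> (\<lambda>C. P \<inter> n C) ` \<C>"
        then obtain C where C: "C \<in> \<C>" "A = P \<inter> n C" by blast
        have A: "submod R V A" using C P submod_Int pure_submod[OF okn(1)] by blast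
        have sA: "sm A" using P C small_subset by blast
        show "submod R (V \<restriction> P) A" using A C submod_restr[of R V P A] P by blast
        have "Fm (V \<restriction> A) (V \<restriction> P) (\<lambda>x. x) (Fm (V \<restriction> P) (fst Y) f (snd Y)) = Fm (V \<restriction> A) (fst Y) f (snd Y)"
          using Fm_comp[OF rc[OF A sA] Pc Yc lin_incl flP yF] C by simp
        also have "\<dots> = Fm (V \<restriction> A) (fst Y) (g C) (snd Y)"
          using Fm_cong[of "V \<restriction> A" f "g C"] f[OF C(1)] C(2) by simp
        also have "\<dots> = x A" using okn(3)[OF C(1) A sA] C(2) by simp
        also have "\<dots> = Fm (V \<restriction> A) (V \<restriction> P) (\<lambda>x. x) (x P)" using xr[OF A, of P] P C(2) by simp
        finally show "Fm (V \<restriction> P \<restriction> A) (V \<restriction> P) (\<lambda>x. x) (Fm (V \<restriction> P) (fst Y) f (snd Y)) =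
          Fm (V \<restriction> P \<restriction> A) (V \<restriction> P) (\<lambda>x. x) (x P)" by simp
      qed (use ne in blast)
    qed
    then have "ok N f" using pN fl unfolding ok_def by blast
    moreover have "\<Union>\<C> = gr N f"
    proof -
      have "gr N f = (\<Union>C\<in>\<C>. gr (n C) f)" by (auto simp: gr_def N_def)
      also have "\<dots> = (\<Union>C\<in>\<C>. gr (n C) (g C))" using f by (auto simp: gr_def)
      also have "\<dots> = \<Union>\<C>" using ng by auto
      finally show ?thesis by simp
    qed
    ultimately show ?thesis unfolding \<A>_def by blast
  qed
  have "\<A> \<noteq> {}" using ok0 unfolding \<A>_def by blast
  from subset_Zorn_nonempty[OF this un] obtain G where G: "G \<in> \<A>" "\<forall>H\<in>\<A>. G \<subseteq> H \<longrightarrow> H = G" by blast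
  then obtain N f where N: "ok N f" "G = gr N f" unfolding \<A>_def by blast
  have pN: "pure_in R V N" and fl: "lin R (V \<restriction> N) (fst Y) f"
    and fx: "\<And>P. \<lbrakk>submod R V P; sm P; P \<subseteq> N\<rbrakk> \<Longrightarrow> Fm (V \<restriction> P) (fst Y) f (snd Y) = x P"
    using N(1) unfolding ok_def by blast+
  note Nsub = pure_submod[OF pN]
  have "N = carrier V"
  proof (rule ccontr)
    assume "N \<noteq> carrier V"
    then obtain v where v: "v \<in> carrier V" "v \<notin> N" using submod_closed(1)[OF Nsub] by blast
    obtain N' where N': "submod R V N'" "tiny R N'" "v \<in> N'" "pure_in R (V \<restriction> N') (N \<inter> N')"
      "pure_in R V (msum V N N')" using tiny_pure_extension[OF V pN v(1)] by blast
    have sN': "sm N'" by (rule small_tiny[OF N'(2)])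
    have N'c: "V \<restriction> N' \<in> module_cat R" by (rule rc[OF N'(1) sN'])
    let ?D = "N \<inter> N'"
    have Dsub: "submod R V ?D" by (rule submod_Int[OF Nsub N'(1)])
    have sD: "sm ?D" by (rule small_subset[OF sN']) blast
    have "task Y (V \<restriction> N') ?D (x N') f"
      unfolding task_def
    proof (intro conjI)
      show "lin R (V \<restriction> N' \<restriction> ?D) (fst Y) f" using lin_restr_dom[OF fl, of ?D] by simp
      show "Fm (V \<restriction> N' \<restriction> ?D) (fst Y) f (snd Y) = Fm (V \<restriction> N' \<restriction> ?D) (V \<restriction> N') (\<lambda>x. x) (x N')"
        using fx[OF Dsub sD] xr[OF Dsub N'(1) sN'] by simp
    qed (use N'c N' xF sN' in auto)
    then have "solved Y (V \<restriction> N') ?D (x N') f" using Y N'(2) unfolding injective_def by simp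
    then obtain g where g: "lin R (V \<restriction> N') (fst Y) g" "\<And>a. a \<in> ?D \<Longrightarrow> g a = f a"
      "Fm (V \<restriction> N') (fst Y) g (snd Y) = x N'" unfolding solved_def by blast
    obtain h where h: "lin R (V \<restriction> msum V N N') (fst Y) h"
      and hf: "\<And>a. a \<in> N \<Longrightarrow> h a = f a" and hg: "\<And>a. a \<in> N' \<Longrightarrow> h a = g a"
      by (rule lin_msum[OF V Nsub N'(1) Ym fl g(1)]) (use g(2) in auto)
    note ms = submod_msum[OF V Nsub N'(1)]
    have "Fm (V \<restriction> P) (fst Y) h (snd Y) = x P" if P: "submod R V P \<and> sm P \<and> P \<subseteq> msum V N N'" for P
    proof -
      \<comment> \<open>N need not be small, so the square of N and N' is replaced by its part
        relevant to P. A collects the components in N that occur, Q = A + N' contains P, and A meets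
        N' exactly where N does; hence \<open>pure_square_sep\<close> applies to A and N'.\<close>
      define A where "A = N \<inter> msum V P N'"
      define Q where "Q = msum V A N'"
      have msP: "submod R V (msum V P N')" "P \<subseteq> msum V P N'" "N' \<subseteq> msum V P N'"
        using submod_msum[OF V _ N'(1)] P by blast+
      have smsum: "sm (msum V B N')" if "sm B" for B
      proof -
        have "msum V B N' = (\<lambda>(a, b). a \<oplus>\<^bsub>V\<^esub> b) ` (B \<times> N')" by (auto simp: msum_def)
        then show ?thesis using small_image[OF small_Times[OF that sN']] by simp
      qed
      have A: "submod R V A" unfolding A_def by (rule submod_Int[OF Nsub msP(1)])
      have sA: "sm A" by (rule small_subset[OF smsum[of P]]) (use P in \<open>auto simp: A_def\<close>)
      have Q: "submod R V Q" "A \<subseteq> Q" "N' \<subseteq> Q" unfolding Q_def using submod_msum[OF V A N'(1)] by blast+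
      have sQ: "sm Q" unfolding Q_def by (rule smsum[OF sA])
      have QN: "Q \<subseteq> msum V N N'" unfolding Q_def A_def msum_def by blast
      have "P \<subseteq> Q"
      proof
        fix p assume p: "p \<in> P"
        then obtain a b where ab: "a \<in> N" "b \<in> N'" "p = a \<oplus>\<^bsub>V\<^esub> b" using P unfolding msum_def by blast
        then have abV: "a \<in> carrier V" "b \<in> carrier V" using submod_closed(1) Nsub N'(1) by blast+
        let ?m = "(\<ominus>\<^bsub>R\<^esub> \<one>\<^bsub>R\<^esub>) \<odot>\<^bsub>V\<^esub> b"
        have "?m \<in> N'" using submod_closed(4)[OF N'(1) _ ab(2)] by simp
        moreover have "a = p \<oplus>\<^bsub>V\<^esub> ?m" using ab abV by (simp add: V.M.a_assoc)
        ultimately have "a \<in> msum V P N'" using p unfolding msum_def by blast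
        then show "p \<in> Q" using ab unfolding Q_def A_def msum_def by blast
      qed
      have AN': "A \<inter> N' = ?D" using msP(3) by (auto simp: A_def)
      have Ac: "V \<restriction> A \<in> module_cat R" and Qc: "V \<restriction> Q \<in> module_cat R" using rc A sA Q sQ by blast+
      have hQ: "lin R (V \<restriction> Q) (fst Y) h" using lin_restr_dom[OF h, of Q] QN by simp
      have "Fm (V \<restriction> Q) (fst Y) h (snd Y) = x Q"
      proof (rule pure_square_sep[of "V \<restriction> A" "V \<restriction> N'" ?D "\<lambda>x. x" "V \<restriction> Q" "\<lambda>x. x" "\<lambda>x. x"])
        show "pure_square R (V \<restriction> A) (V \<restriction> N') ?D (\<lambda>x. x) (V \<restriction> Q) (\<lambda>x. x) (\<lambda>x. x)"
          unfolding pure_square_def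
        proof (intro conjI ballI impI)
          show "lin R (V \<restriction> N' \<restriction> ?D) (V \<restriction> A) (\<lambda>x. x)" using lin_incl[of ?D A R V] AN' by auto
          show "\<exists>a\<in>carrier (V \<restriction> A). \<exists>b\<in>carrier (V \<restriction> N'). q = a \<oplus>\<^bsub>V \<restriction> Q\<^esub> b" if "q \<in> carrier (V \<restriction> Q)" for q
            using that by (auto simp: Q_def msum_def)
          fix a b assume ab: "a \<in> carrier (V \<restriction> A)" "b \<in> carrier (V \<restriction> N')" "a \<oplus>\<^bsub>V \<restriction> Q\<^esub> b = \<zero>\<^bsub>V \<restriction> Q\<^esub>"
          then have abV: "a \<in> carrier V" "b \<in> carrier V" using submod_closed(1)[OF A] submod_closed(1)[OF N'(1)] by auto
          have "b \<oplus>\<^bsub>V\<^esub> a = \<zero>\<^bsub>V\<^esub>" using ab abV by (simp add: V.M.a_comm)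
          then have "b = (\<ominus>\<^bsub>R\<^esub> \<one>\<^bsub>R\<^esub>) \<odot>\<^bsub>V\<^esub> a" using abV by (intro V.eq_neg)
          then have "b \<in> A" using submod_closed(4)[OF A, of "\<ominus>\<^bsub>R\<^esub> \<one>\<^bsub>R\<^esub>" a] ab by simp
          then show "b \<in> ?D" using ab by (auto simp: A_def)
          show "a \<oplus>\<^bsub>V \<restriction> A\<^esub> b = \<zero>\<^bsub>V \<restriction> A\<^esub>" using ab by simp
        qed (use Ac N'c Qc N'(4) lin_incl[OF Q(2)] lin_incl[OF Q(3)] in auto)
        show "Fm (V \<restriction> Q) (fst Y) h (snd Y) \<in> FF (V \<restriction> Q)" by (rule Fm_closed[OF Qc Yc hQ yF])
        show "x Q \<in> FF (V \<restriction> Q)" by (rule xF[OF Q(1) sQ])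
        have "Fm (V \<restriction> A) (V \<restriction> Q) (\<lambda>x. x) (Fm (V \<restriction> Q) (fst Y) h (snd Y)) = Fm (V \<restriction> A) (fst Y) h (snd Y)"
          using Fm_comp[OF Ac Qc Yc lin_incl[OF Q(2)] hQ yF] by simp
        also have "\<dots> = Fm (V \<restriction> A) (fst Y) f (snd Y)"
          using Fm_cong[of "V \<restriction> A" h f] hf by (simp add: A_def)
        also have "\<dots> = x A" by (rule fx[OF A sA]) (simp add: A_def)
        finally show "Fm (V \<restriction> A) (V \<restriction> Q) (\<lambda>x. x) (Fm (V \<restriction> Q) (fst Y) h (snd Y)) = Fm (V \<restriction> A) (V \<restriction> Q) (\<lambda>x. x) (x Q)"
          using xr[OF A Q(1) sQ Q(2)] by simp
        have "Fm (V \<restriction> N') (V \<restriction> Q) (\<lambda>x. x) (Fm (V \<restriction> Q) (fst Y) h (snd Y)) = Fm (V \<restriction> N') (fst Y) h (snd Y)"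
          using Fm_comp[OF N'c Qc Yc lin_incl[OF Q(3)] hQ yF] by simp
        also have "\<dots> = Fm (V \<restriction> N') (fst Y) g (snd Y)"
          using Fm_cong[of "V \<restriction> N'" h g] hg by simp
        finally show "Fm (V \<restriction> N') (V \<restriction> Q) (\<lambda>x. x) (Fm (V \<restriction> Q) (fst Y) h (snd Y)) = Fm (V \<restriction> N') (V \<restriction> Q) (\<lambda>x. x) (x Q)"
          using xr[OF N'(1) Q(1) sQ Q(3)] g(3) by simp
      qed
      moreover have "Fm (V \<restriction> P) (V \<restriction> Q) (\<lambda>x. x) (Fm (V \<restriction> Q) (fst Y) h (snd Y)) = Fm (V \<restriction> P) (fst Y) h (snd Y)"
        using Fm_comp[OF rc Qc Yc lin_incl[OF \<open>P \<subseteq> Q\<close>] hQ yF] P by simp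
      ultimately show ?thesis using xr[OF _ Q(1) sQ \<open>P \<subseteq> Q\<close>] P by simp
    qed
    then have "ok (msum V N N') h" unfolding ok_def using N'(5) h by blast
    then have "gr (msum V N N') h \<in> \<A>" unfolding \<A>_def by blast
    moreover have "gr N f \<subseteq> gr (msum V N N') h" using ms(2) hf by (auto simp: gr_def)
    ultimately have "gr (msum V N N') h = gr N f" using G(2) N(2) by blast
    moreover have "(v, h v) \<in> gr (msum V N N') h" using ms(3) N'(3) by (auto simp: gr_def)
    ultimately show False using v(2) by (auto simp: gr_def)
  qed
  then have "Fm (V \<restriction> P) (fst Y) f (snd Y) = x P" if "submod R V P \<and> sm P" for P
    using fx[of P] that submod_closed(1)[of R V P] by simp
  moreover have "lin R V (fst Y) f" using fl \<open>N = carrier V\<close> by simp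
  ultimately show "\<exists>f. lin R V (fst Y) f \<and> (\<forall>P. submod R V P \<and> sm P \<longrightarrow> Fm (V \<restriction> P) (fst Y) f (snd Y) = x P)"
    by blast
qed

lemma big_small:
  assumes "good X"
  shows "big (fst X) (\<lambda>P. Fm (fst X \<restriction> P) (fst X) (\<lambda>x. x) (snd X))"
  unfolding big_def using goodD[OF assms] Fm_restr restr_closed by blast

lemma weakly_terminal_map:
  assumes Y: "weakly_terminal Y" and X: "good X"
  obtains f where "lin R (fst X) (fst Y) f" "Fm (fst X) (fst Y) f (snd Y) = snd X"
proof -
  obtain f where f: "lin R (fst X) (fst Y) f"
    "\<forall>P. submod R (fst X) P \<and> sm P \<longrightarrow> Fm (fst X \<restriction> P) (fst Y) f (snd Y) = Fm (fst X \<restriction> P) (fst X) (\<lambda>x. x) (snd X)"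
    using Y big_small[OF X] unfolding weakly_terminal_def by blast
  have "submod R (fst X) (carrier (fst X))" using left_module.submod_carrier[OF goodD(3)[OF X]] .
  moreover have "sm (carrier (fst X))" using module_catD(2)[OF goodD(1)[OF X]] .
  ultimately have "Fm (fst X) (fst Y) f (snd Y) = Fm (fst X) (fst X) (\<lambda>x. x) (snd X)" using f(2) by fastforce
  then show thesis using that f(1) Fm_id[OF goodD(1,2)[OF X]] by simp
qed

lemma weakly_terminal_ext:
  assumes Y: "weakly_terminal Y" and Z: "good Z" and g: "lin R (fst Y) (fst Z) g" "Fm (fst Y) (fst Z) g (snd Z) = snd Y"
  shows "weakly_terminal Z"
  unfolding weakly_terminal_def
proof (intro conjI allI impI)
  have gY: "good Y" using Y by (simp add: weakly_terminal_def)
  fix V x assume big: "big V x"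
  then have V: "left_module R V" by (simp add: big_def)
  obtain f where f: "lin R V (fst Y) f" "\<forall>P. submod R V P \<and> sm P \<longrightarrow> Fm (V \<restriction> P) (fst Y) f (snd Y) = x P"
    using Y big unfolding weakly_terminal_def by blast
  have "Fm (V \<restriction> P) (fst Z) (\<lambda>a. g (f a)) (snd Z) = x P" if P: "submod R V P \<and> sm P" for P
  proof -
    have Pc: "V \<restriction> P \<in> module_cat R" using restr_cat[OF V] P by blast
    have "lin R (V \<restriction> P) (fst Y) f" using lin_restr_dom[OF f(1) submod_closed(1)] P by blast
    from Fm_comp[OF Pc goodD(1)[OF gY] goodD(1)[OF Z] this g(1) goodD(2)[OF Z]]
    show ?thesis using g(2) f(2) P by simp
  qed
  then show "\<exists>f. lin R V (fst Z) f \<and> (\<forall>P. submod R V P \<and> sm P \<longrightarrow> Fm (V \<restriction> P) (fst Z) f (snd Z) = x P)"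
    using lin_comp[OF f(1) g(1)] by blast
qed (rule Z)

end

section \<open>Minimality\<close>

lemma lin_inj_on:
  assumes "left_module R M" "left_module R N" "lin R M N f"
    and "\<And>x. x \<in> carrier M \<Longrightarrow> f x = \<zero>\<^bsub>N\<^esub> \<Longrightarrow> x = \<zero>\<^bsub>M\<^esub>"
  shows "inj_on f (carrier M)"
proof (rule inj_onI)
  interpret M: left_module R M by fact
  interpret N: left_module R N by fact
  fix x y assume xy: "x \<in> carrier M" "y \<in> carrier M" "f x = f y"
  let ?n = "\<ominus>\<^bsub>R\<^esub> \<one>\<^bsub>R\<^esub>"
  have "f (x \<oplus>\<^bsub>M\<^esub> ?n \<odot>\<^bsub>M\<^esub> y) = \<zero>\<^bsub>N\<^esub>"
    using xy lin_closed[OF assms(3)] by (simp add: lin_add[OF assms(3)] lin_smult[OF assms(3)])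
  then have "x \<oplus>\<^bsub>M\<^esub> ?n \<odot>\<^bsub>M\<^esub> y = \<zero>\<^bsub>M\<^esub>" using assms(4) xy by simp
  then have "x = ?n \<odot>\<^bsub>M\<^esub> (?n \<odot>\<^bsub>M\<^esub> y)" using xy by (intro M.eq_neg) auto
  then show "x = y" using xy by (simp add: M.smult_assoc[symmetric] M.R.l_minus M.smult_one)
qed

lemma inj_on_directed:
  assumes "\<And>A. A \<in> \<V> \<Longrightarrow> inj_on f A" "\<And>A B. A \<in> \<V> \<Longrightarrow> B \<in> \<V> \<Longrightarrow> \<exists>C\<in>\<V>. A \<union> B \<subseteq> C"
  shows "inj_on f (\<Union>\<V>)"
proof (rule inj_onI)
  fix x y assume xy: "x \<in> \<Union>\<V>" "y \<in> \<Union>\<V>" "f x = f y"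
  then obtain C where "C \<in> \<V>" "x \<in> C" "y \<in> C" using assms(2) by blast
  with xy(3) assms(1) show "x = y" by (meson inj_onD)
qed

lemma dcolim_iso:
  assumes D: "dcolim R I po M e L c" and L': "left_module R L'" and \<theta>: "lin R L L' \<theta>" "bij_betw \<theta> (carrier L) (carrier L')"
  shows "dcolim R I po M e L' (\<lambda>i x. \<theta> (c i x))"
proof -
  have L: "left_module R L" using D by (simp add: dcolim_def)
  have c: "lin R (M i) L (c i)" if "i \<in> I" for i using D that unfolding dcolim_def by meson
  have inj: "inj_on \<theta> (carrier L)" and surj: "carrier L' = \<theta> ` carrier L" using \<theta>(2) by (auto simp: bij_betw_def)
  have z: "\<theta> \<zero>\<^bsub>L\<^esub> = \<zero>\<^bsub>L'\<^esub>" by (rule lin_zero[OF L L' \<theta>(1)])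
  have zc: "\<zero>\<^bsub>L\<^esub> \<in> carrier L" using abelian_groupE(2)[OF left_module.axioms(2)[OF L]] .
  show ?thesis
    unfolding dcolim_def
  proof (intro conjI ballI impI)
    show "lin R (M i) L' (\<lambda>x. \<theta> (c i x))" if "i \<in> I" for i using lin_comp[OF c[OF that] \<theta>(1)] .
    show "\<theta> (c j (e i j x)) = \<theta> (c i x)" if "i \<in> I" "j \<in> I" "po i j" "x \<in> carrier (M i)" for i j x
      using D that unfolding dcolim_def by metis
    show "\<exists>i\<in>I. \<exists>x\<in>carrier (M i). y = \<theta> (c i x)" if y: "y \<in> carrier L'" for y
    proof -
      obtain l where l: "l \<in> carrier L" "y = \<theta> l" using y surj by blast
      then obtain i x where "i \<in> I" "x \<in> carrier (M i)" "l = c i x" using D unfolding dcolim_def by meson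
      then show ?thesis using l by blast
    qed
    show "\<exists>j\<in>I. po i j \<and> e i j x = \<zero>\<^bsub>M j\<^esub>" if i: "i \<in> I" "x \<in> carrier (M i)" "\<theta> (c i x) = \<zero>\<^bsub>L'\<^esub>" for i x
    proof -
      have "c i x = \<zero>\<^bsub>L\<^esub>" using inj_onD[OF inj _ lin_closed[OF c[OF i(1)] i(2)] zc] i(3) z by simp
      then show ?thesis using D i unfolding dcolim_def by meson
    qed
  qed (rule L')
qed

section \<open>Kernels of endomorphisms of a weakly terminal object\<close>

context mod_fun
begin

definition mor :: "('r, 'u) module \<times> 'v \<Rightarrow> ('r, 'u) module \<times> 'v \<Rightarrow> ('u \<Rightarrow> 'u) \<Rightarrow> bool" where
  "mor X Y f \<longleftrightarrow> lin R (fst X) (fst Y) f \<and> Fm (fst X) (fst Y) f (snd Y) = snd X"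

lemma mor_comp:
  assumes "good X" "good Y" "good Z" "mor X Y f" "mor Y Z g"
  shows "mor X Z (\<lambda>x. g (f x))"
  using Fm_comp[OF goodD(1)[OF assms(1)] goodD(1)[OF assms(2)] goodD(1)[OF assms(3)], of f g "snd Z"]
    lin_comp[of R "fst X" "fst Y" f "fst Z" g] goodD(2)[OF assms(3)] assms(4,5)
  by (simp add: mor_def)

lemma mor_id: "good X \<Longrightarrow> mor X X (\<lambda>x. x)"
  by (simp add: mor_def lin_id Fm_id good_def)

lemma mor_ext: "mor X Y (\<lambda>x. x) \<longleftrightarrow> ext X Y"
  by (simp add: mor_def ext_def)

lemma mor_closed: "mor X Y f \<Longrightarrow> x \<in> carrier (fst X) \<Longrightarrow> f x \<in> carrier (fst Y)"
  using lin_closed[of R "fst X" "fst Y" f x] by (simp add: mor_def)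

lemma weakly_terminal_good: "weakly_terminal Y \<Longrightarrow> good Y"
  by (simp add: weakly_terminal_def)

lemma weakly_terminal_mor: "weakly_terminal Y \<Longrightarrow> good X \<Longrightarrow> \<exists>f. mor X Y f"
  unfolding mor_def using weakly_terminal_map by metis

text \<open>All stages carry the same element of F and the transition maps preserve it, so the
  constant family is compatible and glues to an element on the colimit.\<close>

lemma constant_colimit:
  fixes I :: "'i set"
  assumes Y: "good Y" and I: "sm I" and S: "dsystem R I po (\<lambda>_. fst Y) e"
    and e: "\<And>i j. \<lbrakk>i \<in> I; j \<in> I; po i j\<rbrakk> \<Longrightarrow> mor Y Y (e i j)"
  obtains L c where "good L" "dcolim R I po (\<lambda>_. fst Y) e (fst L) c" "\<And>i. i \<in> I \<Longrightarrow> mor Y L (c i)"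
proof -
  obtain L0 :: "('r, ('i \<times> 'u) set) module" and c0 :: "'i \<Rightarrow> 'u \<Rightarrow> ('i \<times> 'u) set"
    where D0: "dcolim R I po (\<lambda>_. fst Y) e L0 c0"
    by (rule directed_colimit_exists[OF ring S])
  have L0: "left_module R L0" using D0 by (simp add: dcolim_def)
  have "carrier L0 \<subseteq> (\<Union>i\<in>I. c0 i ` carrier (fst Y))"
  proof
    fix y assume "y \<in> carrier L0"
    moreover have "\<forall>y\<in>carrier L0. \<exists>i\<in>I. \<exists>x\<in>carrier (fst Y). y = c0 i x" using D0 unfolding dcolim_def by meson
    ultimately obtain i x where "i \<in> I" "x \<in> carrier (fst Y)" "y = c0 i x" by meson
    then show "y \<in> (\<Union>i\<in>I. c0 i ` carrier (fst Y))" by auto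
  qed
  moreover have "sm (\<Union>i\<in>I. c0 i ` carrier (fst Y))"
    by (intro small_UN I small_image module_catD(2) goodD(1) Y)
  ultimately have "sm (carrier L0)" using small_subset by blast
  then obtain L :: "('r, 'u) module" and \<theta> where L: "L \<in> module_cat R" "lin R L0 L \<theta>" "bij_betw \<theta> (carrier L0) (carrier L)"
    by (rule small_copy[OF L0])
  define c where "c i x = \<theta> (c0 i x)" for i x
  have D: "dcolim R I po (\<lambda>_. fst Y) e L c"
    unfolding c_def[abs_def] by (rule dcolim_iso[OF D0 module_catD(1)[OF L(1)] L(2,3)])
  have "\<exists>l\<in>FF L. \<forall>i\<in>I. Fm (fst Y) L (c i) l = snd Y"
  proof (rule colim_glue[OF S I _ D L(1)])
    show "Fm (fst Y) (fst Y) (e i j) (snd Y) = snd Y" if "i \<in> I" "j \<in> I" "po i j" for i j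
      using e[OF that] by (simp add: mor_def)
  qed (use goodD[OF Y] in auto)
  then obtain l where l: "l \<in> FF L" "\<forall>i\<in>I. Fm (fst Y) L (c i) l = snd Y" by blast
  have "lin R (fst Y) L (c i)" if "i \<in> I" for i using D that unfolding dcolim_def by blast
  then show thesis using that[of "(L, l)" c] L(1) l D by (simp add: good_def mor_def)
qed

text \<open>A transfinite chain of endomorphisms with strictly increasing kernels, organised as a
  set of triples \<^term>\<open>(a, b, e)\<close>: indices are elements of the module, \<^term>\<open>e\<close> is the transition map
  from \<^term>\<open>a\<close> to \<^term>\<open>b\<close>, and \<^term>\<open>a\<close> is annihilated by the map from \<^term>\<open>0\<close> to \<^term>\<open>a\<close> but by no
  earlier one.  Zorn's lemma replaces the transfinite recursion.\<close>

definition kernel_chain :: "('r, 'u) module \<times> 'v \<Rightarrow> ('u \<times> 'u \<times> ('u \<Rightarrow> 'u)) set \<Rightarrow> bool" where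
  "kernel_chain Y T \<longleftrightarrow>
     (\<forall>a b e. (a, b, e) \<in> T \<longrightarrow> a \<in> carrier (fst Y) \<and> b \<in> carrier (fst Y) \<and> mor Y Y e \<and>
        (a, a, \<lambda>x. x) \<in> T \<and> (b, b, \<lambda>x. x) \<in> T) \<and>
     (\<forall>a b e e'. (a, b, e) \<in> T \<and> (a, b, e') \<in> T \<longrightarrow> (\<forall>x\<in>carrier (fst Y). e x = e' x)) \<and>
     (\<forall>a b c e e'. (a, b, e) \<in> T \<and> (b, c, e') \<in> T \<longrightarrow>
        (\<exists>e''. (a, c, e'') \<in> T \<and> (\<forall>x\<in>carrier (fst Y). e'' x = e' (e x)))) \<and>
     (\<forall>a b e e'. (a, a, e) \<in> T \<and> (b, b, e') \<in> T \<longrightarrow> (\<exists>d. (a, b, d) \<in> T \<or> (b, a, d) \<in> T)) \<and>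
     (\<zero>\<^bsub>fst Y\<^esub>, \<zero>\<^bsub>fst Y\<^esub>, \<lambda>x. x) \<in> T \<and>
     (\<forall>a e. (a, a, e) \<in> T \<longrightarrow> (\<exists>d. (\<zero>\<^bsub>fst Y\<^esub>, a, d) \<in> T)) \<and>
     (\<forall>a e. (\<zero>\<^bsub>fst Y\<^esub>, a, e) \<in> T \<longrightarrow> e a = \<zero>\<^bsub>fst Y\<^esub>)"

lemma kernel_chain_arrow:
  assumes "kernel_chain Y T" "(a, b, e) \<in> T"
  shows "a \<in> carrier (fst Y)" "b \<in> carrier (fst Y)" "mor Y Y e" "(a, a, \<lambda>x. x) \<in> T" "(b, b, \<lambda>x. x) \<in> T"
proof -
  have "\<forall>a b e. (a, b, e) \<in> T \<longrightarrow> a \<in> carrier (fst Y) \<and> b \<in> carrier (fst Y) \<and> mor Y Y e \<and>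
      (a, a, \<lambda>x. x) \<in> T \<and> (b, b, \<lambda>x. x) \<in> T"
    using assms(1) unfolding kernel_chain_def by (rule conjunct1)
  from this[rule_format, OF assms(2)]
  show "a \<in> carrier (fst Y)" "b \<in> carrier (fst Y)" "mor Y Y e" "(a, a, \<lambda>x. x) \<in> T" "(b, b, \<lambda>x. x) \<in> T"
    by simp_all
qed

lemma kernel_chainD:
  assumes "kernel_chain Y T"
  shows kernel_chain_eq: "\<lbrakk>(a, b, e) \<in> T; (a, b, e') \<in> T; x \<in> carrier (fst Y)\<rbrakk> \<Longrightarrow> e x = e' x"
    and kernel_chain_comp: "\<lbrakk>(a, b, e) \<in> T; (b, c, e') \<in> T\<rbrakk> \<Longrightarrow>
      \<exists>e''. (a, c, e'') \<in> T \<and> (\<forall>x\<in>carrier (fst Y). e'' x = e' (e x))"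
    and kernel_chain_total: "\<lbrakk>(a, a, e) \<in> T; (b, b, e') \<in> T\<rbrakk> \<Longrightarrow> \<exists>d. (a, b, d) \<in> T \<or> (b, a, d) \<in> T"
    and kernel_chain_zero: "(\<zero>\<^bsub>fst Y\<^esub>, \<zero>\<^bsub>fst Y\<^esub>, \<lambda>x. x) \<in> T"
    and kernel_chain_bottom: "(a, a, e) \<in> T \<Longrightarrow> \<exists>d. (\<zero>\<^bsub>fst Y\<^esub>, a, d) \<in> T"
    and kernel_chain_kills: "(\<zero>\<^bsub>fst Y\<^esub>, a, e) \<in> T \<Longrightarrow> e a = \<zero>\<^bsub>fst Y\<^esub>"
proof -
  note C = assms[unfolded kernel_chain_def, THEN conjunct2]
  show "\<lbrakk>(a, b, e) \<in> T; (a, b, e') \<in> T; x \<in> carrier (fst Y)\<rbrakk> \<Longrightarrow> e x = e' x"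
    using C[THEN conjunct1, rule_format, OF conjI] by simp
  note C = C[THEN conjunct2]
  show "\<lbrakk>(a, b, e) \<in> T; (b, c, e') \<in> T\<rbrakk> \<Longrightarrow> \<exists>e''. (a, c, e'') \<in> T \<and> (\<forall>x\<in>carrier (fst Y). e'' x = e' (e x))"
    using C[THEN conjunct1, THEN spec[of _ a], THEN spec[of _ b], THEN spec[of _ c], THEN spec[of _ e], THEN spec[of _ e']] by simp
  note C = C[THEN conjunct2]
  show "\<lbrakk>(a, a, e) \<in> T; (b, b, e') \<in> T\<rbrakk> \<Longrightarrow> \<exists>d. (a, b, d) \<in> T \<or> (b, a, d) \<in> T"
    using C[THEN conjunct1, THEN spec[of _ a], THEN spec[of _ b], THEN spec[of _ e], THEN spec[of _ e']] by simp
  note C = C[THEN conjunct2]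
  show "(\<zero>\<^bsub>fst Y\<^esub>, \<zero>\<^bsub>fst Y\<^esub>, \<lambda>x. x) \<in> T" using C by (rule conjunct1)
  note C = C[THEN conjunct2]
  show "(a, a, e) \<in> T \<Longrightarrow> \<exists>d. (\<zero>\<^bsub>fst Y\<^esub>, a, d) \<in> T"
    using C[THEN conjunct1, THEN spec[of _ a], THEN spec[of _ e]] by simp
  show "(\<zero>\<^bsub>fst Y\<^esub>, a, e) \<in> T \<Longrightarrow> e a = \<zero>\<^bsub>fst Y\<^esub>"
    using C[THEN conjunct2, THEN spec[of _ a], THEN spec[of _ e]] by simp
qed

lemma kernel_chain_Union:
  assumes ne: "\<C> \<noteq> {}" and ch: "subset.chain {T. kernel_chain Y T} \<C>"
  shows "kernel_chain Y (\<Union>\<C>)"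
proof -
  have kc: "kernel_chain Y T" if "T \<in> \<C>" for T using ch that unfolding subset.chain_def by blast
  have two: "\<exists>T\<in>\<C>. p \<in> T \<and> q \<in> T" if "p \<in> \<Union>\<C>" "q \<in> \<Union>\<C>" for p q
    using ch that unfolding subset.chain_def by blast
  show ?thesis
    unfolding kernel_chain_def
  proof (intro conjI allI impI)
    fix a b e assume "(a, b, e) \<in> \<Union>\<C>"
    then obtain T where T: "T \<in> \<C>" "(a, b, e) \<in> T" by (rule UnionE)
    show "a \<in> carrier (fst Y)" "b \<in> carrier (fst Y)" "mor Y Y e" "(a, a, \<lambda>x. x) \<in> \<Union>\<C>" "(b, b, \<lambda>x. x) \<in> \<Union>\<C>"
      using kernel_chain_arrow(1-3)[OF kc[OF T(1)] T(2)] UnionI[OF T(1) kernel_chain_arrow(4)[OF kc[OF T(1)] T(2)]]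
        UnionI[OF T(1) kernel_chain_arrow(5)[OF kc[OF T(1)] T(2)]] by simp_all
  next
    fix a b e e' assume "(a, b, e) \<in> \<Union>\<C> \<and> (a, b, e') \<in> \<Union>\<C>"
    then obtain T where T: "T \<in> \<C>" "(a, b, e) \<in> T" "(a, b, e') \<in> T" using two by meson
    then show "\<forall>x\<in>carrier (fst Y). e x = e' x" using kernel_chain_eq[OF kc[OF T(1)] T(2,3)] by simp
  next
    fix a b c e e' assume "(a, b, e) \<in> \<Union>\<C> \<and> (b, c, e') \<in> \<Union>\<C>"
    then obtain T where T: "T \<in> \<C>" "(a, b, e) \<in> T" "(b, c, e') \<in> T" using two by meson
    show "\<exists>e''. (a, c, e'') \<in> \<Union>\<C> \<and> (\<forall>x\<in>carrier (fst Y). e'' x = e' (e x))"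
      using kernel_chain_comp[OF kc[OF T(1)] T(2,3)] T(1) by (meson UnionI)
  next
    fix a b e e' assume "(a, a, e) \<in> \<Union>\<C> \<and> (b, b, e') \<in> \<Union>\<C>"
    then obtain T where T: "T \<in> \<C>" "(a, a, e) \<in> T" "(b, b, e') \<in> T" using two by meson
    show "\<exists>d. (a, b, d) \<in> \<Union>\<C> \<or> (b, a, d) \<in> \<Union>\<C>"
      using kernel_chain_total[OF kc[OF T(1)] T(2,3)] T(1) by (meson UnionI)
  next
    obtain T where T: "T \<in> \<C>" using ne by blast
    show "(\<zero>\<^bsub>fst Y\<^esub>, \<zero>\<^bsub>fst Y\<^esub>, \<lambda>x. x) \<in> \<Union>\<C>" using UnionI[OF T kernel_chain_zero[OF kc[OF T]]] .
  next
    fix a e assume "(a, a, e) \<in> \<Union>\<C>"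
    then obtain T where T: "T \<in> \<C>" "(a, a, e) \<in> T" by (rule UnionE)
    show "\<exists>d. (\<zero>\<^bsub>fst Y\<^esub>, a, d) \<in> \<Union>\<C>"
      using kernel_chain_bottom[OF kc[OF T(1)] T(2)] T(1) by (meson UnionI)
  next
    fix a e assume "(\<zero>\<^bsub>fst Y\<^esub>, a, e) \<in> \<Union>\<C>"
    then obtain T where T: "T \<in> \<C>" "(\<zero>\<^bsub>fst Y\<^esub>, a, e) \<in> T" by (rule UnionE)
    show "e a = \<zero>\<^bsub>fst Y\<^esub>" by (rule kernel_chain_kills[OF kc[OF T(1)] T(2)])
  qed
qed

text \<open>A maximal chain is followed to its colimit L and back to Y by weak terminality; g is
  this composite on the bottom stage. If h g killed an element a that g does not kill, the chain
  could be prolonged by a stage a, contrary to maximality.\<close>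

lemma kernel_stable_endo:
  assumes wt: "weakly_terminal Y"
  shows "\<exists>g. mor Y Y g \<and> (\<forall>h a. mor Y Y h \<and> a \<in> carrier (fst Y) \<and> h (g a) = \<zero>\<^bsub>fst Y\<^esub> \<longrightarrow> g a = \<zero>\<^bsub>fst Y\<^esub>)"
proof -
  have Y: "good Y" by (rule weakly_terminal_good[OF wt])
  note Ym = goodD(3)[OF Y]
  interpret Y: left_module R "fst Y" by (rule Ym)
  let ?W = "carrier (fst Y)" and ?z = "\<zero>\<^bsub>fst Y\<^esub>"
  have "kernel_chain Y {(?z, ?z, \<lambda>x. x)}" using mor_id[OF Y] by (simp add: kernel_chain_def)
  then have "{T. kernel_chain Y T} \<noteq> {}" by blast
  then have "\<exists>T\<in>{T. kernel_chain Y T}. \<forall>T'\<in>{T. kernel_chain Y T}. T \<subseteq> T' \<longrightarrow> T' = T"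
    by (rule subset_Zorn_nonempty) (use kernel_chain_Union in blast)
  then obtain T where T: "kernel_chain Y T" and max: "\<And>T'. kernel_chain Y T' \<Longrightarrow> T \<subseteq> T' \<Longrightarrow> T' = T" by blast
  have T1: "a \<in> ?W" "b \<in> ?W" "mor Y Y e" "(a, a, \<lambda>x. x) \<in> T" "(b, b, \<lambda>x. x) \<in> T" if "(a, b, e) \<in> T" for a b e
    using kernel_chain_arrow[OF T that] by simp_all
  note T2 = kernel_chain_eq[OF T] and T3 = kernel_chain_comp[OF T] and T4 = kernel_chain_total[OF T]
    and T5 = kernel_chain_zero[OF T] and T6 = kernel_chain_bottom[OF T] and T7 = kernel_chain_kills[OF T]
  \<comment> \<open>A stage is present when its identity triple is. E picks one transition map for
    each related pair; by \<open>T2\<close> the choice affects only values off the carrier.\<close>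
  define I where "I = {a. (a, a, \<lambda>x. x) \<in> T}"
  define po where "po a b \<longleftrightarrow> (\<exists>e. (a, b, e) \<in> T)" for a b
  define E where "E a b = (SOME e. (a, b, e) \<in> T)" for a b
  have E: "(a, b, E a b) \<in> T" if "po a b" for a b using that unfolding po_def E_def by (rule someI_ex)
  have Em: "mor Y Y (E a b)" if "po a b" for a b using T1(3)[OF E[OF that]] .
  have Eeq: "E a b x = e x" if "(a, b, e) \<in> T" "x \<in> ?W" for a b e x
    using T2[OF E that(1)] that unfolding po_def by blast
  have S: "dsystem R I po (\<lambda>_. fst Y) E"
    unfolding dsystem_def
  proof (intro conjI ballI impI)
    show "I \<noteq> {}" using T5 unfolding I_def by blast
    show "po i i" if "i \<in> I" for i using that unfolding I_def po_def by blast
    show "po i k" if "po i j" "po j k" for i j k using T3 that unfolding po_def by blast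
    show "\<exists>k\<in>I. po i k \<and> po j k" if ij: "i \<in> I" "j \<in> I" for i j
    proof -
      have "po i i" "po j j" using ij unfolding I_def po_def by blast+
      moreover have "po i j \<or> po j i" using T4 ij unfolding I_def po_def by blast
      ultimately show ?thesis using ij by blast
    qed
    show "lin R (fst Y) (fst Y) (E i j)" if "po i j" for i j using Em[OF that] by (simp add: mor_def)
    show "E i i x = x" if "i \<in> I" "x \<in> ?W" for i x using Eeq[of i i "\<lambda>x. x" x] that unfolding I_def by blast
    show "E j k (E i j x) = E i k x" if "po i j" "po j k" "x \<in> ?W" for i j k x
      using T3[OF E[OF that(1)] E[OF that(2)]] Eeq that(3) by metis
  qed (rule Ym)
  have "I \<subseteq> ?W" using T1(1) unfolding I_def by blast
  then have "sm I" using small_subset module_catD(2)[OF goodD(1)[OF Y]] by blast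
  obtain L c where L: "good L" and D: "dcolim R I po (\<lambda>_. fst Y) E (fst L) c" and c: "\<forall>i\<in>I. mor Y L (c i)"
    by (rule constant_colimit[OF Y \<open>sm I\<close> S Em]) blast+
  obtain t where t: "mor L Y t" using weakly_terminal_mor[OF wt L] by blast
  have tc: "mor Y Y (\<lambda>x. t (c i x))" if "i \<in> I" for i using mor_comp[OF Y L Y _ t] c that by blast
  have c_E: "c j (E i j x) = c i x" if "i \<in> I" "j \<in> I" "po i j" "x \<in> ?W" for i j x
    using D that unfolding dcolim_def by meson
  have 0: "?z \<in> I" using T5 by (simp add: I_def)
  define g where "g x = t (c ?z x)" for x
  have g: "mor Y Y g" unfolding g_def[abs_def] by (rule tc[OF 0])
  have fld: "a \<in> I \<and> b \<in> I" if "(a, b, e) \<in> T" for a b e using T1[OF that] by (simp add: I_def)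
  have "g a = ?z" if h: "mor Y Y h" "a \<in> ?W" "h (g a) = ?z" for h a
  proof (rule ccontr)
    assume ga: "g a \<noteq> ?z"
    \<comment> \<open>An index is killed on the way from zero to its own stage, hence by g, which
      factors through that stage.\<close>
    have aI: "a \<notin> I"
    proof
      assume aI: "a \<in> I"
      then obtain d where d: "(?z, a, d) \<in> T" using T6 unfolding I_def by blast
      have "E ?z a a = ?z" using Eeq[OF d h(2)] T7[OF d] by simp
      moreover have "c a (E ?z a a) = c ?z a" using c_E[OF 0 aI _ h(2)] d unfolding po_def by blast
      ultimately have "g a = t (c a ?z)" by (simp add: g_def)
      also have "\<dots> = ?z" using lin_zero[OF Ym Ym, of "\<lambda>x. t (c a x)"] tc[OF aI] by (simp add: mor_def)
      finally show False using ga by simp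
    qed
    \<comment> \<open>The maps into the new stage a. They are compatible with the transitions
      because the c i form a cocone, and the one from zero is h g, which kills a as a kernel chain
      demands.\<close>
    define k where "k i x = h (t (c i x))" for i x
    have k: "mor Y Y (k i)" if "i \<in> I" for i unfolding k_def[abs_def] by (rule mor_comp[OF Y Y Y tc[OF that] h(1)])
    define T' where "T' = T \<union> {(i, a, k i) | i. i \<in> I} \<union> {(a, a, \<lambda>x. x)}"
    have T': "(x, y, e) \<in> T' \<longleftrightarrow> (x, y, e) \<in> T \<or> y = a \<and> (x \<in> I \<and> e = k x \<or> x = a \<and> e = (\<lambda>x. x))" for x y e
      by (auto simp: T'_def)
    have no: "(a, y, e) \<notin> T" "(y, a, e) \<notin> T" for y e using fld aI by blast+
    have k_T: "k x v = k y (e v)" if "(x, y, e) \<in> T" "v \<in> ?W" for x y e v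
    proof -
      have "c y (E x y v) = c x v" using c_E[of x y v] fld[OF that(1)] that unfolding po_def by blast
      then show ?thesis using Eeq[OF that] by (simp add: k_def)
    qed
    have "kernel_chain Y T'"
      unfolding kernel_chain_def
    proof (intro conjI allI impI)
      fix x y e assume xy: "(x, y, e) \<in> T'"
      show "x \<in> ?W" "y \<in> ?W" using xy T1(1,2) h(2) \<open>I \<subseteq> ?W\<close> unfolding T' by blast+
      show "mor Y Y e" using xy T1(3) k mor_id[OF Y] unfolding T' by blast
      show "(x, x, \<lambda>x. x) \<in> T'" "(y, y, \<lambda>x. x) \<in> T'" using xy T1(4,5) unfolding T' I_def by blast+
    next
      fix x y e e' assume "(x, y, e) \<in> T' \<and> (x, y, e') \<in> T'"
      then show "\<forall>v\<in>?W. e v = e' v" using T2 no aI unfolding T' by metis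
    next
      fix x y z e e' assume xyz: "(x, y, e) \<in> T' \<and> (y, z, e') \<in> T'"
      show "\<exists>e''. (x, z, e'') \<in> T' \<and> (\<forall>v\<in>?W. e'' v = e' (e v))"
      proof (cases "(y, z, e') \<in> T")
        case True
        then have "(x, y, e) \<in> T" using xyz no unfolding T' by blast
        then show ?thesis using T3[OF _ True] unfolding T' by blast
      next
        case False
        then have z: "z = a" "y \<in> I \<and> e' = k y \<or> y = a \<and> e' = (\<lambda>x. x)" using xyz unfolding T' by blast+
        show ?thesis
        proof (cases "y = a")
          case True
          then have "e' = (\<lambda>x. x)" using z aI by blast
          then show ?thesis using xyz True z(1) by (intro exI[of _ e]) simp
        next
          case False
          then have y: "y \<in> I" "e' = k y" "(x, y, e) \<in> T" using z xyz unfolding T' by blast+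
          then show ?thesis using k_T[OF y(3)] z(1) fld[OF y(3)] unfolding T' by (intro exI[of _ "k x"]) simp
        qed
      qed
    next
      fix x y e e' assume "(x, x, e) \<in> T' \<and> (y, y, e') \<in> T'"
      then have "x \<in> I \<or> x = a" "y \<in> I \<or> y = a" using fld unfolding T' by blast+
      then show "\<exists>d. (x, y, d) \<in> T' \<or> (y, x, d) \<in> T'"
        using T4 unfolding T' I_def by blast
    next
      show "(?z, ?z, \<lambda>x. x) \<in> T'" using T5 by (simp add: T')
    next
      fix x e assume "(x, x, e) \<in> T'"
      then show "\<exists>d. (?z, x, d) \<in> T'" using T6 0 unfolding T' by blast
    next
      fix x e assume "(?z, x, e) \<in> T'"
      then have "(?z, x, e) \<in> T \<or> x = a \<and> e = k ?z" using 0 aI unfolding T' by blast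
      then show "e x = ?z" using T7 h(3) by (auto simp: k_def g_def)
    qed
    then have "T' = T" by (rule max) (auto simp: T'_def)
    moreover have "(a, a, \<lambda>x. x) \<in> T'" by (simp add: T')
    ultimately show False using no by blast
  qed
  with g show ?thesis by blast
qed

section \<open>Objects whose outgoing morphisms are injective\<close>

definition rigid :: "('r, 'u) module \<times> 'v \<Rightarrow> bool" where
  "rigid X \<longleftrightarrow> good X \<and> (\<forall>C h. good C \<and> mor X C h \<longrightarrow> inj_on h (carrier (fst X)))"

text \<open>L is the colimit of Y under iteration of the g from \<open>kernel_stable_endo\<close>.
  An element of L comes from some stage n, hence in the form g a from stage n + 1. If a morphism out
  of L kills it, composing with a map back to Y gives an endomorphism of Y that kills g a, so g a is
  already zero.\<close>

lemma rigid_exists: "\<exists>L. weakly_terminal L \<and> rigid L"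
proof -
  obtain Y where "injective Y" using injective_exists by blast
  then have wt: "weakly_terminal Y" by (rule injective_weakly_terminal)
  then have Y: "good Y" by (rule weakly_terminal_good)
  note Ym = goodD(3)[OF Y]
  obtain g where g: "mor Y Y g"
    and g_ker: "\<And>h a. mor Y Y h \<Longrightarrow> a \<in> carrier (fst Y) \<Longrightarrow> h (g a) = \<zero>\<^bsub>fst Y\<^esub> \<Longrightarrow> g a = \<zero>\<^bsub>fst Y\<^esub>"
    using kernel_stable_endo[OF wt] by blast
  have gn: "mor Y Y (g ^^ n)" for n
  proof (induction n)
    case (Suc n)
    then show ?case using mor_comp[OF Y Y Y Suc g] by (simp add: comp_def)
  qed (use mor_id[OF Y] in \<open>simp add: id_def\<close>)
  have S: "dsystem R (UNIV :: nat set) (\<le>) (\<lambda>_. fst Y) (\<lambda>m n. g ^^ (n - m))"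
    unfolding dsystem_def
  proof (intro conjI ballI impI)
    show "\<exists>k\<in>UNIV. i \<le> k \<and> j \<le> k" for i j :: nat by (intro bexI[of _ "max i j"]) auto
    show "(g ^^ (k - j)) ((g ^^ (j - i)) x) = (g ^^ (k - i)) x" if "i \<le> j" "j \<le> k" for i j k :: nat and x
    proof -
      have "k - i = (k - j) + (j - i)" using that by simp
      then show ?thesis by (simp add: funpow_add)
    qed
  qed (use Ym gn in \<open>auto simp: mor_def\<close>)
  obtain L c where L: "good L" and D: "dcolim R (UNIV :: nat set) (\<le>) (\<lambda>_. fst Y) (\<lambda>m n. g ^^ (n - m)) (fst L) c"
    and c: "\<forall>i. mor Y L (c i)"
    by (rule constant_colimit[OF Y small_tiny[OF tiny_nat] S gn]) blast
  have wL: "weakly_terminal L"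
    using weakly_terminal_ext[OF wt L, of "c 0"] c by (simp add: mor_def)
  have "inj_on h (carrier (fst L))" if h: "good C" "mor L C h" for C h
  proof (rule lin_inj_on[OF goodD(3)[OF L] goodD(3)[OF h(1)]])
    show "lin R (fst L) (fst C) h" using h by (simp add: mor_def)
    fix l assume l: "l \<in> carrier (fst L)" "h l = \<zero>\<^bsub>fst C\<^esub>"
    obtain n a where a: "a \<in> carrier (fst Y)" "l = c n a" using D l(1) unfolding dcolim_def by blast
    have "c (Suc n) ((g ^^ (Suc n - n)) a) = c n a"
      using D a(1) unfolding dcolim_def by (meson UNIV_I le_SucI order_refl)
    then have ga: "l = c (Suc n) (g a)" using a(2) by simp
    obtain t where t: "mor C Y t" using weakly_terminal_mor[OF wt h(1)] by blast
    have "mor Y Y (\<lambda>x. t (h (c (Suc n) x)))"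
      using mor_comp[OF Y h(1) Y mor_comp[OF Y L h(1) _ h(2)] t] c by blast
    moreover have "t (h (c (Suc n) (g a))) = \<zero>\<^bsub>fst Y\<^esub>"
      using l(2) ga lin_zero[OF goodD(3)[OF h(1)] Ym] t by (simp add: mor_def)
    ultimately have "g a = \<zero>\<^bsub>fst Y\<^esub>" using g_ker a(1) by blast
    then show "l = \<zero>\<^bsub>fst L\<^esub>"
      using ga lin_zero[OF Ym goodD(3)[OF L]] c by (simp add: mor_def)
  qed
  with wL L show ?thesis unfolding rigid_def by blast
qed

text \<open>If the union were not small, each of its small subsets would lie in one member, so the
  elements carried by the members would form an element in the sense of \<open>big\<close>. Weak
  terminality of W gives a map from the union to W. On each member it is a morphism, hence injective
  by rigidity; so it is injective on the whole union, which is then bounded by the small carrier of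
  W.\<close>

lemma rigid_union_embeds:
  assumes W: "weakly_terminal W" and ne: "\<C> \<noteq> {}" and rig: "\<And>X. X \<in> \<C> \<Longrightarrow> rigid X"
    and tot: "\<And>X Y. X \<in> \<C> \<Longrightarrow> Y \<in> \<C> \<Longrightarrow> ext X Y \<or> ext Y X"
  shows "sm (\<Union>X\<in>\<C>. carrier (fst X))"
proof (rule ccontr)
  let ?Z = "\<Union>X\<in>\<C>. carrier (fst X)"
  assume notsm: "\<not> sm ?Z"
  have gd: "good X" if "X \<in> \<C>" for X using rig[OF that] by (simp add: rigid_def)
  have gW: "good W" by (rule weakly_terminal_good[OF W])
  \<comment> \<open>If no member contains P, every member misses some p in P and is therefore
    contained in the member chosen through p. The union is then covered by a small family of small
    sets.\<close>
  have below: "\<exists>X\<in>\<C>. P \<subseteq> carrier (fst X)" if P: "sm P" "P \<subseteq> ?Z" for P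
  proof (rule ccontr)
    assume no: "\<not> (\<exists>X\<in>\<C>. P \<subseteq> carrier (fst X))"
    have "\<forall>p\<in>P. \<exists>X. X \<in> \<C> \<and> p \<in> carrier (fst X)" using P(2) by blast
    then obtain Xp where Xp: "\<And>p. p \<in> P \<Longrightarrow> Xp p \<in> \<C> \<and> p \<in> carrier (fst (Xp p))" by metis
    have "?Z \<subseteq> (\<Union>p\<in>P. carrier (fst (Xp p)))"
    proof
      fix z assume "z \<in> ?Z"
      then obtain X where X: "X \<in> \<C>" "z \<in> carrier (fst X)" by blast
      then obtain p where p: "p \<in> P" "p \<notin> carrier (fst X)" using no by blast
      then have "\<not> ext (Xp p) X" using Xp extD(3) by blast
      then have "ext X (Xp p)" using tot X Xp p by blast
      then show "z \<in> (\<Union>p\<in>P. carrier (fst (Xp p)))" using extD(3) X(2) p(1) by blast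
    qed
    moreover have "sm (\<Union>p\<in>P. carrier (fst (Xp p)))"
      by (rule small_UN[OF P(1)]) (use Xp gd module_catD(2) goodD(1) in blast)
    ultimately show False using notsm small_subset by blast
  qed
  have "\<exists>V :: ('r, 'u) module. left_module R V \<and> carrier V = ?Z \<and> (\<forall>X\<in>\<C>. lin R (fst X) V (\<lambda>x. x))"
  proof (rule union_module[OF ring, of "fst ` \<C>"])
    show "left_module R A" if "A \<in> fst ` \<C>" for A using that gd goodD(3) by blast
    show "fst ` \<C> \<noteq> {}" using ne by blast
    fix A B assume "A \<in> fst ` \<C>" "B \<in> fst ` \<C>"
    then obtain X Y where "X \<in> \<C>" "Y \<in> \<C>" "A = fst X" "B = fst Y" by blast
    then show "\<exists>C\<in>fst ` \<C>. lin R A C (\<lambda>x. x) \<and> lin R B C (\<lambda>x. x)"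
      using tot[of X Y] extD(1)[of X Y] extD(1)[of Y X] lin_id by blast
  next
    fix V :: "('r, 'u) module"
    assume "left_module R V" "carrier V = (\<Union>A\<in>fst ` \<C>. carrier A)" "\<And>A. A \<in> fst ` \<C> \<Longrightarrow> lin R A V (\<lambda>x. x)"
    then show "\<exists>V :: ('r, 'u) module. left_module R V \<and> carrier V = ?Z \<and> (\<forall>X\<in>\<C>. lin R (fst X) V (\<lambda>x. x))"
      by (intro exI[of _ V]) simp
  qed
  then obtain V :: "('r, 'u) module" where V: "left_module R V" "carrier V = ?Z" and inc: "\<And>X. X \<in> \<C> \<Longrightarrow> lin R (fst X) V (\<lambda>x. x)" by blast
  have sub: "submod R V (carrier (fst X))" and bk: "lin R (V \<restriction> carrier (fst X)) (fst X) (\<lambda>x. x)" if "X \<in> \<C>" for X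
    using lin_incl_submod[OF goodD(3)[OF gd[OF that]] V(1) inc[OF that]] by blast+
  note rc = restr_cat[OF V(1)]
  have res: "lin R (V \<restriction> P) (fst X) (\<lambda>x. x)" if "X \<in> \<C>" "P \<subseteq> carrier (fst X)" for X P
    using lin_restr_dom[OF bk[OF that(1)], of P] that(2) by simp
  \<comment> \<open>Any member containing P gives the same restriction, because two members are
    always comparable.\<close>
  define x where "x P = (let X = (SOME X. X \<in> \<C> \<and> P \<subseteq> carrier (fst X)) in Fm (V \<restriction> P) (fst X) (\<lambda>x. x) (snd X))" for P
  have x_ext: "Fm (V \<restriction> P) (fst X) (\<lambda>x. x) (snd X) = Fm (V \<restriction> P) (fst Y) (\<lambda>x. x) (snd Y)"
    if P: "submod R V P" "sm P" and X: "X \<in> \<C>" "Y \<in> \<C>" "ext X Y" "P \<subseteq> carrier (fst X)" for P X Y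
    using Fm_comp[OF rc[OF P] goodD(1)[OF gd[OF X(1)]] goodD(1)[OF gd[OF X(2)]] res[OF X(1,4)] extD(1)[OF X(3)] goodD(2)[OF gd[OF X(2)]]]
      extD(2)[OF X(3)] by simp
  have x: "x P = Fm (V \<restriction> P) (fst X) (\<lambda>x. x) (snd X)"
    if P: "submod R V P" "sm P" and X: "X \<in> \<C>" "P \<subseteq> carrier (fst X)" for P X
  proof -
    define Y where "Y = (SOME X. X \<in> \<C> \<and> P \<subseteq> carrier (fst X))"
    have Y: "Y \<in> \<C> \<and> P \<subseteq> carrier (fst Y)" unfolding Y_def by (rule someI[of _ X]) (use X in blast)
    have "Fm (V \<restriction> P) (fst Y) (\<lambda>x. x) (snd Y) = Fm (V \<restriction> P) (fst X) (\<lambda>x. x) (snd X)"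
      using tot[of X Y] x_ext[OF P, of X Y] x_ext[OF P, of Y X] X Y by auto
    then show ?thesis by (simp add: x_def Y_def[symmetric])
  qed
  have "big V x"
    unfolding big_def
  proof (intro conjI allI impI)
    fix P assume P: "submod R V P \<and> sm P"
    then obtain X where X: "X \<in> \<C>" "P \<subseteq> carrier (fst X)" using below[of P] submod_closed(1)[of R V P] V(2) by auto
    show "x P \<in> FF (V \<restriction> P)"
      using x[OF _ _ X] P Fm_closed[OF rc goodD(1)[OF gd[OF X(1)]] res[OF X] goodD(2)[OF gd[OF X(1)]]] by simp
  next
    fix P Q assume PQ: "submod R V P \<and> submod R V Q \<and> sm Q \<and> P \<subseteq> Q"
    then obtain X where X: "X \<in> \<C>" "Q \<subseteq> carrier (fst X)" using below[of Q] submod_closed(1)[of R V Q] V(2) by auto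
    have sP: "sm P" using PQ small_subset by blast
    have "Fm (V \<restriction> P) (V \<restriction> Q) (\<lambda>x. x) (x Q) = Fm (V \<restriction> P) (fst X) (\<lambda>x. x) (snd X)"
      using x[of Q X] X PQ
        Fm_comp[OF rc[of P] rc[of Q] goodD(1)[OF gd[OF X(1)]] lin_incl[of P Q] res[OF X] goodD(2)[OF gd[OF X(1)]]] sP by simp
    also have "\<dots> = x P" using x[of P X] X PQ sP by auto
    finally show "Fm (V \<restriction> P) (V \<restriction> Q) (\<lambda>x. x) (x Q) = x P" .
  qed (rule V(1))
  then obtain f where f: "lin R V (fst W) f"
    and fx: "\<And>P. submod R V P \<and> sm P \<longrightarrow> Fm (V \<restriction> P) (fst W) f (snd W) = x P"
    using W unfolding weakly_terminal_def by blast
  have "inj_on f (\<Union>((\<lambda>X. carrier (fst X)) ` \<C>))"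
  proof (rule inj_on_directed)
    fix A assume "A \<in> (\<lambda>X. carrier (fst X)) ` \<C>"
    then obtain X where X: "X \<in> \<C>" "A = carrier (fst X)" by blast
    note g = goodD(1,2)[OF gd[OF X(1)]]
    have sX: "sm (carrier (fst X))" using module_catD(2)[OF g(1)] .
    note Xc = rc[OF sub[OF X(1)] sX]
    have into: "lin R (fst X) (V \<restriction> carrier (fst X)) (\<lambda>x. x)" using lin_restr_cod[OF inc[OF X(1)]] by simp
    have fX: "lin R (V \<restriction> carrier (fst X)) (fst W) f" using lin_restr_dom[OF f submod_closed(1)[OF sub[OF X(1)]]] .
    have "Fm (fst X) (fst W) f (snd W) = Fm (fst X) (V \<restriction> carrier (fst X)) (\<lambda>x. x) (x (carrier (fst X)))"
      using Fm_comp[OF g(1) Xc goodD(1)[OF gW] into fX goodD(2)[OF gW]] fx sub[OF X(1)] sX by simp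
    also have "\<dots> = Fm (fst X) (fst X) (\<lambda>x. x) (snd X)"
      using Fm_comp[OF g(1) Xc g(1) into bk[OF X(1)] g(2)] x[OF sub[OF X(1)] sX X(1)] by simp
    finally have "mor X W f" using lin_comp[OF into fX] Fm_id[OF g] by (simp add: mor_def)
    then show "inj_on f A" using rig[OF X(1)] gW X(2) unfolding rigid_def by blast
  next
    fix A B assume "A \<in> (\<lambda>X. carrier (fst X)) ` \<C>" "B \<in> (\<lambda>X. carrier (fst X)) ` \<C>"
    then obtain X Y where "X \<in> \<C>" "Y \<in> \<C>" "A = carrier (fst X)" "B = carrier (fst Y)" by blast
    then show "\<exists>C\<in>(\<lambda>X. carrier (fst X)) ` \<C>. A \<union> B \<subseteq> C"
      using tot[of X Y] extD(3)[of X Y] extD(3)[of Y X] by blast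
  qed
  then have "inj_on f ?Z" by simp
  moreover have "f z \<in> carrier (fst W)" if "z \<in> ?Z" for z using lin_closed[OF f] that V(2) by blast
  ultimately have "|?Z| \<le>o |carrier (fst W)|" by (intro card_of_ordLeqI[of f])
  then show False using notsm small_mono[OF module_catD(2)[OF goodD(1)[OF gW]]] by blast
qed

text \<open>A morphism out of the union restricts to a morphism on each member, so it is injective
  on each, and injectivity passes to directed unions.\<close>

lemma rigid_chain_bound:
  assumes W: "weakly_terminal W" and ne: "\<C> \<noteq> {}" and rig: "\<And>X. X \<in> \<C> \<Longrightarrow> rigid X"
    and tot: "\<And>X Y. X \<in> \<C> \<Longrightarrow> Y \<in> \<C> \<Longrightarrow> ext X Y \<or> ext Y X"
  shows "\<exists>U. rigid U \<and> carrier (fst U) = (\<Union>X\<in>\<C>. carrier (fst X)) \<and> (\<forall>X\<in>\<C>. ext X U)"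
proof -
  have gd: "good X" if "X \<in> \<C>" for X using rig[OF that] by (simp add: rigid_def)
  have "\<exists>U. good U \<and> carrier (fst U) = (\<Union>X\<in>\<C>. carrier (fst X)) \<and> (\<forall>X\<in>\<C>. ext X U)"
  proof (rule chain_union[OF ne gd _ rigid_union_embeds[OF W ne rig tot]])
    show "\<exists>Z\<in>\<C>. ext X Z \<and> ext Y Z" if "X \<in> \<C>" "Y \<in> \<C>" for X Y
      using tot[OF that] that ext_refl gd by blast
  qed
  then obtain U where U: "good U" "carrier (fst U) = (\<Union>X\<in>\<C>. carrier (fst X))" "\<forall>X\<in>\<C>. ext X U" by blast
  have "inj_on h (carrier (fst U))" if h: "good C" "mor U C h" for C h
  proof -
    have "inj_on h (\<Union>((\<lambda>X. carrier (fst X)) ` \<C>))"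
    proof (rule inj_on_directed)
      fix A assume "A \<in> (\<lambda>X. carrier (fst X)) ` \<C>"
      then obtain X where X: "X \<in> \<C>" "A = carrier (fst X)" by blast
      then have "mor X U (\<lambda>x. x)" using U(3) mor_ext by blast
      then have "mor X C h" using mor_comp[OF gd[OF X(1)] U(1) h(1) _ h(2)] by blast
      then show "inj_on h A" using rig[OF X(1)] h(1) X(2) unfolding rigid_def by blast
    next
      fix A B assume "A \<in> (\<lambda>X. carrier (fst X)) ` \<C>" "B \<in> (\<lambda>X. carrier (fst X)) ` \<C>"
      then obtain X Y where "X \<in> \<C>" "Y \<in> \<C>" "A = carrier (fst X)" "B = carrier (fst Y)" by blast
      then show "\<exists>C\<in>(\<lambda>X. carrier (fst X)) ` \<C>. A \<union> B \<subseteq> C"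
        using tot[of X Y] extD(3)[of X Y] extD(3)[of Y X] by blast
    qed
    then show ?thesis using U(2) by simp
  qed
  then show ?thesis using U unfolding rigid_def by blast
qed

text \<open>Only objects extending W are compared: they inherit weak terminality from W, and the
  same W bounds the chains.\<close>

lemma minimal_object_exists:
  "\<exists>M. weakly_terminal M \<and> (\<forall>h. mor M M h \<longrightarrow> bij_betw h (carrier (fst M)) (carrier (fst M)))"
proof -
  obtain W where W: "weakly_terminal W" "rigid W" using rigid_exists by blast
  have gW: "good W" by (rule weakly_terminal_good[OF W(1)])
  define \<O> where "\<O> = {X. rigid X \<and> ext W X}"
  have gd: "good X" if "X \<in> \<O>" for X using that by (simp add: \<O>_def rigid_def)
  \<comment> \<open>Strict growth of the carrier is built into the order: records that differ only
    off a common carrier can extend each other, so extension alone is not antisymmetric.\<close>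
  define r where "r = {(X, X'). X \<in> \<O> \<and> X' \<in> \<O> \<and> (X = X' \<or> ext X X' \<and> carrier (fst X) \<subset> carrier (fst X'))}"
  have WO: "W \<in> \<O>" using W gW ext_refl by (simp add: \<O>_def)
  have fld: "Field r = \<O>" by (auto simp: Field_def r_def)
  have r_ext: "ext X X'" if "(X, X') \<in> r" for X X' using that gd ext_refl unfolding r_def by blast
  have po: "Partial_order r"
    unfolding partial_order_on_def preorder_on_def
  proof (intro conjI)
    show "r \<subseteq> Field r \<times> Field r" unfolding fld by (auto simp: r_def)
    show "refl_on (Field r) r" unfolding fld by (auto simp: r_def refl_on_def)
    show "antisym r" by (rule antisymI) (auto simp: r_def)
    show "trans r"
    proof (rule transI)
      fix X Y Z assume XYZ: "(X, Y) \<in> r" "(Y, Z) \<in> r"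
      show "(X, Z) \<in> r"
      proof (cases "X = Y \<or> Y = Z")
        case True
        then show ?thesis using XYZ by blast
      next
        case False
        then have *: "X \<in> \<O>" "Y \<in> \<O>" "Z \<in> \<O>" "ext X Y" "ext Y Z" "carrier (fst X) \<subset> carrier (fst Y)" "carrier (fst Y) \<subset> carrier (fst Z)"
          using XYZ unfolding r_def by blast+
        then have "ext X Z" using ext_trans gd by blast
        then show ?thesis using * unfolding r_def by blast
      qed
    qed
  qed
  have "\<exists>M\<in>Field r. \<forall>X\<in>Field r. (M, X) \<in> r \<longrightarrow> X = M"
  proof (rule Zorns_po_lemma[OF po])
    fix \<C> assume ch: "\<C> \<in> Chains r"
    have tot: "(X, Y) \<in> r \<or> (Y, X) \<in> r" if "X \<in> \<C>" "Y \<in> \<C>" for X Y using ch that by (auto simp: Chains_def)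
    have CO: "X \<in> \<O>" if "X \<in> \<C>" for X using tot[OF that that] by (auto simp: r_def)
    show "\<exists>u\<in>Field r. \<forall>a\<in>\<C>. (a, u) \<in> r"
    proof (cases "\<C> = {} \<or> (\<exists>X\<in>\<C>. \<forall>Y\<in>\<C>. (Y, X) \<in> r)")
      case True
      then show ?thesis using WO CO fld by blast
    next
      case False
      \<comment> \<open>A chain without greatest member has a union whose carrier is strictly larger
        than that of each member, as the order demands of an upper bound.\<close>
      then have ne: "\<C> \<noteq> {}" and nomax: "\<not> (\<exists>X\<in>\<C>. \<forall>Y\<in>\<C>. (Y, X) \<in> r)" by blast+
      have tot': "ext X Y \<or> ext Y X" if "X \<in> \<C>" "Y \<in> \<C>" for X Y using tot[OF that] r_ext by blast
      have rig: "rigid X" if "X \<in> \<C>" for X using CO[OF that] by (simp add: \<O>_def)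
      obtain U where U: "rigid U" "carrier (fst U) = (\<Union>X\<in>\<C>. carrier (fst X))" "\<forall>X\<in>\<C>. ext X U"
        using rigid_chain_bound[OF W(1) ne rig tot'] by blast
      have gU: "good U" using U(1) by (simp add: rigid_def)
      obtain X0 where X0: "X0 \<in> \<C>" using ne by blast
      have "ext W X0" using CO[OF X0] by (simp add: \<O>_def)
      then have "ext W U" using ext_trans[OF gW gd[OF CO[OF X0]] gU] U(3) X0 by blast
      then have UO: "U \<in> \<O>" using U(1) by (simp add: \<O>_def)
      have "(Y, U) \<in> r" if Y: "Y \<in> \<C>" for Y
      proof -
        have "carrier (fst Y) \<noteq> carrier (fst U)"
        proof
          assume eq: "carrier (fst Y) = carrier (fst U)"
          have "(Z, Y) \<in> r" if Z: "Z \<in> \<C>" for Z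
          proof (rule ccontr)
            assume "(Z, Y) \<notin> r"
            then have "(Y, Z) \<in> r" "Y \<noteq> Z" using tot[OF Y Z] by auto
            then have "carrier (fst Y) \<subset> carrier (fst Z)" by (auto simp: r_def)
            moreover have "carrier (fst Z) \<subseteq> carrier (fst U)" using U(2) Z by blast
            ultimately show False using eq by blast
          qed
          then show False using nomax Y by blast
        qed
        moreover have "carrier (fst Y) \<subseteq> carrier (fst U)" using U(2) Y by blast
        ultimately show ?thesis using U(3) Y UO CO unfolding r_def by blast
      qed
      then show ?thesis using UO fld by blast
    qed
  qed
  then obtain M where M: "M \<in> \<O>" and max': "\<forall>X\<in>\<O>. (M, X) \<in> r \<longrightarrow> X = M" unfolding fld by blast
  have max: "X = M" if "(M, X) \<in> r" for X
  proof -
    have "X \<in> \<O>" using that by (simp add: r_def)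
    then show ?thesis using max' that by blast
  qed
  have gM: "good M" by (rule gd[OF M])
  note Mc = goodD(1)[OF gM] and mF = goodD(2)[OF gM]
  have WM: "ext W M" and rM: "rigid M" using M by (simp_all add: \<O>_def)
  have wM: "weakly_terminal M"
    by (rule weakly_terminal_ext[OF W(1) gM extD(1,2)[OF WM]])
  have "bij_betw h (carrier (fst M)) (carrier (fst M))" if h: "mor M M h" for h
  proof -
    have hl: "lin R (fst M) (fst M) h" and hm: "Fm (fst M) (fst M) h (snd M) = snd M" using h by (simp_all add: mor_def)
    have inj: "inj_on h (carrier (fst M))" using rM gM h unfolding rigid_def by blast
    \<comment> \<open>\<theta> is an isomorphism to a superset of M with \<theta> h the inclusion.
      The element of M is transported along \<theta>; as F at h fixes it, the inclusion of M into M'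
      becomes a morphism.\<close>
    obtain M' :: "('r, 'u) module" and \<theta> where M': "M' \<in> module_cat R" and \<theta>: "lin R (fst M) M' \<theta>"
      "bij_betw \<theta> (carrier (fst M)) (carrier M')" and incl: "lin R (fst M) M' (\<lambda>x. x)"
      and \<theta>h: "\<forall>x\<in>carrier (fst M). \<theta> (h x) = x"
      by (rule superset_copy[OF Mc goodD(3)[OF gM] module_catD(2)[OF Mc] hl inj]) blast
    define \<phi> where "\<phi> = inv_into (carrier (fst M)) \<theta>"
    have \<phi>: "lin R M' (fst M) \<phi>" unfolding \<phi>_def by (rule lin_inv[OF goodD(3)[OF gM] \<theta>])
    have \<phi>\<theta>: "\<phi> (\<theta> x) = x" if "x \<in> carrier (fst M)" for x
      using that \<theta>(2) by (simp add: \<phi>_def bij_betw_def)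
    define X where "X = (M', Fm M' (fst M) \<phi> (snd M))"
    have gX: "good X" using M' Fm_closed[OF M' Mc \<phi> mF] by (simp add: X_def good_def)
    have \<theta>m: "Fm (fst M) M' \<theta> (snd X) = snd M"
      using Fm_comp[OF Mc M' Mc \<theta>(1) \<phi> mF] Fm_cong[of "fst M" "\<lambda>x. \<phi> (\<theta> x)" "\<lambda>x. x" "fst M"] \<phi>\<theta> Fm_id[OF Mc mF]
      by (simp add: X_def)
    have m\<theta>: "mor M X \<theta>" using \<theta>(1) \<theta>m by (simp add: mor_def X_def)
    have "Fm (fst M) M' (\<lambda>x. x) (snd X) = Fm (fst M) M' (\<lambda>x. \<theta> (h x)) (snd X)"
      using Fm_cong[of "fst M" "\<lambda>x. x" "\<lambda>x. \<theta> (h x)" M'] \<theta>h by simp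
    also have "\<dots> = Fm (fst M) (fst M) h (Fm (fst M) M' \<theta> (snd X))"
      using Fm_comp[OF Mc Mc M' hl \<theta>(1)] goodD(2)[OF gX] by (simp add: X_def)
    finally have MX: "ext M X" using incl \<theta>m hm by (simp add: ext_def X_def)
    have "inj_on k (carrier M')" if k: "good C" "mor X C k" for C k
    proof -
      have "inj_on (\<lambda>x. k (\<theta> x)) (carrier (fst M))"
        using rM k(1) mor_comp[OF gM gX k(1) m\<theta> k(2)] unfolding rigid_def by blast
      then have "inj_on k (\<theta> ` carrier (fst M))" by (auto simp: inj_on_def)
      then show ?thesis using \<theta>(2) by (simp add: bij_betw_def)
    qed
    then have "inj_on k (carrier (fst X))" if "good C" "mor X C k" for C k using that by (simp add: X_def)
    then have "rigid X" using gX unfolding rigid_def by blast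
    then have XO: "X \<in> \<O>" using ext_trans[OF gW gM gX WM MX] by (simp add: \<O>_def)
    have "carrier M' = carrier (fst M)"
    proof (rule ccontr)
      assume ne: "carrier M' \<noteq> carrier (fst M)"
      then have "carrier (fst M) \<subset> carrier (fst X)" using extD(3)[OF MX] by (auto simp: X_def)
      then have "(M, X) \<in> r" using M XO MX by (simp add: r_def)
      then have "X = M" by (rule max)
      moreover have "fst X = M'" by (simp add: X_def)
      ultimately show False using ne by simp
    qed
    then have \<theta>': "bij_betw \<theta> (carrier (fst M)) (carrier (fst M))" using \<theta>(2) by simp
    \<comment> \<open>Now \<theta> is a bijection of M and a left inverse of h, so h is the inverse
      of \<theta>.\<close>
    have "y \<in> h ` carrier (fst M)" if y: "y \<in> carrier (fst M)" for y
    proof -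
      have ty: "\<theta> y \<in> carrier (fst M)" using \<theta>' y by (auto simp: bij_betw_def)
      then have "\<theta> (h (\<theta> y)) = \<theta> y" using \<theta>h by blast
      then have "h (\<theta> y) = y"
        using inj_onD[OF bij_betw_imp_inj_on[OF \<theta>']] mor_closed[OF h ty] y by blast
      then show ?thesis using ty by (metis imageI)
    qed
    then show ?thesis using inj mor_closed[OF h] by (auto simp: bij_betw_def)
  qed
  with wM show ?thesis by blast
qed

end

section \<open>Minimal presentations\<close>

text \<open>Yoneda in concrete form: an element y of F at Y stands for the transformation from
  Hom(-, Y) that sends f to the restriction of y along f. Weak terminality of (Y, y) says that it is
  onto, and the endomorphisms of Y compatible with it are those fixing y.\<close>

lemma minimal_cover:
  fixes R :: "'r ring" and F :: "('r, 'u, 'v) mod_functor"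
  assumes "ring R" "module_universe R TYPE('u)" "additive_functor R F" "universe_compatible R F"
    and "preserves_filtered_colimits R F"
  shows "\<exists>Y\<in>module_cat R. \<exists>y\<in>carrier (fob F Y).
    (\<forall>M\<in>module_cat R. \<forall>x\<in>carrier (fob F M). \<exists>f\<in>mod_hom R M Y. fmap F M Y f y = x) \<and>
    (\<forall>h\<in>mod_hom R Y Y. fmap F Y Y h y = y \<longrightarrow> bij_betw h (carrier Y) (carrier Y))"
proof -
  interpret mod_fun R "TYPE('u)" F
    using assms by (intro mod_fun.intro mod_univ.intro mod_fun_axioms.intro)
  obtain Z where Z: "weakly_terminal Z" "\<forall>h. mor Z Z h \<longrightarrow> bij_betw h (carrier (fst Z)) (carrier (fst Z))"
    using minimal_object_exists by blast
  have gZ: "good Z" by (rule weakly_terminal_good[OF Z(1)])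
  show ?thesis
  proof (intro bexI[of _ "fst Z"] bexI[of _ "snd Z"] conjI ballI impI)
    show "fst Z \<in> module_cat R" "snd Z \<in> FF (fst Z)" using goodD[OF gZ] by blast+
    fix M x assume M: "M \<in> module_cat R" "x \<in> FF M"
    then have "good (M, x)" by (simp add: good_def)
    then obtain f where "mor (M, x) Z f" using weakly_terminal_mor[OF Z(1)] by blast
    then have f: "lin R M (fst Z) f" "Fm M (fst Z) f (snd Z) = x" by (simp_all add: mor_def)
    show "\<exists>f\<in>mod_hom R M (fst Z). fmap F M (fst Z) f (snd Z) = x"
      using mod_hom_restrict[OF M(1) f(1)] f(2) by (intro bexI[of _ "restrict f (carrier M)"]) (simp_all add: Fm_def)
  next
    fix h assume h: "h \<in> mod_hom R (fst Z) (fst Z)" "fmap F (fst Z) (fst Z) h (snd Z) = snd Z"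
    have "restrict h (carrier (fst Z)) = h" using h(1) by (simp add: mod_hom_def PiE_def extensional_restrict)
    then have "mor Z Z h" using h by (simp add: mor_def Fm_def mod_hom_eq)
    then show "bij_betw h (carrier (fst Z)) (carrier (fst Z))" using Z(2) by blast
  qed
qed

section \<open>Representable functors and their endomorphisms\<close>

lemma module_catD':
  "M \<in> module_cat R \<Longrightarrow> left_module R M"
  by (simp add: module_cat_def)

lemma compose_mod_hom:
  "left_module R M \<Longrightarrow> f \<in> mod_hom R M N \<Longrightarrow> g \<in> mod_hom R N P \<Longrightarrow> compose (carrier M) g f \<in> mod_hom R M P"
  using lin_comp[of R M N f P g] lin_cong[of R M P "\<lambda>x. g (f x)" "compose (carrier M) g f"]
  by (auto simp: mod_hom_eq compose_def)

lemma mod_id_hom: "left_module R M \<Longrightarrow> mod_id M \<in> mod_hom R M M"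
  using lin_cong[OF lin_id, of R M "mod_id M"] by (auto simp: mod_hom_eq mod_id_def)

lemma mod_hom_ext: "f \<in> mod_hom R M N \<Longrightarrow> f \<in> extensional (carrier M)"
  by (simp add: mod_hom_eq)

lemma mod_hom_closed: "f \<in> mod_hom R M N \<Longrightarrow> x \<in> carrier M \<Longrightarrow> f x \<in> carrier N"
  by (auto simp: mod_hom_def)

lemma compose_mod_id:
  assumes "f \<in> mod_hom R M N"
  shows "compose (carrier M) f (mod_id M) = f" "compose (carrier M) (mod_id N) f = f"
  using assms by (auto simp: mod_hom_def PiE_def compose_def mod_id_def extensional_def fun_eq_iff Pi_iff)

lemma compose_assoc_hom:
  "f \<in> mod_hom R M N \<Longrightarrow> compose (carrier M) h (compose (carrier M) g f) = compose (carrier M) (compose (carrier N) h g) f"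
  by (auto simp: mod_hom_def compose_def fun_eq_iff)

lemma comm_group_hom_group:
  assumes "left_module R M" "left_module R Y"
  shows "comm_group (hom_group R M Y)"
proof (rule comm_groupI)
  interpret M: left_module R M by fact
  interpret Y: left_module R Y by fact
  let ?H = "hom_group R M Y"
  have homI: "restrict f (carrier M) \<in> carrier ?H" if "lin R M Y f" for f
    using lin_cong[OF that assms(1), of "restrict f (carrier M)"] by (simp add: hom_group_def mod_hom_eq)
  have homD: "lin R M Y f" "f \<in> extensional (carrier M)" if "f \<in> carrier ?H" for f
    using that by (simp_all add: hom_group_def mod_hom_eq)
  note cl = lin_closed[OF homD(1)]
  show "f \<otimes>\<^bsub>?H\<^esub> g \<in> carrier ?H" if "f \<in> carrier ?H" "g \<in> carrier ?H" for f g
    using homI[OF lin_plus[OF assms homD(1) homD(1)], OF that] by (simp add: hom_group_def)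
  show "\<one>\<^bsub>?H\<^esub> \<in> carrier ?H" using homI[OF Y.lin_zero_map[OF assms(1)]] by (simp add: hom_group_def)
  show "f \<otimes>\<^bsub>?H\<^esub> g \<otimes>\<^bsub>?H\<^esub> h = f \<otimes>\<^bsub>?H\<^esub> (g \<otimes>\<^bsub>?H\<^esub> h)"
    if "f \<in> carrier ?H" "g \<in> carrier ?H" "h \<in> carrier ?H" for f g h
    using cl that by (auto simp: hom_group_def Y.M.a_assoc)
  show "f \<otimes>\<^bsub>?H\<^esub> g = g \<otimes>\<^bsub>?H\<^esub> f" if "f \<in> carrier ?H" "g \<in> carrier ?H" for f g
    using cl that by (auto simp: hom_group_def Y.M.a_comm)
  show "\<one>\<^bsub>?H\<^esub> \<otimes>\<^bsub>?H\<^esub> f = f" if "f \<in> carrier ?H" for f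
    using cl[OF that] homD(2)[OF that] by (auto simp: hom_group_def extensional_def fun_eq_iff)
  show "\<exists>g\<in>carrier ?H. g \<otimes>\<^bsub>?H\<^esub> f = \<one>\<^bsub>?H\<^esub>" if "f \<in> carrier ?H" for f
  proof (rule bexI[OF _ homI[OF lin_neg[OF assms homD(1)[OF that]]]])
    show "restrict (\<lambda>x. (\<ominus>\<^bsub>R\<^esub> \<one>\<^bsub>R\<^esub>) \<odot>\<^bsub>Y\<^esub> f x) (carrier M) \<otimes>\<^bsub>?H\<^esub> f = \<one>\<^bsub>?H\<^esub>"
      using cl[OF that] by (auto simp: hom_group_def)
  qed
qed

text \<open>By Yoneda an endomorphism \<phi> of Hom(-, Y) is composition with the image h of the
  identity, and compatibility with \<alpha>, evaluated at the identity, is the condition on h in the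
  hypothesis. Composition with the inverse of the bijection h then inverts \<phi>.\<close>

lemma right_minimal_Hom:
  fixes Y :: "('r, 'u) module"
  assumes Y: "Y \<in> module_cat R"
    and bij: "\<And>h. h \<in> mod_hom R Y Y \<Longrightarrow> \<alpha> Y h = \<alpha> Y (mod_id Y) \<Longrightarrow> bij_betw h (carrier Y) (carrier Y)"
  shows "right_minimal R (Hom_functor R Y) \<alpha>"
  unfolding right_minimal_def
proof (intro allI impI, elim conjE)
  have Ym: "left_module R Y" by (rule module_catD'[OF Y])
  fix \<phi> assume nt: "nat_trans R (Hom_functor R Y) (Hom_functor R Y) \<phi>"
    and \<alpha>\<phi>: "\<forall>M\<in>module_cat R. \<forall>x\<in>carrier (fob (Hom_functor R Y) M). \<alpha> M (\<phi> M x) = \<alpha> M x"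
  have \<phi>_hom: "\<phi> M f \<in> mod_hom R M Y" if "M \<in> module_cat R" "f \<in> mod_hom R M Y" for M f
    using nt that by (auto simp: nat_trans_def Hom_functor_def hom_group_def hom_def)
  have \<phi>_nat: "\<phi> M (compose (carrier M) g f) = compose (carrier M) (\<phi> N g) f"
    if "M \<in> module_cat R" "N \<in> module_cat R" "f \<in> mod_hom R M N" "g \<in> mod_hom R N Y" for M N f g
    using nt that unfolding nat_trans_def by (auto simp: Hom_functor_def hom_group_def)
  define h where "h = \<phi> Y (mod_id Y)"
  have id: "mod_id Y \<in> mod_hom R Y Y" by (rule mod_id_hom[OF Ym])
  have h: "h \<in> mod_hom R Y Y" unfolding h_def by (rule \<phi>_hom[OF Y id])
  have "\<alpha> Y h = \<alpha> Y (mod_id Y)"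
    using \<alpha>\<phi> Y id unfolding h_def by (simp add: Hom_functor_def hom_group_def)
  then have bh: "bij_betw h (carrier Y) (carrier Y)" by (rule bij[OF h])
  have \<phi>: "\<phi> M f = compose (carrier M) h f" if "M \<in> module_cat R" "f \<in> mod_hom R M Y" for M f
    using \<phi>_nat[OF that(1) Y that(2) id] compose_mod_id(2)[OF that(2)] by (simp add: h_def)
  define k where "k = restrict (inv_into (carrier Y) h) (carrier Y)"
  have hl: "lin R Y Y h" using h by (simp add: mod_hom_eq)
  have k: "k \<in> mod_hom R Y Y"
    using lin_cong[OF lin_inv[OF Ym hl bh] Ym, of k] by (simp add: k_def mod_hom_eq)
  have kh: "k (h y) = y" and hk: "h (k y) = y" if "y \<in> carrier Y" for y
    using that bh mod_hom_closed[OF h that] by (auto simp: k_def bij_betw_def f_inv_into_f)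
  define \<psi> where "\<psi> M f = compose (carrier M) k f" for M :: "('r, 'u) module" and f
  have \<psi>_hom: "\<psi> M f \<in> mod_hom R M Y" if "M \<in> module_cat R" "f \<in> mod_hom R M Y" for M f
    unfolding \<psi>_def by (rule compose_mod_hom[OF module_catD'[OF that(1)] that(2) k])
  have kl: "k (a \<oplus>\<^bsub>Y\<^esub> b) = k a \<oplus>\<^bsub>Y\<^esub> k b" if "a \<in> carrier Y" "b \<in> carrier Y" for a b
    using k that lin_add[of R Y Y k a b] by (simp add: mod_hom_eq)
  show "nat_invertible R (Hom_functor R Y) (Hom_functor R Y) \<phi>"
    unfolding nat_invertible_def
  proof (intro exI[of _ \<psi>] conjI ballI)
    show "nat_trans R (Hom_functor R Y) (Hom_functor R Y) \<psi>"
      unfolding nat_trans_def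
    proof (intro conjI ballI)
      fix M :: "('r, 'u) module" assume M: "M \<in> module_cat R"
      have "\<psi> M (f \<otimes>\<^bsub>hom_group R M Y\<^esub> g) = \<psi> M f \<otimes>\<^bsub>hom_group R M Y\<^esub> \<psi> M g"
        if "f \<in> mod_hom R M Y" "g \<in> mod_hom R M Y" for f g
        using mod_hom_closed[OF that(1)] mod_hom_closed[OF that(2)]
        by (auto simp: \<psi>_def hom_group_def compose_def kl)
      then show "\<psi> M \<in> hom (fob (Hom_functor R Y) M) (fob (Hom_functor R Y) M)"
        using \<psi>_hom[OF M] by (auto simp: hom_def Hom_functor_def) (simp_all add: hom_group_def)
    next
      fix M N :: "('r, 'u) module" and f g assume "M \<in> module_cat R" "N \<in> module_cat R" "f \<in> mod_hom R M N" "g \<in> carrier (fob (Hom_functor R Y) N)"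
      then show "\<psi> M (fmap (Hom_functor R Y) M N f g) = fmap (Hom_functor R Y) M N f (\<psi> N g)"
        by (simp add: Hom_functor_def \<psi>_def compose_assoc_hom)
    qed
    fix M :: "('r, 'u) module" and f assume M: "M \<in> module_cat R" and "f \<in> carrier (fob (Hom_functor R Y) M)"
    then have f: "f \<in> mod_hom R M Y" by (simp add: Hom_functor_def hom_group_def)
    note fx = mod_hom_closed[OF f] and fe = mod_hom_ext[OF f]
    have "compose (carrier M) k (compose (carrier M) h f) = f" "compose (carrier M) h (compose (carrier M) k f) = f"
      using fx fe by (auto simp: compose_def fun_eq_iff extensional_def kh hk)
    then show "\<psi> M (\<phi> M f) = f" "\<phi> M (\<psi> M f) = f"
      using \<phi>[OF M f] \<phi>[OF M \<psi>_hom[OF M f]] by (simp_all add: \<psi>_def)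
  qed
qed

text \<open>The kernel of the transformation from Hom(-, Y) to F given by y. As a subfunctor of
  Hom(-, Y) it differs from it only in the carriers.\<close>

definition kernel_functor ::
    "('r, 'k) ring_scheme \<Rightarrow> ('r, 'u, 'v) mod_functor \<Rightarrow> ('r, 'u) module \<Rightarrow> 'v \<Rightarrow> ('r, 'u, 'u \<Rightarrow> 'u) mod_functor" where
  "kernel_functor R F Y y = Hom_functor R Y
     \<lparr>fob := \<lambda>M. (hom_group R M Y)\<lparr>carrier := {f \<in> mod_hom R M Y. fmap F M Y f y = \<one>\<^bsub>fob F M\<^esub>}\<rparr>\<rparr>"

lemma kernel_functor_simps:
  "carrier (fob (kernel_functor R F Y y) M) = {f \<in> mod_hom R M Y. fmap F M Y f y = \<one>\<^bsub>fob F M\<^esub>}"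
  "mult (fob (kernel_functor R F Y y) M) = mult (hom_group R M Y)"
  "one (fob (kernel_functor R F Y y) M) = one (hom_group R M Y)"
  "fmap (kernel_functor R F Y y) M N f g = compose (carrier M) g f"
  by (simp_all add: kernel_functor_def Hom_functor_def)

section \<open>The kernel functor inherits the hypotheses on F\<close>

context
  fixes R :: "'r ring" and F :: "('r, 'u, 'v) mod_functor" and Y :: "('r, 'u) module" and y :: 'v
  assumes R: "ring R" and univ: "module_universe R TYPE('u)" and add: "additive_functor R F"
    and compat: "universe_compatible R F" and pres: "preserves_filtered_colimits R F"
    and Y: "Y \<in> module_cat R" and y: "y \<in> carrier (fob F Y)"
begin

interpretation mod_fun R "TYPE('u)" F
  using R univ add compat pres by (intro mod_fun.intro mod_univ.intro mod_fun_axioms.intro)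

abbreviation (input) "K \<equiv> kernel_functor R F Y y"

lemma Fm_mod_hom: "f \<in> mod_hom R M N \<Longrightarrow> fmap F M N f x = Fm M N f x"
  by (simp add: Fm_def mod_hom_eq extensional_restrict)

lemma mod_homD: "f \<in> mod_hom R M N \<Longrightarrow> lin R M N f"
  by (simp add: mod_hom_eq)

lemma kernel_additive: "additive_functor R K"
proof -
  note Ym = module_catD(1)[OF Y]
  have hg: "comm_group (hom_group R M Y)" if "M \<in> module_cat R" for M
    by (rule comm_group_hom_group[OF module_catD(1)[OF that] Ym])
  have mult: "fmap F M Y (f \<otimes>\<^bsub>hom_group R M Y\<^esub> g) y = fmap F M Y f y \<otimes>\<^bsub>fob F M\<^esub> fmap F M Y g y"
    if "M \<in> module_cat R" "f \<in> mod_hom R M Y" "g \<in> mod_hom R M Y" for M f g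
    using add that Y y unfolding additive_functor_def by blast
  have one: "fmap F M Y \<one>\<^bsub>hom_group R M Y\<^esub> y = \<one>\<^bsub>fob F M\<^esub>" if "M \<in> module_cat R" for M
    using Fm_zero[OF that Y y] by (simp add: hom_group_def Fm_def)
  have Kgrp: "comm_group (fob K M)" if M: "M \<in> module_cat R" for M
  proof -
    interpret H: comm_group "hom_group R M Y" by (rule hg[OF M])
    interpret G: comm_group "fob F M" by (rule F_group[OF M])
    have Hc: "f \<in> carrier (hom_group R M Y) \<longleftrightarrow> f \<in> mod_hom R M Y" for f by (simp add: hom_group_def)
    have K1: "\<one>\<^bsub>hom_group R M Y\<^esub> \<in> mod_hom R M Y" using H.one_closed by (simp add: Hc)
    show ?thesis
    proof (rule comm_groupI)
      fix f assume f: "f \<in> carrier (fob K M)"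
      then have fH: "f \<in> carrier (hom_group R M Y)" and f1: "fmap F M Y f y = \<one>\<^bsub>fob F M\<^esub>"
        by (simp_all add: kernel_functor_simps Hc)
      show "\<one>\<^bsub>fob K M\<^esub> \<otimes>\<^bsub>fob K M\<^esub> f = f" using fH by (simp add: kernel_functor_simps)
      let ?g = "inv\<^bsub>hom_group R M Y\<^esub> f"
      have gH: "?g \<in> carrier (hom_group R M Y)" using fH by simp
      have "fmap F M Y (?g \<otimes>\<^bsub>hom_group R M Y\<^esub> f) y = fmap F M Y ?g y \<otimes>\<^bsub>fob F M\<^esub> fmap F M Y f y"
        by (rule mult[OF M]) (use gH fH in \<open>simp_all add: Hc\<close>)
      moreover have "fmap F M Y ?g y \<in> carrier (fob F M)"
        using Fm_closed[OF M Y mod_homD y] Fm_mod_hom gH by (simp add: Hc)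
      ultimately have "fmap F M Y ?g y = \<one>\<^bsub>fob F M\<^esub>" using fH f1 one[OF M] by simp
      then show "\<exists>g\<in>carrier (fob K M). g \<otimes>\<^bsub>fob K M\<^esub> f = \<one>\<^bsub>fob K M\<^esub>"
        using gH fH by (intro bexI[of _ ?g]) (simp_all add: kernel_functor_simps Hc)
      fix g assume g: "g \<in> carrier (fob K M)"
      then have gH: "g \<in> carrier (hom_group R M Y)" and g1: "fmap F M Y g y = \<one>\<^bsub>fob F M\<^esub>"
        by (simp_all add: kernel_functor_simps Hc)
      show "f \<otimes>\<^bsub>fob K M\<^esub> g = g \<otimes>\<^bsub>fob K M\<^esub> f" using fH gH by (simp add: kernel_functor_simps H.m_comm)
      show "f \<otimes>\<^bsub>fob K M\<^esub> g \<in> carrier (fob K M)"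
        using H.m_closed[OF fH gH] mult[OF M] fH gH f1 g1 by (simp add: kernel_functor_simps Hc)
      fix h assume "h \<in> carrier (fob K M)"
      then have "h \<in> carrier (hom_group R M Y)" by (simp add: kernel_functor_simps Hc)
      then show "f \<otimes>\<^bsub>fob K M\<^esub> g \<otimes>\<^bsub>fob K M\<^esub> h = f \<otimes>\<^bsub>fob K M\<^esub> (g \<otimes>\<^bsub>fob K M\<^esub> h)"
        using fH gH by (simp add: kernel_functor_simps H.m_assoc)
    qed (simp add: kernel_functor_simps K1 one[OF M])
  qed
  have Kmap: "compose (carrier M) g f \<in> carrier (fob K M)"
    if M: "M \<in> module_cat R" "N \<in> module_cat R" and f: "f \<in> mod_hom R M N" and g: "g \<in> carrier (fob K N)" for M N f g
  proof -
    have gh: "g \<in> mod_hom R N Y" and g1: "fmap F N Y g y = \<one>\<^bsub>fob F N\<^esub>" using g by (simp_all add: kernel_functor_simps)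
    have "fmap F M Y (compose (carrier M) g f) y = fmap F M N f (fmap F N Y g y)"
      using add M Y f gh y unfolding additive_functor_def by blast
    also have "\<dots> = \<one>\<^bsub>fob F M\<^esub>" using g1 Fm_one[OF M mod_homD[OF f]] Fm_mod_hom[OF f] by simp
    finally show ?thesis using compose_mod_hom[OF module_catD(1)[OF M(1)] f gh] by (simp add: kernel_functor_simps)
  qed
  show ?thesis
    unfolding additive_functor_def
  proof (intro conjI ballI)
    fix M :: "('r, 'u) module" assume "M \<in> module_cat R"
    then show "comm_group (fob K M)" by (rule Kgrp)
  next
    fix M N :: "('r, 'u) module" and f assume M: "M \<in> module_cat R" "N \<in> module_cat R" and f: "f \<in> mod_hom R M N"
    have "compose (carrier M) (g \<otimes>\<^bsub>hom_group R N Y\<^esub> h) f = compose (carrier M) g f \<otimes>\<^bsub>hom_group R M Y\<^esub> compose (carrier M) h f" for g h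
      using mod_hom_closed[OF f] by (auto simp: compose_def hom_group_def)
    then show "fmap K M N f \<in> hom (fob K N) (fob K M)"
      using Kmap[OF M f] by (intro homI) (simp_all add: kernel_functor_simps)
  next
    fix M :: "('r, 'u) module" and f assume "M \<in> module_cat R" "f \<in> carrier (fob K M)"
    then have "f \<in> mod_hom R M Y" by (simp add: kernel_functor_simps)
    then show "fmap K M M (mod_id M) f = f" by (simp add: kernel_functor_simps(4) compose_mod_id(1))
  next
    fix M N P :: "('r, 'u) module" and f g x assume "f \<in> mod_hom R M N" "x \<in> carrier (fob K P)"
    then show "fmap K M P (compose (carrier M) g f) x = fmap K M N f (fmap K N P g x)"
      by (simp add: kernel_functor_simps compose_assoc_hom)
  next
    fix M N :: "('r, 'u) module" and f g x assume M: "M \<in> module_cat R" "N \<in> module_cat R" "f \<in> mod_hom R M N" "g \<in> mod_hom R M N" "x \<in> carrier (fob K N)"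
    then have x: "lin R N Y x" by (simp add: kernel_functor_simps mod_hom_eq)
    have "compose (carrier M) x (f \<otimes>\<^bsub>hom_group R M N\<^esub> g) = compose (carrier M) x f \<otimes>\<^bsub>hom_group R M Y\<^esub> compose (carrier M) x g"
      using mod_hom_closed[OF M(3)] mod_hom_closed[OF M(4)] by (auto simp: compose_def hom_group_def lin_add[OF x])
    then show "fmap K M N (f \<otimes>\<^bsub>hom_group R M N\<^esub> g) x = fmap K M N f x \<otimes>\<^bsub>fob K M\<^esub> fmap K M N g x"
      by (simp add: kernel_functor_simps)
  qed
qed

text \<open>\<open>small_PiE\<close> bounds the maps from a tiny module into Y. For larger modules
  no such bound is at hand, even for a representable functor.\<close>

lemma kernel_compatible: "universe_compatible R K"
  unfolding universe_compatible_def
proof (intro ballI impI)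
  fix M :: "('r, 'u) module" assume M: "M \<in> module_cat R" "|carrier M| \<le>o |carrier R \<times> (UNIV :: nat set)|"
  have "sm (carrier M \<rightarrow>\<^sub>E carrier Y)"
    using M(2) by (intro small_PiE module_catD(2)[OF Y]) (simp add: tiny_def)
  then show "sm (carrier (fob K M))"
    by (rule small_subset) (auto simp: kernel_functor_simps mod_hom_def)
qed

text \<open>An element of the limit is a cocone on Y, so it comes from a unique h on the colimit C.
  That h lies in the kernel is tested in F at C, where elements are separated by the stages because
  F preserves the colimit.\<close>

lemma kernel_preserves: "preserves_filtered_colimits R K"
  unfolding preserves_filtered_colimits_def
proof (intro allI impI, elim conjE)
  fix J :: "('u, 'u) category" and D :: "'u \<Rightarrow> ('r, 'u) module" and d C c
  assume J: "small_category TYPE('u) J" "filtered J" and Dd: "mod_diagram R J D d" and C: "mod_colimit R J D d C c"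
  have cone: "mod_cocone R J D d C c" using C by (simp add: mod_colimit_def)
  have Cc: "C \<in> module_cat R" and c: "\<And>i. i \<in> Ob J \<Longrightarrow> c i \<in> mod_hom R (D i) C"
    and cd: "\<And>i j a. \<lbrakk>i \<in> Ob J; j \<in> Ob J; a \<in> Arr J i j\<rbrakk> \<Longrightarrow> compose (carrier (D i)) (c j) (d i j a) = c i"
    using cone unfolding mod_cocone_def by blast+
  have Dc: "D i \<in> module_cat R" if "i \<in> Ob J" for i using Dd that unfolding mod_diagram_def by blast
  let ?\<Phi> = "\<lambda>f. \<lambda>i\<in>Ob J. fmap K (D i) C (c i) f"
  let ?L = "inverse_limit J (\<lambda>i. fob K (D i)) (\<lambda>i j a. fmap K (D i) (D j) (d i j a))"
  have \<Phi>: "?\<Phi> f i = compose (carrier (D i)) f (c i)" if "i \<in> Ob J" for f i using that by (simp add: kernel_functor_simps)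
  have Khom: "fmap K (D i) C (c i) \<in> hom (fob K C) (fob K (D i))" if "i \<in> Ob J" for i
    using kernel_additive Dc[OF that] Cc c[OF that] unfolding additive_functor_def by blast
  have injF: "inj_on (\<lambda>x. \<lambda>i\<in>Ob J. fmap F (D i) C (c i) x) (FF C)"
  proof -
    have "(\<lambda>x. \<lambda>i\<in>Ob J. fmap F (D i) C (c i) x) \<in>
        iso (fob F C) (inverse_limit J (\<lambda>i. fob F (D i)) (\<lambda>i j a. fmap F (D i) (D j) (d i j a)))"
      using pres J Dd C unfolding preserves_filtered_colimits_def by blast
    then show ?thesis by (simp add: iso_def bij_betw_def)
  qed
  have LK: "carrier ?L = {z \<in> \<Pi>\<^sub>E i\<in>Ob J. carrier (fob K (D i)).
      \<forall>i\<in>Ob J. \<forall>j\<in>Ob J. \<forall>a\<in>Arr J i j. compose (carrier (D i)) (z j) (d i j a) = z i}"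
    by (simp add: inverse_limit_def product_group_def kernel_functor_simps(4))
  have into: "?\<Phi> f \<in> carrier ?L" if f: "f \<in> carrier (fob K C)" for f
  proof -
    have "compose (carrier (D i)) (compose (carrier (D j)) f (c j)) (d i j a) = compose (carrier (D i)) f (c i)"
      if "i \<in> Ob J" "j \<in> Ob J" "a \<in> Arr J i j" for i j a
    proof -
      have "d i j a \<in> mod_hom R (D i) (D j)" using Dd that unfolding mod_diagram_def by blast
      then show ?thesis using compose_assoc_hom[of "d i j a" R "D i" "D j" f "c j"] cd[OF that] by simp
    qed
    moreover have "fmap K (D i) C (c i) f \<in> carrier (fob K (D i))" if "i \<in> Ob J" for i
      using Khom[OF that] f by (auto simp: hom_def)
    ultimately show ?thesis unfolding LK by (simp add: kernel_functor_simps(4))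
  qed
  show "?\<Phi> \<in> iso (fob K C) ?L"
    unfolding iso_def
  proof (intro CollectI conjI)
    show "?\<Phi> \<in> hom (fob K C) ?L"
    proof (rule homI)
      fix f g assume fg: "f \<in> carrier (fob K C)" "g \<in> carrier (fob K C)"
      have "fmap K (D i) C (c i) (f \<otimes>\<^bsub>fob K C\<^esub> g) = fmap K (D i) C (c i) f \<otimes>\<^bsub>fob K (D i)\<^esub> fmap K (D i) C (c i) g"
        if "i \<in> Ob J" for i using hom_mult[OF Khom[OF that] fg] .
      then show "?\<Phi> (f \<otimes>\<^bsub>fob K C\<^esub> g) = ?\<Phi> f \<otimes>\<^bsub>?L\<^esub> ?\<Phi> g"
        by (auto simp: inverse_limit_def product_group_def)
    qed (rule into)
    show "bij_betw ?\<Phi> (carrier (fob K C)) (carrier ?L)"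
      unfolding bij_betw_def
    proof
      have cone_of: "mod_cocone R J D d Y z" if z: "z \<in> carrier ?L" for z
        using z Y unfolding LK mod_cocone_def by (auto simp: kernel_functor_simps)
      show "inj_on ?\<Phi> (carrier (fob K C))"
      proof (rule inj_onI)
        fix f g assume fg: "f \<in> carrier (fob K C)" "g \<in> carrier (fob K C)" "?\<Phi> f = ?\<Phi> g"
        have "compose (carrier (D i)) g (c i) = ?\<Phi> f i" "compose (carrier (D i)) f (c i) = ?\<Phi> f i" if "i \<in> Ob J" for i
          using \<Phi>[OF that, of f] \<Phi>[OF that, of g] fun_cong[OF fg(3), of i] by (simp_all only:)
        moreover have "f \<in> mod_hom R C Y" "g \<in> mod_hom R C Y" using fg by (simp_all add: kernel_functor_simps)
        moreover have "\<exists>!h. h \<in> mod_hom R C Y \<and> (\<forall>i\<in>Ob J. compose (carrier (D i)) h (c i) = ?\<Phi> f i)"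
          using C cone_of[OF into[OF fg(1)]] unfolding mod_colimit_def by blast
        ultimately show "f = g" by blast
      qed
      show "?\<Phi> ` carrier (fob K C) = carrier ?L"
      proof
        show "?\<Phi> ` carrier (fob K C) \<subseteq> carrier ?L" using into by blast
        show "carrier ?L \<subseteq> ?\<Phi> ` carrier (fob K C)"
        proof
          fix z assume z: "z \<in> carrier ?L"
          obtain h where h: "h \<in> mod_hom R C Y" "\<And>i. i \<in> Ob J \<Longrightarrow> compose (carrier (D i)) h (c i) = z i"
            using C cone_of[OF z] unfolding mod_colimit_def by blast
          have "fmap F C Y h y = \<one>\<^bsub>fob F C\<^esub>"
          proof (rule inj_onD[OF injF])
            show "(\<lambda>i\<in>Ob J. fmap F (D i) C (c i) (fmap F C Y h y)) = (\<lambda>i\<in>Ob J. fmap F (D i) C (c i) \<one>\<^bsub>fob F C\<^esub>)"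
            proof (rule restrict_ext)
              fix i assume i: "i \<in> Ob J"
              have "fmap F (D i) C (c i) (fmap F C Y h y) = fmap F (D i) Y (compose (carrier (D i)) h (c i)) y"
                using add Dc[OF i] Cc Y c[OF i] h(1) y unfolding additive_functor_def by metis
              also have "\<dots> = \<one>\<^bsub>fob F (D i)\<^esub>"
                using h(2)[OF i] z i unfolding LK by (auto simp: kernel_functor_simps)
              also have "\<dots> = fmap F (D i) C (c i) \<one>\<^bsub>fob F C\<^esub>"
                using Fm_one[OF Dc[OF i] Cc mod_homD[OF c[OF i]]] Fm_mod_hom[OF c[OF i]] by simp
              finally show "fmap F (D i) C (c i) (fmap F C Y h y) = fmap F (D i) C (c i) \<one>\<^bsub>fob F C\<^esub>" .
            qed
            show "fmap F C Y h y \<in> FF C"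
              using Fm_closed[OF Cc Y mod_homD[OF h(1)] y] Fm_mod_hom[OF h(1)] by simp
            show "\<one>\<^bsub>fob F C\<^esub> \<in> FF C"
              using F_group[OF Cc] by (simp add: comm_group.axioms(2) group.is_monoid monoid.one_closed)
          qed
          then have hK: "h \<in> carrier (fob K C)" using h(1) by (simp add: kernel_functor_simps)
          have "?\<Phi> h = z"
            using z h(2) unfolding LK by (auto simp: kernel_functor_simps PiE_def extensional_def fun_eq_iff)
          then show "z \<in> ?\<Phi> ` carrier (fob K C)" using hK by blast
        qed
      qed
    qed
  qed
qed

end

theorem theoremA1:
  fixes R :: "'r ring"
    and F :: "('r, 'u, 'v) mod_functor"
  assumes "ring R"
    and "module_universe R TYPE('u)"
    and "additive_functor R F"
    and "universe_compatible R F"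
    and "preserves_filtered_colimits R F"
  shows "\<exists>A\<in>module_cat R. \<exists>B\<in>module_cat R. \<exists>\<alpha> \<beta>. minimal_presentation R F A B \<alpha> \<beta>"
proof -
  obtain Y y where Y: "Y \<in> module_cat R" and y: "y \<in> carrier (fob F Y)"
    and y_cov: "\<forall>M\<in>module_cat R. \<forall>x\<in>carrier (fob F M). \<exists>f\<in>mod_hom R M Y. fmap F M Y f y = x"
    and y_min: "\<forall>h\<in>mod_hom R Y Y. fmap F Y Y h y = y \<longrightarrow> bij_betw h (carrier Y) (carrier Y)"
    using minimal_cover[OF assms] by blast
  let ?K = "kernel_functor R F Y y"
  obtain X k where X: "X \<in> module_cat R" and k: "k \<in> carrier (fob ?K X)"
    and k_cov: "\<forall>M\<in>module_cat R. \<forall>x\<in>carrier (fob ?K M). \<exists>f\<in>mod_hom R M X. fmap ?K M X f k = x"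
    and k_min: "\<forall>h\<in>mod_hom R X X. fmap ?K X X h k = k \<longrightarrow> bij_betw h (carrier X) (carrier X)"
    using minimal_cover[OF assms(1,2) kernel_additive[OF assms Y y] kernel_compatible[OF assms Y y]
        kernel_preserves[OF assms Y y]] by blast
  \<comment> \<open>An element of the kernel functor at X is itself a homomorphism from X to Y.
    Composition with it is the first map of the presentation, and covering the kernel functor means
    exactness at Hom(-, Y).\<close>
  have kh: "k \<in> mod_hom R X Y" using k by (simp add: kernel_functor_simps)
  then have kl: "lin R X Y k" by (simp add: mod_hom_eq)
  define \<alpha> where "\<alpha> M f = compose (carrier M) k f" for M :: "('r, 'u) module" and f
  define \<beta> where "\<beta> M f = fmap F M Y f y" for M f
  note m = module_catD'
  have \<alpha>_hom: "\<alpha> M \<in> hom (hom_group R M X) (hom_group R M Y)" if M: "M \<in> module_cat R" for M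
  proof (rule homI)
    show "\<alpha> M f \<in> carrier (hom_group R M Y)" if "f \<in> carrier (hom_group R M X)" for f
      using compose_mod_hom[OF m[OF M] _ kh] that by (simp add: \<alpha>_def hom_group_def)
    fix f g assume fg: "f \<in> carrier (hom_group R M X)" "g \<in> carrier (hom_group R M X)"
    then have "f x \<in> carrier X" "g x \<in> carrier X" if "x \<in> carrier M" for x
      using mod_hom_closed that by (auto simp: hom_group_def)
    then show "\<alpha> M (f \<otimes>\<^bsub>hom_group R M X\<^esub> g) = \<alpha> M f \<otimes>\<^bsub>hom_group R M Y\<^esub> \<alpha> M g"
      by (auto simp: \<alpha>_def hom_group_def compose_def lin_add[OF kl])
  qed
  have \<beta>_hom: "\<beta> M \<in> hom (hom_group R M Y) (fob F M)" if M: "M \<in> module_cat R" for M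
  proof (rule homI)
    fix f assume "f \<in> carrier (hom_group R M Y)"
    then have f: "f \<in> mod_hom R M Y" by (simp add: hom_group_def)
    then have "fmap F M Y f \<in> hom (fob F Y) (fob F M)"
      using assms(3) M Y unfolding additive_functor_def by blast
    then show "\<beta> M f \<in> carrier (fob F M)" using y by (auto simp: \<beta>_def hom_def)
    fix g assume "g \<in> carrier (hom_group R M Y)"
    then have "g \<in> mod_hom R M Y" by (simp add: hom_group_def)
    then show "\<beta> M (f \<otimes>\<^bsub>hom_group R M Y\<^esub> g) = \<beta> M f \<otimes>\<^bsub>fob F M\<^esub> \<beta> M g"
      using assms(3) M Y f y unfolding additive_functor_def \<beta>_def by blast
  qed
  have "nat_trans R (Hom_functor R X) (Hom_functor R Y) \<alpha>"
    unfolding nat_trans_def using \<alpha>_hom by (auto simp: Hom_functor_def \<alpha>_def compose_assoc_hom)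
  moreover have "nat_trans R (Hom_functor R Y) F \<beta>"
    unfolding nat_trans_def
  proof (intro conjI ballI)
    show "\<beta> M \<in> hom (fob (Hom_functor R Y) M) (fob F M)" if "M \<in> module_cat R" for M
      using \<beta>_hom[OF that] by (simp add: Hom_functor_def)
    fix M N f g assume "M \<in> module_cat R" "N \<in> module_cat R" "f \<in> mod_hom R M N" "g \<in> carrier (fob (Hom_functor R Y) N)"
    then have "fmap F M Y (compose (carrier M) g f) y = fmap F M N f (fmap F N Y g y)"
      using assms(3) Y y unfolding additive_functor_def by (simp add: Hom_functor_def hom_group_def)
    then show "\<beta> M (fmap (Hom_functor R Y) M N f g) = fmap F M N f (\<beta> N g)"
      by (simp add: \<beta>_def Hom_functor_def)
  qed
  moreover have "\<alpha> M ` carrier (hom_group R M X) = kernel (hom_group R M Y) (fob F M) (\<beta> M)"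
    if M: "M \<in> module_cat R" for M
  proof
    have "additive_functor R ?K" by (rule kernel_additive[OF assms Y y])
    then have "fmap ?K M X f \<in> hom (fob ?K X) (fob ?K M)" if "f \<in> mod_hom R M X" for f
      using M X that unfolding additive_functor_def by blast
    then have "fmap ?K M X f k \<in> carrier (fob ?K M)" if "f \<in> mod_hom R M X" for f
      by (rule hom_in_carrier[OF _ k]) (rule that)
    then have "compose (carrier M) k f \<in> carrier (fob ?K M)" if "f \<in> mod_hom R M X" for f
      using that by (simp only: kernel_functor_simps(4))
    then show "\<alpha> M ` carrier (hom_group R M X) \<subseteq> kernel (hom_group R M Y) (fob F M) (\<beta> M)"
      by (auto simp: kernel_def \<alpha>_def \<beta>_def hom_group_def kernel_functor_simps)
    show "kernel (hom_group R M Y) (fob F M) (\<beta> M) \<subseteq> \<alpha> M ` carrier (hom_group R M X)"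
    proof
      fix g assume "g \<in> kernel (hom_group R M Y) (fob F M) (\<beta> M)"
      then have "g \<in> carrier (fob ?K M)" by (simp add: kernel_def \<beta>_def hom_group_def kernel_functor_simps)
      then obtain f where "f \<in> mod_hom R M X" "fmap ?K M X f k = g" using k_cov M by blast
      then show "g \<in> \<alpha> M ` carrier (hom_group R M X)" by (auto simp: \<alpha>_def hom_group_def kernel_functor_simps(4))
    qed
  qed
  moreover have "\<beta> M ` carrier (hom_group R M Y) = carrier (fob F M)" if M: "M \<in> module_cat R" for M
  proof
    show "\<beta> M ` carrier (hom_group R M Y) \<subseteq> carrier (fob F M)" using \<beta>_hom[OF M] by (auto simp: hom_def)
    show "carrier (fob F M) \<subseteq> \<beta> M ` carrier (hom_group R M Y)"
      using y_cov M unfolding \<beta>_def hom_group_def by fastforce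
  qed
  moreover have "right_minimal R (Hom_functor R Y) \<beta>"
  proof (rule right_minimal_Hom[OF Y])
    fix h assume h: "h \<in> mod_hom R Y Y" "\<beta> Y h = \<beta> Y (mod_id Y)"
    have "fmap F Y Y (mod_id Y) y = y" using assms(3) Y y unfolding additive_functor_def by blast
    then show "bij_betw h (carrier Y) (carrier Y)" using y_min h by (simp add: \<beta>_def)
  qed
  moreover have "right_minimal R (Hom_functor R X) \<alpha>"
  proof (rule right_minimal_Hom[OF X])
    fix h assume h: "h \<in> mod_hom R X X" "\<alpha> X h = \<alpha> X (mod_id X)"
    \<comment> \<open>The equation for \<alpha> says k h = k, that is, h fixes the element k of the
      kernel functor at X.\<close>
    then have "fmap ?K X X h k = k" using compose_mod_id(1)[OF kh] by (simp add: \<alpha>_def kernel_functor_simps(4))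
    then show "bij_betw h (carrier X) (carrier X)" using k_min h by blast
  qed
  ultimately have "minimal_presentation R F X Y \<alpha> \<beta>"
    unfolding minimal_presentation_def presentation_def by blast
  then show ?thesis using X Y by blast
qed

end
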